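(* Let $T\in\mathcal{K}(V)$ be bisectorial of angle $\omega\in(0,\frac{\pi}{2})$, let $\theta\in(\omega,\frac{\pi}{2})$, $g\in\mathcal{N}^{\mathrm{bnd}}(D_\theta)$, and let $p$ be an intrinsic polynomial. Then $p\circ g\in\mathcal{N}^{\mathrm{bnd}}(D_\theta)$ and $$(p\circ g)(T)=p[g(T)],$$ where $(p\circ g)(T)$ and $g(T)$ are given by the extended $\omega$-functional calculus.
   Context: Clifford setting. Fix an integer $n\geq 1$. $\mathbb{R}_n$ is the real Clifford algebra generated by $e_1,\dots,e_n$ with $e_i^2=-1$, $e_ie_j=-e_je_i$ ($i\neq j$), with basis $e_A=e_{i_1}\cdots e_{i_r}$ for $A=(i_1<\dots<i_r)$, $e_\emptyset=1$, and $|s|^2=\sum_As_A^2$ for $s=\sum_As_Ae_A$. Paravectors: $\mathbb{R}^{n+1}=\{s_0+s_1e_1+\dots+s_ne_n\}\subseteq\mathbb{R}_n$ with $\overline{s}=s_0-s_1e_1-\dots-s_ne_n$. $\mathbb{S}=\{s\in\mathbb{R}^{n+1}: s_0=0,|s|=1\}$ and $\mathbb{C}_J=\{x+Jy: x,y\in\mathbb{R}\}$ for $J\in\mathbb{S}$. $U\subseteq\mathbb{R}^{n+1}$ is axially symmetric if $x+Jy\in U$ ($x,y\in\mathbb{R}$, $J\in\mathbb{S}$) implies $x+Iy\in U$ for all $I\in\mathbb{S}$. Slice hyperholomorphic functions. For $U$ open and axially symmetric, $f:U\to\mathbb{R}_n$ is left slice hyperholomorphic ($f\in\mathcal{SH}_L(U)$)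 if there are continuously differentiable $f_0,f_1:\{(x,y)\in\mathbb{R}^2: x+\mathbb{S}y\subseteq U\}\to\mathbb{R}_n$ with $f(x+Jy)=f_0(x,y)+Jf_1(x,y)$ for all $J\in\mathbb{S}$, $f_0(x,-y)=f_0(x,y)$, $f_1(x,-y)=-f_1(x,y)$, $\partial_xf_0=\partial_yf_1$, $\partial_yf_0=-\partial_xf_1$. If $f_0,f_1$ are real valued, $f$ is called intrinsic ($f\in\mathcal{N}(U)$). Operators. $V_\mathbb{R}$ is a real Banach space, $V=\{\sum_Av_A\otimes e_A: v_A\in V_\mathbb{R}\}$ the corresponding Clifford module with norm $\|v\|^2=\sum_A\|v_A\|^2$ and the natural left and right multiplications by $\mathbb{R}_n$. $\mathcal{B}(V)$: bounded everywhere defined right-linear operators; $\mathcal{K}(V)$: closed right-linear operators $T:\operatorname{dom}(T)\to V$ with right-linear domain $\operatorname{dom}(T)\subseteq V$. A Clifford number $a$ is identified with the operator $v\mapsto av$, so $(aT)v=a(Tv)$, $(Ta)v=T(av)$. For $s\in\mathbb{R}^{n+1}$, $Q_s[T]=T^2-2s_0T+|s|^2$ on $\operatorname{dom}(T^2)$; $\rho_S(T)=\{s\in\mathbb{R}^{n+1}: Q_s[T]^{-1}\in\mathcal{B}(V)\}$, $\sigma_S(T)=\mathbb{R}^{n+1}\setminus\rho_S(T)$, and $S_L^{-1}(s,T)=Q_s[T]^{-1}\overline{s}-TQ_s[T]^{-1}$ for $s\in\rho_S(T)$. Bisectorial operators. For $\omega\in(0,\frac{\pi}{2})$, $I_\omega=(-\omega,\omega)\cup(\pi-\omega,\pi+\omega)$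 and $D_\omega=\{re^{J\phi}: r>0,\,J\in\mathbb{S},\,\phi\in I_\omega\}\subseteq\mathbb{R}^{n+1}$. $T\in\mathcal{K}(V)$ is bisectorial of angle $\omega$ if $\sigma_S(T)\subseteq\overline{D_\omega}$ and for every $\varphi\in(\omega,\frac{\pi}{2})$ there is $C_\varphi\geq 0$ with $\|S_L^{-1}(s,T)\|\leq\frac{C_\varphi}{|s|}$ for all $s\in\mathbb{R}^{n+1}\setminus(D_\varphi\cup\{0\})$. $\omega$-functional calculus. $\mathcal{SH}_L^0(D_\theta)$ is the set of bounded $f\in\mathcal{SH}_L(D_\theta)$ with $\int_0^\infty|f(te^{J\phi})|\frac{dt}{t}<\infty$ for all $J\in\mathbb{S}$, $\phi\in I_\theta$; $\mathcal{N}^0(D_\theta)$ is the set of intrinsic such functions. For $T$ bisectorial of angle $\omega$, $\theta\in(\omega,\frac{\pi}{2})$ and $f\in\mathcal{SH}_L^0(D_\theta)$, $$f(T)=\frac{1}{2\pi}\int_{\partial D_\varphi\cap\mathbb{C}_J}S_L^{-1}(s,T)ds_Jf(s):=\frac{1}{2\pi}\sum_\pm\int_\mathbb{R}S_L^{-1}(\gamma_\pm(t),T)\frac{\gamma_\pm'(t)}{J}f(\gamma_\pm(t))dt\in\mathcal{B}(V),$$ with $\gamma_\pm(t)=\pm|t|e^{-\operatorname{sgn}(t)J\varphi}$; it does not depend on the choice of $\varphi\in(\omega,\theta)$ and $J\in\mathbb{S}$. Extended $\omega$-functional calculus. $\mathcal{N}^{\mathrm{bnd}}(D_\theta)$ is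 the set of functions $g(s)=g_\infty+\frac{1}{1+s^2}(g_0-g_\infty)+\widetilde{g}(s)$ on $D_\theta$ with $g_0,g_\infty\in\mathbb{R}$, $\widetilde{g}\in\mathcal{N}^0(D_\theta)$ (unique components). For such $g$, $g(T):=g_\infty+(1+T^2)^{-1}(g_0-g_\infty)+\widetilde{g}(T)\in\mathcal{B}(V)$, with $\widetilde{g}(T)$ from the $\omega$-functional calculus; here $1+T^2$ is boundedly invertible since $\mathbb{S}\subseteq\rho_S(T)$. Polynomials. An intrinsic polynomial of degree $m$ is $p(s)=p_0+p_1s+\dots+p_ms^m$ with real coefficients, $p_m\neq 0$; for an operator $A$, $p[A]=p_0+p_1A+\dots+p_mA^m$ with $\operatorname{dom}(p[A])=\operatorname{dom}(A^m)$. *)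

theory Defs
  imports "HOL-Analysis.Analysis" "HOL-Computational_Algebra.Polynomial"
begin

section \<open>The Clifford algebra and Clifford modules\<close>

text \<open>
  The generators $e_i$ are indexed by a finite linearly ordered type \<open>'n\<close>, so $n$ is the
  cardinality of \<open>'n\<close>; the basis elements $e_A$ are indexed by the subsets $A$ of \<open>'n\<close>.
  A Clifford number is its coordinate vector in \<open>real ^ 'n set\<close>, and an element
  $\sum_A v_A \otimes e_A$ of the Clifford module $V$ over a real Banach space \<open>'v\<close> is a vector
  in \<open>'v ^ 'n set\<close>. The library norm of both types is the Euclidean norm of the family of
  the norms of the components, as required.

  Pitfall: the type class operations \<open>*\<close>, \<open>1\<close>, \<open>^\<close> of the vector types are componentwise and
  are not the Clifford operations; they are never used on Clifford numbers below.
\<close>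

text \<open>
  $e_A e_B = \pm e_{A \triangle B}$: sorting costs one sign for each pair $b < a$ with
  $a \in A$, $b \in B$, and each common index one more sign from $e_a^2 = -1$.
\<close>

definition cl_sign :: "'n::{finite,linorder} set \<Rightarrow> 'n set \<Rightarrow> real" where
  "cl_sign A B = (- 1) ^ card {(a, b). a \<in> A \<and> b \<in> B \<and> b \<le> a}"

definition cl_lmult ::
    "real ^ 'n set \<Rightarrow> 'v::real_vector ^ 'n::{finite,linorder} set \<Rightarrow> 'v ^ 'n set"
    (infixr "\<cdot>\<^sub>l" 75) where
  "a \<cdot>\<^sub>l v =
    (\<Sum>A\<in>UNIV. \<Sum>B\<in>UNIV. axis (sym_diff A B) ((cl_sign A B * (a $ A)) *\<^sub>R (v $ B)))"

definition cl_rmult ::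
    "'v::real_vector ^ 'n::{finite,linorder} set \<Rightarrow> real ^ 'n set \<Rightarrow> 'v ^ 'n set"
    (infixl "\<cdot>\<^sub>r" 75) where
  "v \<cdot>\<^sub>r a =
    (\<Sum>A\<in>UNIV. \<Sum>B\<in>UNIV. axis (sym_diff A B) ((cl_sign A B * (a $ B)) *\<^sub>R (v $ A)))"

text \<open>
  The product of Clifford numbers is \<open>\<cdot>\<^sub>l\<close> for \<open>'v = real\<close> (equivalently \<open>\<cdot>\<^sub>r\<close>, see below).
\<close>

definition cl_one :: "real ^ 'n::{finite,linorder} set" where
  "cl_one = axis {} 1"

definition cl_gen :: "'n::{finite,linorder} \<Rightarrow> real ^ 'n set" where
  "cl_gen i = axis {i} 1"

fun cl_power :: "real ^ 'n::{finite,linorder} set \<Rightarrow> nat \<Rightarrow> real ^ 'n set" where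
  "cl_power a 0 = cl_one"
| "cl_power a (Suc k) = a \<cdot>\<^sub>l cl_power a k"

lemma cl_mult_commute_sides: "(a :: real ^ 'n::{finite,linorder} set) \<cdot>\<^sub>l b = a \<cdot>\<^sub>r b"
  by (simp add: cl_lmult_def cl_rmult_def mult.commute mult.left_commute)

lemma cl_lmult_axis:
  "axis A x \<cdot>\<^sub>l axis B v = axis (sym_diff A B) ((cl_sign A B * x) *\<^sub>R v)"
proof -
  have "axis A x \<cdot>\<^sub>l axis B v = (\<Sum>A'\<in>UNIV. \<Sum>B'\<in>UNIV.
      if A' = A then if B' = B then axis (sym_diff A B) ((cl_sign A B * x) *\<^sub>R v) else 0 else 0)"
    unfolding cl_lmult_def by (intro sum.cong refl) (auto simp: axis_def vec_eq_iff)
  also have "\<dots> = axis (sym_diff A B) ((cl_sign A B * x) *\<^sub>R v)"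
    by (subst sum.swap) simp
  finally show ?thesis .
qed

lemma cl_gen_square: "cl_gen i \<cdot>\<^sub>l cl_gen i = - cl_one"
proof -
  have "{(a, b). a = i \<and> b = i \<and> b \<le> a} = {(i, i)}" by auto
  then have "cl_gen i \<cdot>\<^sub>l cl_gen i = axis {} (- 1)"
    unfolding cl_gen_def cl_lmult_axis by (simp add: cl_sign_def)
  then show ?thesis by (simp add: cl_one_def axis_def vec_eq_iff)
qed

lemma cl_gen_anticommute:
  assumes "i \<noteq> j"
  shows "cl_gen i \<cdot>\<^sub>l cl_gen j = - (cl_gen j \<cdot>\<^sub>l cl_gen i)"
proof -
  have eq: "{(a, b). a = i \<and> b = j \<and> b \<le> a} = (if j \<le> i then {(i, j)} else {})" for i j :: 'a
    by auto
  have "sym_diff {i} {j} = sym_diff {j} {i}" by auto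
  moreover have "cl_sign {i} {j} = - cl_sign {j} {i}"
    using assms by (auto simp: cl_sign_def eq)
  ultimately show ?thesis
    unfolding cl_gen_def cl_lmult_axis by (simp add: axis_def vec_eq_iff)
qed

lemma cl_basis_insert:
  assumes "\<And>a. a \<in> A \<Longrightarrow> i < a"
  shows "cl_gen i \<cdot>\<^sub>l (axis A 1 :: real ^ 'n::{finite,linorder} set) = axis (insert i A) 1"
proof -
  have "{(a, b). a = i \<and> b \<in> A \<and> b \<le> a} = {}" using assms by (auto simp: not_le)
  then have "cl_sign {i} A = 1" unfolding cl_sign_def singleton_iff by (simp only: card.empty power_0)
  moreover have "sym_diff {i} A = insert i A" using assms by auto
  ultimately show ?thesis unfolding cl_gen_def cl_lmult_axis by simp
qed

lemma cl_sign_prod: "cl_sign A B = (\<Prod>a\<in>A. \<Prod>b\<in>B. if b \<le> a then - 1 else 1)"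
proof -
  have "cl_sign A B = (\<Prod>x\<in>{x \<in> A \<times> B. snd x \<le> fst x}. - 1)"
    unfolding cl_sign_def prod_constant
    by (intro arg_cong[of _ _ "\<lambda>S. (- 1) ^ card S"]) auto
  also have "\<dots> = (\<Prod>x\<in>A \<times> B. if snd x \<le> fst x then - 1 else 1)"
    by (subst prod.inter_filter) auto
  finally show ?thesis by (simp add: prod.cartesian_product case_prod_beta)
qed

lemma prod_sym_diff_sign:
  fixes f :: "'a::finite \<Rightarrow> real"
  assumes "\<And>a. f a * f a = 1"
  shows "prod f (sym_diff A B) = prod f A * prod f B"
proof -
  have "prod f A = prod f (A - B) * prod f (A \<inter> B)"
    by (metis Diff_Diff_Int finite mult.commute prod.subset_diff Diff_subset Int_lower1)
  moreover have "prod f B = prod f (B - A) * prod f (A \<inter> B)"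
    by (metis Diff_Diff_Int finite mult.commute prod.subset_diff Diff_subset Int_commute)
  moreover have "prod f (sym_diff A B) = prod f (A - B) * prod f (B - A)"
    by (rule prod.union_disjoint) auto
  moreover have "prod f (A \<inter> B) * prod f (A \<inter> B) = 1"
    by (simp add: prod.distrib[symmetric] assms)
  ultimately show ?thesis by (simp add: algebra_simps)
qed

lemma cl_sign_sym_diff_left: "cl_sign (sym_diff A B) C = cl_sign A C * cl_sign B C"
  unfolding cl_sign_prod
  by (rule prod_sym_diff_sign) (simp add: prod.distrib[symmetric], rule prod.neutral, simp)

lemma cl_sign_sym_diff_right: "cl_sign C (sym_diff A B) = cl_sign C A * cl_sign C B"
  unfolding cl_sign_prod prod.swap[of _ _ C]
  by (rule prod_sym_diff_sign) (simp add: prod.distrib[symmetric], rule prod.neutral, simp)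

lemma axis_add: "axis A (x + y) = axis A x + (axis A y :: 'a::ab_group_add ^ 'n::finite)"
  by (simp add: axis_def vec_eq_iff)

lemma axis_0: "axis A (0 :: 'a::ab_group_add) = (0 :: 'a ^ 'n::finite)"
  by (simp add: axis_def vec_eq_iff)

lemma cl_lmult_add_left: "(a + b) \<cdot>\<^sub>l v = a \<cdot>\<^sub>l v + b \<cdot>\<^sub>l v"
  by (simp add: cl_lmult_def algebra_simps axis_add sum.distrib)

lemma cl_lmult_add_right: "a \<cdot>\<^sub>l (v + w) = a \<cdot>\<^sub>l v + a \<cdot>\<^sub>l w"
  by (simp add: cl_lmult_def scaleR_add_right axis_add sum.distrib)

lemma cl_lmult_0: "0 \<cdot>\<^sub>l v = 0" "a \<cdot>\<^sub>l 0 = 0"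
  by (simp_all add: cl_lmult_def axis_0)

lemma cl_lmult_sum_left: "(\<Sum>i\<in>I. f i) \<cdot>\<^sub>l v = (\<Sum>i\<in>I. f i \<cdot>\<^sub>l v)"
  by (induction I rule: infinite_finite_induct) (simp_all add: cl_lmult_0 cl_lmult_add_left)

lemma cl_lmult_sum_right: "a \<cdot>\<^sub>l (\<Sum>i\<in>I. f i) = (\<Sum>i\<in>I. a \<cdot>\<^sub>l f i)"
  by (induction I rule: infinite_finite_induct) (simp_all add: cl_lmult_0 cl_lmult_add_right)

lemma vec_axis_sum: "(v :: 'a::ab_group_add ^ 'n::finite) = (\<Sum>A\<in>UNIV. axis A (v $ A))"
  by (simp add: vec_eq_iff axis_def)

lemma cl_lmult_assoc:
  fixes v :: "'v::real_vector ^ 'n::{finite,linorder} set"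
  shows "(a \<cdot>\<^sub>l b) \<cdot>\<^sub>l v = a \<cdot>\<^sub>l (b \<cdot>\<^sub>l v)"
proof -
  have basis: "(axis A x \<cdot>\<^sub>l axis B y) \<cdot>\<^sub>l axis C w = axis A x \<cdot>\<^sub>l (axis B y \<cdot>\<^sub>l axis C w)"
    for A B C :: "'n set" and x y :: real and w :: 'v
  proof -
    have "sym_diff (sym_diff A B) C = sym_diff A (sym_diff B C)" by blast
    moreover have "cl_sign (sym_diff A B) C * (cl_sign A B * x * y)
      = cl_sign A (sym_diff B C) * x * (cl_sign B C * y)"
      by (simp only: cl_sign_sym_diff_left cl_sign_sym_diff_right mult_ac)
    ultimately show ?thesis by (simp only: cl_lmult_axis scaleR_scaleR real_scaleR_def)
  qed
  show ?thesis
    by (subst (1 2) vec_axis_sum[of a], subst (1 2) vec_axis_sum[of b],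
        subst (1 2) vec_axis_sum[of v])
      (simp only: cl_lmult_sum_left cl_lmult_sum_right basis)
qed

section \<open>Paravectors, slices and slice hyperholomorphic functions\<close>

definition paravectors :: "(real ^ 'n::{finite,linorder} set) set" where
  "paravectors = {s. \<exists>s0 c. s = s0 *\<^sub>R cl_one + (\<Sum>i\<in>UNIV. c i *\<^sub>R cl_gen i)}"

definition re_part :: "real ^ 'n::{finite,linorder} set \<Rightarrow> real" where
  "re_part s = s $ {}"

text \<open>Conjugation and inverse are only meaningful on (nonzero) paravectors.\<close>

definition pv_cnj :: "real ^ 'n::{finite,linorder} set \<Rightarrow> real ^ 'n set" where
  "pv_cnj s = (\<chi> A. if A = {} then s $ A else - (s $ A))"

definition pv_inverse :: "real ^ 'n::{finite,linorder} set \<Rightarrow> real ^ 'n set" where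
  "pv_inverse s = (1 / (norm s)\<^sup>2) *\<^sub>R pv_cnj s"

definition unit_sphere :: "(real ^ 'n::{finite,linorder} set) set" where
  "unit_sphere = {s \<in> paravectors. re_part s = 0 \<and> norm s = 1}"

definition slice_pt ::
    "real ^ 'n::{finite,linorder} set \<Rightarrow> real \<Rightarrow> real \<Rightarrow> real ^ 'n set" where
  "slice_pt J x y = x *\<^sub>R cl_one + y *\<^sub>R J"

definition axially_symmetric :: "(real ^ 'n::{finite,linorder} set) set \<Rightarrow> bool" where
  "axially_symmetric U \<longleftrightarrow> U \<subseteq> paravectors \<and>
    (\<forall>x y. \<forall>J\<in>unit_sphere. slice_pt J x y \<in> U \<longrightarrow> (\<forall>I\<in>unit_sphere. slice_pt I x y \<in> U))"

definition slice_dom :: "(real ^ 'n::{finite,linorder} set) set \<Rightarrow> (real \<times> real) set" where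
  "slice_dom U = {(x, y). \<forall>J\<in>unit_sphere. slice_pt J x y \<in> U}"

text \<open>\<open>f\<close> is continuously differentiable on the open set \<open>S\<close> with partial derivatives
  \<open>fx\<close> and \<open>fy\<close>.\<close>

definition C1_with_partials ::
    "(real \<times> real) set \<Rightarrow> (real \<times> real \<Rightarrow> 'a::real_normed_vector) \<Rightarrow>
     (real \<times> real \<Rightarrow> 'a) \<Rightarrow> (real \<times> real \<Rightarrow> 'a) \<Rightarrow> bool" where
  "C1_with_partials S f fx fy \<longleftrightarrow>
    (\<forall>z\<in>S. (f has_derivative (\<lambda>(h, k). h *\<^sub>R fx z + k *\<^sub>R fy z)) (at z)) \<and>
    continuous_on S fx \<and> continuous_on S fy"

text \<open>Functions on \<open>U\<close> are total functions whose values outside \<open>U\<close> are irrelevant.\<close>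

definition slice_hyperholomorphic_with ::
    "(real ^ 'n::{finite,linorder} set) set \<Rightarrow> (real ^ 'n set \<Rightarrow> real ^ 'n set) \<Rightarrow>
     (real \<times> real \<Rightarrow> real ^ 'n set) \<Rightarrow> (real \<times> real \<Rightarrow> real ^ 'n set) \<Rightarrow> bool" where
  "slice_hyperholomorphic_with U f f0 f1 \<longleftrightarrow>
    openin (top_of_set paravectors) U \<and> axially_symmetric U \<and>
    (\<forall>(x, y)\<in>slice_dom U. \<forall>J\<in>unit_sphere.
       f (slice_pt J x y) = f0 (x, y) + J \<cdot>\<^sub>l f1 (x, y)) \<and>
    (\<forall>(x, y)\<in>slice_dom U. f0 (x, - y) = f0 (x, y) \<and> f1 (x, - y) = - f1 (x, y)) \<and>
    (\<exists>f0x f0y f1x f1y.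
       C1_with_partials (slice_dom U) f0 f0x f0y \<and>
       C1_with_partials (slice_dom U) f1 f1x f1y \<and>
       (\<forall>z\<in>slice_dom U. f0x z = f1y z \<and> f0y z = - f1x z))"

definition SH_L ::
    "(real ^ 'n::{finite,linorder} set) set \<Rightarrow> (real ^ 'n set \<Rightarrow> real ^ 'n set) set" where
  "SH_L U = {f. \<exists>f0 f1. slice_hyperholomorphic_with U f f0 f1}"

definition intrinsic ::
    "(real ^ 'n::{finite,linorder} set) set \<Rightarrow> (real ^ 'n set \<Rightarrow> real ^ 'n set) set" where
  "intrinsic U = {f. \<exists>f0 f1. slice_hyperholomorphic_with U f f0 f1 \<and>
     (\<forall>z\<in>slice_dom U. f0 z \<in> range (\<lambda>r. r *\<^sub>R cl_one) \<and> f1 z \<in> range (\<lambda>r. r *\<^sub>R cl_one))}"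

section \<open>Operators on the Clifford module\<close>

text \<open>
  An unbounded operator is given by its domain \<open>D\<close> and a total function \<open>T\<close> of which only the
  values on \<open>D\<close> matter; bounded everywhere defined operators are of type \<open>\<Rightarrow>\<^sub>L\<close>.
\<close>

definition closed_right_linear ::
    "('v::banach ^ 'n::{finite,linorder} set) set \<Rightarrow> ('v ^ 'n set \<Rightarrow> 'v ^ 'n set) \<Rightarrow> bool" where
  "closed_right_linear D T \<longleftrightarrow>
    0 \<in> D \<and>
    (\<forall>u\<in>D. \<forall>v\<in>D. u + v \<in> D \<and> T (u + v) = T u + T v) \<and>
    (\<forall>v\<in>D. \<forall>a. v \<cdot>\<^sub>r a \<in> D \<and> T (v \<cdot>\<^sub>r a) = T v \<cdot>\<^sub>r a) \<and>
    closed {(v, T v) |v. v \<in> D}"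

definition right_linear_blinfun ::
    "('v::banach ^ 'n::{finite,linorder} set) \<Rightarrow>\<^sub>L ('v ^ 'n set) \<Rightarrow> bool" where
  "right_linear_blinfun B \<longleftrightarrow> (\<forall>v a. blinfun_apply B (v \<cdot>\<^sub>r a) = blinfun_apply B v \<cdot>\<^sub>r a)"

definition is_bdd_inverse ::
    "('v::banach ^ 'n::{finite,linorder} set) set \<Rightarrow> ('v ^ 'n set \<Rightarrow> 'v ^ 'n set) \<Rightarrow>
     ('v ^ 'n set) \<Rightarrow>\<^sub>L ('v ^ 'n set) \<Rightarrow> bool" where
  "is_bdd_inverse D A B \<longleftrightarrow> right_linear_blinfun B \<and>
    (\<forall>v. blinfun_apply B v \<in> D \<and> A (blinfun_apply B v) = v) \<and>
    (\<forall>v\<in>D. blinfun_apply B (A v) = v)"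

definition bdd_inverse ::
    "('v::banach ^ 'n::{finite,linorder} set) set \<Rightarrow> ('v ^ 'n set \<Rightarrow> 'v ^ 'n set) \<Rightarrow>
     ('v ^ 'n set) \<Rightarrow>\<^sub>L ('v ^ 'n set)" where
  "bdd_inverse D A = (THE B. is_bdd_inverse D A B)"

definition dom_sq :: "'a set \<Rightarrow> ('a \<Rightarrow> 'a) \<Rightarrow> 'a set" where
  "dom_sq D T = {v \<in> D. T v \<in> D}"

definition Q_op ::
    "('v::banach ^ 'n::{finite,linorder} set \<Rightarrow> 'v ^ 'n set) \<Rightarrow> real ^ 'n set \<Rightarrow>
     'v ^ 'n set \<Rightarrow> 'v ^ 'n set" where
  "Q_op T s v = T (T v) - (2 * re_part s) *\<^sub>R T v + (norm s)\<^sup>2 *\<^sub>R v"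

definition S_resolvent_set ::
    "('v::banach ^ 'n::{finite,linorder} set) set \<Rightarrow> ('v ^ 'n set \<Rightarrow> 'v ^ 'n set) \<Rightarrow>
     (real ^ 'n set) set" where
  "S_resolvent_set D T = {s \<in> paravectors. \<exists>B. is_bdd_inverse (dom_sq D T) (Q_op T s) B}"

definition S_spectrum ::
    "('v::banach ^ 'n::{finite,linorder} set) set \<Rightarrow> ('v ^ 'n set \<Rightarrow> 'v ^ 'n set) \<Rightarrow>
     (real ^ 'n set) set" where
  "S_spectrum D T = paravectors - S_resolvent_set D T"

text \<open>
  The operator $v \mapsto a v$. The map given to \<open>Blinfun\<close> here is always bounded and linear.
\<close>

definition left_op ::
    "real ^ 'n set \<Rightarrow> ('v::banach ^ 'n::{finite,linorder} set) \<Rightarrow>\<^sub>L ('v ^ 'n set)" where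
  "left_op a = Blinfun (\<lambda>v. a \<cdot>\<^sub>l v)"

text \<open>
  For closed \<open>T\<close> and \<open>s\<close> in the S-resolvent set, $T\,Q_s[T]^{-1}$ is bounded by the closed graph
  theorem, so \<open>Blinfun\<close> is again applied to a bounded linear map.
\<close>

definition S_L_resolvent ::
    "('v::banach ^ 'n::{finite,linorder} set) set \<Rightarrow> ('v ^ 'n set \<Rightarrow> 'v ^ 'n set) \<Rightarrow>
     real ^ 'n set \<Rightarrow> ('v ^ 'n set) \<Rightarrow>\<^sub>L ('v ^ 'n set)" where
  "S_L_resolvent D T s =
    (let Qinv = blinfun_apply (bdd_inverse (dom_sq D T) (Q_op T s))
     in Blinfun (\<lambda>v. Qinv (pv_cnj s \<cdot>\<^sub>l v) - T (Qinv v)))"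

section \<open>Bisectorial operators\<close>

text \<open>$e^{J\phi} = \cos\phi + J\sin\phi$, since $J^2 = -1$.\<close>

definition expJ :: "real ^ 'n::{finite,linorder} set \<Rightarrow> real \<Rightarrow> real ^ 'n set" where
  "expJ J \<phi> = slice_pt J (cos \<phi>) (sin \<phi>)"

definition I_angle :: "real \<Rightarrow> real set" where
  "I_angle \<omega> = {- \<omega> <..< \<omega>} \<union> {pi - \<omega> <..< pi + \<omega>}"

definition D_sector :: "real \<Rightarrow> (real ^ 'n::{finite,linorder} set) set" where
  "D_sector \<omega> = {r *\<^sub>R expJ J \<phi> |r J \<phi>. r > 0 \<and> J \<in> unit_sphere \<and> \<phi> \<in> I_angle \<omega>}"

definition bisectorial ::
    "real \<Rightarrow> ('v::banach ^ 'n::{finite,linorder} set) set \<Rightarrow> ('v ^ 'n set \<Rightarrow> 'v ^ 'n set) \<Rightarrow> bool"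
    where
  "bisectorial \<omega> D T \<longleftrightarrow>
    closed_right_linear D T \<and>
    S_spectrum D T \<subseteq> closure (D_sector \<omega>) \<and>
    (\<forall>\<phi>\<in>{\<omega> <..< pi / 2}. \<exists>C\<ge>0. \<forall>s\<in>paravectors - (D_sector \<phi> \<union> {0}).
       norm (S_L_resolvent D T s) \<le> C / norm s)"

section \<open>The omega-functional calculus and its extension\<close>

text \<open>
  The integrand of the decay condition is nonnegative, so its gauge integrability on the half
  line means that its Lebesgue integral is finite.
\<close>

definition SH_L_0 :: "real \<Rightarrow> (real ^ 'n::{finite,linorder} set \<Rightarrow> real ^ 'n set) set" where
  "SH_L_0 \<theta> = {f \<in> SH_L (D_sector \<theta>). bounded (f ` D_sector \<theta>) \<and>
     (\<forall>J\<in>unit_sphere. \<forall>\<phi>\<in>I_angle \<theta>. (\<lambda>t. norm (f (t *\<^sub>R expJ J \<phi>)) / t) integrable_on {0<..})}"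

definition N_0 :: "real \<Rightarrow> (real ^ 'n::{finite,linorder} set \<Rightarrow> real ^ 'n set) set" where
  "N_0 \<theta> = SH_L_0 \<theta> \<inter> intrinsic (D_sector \<theta>)"

definition gamma_path ::
    "real \<Rightarrow> real ^ 'n::{finite,linorder} set \<Rightarrow> real \<Rightarrow> real \<Rightarrow> real ^ 'n set" where
  "gamma_path \<epsilon> J \<phi> t = (\<epsilon> * \<bar>t\<bar>) *\<^sub>R expJ J (- sgn t * \<phi>)"

text \<open>
  The value of $f(T)$ computed with the angle \<open>\<phi>\<close> and the imaginary unit \<open>J\<close>; the integral is
  the (norm-valued) gauge integral in the Banach space of bounded operators. The integrand at
  $t = 0$ is a junk value, which does not affect the integral.
\<close>

definition omega_calc ::
    "('v::banach ^ 'n::{finite,linorder} set) set \<Rightarrow> ('v ^ 'n set \<Rightarrow> 'v ^ 'n set) \<Rightarrow>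
     real \<Rightarrow> real ^ 'n set \<Rightarrow> (real ^ 'n set \<Rightarrow> real ^ 'n set) \<Rightarrow>
     ('v ^ 'n set) \<Rightarrow>\<^sub>L ('v ^ 'n set)" where
  "omega_calc D T \<phi> J f = (1 / (2 * pi)) *\<^sub>R (\<Sum>\<epsilon>\<in>{1, - 1}. integral UNIV (\<lambda>t.
     S_L_resolvent D T (gamma_path \<epsilon> J \<phi> t) o\<^sub>L
     left_op (vector_derivative (gamma_path \<epsilon> J \<phi>) (at t) \<cdot>\<^sub>l pv_inverse J) o\<^sub>L
     left_op (f (gamma_path \<epsilon> J \<phi> t))))"

definition bnd_decomp ::
    "real \<Rightarrow> (real ^ 'n::{finite,linorder} set \<Rightarrow> real ^ 'n set) \<Rightarrow>
     real \<Rightarrow> real \<Rightarrow> (real ^ 'n set \<Rightarrow> real ^ 'n set) \<Rightarrow> bool" where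
  "bnd_decomp \<theta> g g0 ginf h \<longleftrightarrow> h \<in> N_0 \<theta> \<and>
    (\<forall>s\<in>D_sector \<theta>.
       g s = ginf *\<^sub>R cl_one + (g0 - ginf) *\<^sub>R pv_inverse (cl_one + s \<cdot>\<^sub>l s) + h s)"

definition N_bnd :: "real \<Rightarrow> (real ^ 'n::{finite,linorder} set \<Rightarrow> real ^ 'n set) set" where
  "N_bnd \<theta> = {g. \<exists>g0 ginf h. bnd_decomp \<theta> g g0 ginf h}"

text \<open>
  The components $g_0$, $g_\infty$ are unique and $\tilde g$ is unique on the double sector, hence
  so is the resulting operator.
\<close>

definition ext_omega_calc ::
    "('v::banach ^ 'n::{finite,linorder} set) set \<Rightarrow> ('v ^ 'n set \<Rightarrow> 'v ^ 'n set) \<Rightarrow>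
     real \<Rightarrow> real \<Rightarrow> real ^ 'n set \<Rightarrow> (real ^ 'n set \<Rightarrow> real ^ 'n set) \<Rightarrow>
     ('v ^ 'n set) \<Rightarrow>\<^sub>L ('v ^ 'n set)" where
  "ext_omega_calc D T \<theta> \<phi> J g = (THE A. \<exists>g0 ginf h. bnd_decomp \<theta> g g0 ginf h \<and>
     A = ginf *\<^sub>R id_blinfun
       + (g0 - ginf) *\<^sub>R bdd_inverse (dom_sq D T) (\<lambda>v. v + T (T v))
       + omega_calc D T \<phi> J h)"

section \<open>Intrinsic polynomials\<close>

definition cl_poly ::
    "real poly \<Rightarrow> real ^ 'n::{finite,linorder} set \<Rightarrow> real ^ 'n set" where
  "cl_poly p s = (\<Sum>i\<le>degree p. coeff p i *\<^sub>R cl_power s i)"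

text \<open>\<open>p[A]\<close> for everywhere defined \<open>A\<close>, where all powers of \<open>A\<close> are everywhere defined.\<close>

definition op_poly ::
    "real poly \<Rightarrow> 'a::real_normed_vector \<Rightarrow>\<^sub>L 'a \<Rightarrow> 'a \<Rightarrow>\<^sub>L 'a" where
  "op_poly p A = (\<Sum>i\<le>degree p. coeff p i *\<^sub>R (((\<lambda>B. A o\<^sub>L B) ^^ i) id_blinfun))"

end

theory Submission
  imports Defs "HOL-Complex_Analysis.Cauchy_Integral_Formula"
begin

text \<open>
  Bounded linear functionals separate operators, so identities between operator valued integrals
  reduce to identities between complex contour integrals. An intrinsic function is
  $u + Jv$ on every slice with the same holomorphic $H = u + iv$, and for a functional \<open>l\<close>,
  $l(f(T))$ becomes the integral of $H(z)\,l((z - T)^{-1})$ over the boundary of a double sector,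
  where $(z - T)^{-1} = \overline{z} Q_s[T]^{-1} - T Q_s[T]^{-1}$ is the complexified resolvent. The part
  of the integrand carrying \<open>J\<close> drops out, since the scalar integrals are real by conjugation
  symmetry. Multiplicativity is the resolvent identity combined with Fubini's theorem and Cauchy's
  formula for two nested boundaries. Multiplication by $1/(1 + z^2)$ corresponds to
  composition with $(1 + T^2)^{-1}$, so the correspondence between functions
  $a + b/(1 + z^2) + H(z)$ and operators is multiplicative as well, hence compatible with
  polynomials.
\<close>

section \<open>Separating functionals and the closed graph theorem\<close>

text \<open>Two obstacles shape the argument. The definition of \<open>N_0\<close> prescribes no
  rate of decay: F(z)/z is integrable along each ray, but inside the double sector F(z) times the
  resolvent is only known to be of size 1/|z|, and this bound does not make the arcs vanish.
  Contours are therefore moved after multiplication by a factor that decays at 0 and at infinity,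
  and the limit is taken on the rays alone. The second obstacle is the square of 1/(1 + z^2), which
  is not one of the terms of the decomposition. It is written as 1/(1 + z^2) - (z/(1 + z^2))^2,
  where z/(1 + z^2) is a decaying function; the operators satisfy the same identity. It then has to
  be shown that the contour integral assigns T(1 + T^2)^{-1} to z/(1 + z^2). The poles i and -i of
  this function lie outside the double sector, in the region where the resolvent is holomorphic, so
  the contour is closed through the two outer sectors instead of the inner ones.\<close>

definition sublinear :: "('a::real_vector \<Rightarrow> real) \<Rightarrow> bool" where
  "sublinear q \<longleftrightarrow> (\<forall>x y. q (x + y) \<le> q x + q y) \<and> (\<forall>c\<ge>0. \<forall>x. q (c *\<^sub>R x) = c * q x)"

text \<open>Applying the scaling inequality with the factor 1/c to the vector c x gives the reverse
  inequality, so an upper estimate for positive c is enough for homogeneity.\<close>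

lemma sublinearI:
  assumes add: "\<And>x y. q (x + y) \<le> q x + q y"
    and scale: "\<And>c x. c > 0 \<Longrightarrow> q (c *\<^sub>R x) \<le> c * q x" and zero: "q 0 = 0"
  shows "sublinear q"
  unfolding sublinear_def
proof (intro conjI allI impI add)
  fix c :: real and x assume "c \<ge> 0"
  show "q (c *\<^sub>R x) = c * q x"
  proof (cases "c = 0")
    case False
    then have c: "c > 0" using \<open>c \<ge> 0\<close> by simp
    have "q ((1 / c) *\<^sub>R (c *\<^sub>R x)) \<le> (1 / c) * q (c *\<^sub>R x)" using c by (intro scale) simp
    then have "c * q x \<le> q (c *\<^sub>R x)" using c by (simp add: field_simps)
    then show ?thesis using scale[OF c, of x] by simp
  qed (simp add: zero)
qed

lemma sublinear_zero: "sublinear q \<Longrightarrow> q 0 = 0"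
  unfolding sublinear_def by (metis mult_zero_left order_refl scaleR_zero_left)

lemma sublinear_minus_le:
  assumes "sublinear q"
  shows "- q (- x) \<le> q x"
proof -
  have "q (x + - x) \<le> q x + q (- x)" using assms unfolding sublinear_def by blast
  then show ?thesis using sublinear_zero[OF assms] by simp
qed

text \<open>The one-step lowering of Hahn-Banach type: t = 1 at x = -y shows that the value at -y
  drops to at most \<open>- q y\<close>, which makes the functional odd on the line of y.
  Subadditivity of q keeps the infimum above - q(-x).\<close>

definition sublinear_push :: "('a::real_vector \<Rightarrow> real) \<Rightarrow> 'a \<Rightarrow> 'a \<Rightarrow> real" where
  "sublinear_push q y x = (INF t\<in>{0..}. q (x + t *\<^sub>R y) - t * q y)"

lemma sublinear_push_le:
  assumes "sublinear q" "t \<ge> 0"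
  shows "sublinear_push q y x \<le> q (x + t *\<^sub>R y) - t * q y"
  unfolding sublinear_push_def
proof (rule cINF_lower)
  show "bdd_below ((\<lambda>t. q (x + t *\<^sub>R y) - t * q y) ` {0..})"
  proof (rule bdd_belowI2)
    fix t :: real assume "t \<in> {0..}"
    then have "t * q y = q ((x + t *\<^sub>R y) + - x)" using assms(1) by (simp add: sublinear_def)
    also have "\<dots> \<le> q (x + t *\<^sub>R y) + q (- x)" using assms(1) unfolding sublinear_def by blast
    finally show "- q (- x) \<le> q (x + t *\<^sub>R y) - t * q y" by simp
  qed
qed (use assms in simp)

lemma sublinear_push_greatest:
  assumes "\<And>t. t \<ge> 0 \<Longrightarrow> c \<le> q (x + t *\<^sub>R y) - t * q y"
  shows "c \<le> sublinear_push q y x"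
  unfolding sublinear_push_def by (rule cINF_greatest) (use assms in auto)

text \<open>For subadditivity a shift s for the first vector and a shift t for the second are
  combined into the shift s + t for the sum; for homogeneity the shift is scaled along with the
  vector.\<close>

lemma sublinear_sublinear_push:
  assumes q: "sublinear q"
  shows "sublinear (sublinear_push q y)"
proof (rule sublinearI)
  fix x1 x2
  have *: "sublinear_push q y (x1 + x2) - (q (x2 + t *\<^sub>R y) - t * q y) \<le> q (x1 + s *\<^sub>R y) - s * q y"
    if "s \<ge> 0" "t \<ge> 0" for s t
  proof -
    have "sublinear_push q y (x1 + x2) \<le> q (x1 + x2 + (s + t) *\<^sub>R y) - (s + t) * q y"
      using that by (intro sublinear_push_le q) simp
    also have "x1 + x2 + (s + t) *\<^sub>R y = (x1 + s *\<^sub>R y) + (x2 + t *\<^sub>R y)"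
      by (simp add: scaleR_add_left)
    also have "q \<dots> \<le> q (x1 + s *\<^sub>R y) + q (x2 + t *\<^sub>R y)" using q unfolding sublinear_def by blast
    finally show ?thesis by (simp add: algebra_simps)
  qed
  have "sublinear_push q y (x1 + x2) - (q (x2 + t *\<^sub>R y) - t * q y) \<le> sublinear_push q y x1"
    if "t \<ge> 0" for t
    by (rule sublinear_push_greatest) (rule *[OF _ that])
  then have "sublinear_push q y (x1 + x2) - sublinear_push q y x1 \<le> sublinear_push q y x2"
    by (intro sublinear_push_greatest) (simp add: algebra_simps)
  then show "sublinear_push q y (x1 + x2) \<le> sublinear_push q y x1 + sublinear_push q y x2"
    by simp
next
  fix c :: real and x assume c: "c > 0"
  have "sublinear_push q y (c *\<^sub>R x) / c \<le> sublinear_push q y x"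
  proof (rule sublinear_push_greatest)
    fix t :: real assume t: "t \<ge> 0"
    have "sublinear_push q y (c *\<^sub>R x) \<le> q (c *\<^sub>R x + (c * t) *\<^sub>R y) - (c * t) * q y"
      using t c by (intro sublinear_push_le q) simp
    also have "q (c *\<^sub>R x + (c * t) *\<^sub>R y) = c * q (x + t *\<^sub>R y)"
      using q c unfolding sublinear_def by (metis less_imp_le scaleR_add_right scaleR_scaleR)
    finally show "sublinear_push q y (c *\<^sub>R x) / c \<le> q (x + t *\<^sub>R y) - t * q y"
      using c by (simp add: field_simps)
  qed
  then show "sublinear_push q y (c *\<^sub>R x) \<le> c * sublinear_push q y x"
    using c by (simp add: field_simps)
next
  have "sublinear_push q y 0 \<le> q (0 + 0 *\<^sub>R y) - 0 * q y" by (intro sublinear_push_le q) simp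
  moreover have "0 \<le> sublinear_push q y 0"
    by (rule sublinear_push_greatest) (use q in \<open>simp add: sublinear_def\<close>)
  ultimately show "sublinear_push q y 0 = 0" by (simp add: sublinear_zero[OF q])
qed

text \<open>A minimal sublinear functional is linear, because it cannot be pushed down any further.\<close>

lemma norming_functional:
  fixes x0 :: "'a::real_normed_vector"
  shows "\<exists>f::'a \<Rightarrow> real. bounded_linear f \<and> f x0 = norm x0"
proof -
  \<comment> \<open>For a linear member, the bound by the norm and the last condition force the
    value \<open>norm x0\<close> at \<open>x0\<close>. The condition is an upper bound at
    \<open>- x0\<close>, so it survives any further lowering of q.\<close>
  define A where "A = {q :: 'a \<Rightarrow> real. sublinear q \<and> (\<forall>x. q x \<le> norm x) \<and> q (- x0) \<le> - norm x0}"
  have norm_sub: "sublinear (norm :: 'a \<Rightarrow> real)"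
    by (simp add: sublinear_def norm_triangle_ineq)
  \<comment> \<open>The norm itself violates the condition at \<open>- x0\<close> unless
    \<open>x0\<close> is zero; one push along \<open>x0\<close> repairs this.\<close>
  have start: "sublinear_push norm x0 \<in> A"
    unfolding A_def mem_Collect_eq
  proof (intro conjI allI sublinear_sublinear_push norm_sub)
    show "sublinear_push norm x0 x \<le> norm x" for x
      using sublinear_push_le[OF norm_sub, of 0 x0 x] by simp
    show "sublinear_push norm x0 (- x0) \<le> - norm x0"
      using sublinear_push_le[OF norm_sub, of 1 x0 "- x0"] by simp
  qed
  have lower: "- norm x \<le> q x" if "q \<in> A" for q x
    using that sublinear_minus_le[of q x] unfolding A_def
    by (smt (verit, best) mem_Collect_eq norm_minus_cancel)
  have "\<exists>m\<in>A. \<forall>a\<in>A. a \<le> m \<longrightarrow> a = m"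
  proof (rule predicate_Zorn[of A "\<lambda>a b. b \<le> a"])
    show "partial_order_on A (relation_of (\<lambda>a b. b \<le> a) A)"
      by (rule partial_order_on_relation_ofI) auto
    fix C assume C: "C \<in> Chains (relation_of (\<lambda>a b. b \<le> a) A)"
    then have CA: "C \<subseteq> A" and chain: "\<And>a b. a \<in> C \<Longrightarrow> b \<in> C \<Longrightarrow> a \<le> b \<or> b \<le> a"
      by (auto simp: Chains_def relation_of_def)
    show "\<exists>u\<in>A. \<forall>a\<in>C. u \<le> a"
    proof (cases "C = {}")
      case True then show ?thesis using start by blast
    next
      case False
      \<comment> \<open>The pointwise infimum is a lower bound of the chain. It is subadditive
        because two members of the chain have a common smaller one, namely one of the two.\<close>
      define u where "u x = (INF q\<in>C. q x)" for x
      have le: "u x \<le> q x" if "q \<in> C" for q x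
        unfolding u_def using that CA lower by (intro cINF_lower bdd_belowI2[of _ "- norm x"]) auto
      have ge: "c \<le> u x" if "\<And>q. q \<in> C \<Longrightarrow> c \<le> q x" for c x
        unfolding u_def using that False by (intro cINF_greatest) auto
      have sub: "sublinear q" if "q \<in> C" for q using that CA unfolding A_def by blast
      have "sublinear u"
      proof (rule sublinearI)
        fix x y
        have "u (x + y) - q2 y \<le> q1 x" if "q1 \<in> C" "q2 \<in> C" for q1 q2
        proof -
          obtain q where q: "q \<in> C" "q \<le> q1" "q \<le> q2" using chain \<open>q1 \<in> C\<close> \<open>q2 \<in> C\<close> by blast
          have "u (x + y) \<le> q (x + y)" by (rule le[OF q(1)])
          also have "\<dots> \<le> q x + q y" using sub[OF q(1)] unfolding sublinear_def by blast
          also have "\<dots> \<le> q1 x + q2 y" using q(2,3) by (intro add_mono) (auto simp: le_fun_def)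
          finally show ?thesis by simp
        qed
        then have "u (x + y) - q2 y \<le> u x" if "q2 \<in> C" for q2 using that by (intro ge)
        then have "u (x + y) - u x \<le> q2 y" if "q2 \<in> C" for q2 using that by (simp add: algebra_simps)
        then have "u (x + y) - u x \<le> u y" by (intro ge)
        then show "u (x + y) \<le> u x + u y" by simp
      next
        fix c :: real and x assume c: "c > 0"
        have "u (c *\<^sub>R x) / c \<le> u x"
        proof (rule ge)
          fix q assume q: "q \<in> C"
          have "u (c *\<^sub>R x) \<le> c * q x"
            using le[OF q, of "c *\<^sub>R x"] sub[OF q] c unfolding sublinear_def by auto
          then show "u (c *\<^sub>R x) / c \<le> q x" using c by (simp add: field_simps)
        qed
        then show "u (c *\<^sub>R x) \<le> c * u x" using c by (simp add: field_simps)
      next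
        show "u 0 = 0" unfolding u_def using False sub by (simp add: sublinear_zero)
      qed
      moreover obtain q where q: "q \<in> C" using False by blast
      moreover have "u x \<le> norm x" for x
        using le[OF q, of x] q CA unfolding A_def by (force intro: order_trans)
      moreover have "u (- x0) \<le> - norm x0"
        using le[OF q, of "- x0"] q CA unfolding A_def by (force intro: order_trans)
      ultimately have "u \<in> A" unfolding A_def by blast
      then show ?thesis using le by (auto simp: le_fun_def)
    qed
  qed
  then obtain m where m: "m \<in> A" and min: "\<And>a. a \<in> A \<Longrightarrow> a \<le> m \<Longrightarrow> a = m" by blast
  then have ms: "sublinear m" and mn: "\<And>x. m x \<le> norm x" and m0: "m (- x0) \<le> - norm x0"
    unfolding A_def by auto
  have push: "sublinear_push m y = m" for y
  proof (rule min)
    show le: "sublinear_push m y \<le> m"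
      using sublinear_push_le[OF ms, of 0 y] by (auto simp: le_fun_def)
    show "sublinear_push m y \<in> A"
      unfolding A_def using le mn m0 sublinear_sublinear_push[OF ms]
      by (auto simp: le_fun_def intro: order_trans)
  qed
  have add: "m (x + y) = m x + m y" for x y
  proof (rule antisym)
    show "m (x + y) \<le> m x + m y" using ms unfolding sublinear_def by blast
    show "m x + m y \<le> m (x + y)" using sublinear_push_le[OF ms, of 1 y x] push by simp
  qed
  have minus: "m (- x) = - m x" for x using add[of x "- x"] sublinear_zero[OF ms] by simp
  have scale: "m (c *\<^sub>R x) = c * m x" for c x
  proof (cases "c \<ge> 0")
    case False
    then have "m ((- c) *\<^sub>R x) = (- c) * m x" using ms unfolding sublinear_def by (meson linear neg_0_le_iff_le)
    then show ?thesis by (simp add: minus)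
  qed (use ms in \<open>simp add: sublinear_def\<close>)
  have "bounded_linear m"
  proof (rule bounded_linear_intro[of m 1])
    show "norm (m x) \<le> norm x * 1" for x using mn[of x] mn[of "- x"] minus[of x] by simp
  qed (simp_all add: add scale)
  moreover have "m x0 = norm x0" using mn[of x0] m0 minus[of x0] by simp
  ultimately show ?thesis by blast
qed

lemma bounded_linear_functionals_separate:
  fixes x y :: "'a::real_normed_vector"
  assumes "\<And>f::'a \<Rightarrow> real. bounded_linear f \<Longrightarrow> f x = f y"
  shows "x = y"
proof -
  obtain f :: "'a \<Rightarrow> real" where f: "bounded_linear f" "f (x - y) = norm (x - y)"
    using norming_functional by blast
  then show ?thesis using assms[OF f(1)] by (simp add: linear_diff bounded_linear.linear)
qed

text \<open>By Baire's theorem the closure of some set of vectors with |S v| at most n contains a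
  ball. Differences and scaling turn this into approximate solutions near 0 with controlled image,
  which are summed in a series of successive corrections. The closed graph identifies the image of
  the sum with the sum of the images.\<close>

theorem closed_graph_bounded_linear:
  fixes S :: "'a::banach \<Rightarrow> 'b::banach"
  assumes lin: "linear S" and graph: "closed {(v, S v) |v. True}"
  shows "bounded_linear S"
proof -
  interpret S: linear S by (rule lin)
  define A where "A n = {v. norm (S v) \<le> real n}" for n
  have "\<exists>n. interior (closure (A n)) \<noteq> {}"
  proof (rule ccontr)
    assume none: "\<not> ?thesis"
    have "Met_TC.mtopology interior_of \<Union> (range (\<lambda>n. closure (A n))) = ({} :: 'a set)"
    proof (rule Met_TC.metric_Baire_category_alt)
      show "Met_TC.mcomplete TYPE('a)" using complete_UNIV by (simp add: mcomplete_iff_complete)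
      fix U assume "U \<in> range (\<lambda>n. closure (A n))"
      then show "closedin Met_TC.mtopology U \<and> Met_TC.mtopology interior_of U = ({} :: 'a set)"
        using none by auto
    qed auto
    moreover have "v \<in> \<Union> (range (\<lambda>n. closure (A n)))" for v
    proof -
      obtain n where "norm (S v) \<le> real n" using real_arch_simple by blast
      then show ?thesis using closure_subset by (fastforce simp: A_def)
    qed
    then have "\<Union> (range (\<lambda>n. closure (A n))) = UNIV" by blast
    ultimately show False by simp
  qed
  then obtain n v0 where "v0 \<in> interior (closure (A n))" by blast
  then obtain r where r: "r > 0" "ball v0 r \<subseteq> closure (A n)"
    by (meson interior_subset open_contains_ball open_interior subset_trans)
  define M where "M = real (2 * n)"
  \<comment> \<open>The centre \<open>v0\<close> of the ball is removed by taking the difference of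
    a point near v0 + w' and a point near v0; this doubles the bound n, hence
    \<open>M\<close>.\<close>
  have dense: "\<exists>a. norm (S a) \<le> M * k \<and> dist a w < e"
    if w: "norm w < r * k" and k: "k > 0" and e: "e > 0" for w k e
  proof -
    define w' where "w' = (1 / k) *\<^sub>R w"
    have "norm w' < r" using w k by (simp add: w'_def field_simps)
    then have "v0 + w' \<in> closure (A n)" "v0 \<in> closure (A n)" using r by (auto simp: dist_norm)
    then obtain a b where ab: "a \<in> A n" "dist a (v0 + w') < e / k / 2" "b \<in> A n" "dist b v0 < e / k / 2"
      using e k closure_approachable by (metis divide_pos_pos zero_less_numeral)
    have "norm (S (k *\<^sub>R (a - b))) = k * norm (S a - S b)" using k by (simp add: S.scale S.diff)
    also have "\<dots> \<le> k * M"
      using ab(1,3) norm_triangle_ineq4[of "S a" "S b"] k by (simp add: A_def M_def)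
    finally have 1: "norm (S (k *\<^sub>R (a - b))) \<le> M * k" by (simp add: mult.commute)
    have "norm ((a - b) - w') = norm ((a - (v0 + w')) - (b - v0))" by (simp add: algebra_simps)
    also have "\<dots> < e / k" using ab(2,4) norm_triangle_ineq4[of "a - (v0 + w')" "b - v0"]
      by (simp add: dist_norm)
    finally have "norm ((a - b) - w') < e / k" .
    moreover have "dist (k *\<^sub>R (a - b)) w = k * norm ((a - b) - w')"
    proof -
      have "k *\<^sub>R (a - b) - w = k *\<^sub>R ((a - b) - w')" using k by (simp add: w'_def algebra_simps)
      then show ?thesis using k by (simp add: dist_norm)
    qed
    ultimately have "dist (k *\<^sub>R (a - b)) w < e" using k by (simp add: field_simps)
    with 1 show ?thesis by blast
  qed
  have bound: "norm (S w) \<le> 2 * M" if w: "norm w < r" for w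
  proof -
    \<comment> \<open>Each correction halves the remaining error, so the images of the corrections
      are dominated by a geometric series with sum 2 M.\<close>
    define k where "k j = (1 / 2 :: real) ^ j" for j :: nat
    have kpos: "k j > 0" for j by (simp add: k_def)
    have "\<forall>u. \<exists>b. norm (snd u) < r * k (fst u) \<longrightarrow>
        norm (S b) \<le> M * k (fst u) \<and> dist b (snd u) < r * k (Suc (fst u))"
      using dense[OF _ kpos] r(1) kpos by (metis mult_pos_pos)
    from choice[OF this] obtain b where b: "\<And>u. norm (snd u) < r * k (fst u) \<Longrightarrow>
        norm (S (b u)) \<le> M * k (fst u) \<and> dist (b u) (snd u) < r * k (Suc (fst u))"
      by blast
    define a where "a j x = b (j, x)" for j x
    have a: "norm (S (a j x)) \<le> M * k j \<and> dist (a j x) x < r * k (Suc j)"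
      if "norm x < r * k j" for j x
      using b[of "(j, x)"] that by (simp add: a_def)
    define x where "x = rec_nat w (\<lambda>j y. y - a j y)"
    have x0: "x 0 = w" and xS: "x (Suc j) = x j - a j (x j)" for j by (simp_all add: x_def)
    have xb: "norm (x j) < r * k j" for j
    proof (induction j)
      case (Suc j)
      then show ?case using a[OF Suc] by (simp add: xS dist_norm norm_minus_commute)
    qed (use w in \<open>simp add: x0 k_def\<close>)
    have ab: "norm (S (a j (x j))) \<le> M * k j" for j using a[OF xb] by blast
    have part: "(\<Sum>j<m. a j (x j)) = w - x m" for m
      by (induction m) (simp_all add: x0 xS)
    have "x \<longlonglongrightarrow> 0"
    proof (rule Lim_null_comparison)
      show "\<forall>\<^sub>F j in sequentially. norm (x j) \<le> r * k j"
        using xb by (auto intro: always_eventually less_imp_le)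
      show "(\<lambda>j. r * k j) \<longlonglongrightarrow> 0"
        unfolding k_def by (intro tendsto_mult_right_zero LIMSEQ_realpow_zero) auto
    qed
    then have lim1: "(\<lambda>m. \<Sum>j<m. a j (x j)) \<longlonglongrightarrow> w"
      unfolding part using tendsto_diff[OF tendsto_const] by force
    have ksum: "(\<lambda>j. M * k j) sums (M * 2)"
      unfolding k_def using geometric_sums[of "1 / 2 :: real"] by (intro sums_mult) simp
    have sS: "summable (\<lambda>j. norm (S (a j (x j))))"
      by (rule summable_comparison_test'[OF sums_summable[OF ksum], of 0]) (simp add: ab)
    have lim2: "(\<lambda>m. \<Sum>j<m. S (a j (x j))) \<longlonglongrightarrow> (\<Sum>j. S (a j (x j)))"
      by (rule summable_LIMSEQ[OF summable_norm_cancel[OF sS]])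
    have "(w, \<Sum>j. S (a j (x j))) \<in> {(v, S v) |v. True}"
    proof (rule closed_sequentially[OF graph])
      show "(\<Sum>j<m. a j (x j), \<Sum>j<m. S (a j (x j))) \<in> {(v, S v) |v. True}" for m
        by (auto simp: S.sum)
      show "(\<lambda>m. (\<Sum>j<m. a j (x j), \<Sum>j<m. S (a j (x j)))) \<longlonglongrightarrow> (w, \<Sum>j. S (a j (x j)))"
        by (rule tendsto_Pair[OF lim1 lim2])
    qed
    then have "S w = (\<Sum>j. S (a j (x j)))" by simp
    also have "norm \<dots> \<le> (\<Sum>j. norm (S (a j (x j))))" by (rule summable_norm[OF sS])
    also have "\<dots> \<le> M * 2"
      using suminf_le[OF ab sS sums_summable[OF ksum]] sums_unique[OF ksum] by simp
    finally show ?thesis by simp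
  qed
  show ?thesis
  \<comment> \<open>The bound 2 M on the ball of radius r is used for the multiple of v of norm
    r/2.\<close>
  proof (rule bounded_linear_intro[of S "4 * M / r"])
    fix v
    show "norm (S v) \<le> norm v * (4 * M / r)"
    proof (cases "v = 0")
      case False
      define w where "w = (r / (2 * norm v)) *\<^sub>R v"
      have "norm w < r" using r(1) False by (simp add: w_def)
      then have "norm (S w) \<le> 2 * M" by (rule bound)
      moreover have "norm (S w) = r / (2 * norm v) * norm (S v)" using r(1) by (simp add: w_def S.scale)
      ultimately show ?thesis using r(1) False by (simp add: field_simps)
    qed (simp add: S.zero)
  qed (simp_all add: S.add S.scale)
qed

section \<open>Gauge integrability by domination\<close>

text \<open>Riemann sums of f differ from those of g by at most the Riemann sums of h, and these are
  close to the small integral of h. Hence the Cauchy criterion passes from g to f.\<close>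

lemma integrable_on_cbox_approx:
  fixes f :: "'a::euclidean_space \<Rightarrow> 'b::banach"
  assumes approx: "\<And>e. e > 0 \<Longrightarrow> \<exists>g h. g integrable_on cbox a b \<and> (h::'a \<Rightarrow> real) integrable_on cbox a b \<and>
      integral (cbox a b) h \<le> e \<and> (\<forall>x\<in>cbox a b. norm (f x - g x) \<le> h x)"
  shows "f integrable_on cbox a b"
  unfolding integrable_Cauchy
proof (intro allI impI)
  fix e :: real assume e: "e > 0"
  then obtain g h where g: "g integrable_on cbox a b" and h: "h integrable_on cbox a b"
    and ih: "integral (cbox a b) h \<le> e / 8" and fg: "\<And>x. x \<in> cbox a b \<Longrightarrow> norm (f x - g x) \<le> h x"
    using approx[of "e / 8"] by auto
  obtain d1 where d1: "gauge d1" and D1: "\<And>p. p tagged_division_of cbox a b \<Longrightarrow> d1 fine p \<Longrightarrow>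
      norm ((\<Sum>(x, k)\<in>p. measure lborel k *\<^sub>R g x) - integral (cbox a b) g) < e / 8"
    using has_integral[THEN iffD1, OF integrable_integral[OF g], rule_format, of "e / 8"] e by auto
  obtain d2 where d2: "gauge d2" and D2: "\<And>p. p tagged_division_of cbox a b \<Longrightarrow> d2 fine p \<Longrightarrow>
      norm ((\<Sum>(x, k)\<in>p. measure lborel k *\<^sub>R h x) - integral (cbox a b) h) < e / 8"
    using has_integral[THEN iffD1, OF integrable_integral[OF h], rule_format, of "e / 8"] e by auto
  have est: "norm ((\<Sum>(x, k)\<in>p. measure lborel k *\<^sub>R f x) - integral (cbox a b) g) < e / 2"
    if p: "p tagged_division_of cbox a b" and fine: "(\<lambda>x. d1 x \<inter> d2 x) fine p" for p
  proof -
    have fine12: "d1 fine p" "d2 fine p" using fine by (simp_all add: fine_Int)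
    have "norm ((\<Sum>(x, k)\<in>p. measure lborel k *\<^sub>R f x) - (\<Sum>(x, k)\<in>p. measure lborel k *\<^sub>R g x))
        = norm (\<Sum>(x, k)\<in>p. measure lborel k *\<^sub>R (f x - g x))"
      by (simp add: sum_subtractf[symmetric] case_prod_unfold scaleR_diff_right)
    also have "\<dots> \<le> (\<Sum>(x, k)\<in>p. measure lborel k *\<^sub>R h x)"
    proof (rule sum_norm_le)
      fix y assume "y \<in> p"
      then obtain x k where y: "y = (x, k)" "(x, k) \<in> p" by (cases y) auto
      then have "x \<in> cbox a b" using p by (meson tag_in_interval)
      then have "norm (f x - g x) \<le> h x" by (rule fg)
      then show "norm (case y of (x, k) \<Rightarrow> measure lborel k *\<^sub>R (f x - g x)) \<le> (case y of (x, k) \<Rightarrow> measure lborel k *\<^sub>R h x)"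
        by (simp add: y mult_left_mono)
    qed
    also have "\<dots> < e / 4" using D2[OF p fine12(2)] ih by (simp add: real_norm_def abs_if split: if_splits)
    finally have "norm ((\<Sum>(x, k)\<in>p. measure lborel k *\<^sub>R f x) - (\<Sum>(x, k)\<in>p. measure lborel k *\<^sub>R g x)) < e / 4" .
    then show ?thesis using D1[OF p fine12(1)]
      using norm_diff_triangle_less[of "\<Sum>(x, k)\<in>p. measure lborel k *\<^sub>R f x" "\<Sum>(x, k)\<in>p. measure lborel k *\<^sub>R g x" "e / 4"
          "integral (cbox a b) g" "e / 8"] e by linarith
  qed
  show "\<exists>\<gamma>. gauge \<gamma> \<and> (\<forall>\<D>1 \<D>2. \<D>1 tagged_division_of cbox a b \<and> \<gamma> fine \<D>1 \<and>
      \<D>2 tagged_division_of cbox a b \<and> \<gamma> fine \<D>2 \<longrightarrow>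
      norm ((\<Sum>(x, K)\<in>\<D>1. measure lborel K *\<^sub>R f x) - (\<Sum>(x, K)\<in>\<D>2. measure lborel K *\<^sub>R f x)) < e)"
  proof (intro exI[of _ "\<lambda>x. d1 x \<inter> d2 x"] conjI allI impI gauge_Int d1 d2)
    fix p1 p2
    assume A: "p1 tagged_division_of cbox a b \<and> (\<lambda>x. d1 x \<inter> d2 x) fine p1 \<and>
      p2 tagged_division_of cbox a b \<and> (\<lambda>x. d1 x \<inter> d2 x) fine p2"
    show "norm ((\<Sum>(x, K)\<in>p1. measure lborel K *\<^sub>R f x) - (\<Sum>(x, K)\<in>p2. measure lborel K *\<^sub>R f x)) < e"
      using est[of p1] est[of p2] A
        norm_triangle_half_r[of "integral (cbox a b) g" "\<Sum>(x, K)\<in>p1. measure lborel K *\<^sub>R f x" e "\<Sum>(x, K)\<in>p2. measure lborel K *\<^sub>R f x"]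
      by (simp add: norm_minus_commute)
  qed
qed

text \<open>The function is cut off on {0..c}. The error is dominated by h there, and its integral
  is small for small c by continuity of the indefinite integral of h.\<close>

lemma integrable_on_Icc_dominated_at_left:
  fixes f :: "real \<Rightarrow> 'b::banach"
  assumes cont: "continuous_on {0<..b} f" and h: "h integrable_on {0..b}"
    and bd: "\<And>t. t \<in> {0..b} \<Longrightarrow> norm (f t) \<le> h t"
  shows "f integrable_on {0..b}"
proof (cases "b > 0")
  case True
  have "f integrable_on cbox 0 b"
  proof (rule integrable_on_cbox_approx)
    fix e :: real assume e: "e > 0"
    have "((\<lambda>x. integral {0..x} h) \<longlongrightarrow> integral {0..0} h) (at 0 within {0..b})"
      by (rule indefinite_integral_continuous_1[OF h, unfolded continuous_on_def, rule_format]) (use True in simp)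
    then have "\<forall>\<^sub>F x in at 0 within {0..b}. dist (integral {0..x} h) 0 < e"
      using e by (simp add: tendsto_iff)
    then obtain d where d: "d > 0" and D: "\<And>x. x \<in> {0..b} \<Longrightarrow> x \<noteq> 0 \<Longrightarrow> dist x 0 < d \<Longrightarrow> \<bar>integral {0..x} h\<bar> < e"
      unfolding eventually_at by (auto simp: dist_norm)
    define c where "c = min (d / 2) b"
    have c: "0 < c" "c \<le> b" and ic: "\<bar>integral {0..c} h\<bar> < e"
      using d True D[of c] by (auto simp: c_def dist_norm)
    define g where "g t = (if t \<in> {c..b} then f t else 0)" for t
    define h' where "h' t = (if t \<in> {0..c} then h t else 0)" for t
    have "f integrable_on {c..b}"
      by (rule integrable_continuous_real[OF continuous_on_subset[OF cont]]) (use c in auto)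
    then have "g integrable_on cbox 0 b" unfolding g_def
      using integrable_on_subcbox integrable_restrict_UNIV by blast
    moreover have "h integrable_on {0..c}" using integrable_subinterval_real[OF h] c by auto
    then have "h' integrable_on cbox 0 b" unfolding h'_def
      using integrable_on_subcbox integrable_restrict_UNIV by blast
    moreover have "integral (cbox 0 b) h' = integral {0..c} h"
    proof -
      have "integral (cbox 0 b) h' = integral ({0..b} \<inter> {0..c}) h"
        unfolding h'_def using integral_restrict_Int[of "cbox 0 b" "{0..c}" h] by (simp add: Int_commute)
      also have "{0..b} \<inter> {0..c} = {0..c}" using c by auto
      finally show ?thesis .
    qed
    moreover have "norm (f x - g x) \<le> h' x" if "x \<in> cbox 0 b" for x
      using bd[of x] that order_trans[OF norm_ge_zero bd[of x]] by (auto simp: g_def h'_def)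
    ultimately show "\<exists>g h'. g integrable_on cbox 0 b \<and> h' integrable_on cbox 0 b \<and>
        integral (cbox 0 b) h' \<le> e \<and> (\<forall>x\<in>cbox 0 b. norm (f x - g x) \<le> h' x)"
      using ic by (intro exI[of _ g] exI[of _ h']) auto
  qed
  then show ?thesis by simp
next
  case False
  then have "{0..b} = {} \<or> {0..b} = cbox 0 0" by auto
  then show ?thesis using integrable_on_refl[of f 0] integrable_on_empty by metis
qed

lemma integral_combine3:
  fixes u :: "real \<Rightarrow> 'b::banach"
  assumes "a \<le> c" "c \<le> d" "d \<le> b" "\<And>x y. u integrable_on {x..y}"
  shows "integral {a..b} u = integral {a..c} u + integral {c..d} u + integral {d..b} u"
proof -
  have "integral {a..c} u + integral {c..b} u = integral {a..b} u"
    by (rule Henstock_Kurzweil_Integration.integral_combine) (use assms(1-3) in \<open>auto intro: assms(4)\<close>)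
  moreover have "integral {c..d} u + integral {d..b} u = integral {c..b} u"
    by (rule Henstock_Kurzweil_Integration.integral_combine) (use assms(1-3) in \<open>auto intro: assms(4)\<close>)
  ultimately show ?thesis by (simp add: add.assoc)
qed

text \<open>
  For Banach space valued functions this is the substitute for Lebesgue integrability: the
  Bochner integral of the library needs a second countable range.
\<close>

lemma integrable_on_UNIV_dominated:
  fixes f :: "real \<Rightarrow> 'b::banach"
  assumes cont: "continuous_on (- {0}) f" and h: "h integrable_on UNIV"
    and bd: "\<And>t. norm (f t) \<le> h t"
  shows "f integrable_on UNIV"
proof -
  have hI: "h integrable_on {a..b}" for a b
    using integrable_on_subcbox[OF h, of a b] by simp
  have right: "f integrable_on {0..b}" for b
    by (rule integrable_on_Icc_dominated_at_left[OF continuous_on_subset[OF cont] hI]) (use bd in auto)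
  have left: "f integrable_on {a..0}" for a
  proof -
    have "(\<lambda>t. f (- t)) integrable_on {0..- a}"
    proof (rule integrable_on_Icc_dominated_at_left)
      show "continuous_on {0<..- a} (\<lambda>t. f (- t))"
        by (intro continuous_on_compose2[OF cont] continuous_intros) auto
      show "(\<lambda>t. h (- t)) integrable_on {0..- a}"
        using Henstock_Kurzweil_Integration.integrable_reflect_real[where f = h and a = a and b = 0] hI[of a 0] by simp
    qed (rule bd)
    then show ?thesis using Henstock_Kurzweil_Integration.integrable_reflect_real[where f = f and a = a and b = 0] by simp
  qed
  have fI: "f integrable_on {a..b}" for a b
  proof -
    have "f integrable_on {min a 0..max b 0}"
      by (rule Henstock_Kurzweil_Integration.integrable_combine[OF _ _ left right]) auto
    then show ?thesis by (rule integrable_subinterval_real) auto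
  qed
  have ball: "a \<le> - B \<and> B \<le> b" if "ball 0 B \<subseteq> cbox a b" "B > 0" for a b B :: real
  proof -
    have "closure (ball 0 B) \<subseteq> cbox a b" using that(1) by (intro closure_minimal) auto
    then have "cball 0 B \<subseteq> {a..b}" using that(2) by simp
    moreover have "- B \<in> cball 0 B" "B \<in> cball 0 B" using that(2) by auto
    ultimately have "- B \<in> {a..b}" "B \<in> {a..b}" by blast+
    then show ?thesis by simp
  qed
  show ?thesis
  proof (rule integrable_alt[THEN iffD2], intro conjI allI impI)
    show "(\<lambda>x. if x \<in> UNIV then f x else 0) integrable_on cbox a b" for a b using fI by simp
    fix e :: real assume e: "e > 0"
    then have "e / 2 > 0" by simp
    from integrable_alt[THEN iffD1, OF h, THEN conjunct2, rule_format, OF this]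
    obtain B where B: "B > 0" and HB: "\<And>a b c d. ball 0 B \<subseteq> cbox a b \<Longrightarrow> ball 0 B \<subseteq> cbox c d \<Longrightarrow>
        norm (integral {a..b} h - integral {c..d} h) < e / 2"
      by (simp only: UNIV_I if_True box_real) blast
    \<comment> \<open>Outside {- B..B} both tails of f are bounded by the tails of h, and B was
      chosen from the Cauchy condition for h.\<close>
    have est: "norm (integral {a..b} f - integral {- B..B} f) < e / 2" if ab: "ball 0 B \<subseteq> cbox a b" for a b
    proof -
      have le: "a \<le> - B" "B \<le> b" "- B \<le> B" using ball[OF ab B] B by auto
      have "norm (integral {a..b} f - integral {- B..B} f) \<le> norm (integral {a..- B} f) + norm (integral {B..b} f)"
        using integral_combine3[OF le(1,3,2) fI] by (simp add: norm_triangle_ineq)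
      also have "\<dots> \<le> integral {a..- B} h + integral {B..b} h"
        by (intro add_mono integral_norm_bound_integral fI hI bd)
      also have "\<dots> = integral {a..b} h - integral {- B..B} h" using integral_combine3[OF le(1,3,2) hI] by simp
      also have "\<dots> < e / 2"
      proof -
        have "ball 0 B \<subseteq> cbox (- B) B" by (auto simp: dist_real_def)
        from HB[OF ab this] show ?thesis unfolding real_norm_def by linarith
      qed
      finally show ?thesis .
    qed
    show "\<exists>B>0. \<forall>a b c d. ball 0 B \<subseteq> cbox a b \<and> ball 0 B \<subseteq> cbox c d \<longrightarrow>
      norm (integral (cbox a b) (\<lambda>x. if x \<in> UNIV then f x else 0) -
        integral (cbox c d) (\<lambda>x. if x \<in> UNIV then f x else 0)) < e"
    proof (intro exI[of _ B] conjI allI impI B)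
      fix a b c d :: real assume "ball 0 B \<subseteq> cbox a b \<and> ball 0 B \<subseteq> cbox c d"
      then show "norm (integral (cbox a b) (\<lambda>x. if x \<in> UNIV then f x else 0) -
        integral (cbox c d) (\<lambda>x. if x \<in> UNIV then f x else 0)) < e"
        using norm_triangle_half_r[of "integral {- B..B} f" "integral {a..b} f" e "integral {c..d} f"] est[of a b] est[of c d]
        by (simp add: norm_minus_commute)
    qed
  qed
qed

section \<open>Integrals along rays\<close>

definition ray :: "real \<Rightarrow> complex set" where
  "ray a = (\<lambda>t. complex_of_real t * cis a) ` {0<..}"

definition ray_integrable :: "real \<Rightarrow> (complex \<Rightarrow> complex) \<Rightarrow> bool" where
  "ray_integrable a F \<longleftrightarrow> set_integrable lborel {0<..} (\<lambda>t. F (of_real t * cis a))"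

definition ray_integral :: "real \<Rightarrow> (complex \<Rightarrow> complex) \<Rightarrow> complex" where
  "ray_integral a F = cis a * (LINT t:{0<..}|lborel. F (of_real t * cis a))"

lemma ray_integrable_cong:
  "(\<And>z. z \<in> ray a \<Longrightarrow> F z = G z) \<Longrightarrow> ray_integrable a F \<longleftrightarrow> ray_integrable a G"
  unfolding ray_integrable_def by (rule set_integrable_cong) (auto simp: ray_def)

lemma ray_integral_cong:
  "(\<And>z. z \<in> ray a \<Longrightarrow> F z = G z) \<Longrightarrow> ray_integral a F = ray_integral a G"
  unfolding ray_integral_def by (intro arg_cong2[where f = "(*)"] set_lebesgue_integral_cong) (auto simp: ray_def)

lemma ray_integrable_add: "ray_integrable a F \<Longrightarrow> ray_integrable a G \<Longrightarrow> ray_integrable a (\<lambda>z. F z + G z)"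
  unfolding ray_integrable_def by (rule set_integral_add)

lemma ray_integrable_diff: "ray_integrable a F \<Longrightarrow> ray_integrable a G \<Longrightarrow> ray_integrable a (\<lambda>z. F z - G z)"
  unfolding ray_integrable_def by (rule set_integral_diff)

lemma ray_integrable_cmult: "ray_integrable a F \<Longrightarrow> ray_integrable a (\<lambda>z. c * F z)"
  unfolding ray_integrable_def by (rule set_integrable_mult_right)

lemma ray_integral_add:
  "ray_integrable a F \<Longrightarrow> ray_integrable a G \<Longrightarrow>
    ray_integral a (\<lambda>z. F z + G z) = ray_integral a F + ray_integral a G"
  unfolding ray_integrable_def ray_integral_def by (simp add: set_integral_add distrib_left)

lemma ray_integral_diff:
  "ray_integrable a F \<Longrightarrow> ray_integrable a G \<Longrightarrow>
    ray_integral a (\<lambda>z. F z - G z) = ray_integral a F - ray_integral a G"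
  unfolding ray_integrable_def ray_integral_def by (simp add: set_integral_diff right_diff_distrib)

lemma ray_integral_cmult: "ray_integral a (\<lambda>z. c * F z) = c * ray_integral a F"
  unfolding ray_integral_def by simp

lemma ray_integral_shift:
  "ray_integral (a + b) F = cis b * ray_integral a (\<lambda>z. F (z * cis b))"
  unfolding ray_integral_def by (simp add: cis_mult[symmetric] mult.assoc mult.left_commute)

lemma ray_integrable_shift:
  "ray_integrable (a + b) F \<longleftrightarrow> ray_integrable a (\<lambda>z. F (z * cis b))"
  unfolding ray_integrable_def by (simp add: cis_mult[symmetric] mult.assoc)

lemma set_borel_measurable_ray:
  fixes F :: "complex \<Rightarrow> complex"
  assumes "continuous_on (ray a) F"
  shows "set_borel_measurable lborel {0<..} (\<lambda>t. F (of_real t * cis a))"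
proof -
  have "continuous_on {0<..} (\<lambda>t. F (of_real t * cis a))"
    by (intro continuous_on_compose2[OF assms] continuous_intros) (auto simp: ray_def)
  then show ?thesis
    unfolding set_borel_measurable_def by (simp add: borel_measurable_continuous_on_indicator)
qed

lemma set_integrable_dominated_real:
  fixes f :: "real \<Rightarrow> 'b::{banach, second_countable_topology}" and g :: "real \<Rightarrow> real"
  assumes "set_integrable lborel A g" "set_borel_measurable lborel A f"
    and "\<And>t. t \<in> A \<Longrightarrow> norm (f t) \<le> g t"
  shows "set_integrable lborel A f"
  by (rule set_integrable_bound[OF assms(1,2)]) (use assms(3) in \<open>force intro!: AE_I2\<close>)

lemma ray_integrable_bound:
  assumes "ray_integrable a F" "continuous_on (ray a) G"
    and "\<And>z. z \<in> ray a \<Longrightarrow> norm (G z) \<le> K * norm (F z)"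
  shows "ray_integrable a G"
  unfolding ray_integrable_def
proof (rule set_integrable_dominated_real[OF _ set_borel_measurable_ray[OF assms(2)]])
  show "set_integrable lborel {0<..} (\<lambda>t. K * norm (F (of_real t * cis a)))"
    using assms(1) unfolding ray_integrable_def by (intro set_integrable_mult_right set_integrable_norm)
qed (use assms(3) in \<open>auto simp: ray_def\<close>)

text \<open>For a < b with b - a at most pi this is the open sector of arguments between a and b.
  Written as an intersection of two half planes it is visibly open and convex, so holomorphic
  functions on it have primitives.\<close>

definition wedge :: "real \<Rightarrow> real \<Rightarrow> complex set" where
  "wedge a b = {z. 0 < Im (z * cis (- a)) \<and> Im (z * cis (- b)) < 0}"

lemma Im_mult_cis: "Im (z * cis a) = Re z * sin a + Im z * cos a"
  by (simp add: algebra_simps)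

lemma Im_ray_mult_cis: "Im (of_real t * cis c * cis a) = t * sin (c + a)"
  by (simp add: sin_add algebra_simps)

lemma ray_subset_wedge:
  assumes "a < c" "c < b" "b - a \<le> pi"
  shows "ray c \<subseteq> wedge a b"
proof -
  have "sin (c - a) > 0" by (rule sin_gt_zero) (use assms in auto)
  moreover have "sin (b - c) > 0" by (rule sin_gt_zero) (use assms in auto)
  moreover have "sin (c - b) = - sin (b - c)" by (metis minus_diff_eq sin_minus)
  ultimately have "0 < t * sin (c + - a)" "t * sin (c + - b) < 0" if "t > 0" for t
    using that by (simp_all del: sin_diff add: mult_pos_neg)
  then show ?thesis unfolding ray_def wedge_def by (auto simp only: Im_ray_mult_cis mem_Collect_eq greaterThan_iff)
qed

lemma open_wedge: "open (wedge a b)"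
  unfolding wedge_def by (intro open_Collect_conj open_Collect_less continuous_intros)

lemma convex_wedge: "convex (wedge a b)"
proof -
  have "wedge a b = {z. 0 < inner z (Complex (- sin a) (cos a))} \<inter> {z. inner z (Complex (- sin b) (cos b)) < 0}"
    by (auto simp: wedge_def inner_complex_def Im_mult_cis algebra_simps)
  moreover have "convex {z::complex. 0 < inner z (Complex (- sin a) (cos a))}"
    using convex_halfspace_gt[of 0 "Complex (- sin a) (cos a)"] by (simp add: inner_commute)
  moreover have "convex {z::complex. inner z (Complex (- sin b) (cos b)) < 0}"
    using convex_halfspace_lt[of "Complex (- sin b) (cos b)" 0] by (simp add: inner_commute)
  ultimately show ?thesis by (simp add: convex_Int)
qed

text \<open>Subtracting the two defining expressions cancels the imaginary part and leaves 2 Re z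
  sin \<eta>.\<close>

lemma wedge_Re_pos:
  assumes "z \<in> wedge (- \<eta>) \<eta>" "0 < \<eta>" "\<eta> \<le> pi / 2"
  shows "Re z > 0"
proof -
  have "sin \<eta> > 0" by (rule sin_gt_zero) (use assms pi_gt_zero in linarith)+
  moreover have "2 * (Re z * sin \<eta>) > 0"
    using assms(1) unfolding wedge_def mem_Collect_eq Im_mult_cis by (simp add: algebra_simps)
  ultimately show ?thesis by (simp add: zero_less_mult_iff)
qed

lemma ray_integral_FTC:
  assumes P: "\<And>z. z \<in> S \<Longrightarrow> (P has_field_derivative F z) (at z)" and S: "ray a \<subseteq> S"
    and cF: "continuous_on S F" and xy: "0 < x" "x \<le> y"
  shows "(LINT t:{x..y}|lborel. cis a * F (of_real t * cis a)) = P (of_real y * cis a) - P (of_real x * cis a)"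
  unfolding set_lebesgue_integral_def
proof (rule integral_FTC_atLeastAtMost[OF xy(2)])
  fix t :: real assume t: "x \<le> t" "t \<le> y"
  then have z: "of_real t * cis a \<in> S" using S xy by (auto simp: ray_def)
  have "((\<lambda>t. complex_of_real t * cis a) has_vector_derivative cis a) (at t within {x..y})"
    by (auto intro!: derivative_eq_intros)
  from field_vector_diff_chain_within[OF this has_field_derivative_at_within[OF P[OF z]]]
  show "((\<lambda>t. P (of_real t * cis a)) has_vector_derivative cis a * F (of_real t * cis a)) (at t within {x..y})"
    by (simp add: o_def)
next
  show "continuous_on {x..y} (\<lambda>t. cis a * F (of_real t * cis a))"
    by (intro continuous_intros continuous_on_compose2[OF cF]) (use S xy in \<open>auto simp: ray_def\<close>)
qed

lemma borel_measurable_indicator_Icc: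
  fixes u :: "real \<Rightarrow> complex"
  assumes [measurable]: "u \<in> borel_measurable lborel"
  shows "(\<lambda>t. indicat_real {a..b} t *\<^sub>R u t) \<in> borel_measurable lborel"
  by measurable

lemma ray_integral_limit:
  assumes "ray_integrable a F"
  shows "(\<lambda>m. LINT t:{1 / real (Suc m)..real (Suc m)}|lborel. cis a * F (of_real t * cis a)) \<longlonglongrightarrow> ray_integral a F"
proof -
  let ?f = "\<lambda>t. cis a * F (of_real t * cis a)"
  have int: "set_integrable lborel {0<..} ?f"
    using assms unfolding ray_integrable_def by (rule set_integrable_mult_right)
  have "(\<lambda>m. LINT t:{1 / real (Suc m)..real (Suc m)}|lborel. ?f t) \<longlonglongrightarrow> (LINT t:{0<..}|lborel. ?f t)"
    unfolding set_lebesgue_integral_def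
  proof (rule integral_dominated_convergence)
    show "integrable lborel (\<lambda>t. norm (indicat_real {0<..} t *\<^sub>R ?f t))"
      using int unfolding set_integrable_def by (rule integrable_norm)
    show meas: "(\<lambda>t. indicat_real {0<..} t *\<^sub>R ?f t) \<in> borel_measurable lborel"
      using int unfolding set_integrable_def by (rule borel_measurable_integrable)
    show "(\<lambda>t. indicat_real {1 / real (Suc m)..real (Suc m)} t *\<^sub>R ?f t) \<in> borel_measurable lborel" for m
    proof -
      have "(\<lambda>t. indicat_real {1 / real (Suc m)..real (Suc m)} t *\<^sub>R (indicat_real {0<..} t *\<^sub>R ?f t)) \<in> borel_measurable lborel"
        by (rule borel_measurable_indicator_Icc[OF meas])
      moreover have "(\<lambda>t. indicat_real {1 / real (Suc m)..real (Suc m)} t *\<^sub>R (indicat_real {0<..} t *\<^sub>R ?f t)) =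
          (\<lambda>t. indicat_real {1 / real (Suc m)..real (Suc m)} t *\<^sub>R ?f t)"
      proof
        fix t
        have "t \<in> {1 / real (Suc m)..real (Suc m)} \<Longrightarrow> t \<in> {0<..}"
          using less_le_trans[of 0 "1 / real (Suc m)" t] by simp
        then show "indicat_real {1 / real (Suc m)..real (Suc m)} t *\<^sub>R (indicat_real {0<..} t *\<^sub>R ?f t) =
          indicat_real {1 / real (Suc m)..real (Suc m)} t *\<^sub>R ?f t"
          by (auto simp: indicator_def)
      qed
      ultimately show ?thesis by (simp only:)
    qed
    show "AE t in lborel. norm (indicat_real {1 / real (Suc m)..real (Suc m)} t *\<^sub>R ?f t) \<le> norm (indicat_real {0<..} t *\<^sub>R ?f t)" for m
    proof (rule AE_I2)
      fix t
      have "t \<in> {1 / real (Suc m)..real (Suc m)} \<Longrightarrow> t \<in> {0<..}"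
        using less_le_trans[of 0 "1 / real (Suc m)" t] by simp
      then show "norm (indicat_real {1 / real (Suc m)..real (Suc m)} t *\<^sub>R ?f t) \<le> norm (indicat_real {0<..} t *\<^sub>R ?f t)"
        by (auto simp: indicator_def)
    qed
    show "AE t in lborel. (\<lambda>m. indicat_real {1 / real (Suc m)..real (Suc m)} t *\<^sub>R ?f t) \<longlonglongrightarrow> indicat_real {0<..} t *\<^sub>R ?f t"
    proof (rule AE_I2, rule tendsto_eventually)
      fix t :: real
      show "\<forall>\<^sub>F m in sequentially. indicat_real {1 / real (Suc m)..real (Suc m)} t *\<^sub>R ?f t = indicat_real {0<..} t *\<^sub>R ?f t"
      proof (cases "t > 0")
        case True
        obtain N1 N2 where N: "t \<le> real N1" "1 / t \<le> real N2" by (meson real_arch_simple)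
        have "t \<in> {1 / real (Suc m)..real (Suc m)}" if "m \<ge> max N1 N2" for m
        proof -
          have "t \<le> real (Suc m)" "1 / t \<le> real (Suc m)" using that N by auto
          then show ?thesis using True by (auto simp: field_simps)
        qed
        then show ?thesis using True by (auto simp: eventually_sequentially indicator_def intro!: exI[of _ "max N1 N2"])
      next
        case False
        then have "t \<notin> {1 / real (Suc m)..real (Suc m)}" for m
          using less_le_trans[of 0 "1 / real (Suc m)" t] by auto
        then show ?thesis using False by simp
      qed
    qed
  qed
  then show ?thesis by (simp add: ray_integral_def)
qed

text \<open>
  Rotation of a ray inside a half plane where the integrand decays like $|z|^{-2}$ at infinity
  and is bounded at the origin, so that the connecting arcs do not contribute.
\<close>

lemma ray_integral_rotate_decay:
  assumes eta: "0 < \<eta>" "\<eta> \<le> pi / 2" and ab: "\<bar>a\<bar> < \<eta>" "\<bar>b\<bar> < \<eta>"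
    and hol: "F holomorphic_on wedge (- \<eta>) \<eta>"
    and M1: "\<And>z. z \<in> wedge (- \<eta>) \<eta> \<Longrightarrow> norm (F z) \<le> M"
    and M2: "\<And>z. z \<in> wedge (- \<eta>) \<eta> \<Longrightarrow> norm (F z) \<le> M / (norm z)\<^sup>2"
    and int: "ray_integrable a F" "ray_integrable b F"
  shows "ray_integral a F = ray_integral b F"
proof -
  let ?S = "wedge (- \<eta>) \<eta>"
  have ra: "ray c \<subseteq> ?S" if "\<bar>c\<bar> < \<eta>" for c by (rule ray_subset_wedge) (use that eta in auto)
  obtain P where P: "\<And>z. z \<in> ?S \<Longrightarrow> (P has_field_derivative F z) (at z within ?S)"
    using holomorphic_convex_primitive'[OF convex_wedge open_wedge hol] by blast
  then have P': "\<And>z. z \<in> ?S \<Longrightarrow> (P has_field_derivative F z) (at z)"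
    by (metis at_within_open open_wedge)
  note cF = holomorphic_on_imp_continuous_on[OF hol]
  have "0 < cos a" "0 < cos b" using ab eta by (auto intro!: cos_gt_zero_pi)
  then obtain k where k: "0 < k" "k \<le> cos a" "k \<le> cos b" by (meson linorder_le_cases order_refl)
  have inS: "of_real t * cis c \<in> ?S" if "t > 0" "\<bar>c\<bar> < \<eta>" for t c
    using ra[OF that(2)] that(1) by (auto simp: ray_def)
  have M0: "M \<ge> 0" using M1[OF inS[OF zero_less_one ab(1)]] norm_ge_zero order_trans by blast
  \<comment> \<open>With a primitive P the difference of the truncated ray integrals is an increment
    of P between the rays at the large radius minus one at the small radius.\<close>
  define E where "E m = (P (of_real (real (Suc m)) * cis a) - P (of_real (real (Suc m)) * cis b))
     - (P (of_real (1 / real (Suc m)) * cis a) - P (of_real (1 / real (Suc m)) * cis b))" for m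
  have diffE: "(LINT t:{1 / real (Suc m)..real (Suc m)}|lborel. cis a * F (of_real t * cis a))
     - (LINT t:{1 / real (Suc m)..real (Suc m)}|lborel. cis b * F (of_real t * cis b)) = E m" for m
  proof -
    have m: "0 < 1 / real (Suc m)" "1 / real (Suc m) \<le> real (Suc m)" by (auto simp: field_simps)
    show ?thesis
      using ray_integral_FTC[OF P' ra[OF ab(1)] cF m] ray_integral_FTC[OF P' ra[OF ab(2)] cF m]
      by (simp add: E_def)
  qed
  have bound: "norm (E m) \<le> (2 * M / k\<^sup>2 + 2 * M) * (1 / real (Suc m))" for m
  proof -
    let ?R = "real (Suc m)"
    have R: "?R > 0" by simp
    have chord: "norm (of_real r * cis a - of_real r * cis b) \<le> 2 * r" if "r > 0" for r
      using norm_triangle_ineq4[of "of_real r * cis a" "of_real r * cis b"] that by (simp add: norm_mult)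
    \<comment> \<open>The arc is replaced by the chord. On it the real part is at least R k, with k
      below both cosines, so the integrand is at most M/(R k)^2 over a length of at most 2
      R.\<close>
    let ?C = "?S \<inter> {z. Re z \<ge> ?R * k}"
    have conv: "convex ?C" by (intro convex_Int convex_wedge convex_halfspace_Re_ge)
    have big: "norm (P (of_real ?R * cis a) - P (of_real ?R * cis b))
      \<le> (M / (?R * k)\<^sup>2) * norm (of_real ?R * cis a - of_real ?R * cis b)"
    proof (rule field_differentiable_bound[OF conv])
      show "(P has_field_derivative F z) (at z within ?C)" if "z \<in> ?C" for z
        using P'[of z] that has_field_derivative_at_within by blast
      show "norm (F z) \<le> M / (?R * k)\<^sup>2" if "z \<in> ?C" for z
      proof -
        have "?R * k \<le> norm z" using that complex_Re_le_cmod[of z] by auto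
        moreover have Rk: "0 < ?R * k" using R k by simp
        ultimately have le: "(?R * k)\<^sup>2 \<le> (norm z)\<^sup>2" by (intro power_mono) auto
        have "0 < (?R * k)\<^sup>2" using Rk by (rule zero_less_power)
        with le have "M / (norm z)\<^sup>2 \<le> M / (?R * k)\<^sup>2" using M0
          by (intro divide_left_mono mult_pos_pos) linarith+
        then show ?thesis using M2[of z] that by auto
      qed
      have "?R * k \<le> Re (of_real ?R * cis c)" if "k \<le> cos c" for c
        using mult_left_mono[OF that less_imp_le[OF R]] by simp
      then show "of_real ?R * cis a \<in> ?C" "of_real ?R * cis b \<in> ?C"
        using inS[OF R ab(1)] inS[OF R ab(2)] k by blast+
    qed
    also have "\<dots> \<le> (M / (?R * k)\<^sup>2) * (2 * ?R)" using chord[OF R] M0 by (intro mult_left_mono) auto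
    also have "\<dots> = 2 * M / k\<^sup>2 * (1 / ?R)"
    proof -
      have "M / (R * k)\<^sup>2 * (2 * R) = 2 * M / k\<^sup>2 * (1 / R)" if "R > 0" for R
        using that k by (simp add: power2_eq_square mult_ac)
      then show ?thesis using R by blast
    qed
    finally have 1: "norm (P (of_real ?R * cis a) - P (of_real ?R * cis b)) \<le> 2 * M / k\<^sup>2 * (1 / ?R)" .
    have r: "1 / ?R > 0" by simp
    have "norm (P (of_real (1 / ?R) * cis a) - P (of_real (1 / ?R) * cis b))
      \<le> M * norm (of_real (1 / ?R) * cis a - of_real (1 / ?R) * cis b)"
      by (rule field_differentiable_bound[OF convex_wedge P M1 inS[OF r ab(1)] inS[OF r ab(2)]])
    also have "\<dots> \<le> M * (2 * (1 / ?R))" using chord[OF r] M0 by (intro mult_left_mono)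
    finally have 2: "norm (P (of_real (1 / ?R) * cis a) - P (of_real (1 / ?R) * cis b)) \<le> 2 * M * (1 / ?R)" by (simp add: mult.commute)
    show ?thesis unfolding E_def distrib_right
      by (rule order_trans[OF norm_triangle_ineq4 add_mono[OF 1 2]])
  qed
  have "E \<longlonglongrightarrow> 0"
  proof (rule Lim_null_comparison)
    show "\<forall>\<^sub>F m in sequentially. norm (E m) \<le> (2 * M / k\<^sup>2 + 2 * M) * (1 / real (Suc m))"
      using bound by simp
    show "(\<lambda>m. (2 * M / k\<^sup>2 + 2 * M) * (1 / real (Suc m))) \<longlonglongrightarrow> 0"
      using tendsto_mult_right_zero[OF LIMSEQ_inverse_real_of_nat] by (simp add: inverse_eq_divide)
  qed
  moreover have "E \<longlonglongrightarrow> ray_integral a F - ray_integral b F"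
    using tendsto_diff[OF ray_integral_limit[OF int(1)] ray_integral_limit[OF int(2)]] unfolding diffE .
  ultimately show ?thesis using LIMSEQ_unique by force
qed

text \<open>In the right half plane this factor is bounded by 1 and tends to 1 as n grows, while for
  fixed n it is O(|z|) at the origin and O(1/|z|) at infinity. It turns an integrand of size 1/|z|
  into one that is bounded at 0 and of size 1/|z|^2 at infinity.\<close>

definition regulariser :: "nat \<Rightarrow> complex \<Rightarrow> complex" where
  "regulariser n z = (of_nat (Suc n) * z / (1 + of_nat (Suc n) * z)) * (of_nat (Suc n) / (of_nat (Suc n) + z))"

lemma norm_add_of_nat_ge:
  assumes "Re z > 0"
  shows "real (Suc n) \<le> norm (of_nat (Suc n) + z)" "norm z \<le> norm (of_nat (Suc n) + z)"
    "1 \<le> norm (1 + of_nat (Suc n) * z)" "norm (of_nat (Suc n) * z) \<le> norm (1 + of_nat (Suc n) * z)"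
proof -
  have pos: "0 < real (Suc n) * Re z" using assms by (intro mult_pos_pos) auto
  have "real (Suc n) + Re z \<le> norm (of_nat (Suc n) + z)"
    using complex_Re_le_cmod[of "of_nat (Suc n) + z"] by (simp del: of_nat_Suc)
  then show "real (Suc n) \<le> norm (of_nat (Suc n) + z)" using assms by linarith
  have "1 + real (Suc n) * Re z \<le> norm (1 + of_nat (Suc n) * z)"
    using complex_Re_le_cmod[of "1 + of_nat (Suc n) * z"] by (simp del: of_nat_Suc)
  then show "1 \<le> norm (1 + of_nat (Suc n) * z)" using pos by linarith
  have *: "norm w \<le> norm (of_real r + w)" if "Re w > 0" "r > 0" for w r
    using that by (simp add: cmod_def power2_eq_square algebra_simps)
  show "norm z \<le> norm (of_nat (Suc n) + z)" using *[of z "real (Suc n)"] assms by simp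
  show "norm (of_nat (Suc n) * z) \<le> norm (1 + of_nat (Suc n) * z)"
    using *[of "of_nat (Suc n) * z" 1] assms by (simp del: of_nat_Suc)
qed

lemma norm_regulariser:
  assumes "Re z > 0"
  shows "norm (regulariser n z) \<le> 1" "norm (regulariser n z) \<le> real (Suc n) * norm z"
    "norm (regulariser n z) \<le> real (Suc n) / norm z"
proof -
  note b = norm_add_of_nat_ge[OF assms, of n]
  have z: "norm z > 0" using assms by auto
  define k where "k = real (Suc n)"
  have k: "k > 0" by (simp add: k_def)
  have nk: "norm (of_nat (Suc n) :: complex) = k" unfolding k_def by (rule norm_of_nat)
  define A where "A = norm (of_nat (Suc n) * z / (1 + of_nat (Suc n) * z))"
  define B where "B = norm (of_nat (Suc n) / (of_nat (Suc n) + z))"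
  have e: "norm (regulariser n z) = A * B" unfolding regulariser_def A_def B_def by (rule norm_mult)
  have A1: "A \<le> 1" and A2: "A \<le> k * norm z"
    using b(3,4) mult_left_mono[OF b(3), of "k * norm z"] k unfolding A_def
    by (simp_all only: norm_divide norm_mult nk) (auto simp: divide_le_eq field_simps)
  have B: "B = k / norm (of_nat (Suc n) + z)" unfolding B_def by (simp only: norm_divide nk)
  have B1: "B \<le> 1" using b(1) k unfolding B k_def[symmetric] by (auto simp: divide_le_eq)
  have B2: "B \<le> k / norm z"
    unfolding B by (rule divide_left_mono[OF b(2)]) (use b(2) z k in \<open>auto intro!: mult_pos_pos\<close>)
  have nn: "A \<ge> 0" "B \<ge> 0" by (simp_all add: A_def B_def)
  show "norm (regulariser n z) \<le> 1" unfolding e using mult_mono[OF A1 B1] nn by simp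
  show "norm (regulariser n z) \<le> real (Suc n) * norm z"
    unfolding e k_def[symmetric] using mult_mono[OF A2 B1] nn k by simp
  show "norm (regulariser n z) \<le> real (Suc n) / norm z"
    unfolding e k_def[symmetric] using mult_mono[OF A1 B2] nn by simp
qed

lemma regulariser_tendsto:
  assumes "Re z > 0"
  shows "(\<lambda>n. regulariser n z) \<longlonglongrightarrow> 1"
proof -
  have z: "z \<noteq> 0" using assms by auto
  have r: "regulariser n z = (z / (inverse (of_nat (Suc n)) + z)) * (1 / (1 + z * inverse (of_nat (Suc n))))" for n
  proof -
    have k: "of_nat (Suc n) \<noteq> (0::complex)" by (metis of_nat_neq_0)
    have "of_nat (Suc n) * z / (1 + of_nat (Suc n) * z) = z / (inverse (of_nat (Suc n)) + z)"
    proof -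
      have "inverse (of_nat (Suc n)) + z = (1 + of_nat (Suc n) * z) / of_nat (Suc n)"
        using k by (simp add: divide_simps)
      then show ?thesis using k by (simp add: mult.commute del: of_nat_Suc)
    qed
    moreover have "of_nat (Suc n) / (of_nat (Suc n) + z) = 1 / (1 + z * inverse (of_nat (Suc n)))"
    proof -
      have "1 + z * inverse (of_nat (Suc n)) = (of_nat (Suc n) + z) / of_nat (Suc n)"
        using k by (simp add: divide_simps)
      then show ?thesis by (simp del: of_nat_Suc)
    qed
    ultimately show ?thesis by (simp add: regulariser_def)
  qed
  have "(\<lambda>n. (z / (inverse (of_nat (Suc n)) + z)) * (1 / (1 + z * inverse (of_nat (Suc n))))) \<longlonglongrightarrow>
      (z / (0 + z)) * (1 / (1 + z * 0))"
    using z by (intro tendsto_intros LIMSEQ_Suc[OF lim_inverse_n]) auto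
  then show ?thesis using z by (simp add: r)
qed

lemma holomorphic_regulariser: "regulariser n holomorphic_on {z. Re z > 0}"
proof -
  have "1 + of_nat (Suc n) * z \<noteq> 0" "of_nat (Suc n) + z \<noteq> 0" if "Re z > 0" for z :: complex
    using norm_add_of_nat_ge[OF that, of n] by (auto simp del: of_nat_Suc)
  then show ?thesis unfolding regulariser_def by (intro holomorphic_intros) auto
qed

lemma ray_integral_tendsto_dominated:
  assumes int: "ray_integrable a F" and cont: "\<And>n. continuous_on (ray a) (\<lambda>z. F z * h n z)"
    and h1: "\<And>n z. z \<in> ray a \<Longrightarrow> norm (h n z) \<le> 1" and lim: "\<And>z. z \<in> ray a \<Longrightarrow> (\<lambda>n. h n z) \<longlonglongrightarrow> 1"
  shows "(\<lambda>n. ray_integral a (\<lambda>z. F z * h n z)) \<longlonglongrightarrow> ray_integral a F"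
  unfolding ray_integral_def
proof (rule tendsto_mult_left)
  let ?z = "\<lambda>t. of_real t * cis a"
  show "(\<lambda>n. LINT t:{0<..}|lborel. F (?z t) * h n (?z t)) \<longlonglongrightarrow> (LINT t:{0<..}|lborel. F (?z t))"
    unfolding set_lebesgue_integral_def
  proof (rule integral_dominated_convergence)
    show "(\<lambda>t. indicat_real {0<..} t *\<^sub>R F (?z t)) \<in> borel_measurable lborel"
      using int unfolding ray_integrable_def set_integrable_def by (rule borel_measurable_integrable)
    show "(\<lambda>t. indicat_real {0<..} t *\<^sub>R (F (?z t) * h n (?z t))) \<in> borel_measurable lborel" for n
      using set_borel_measurable_ray[OF cont] unfolding set_borel_measurable_def .
    show "integrable lborel (\<lambda>t. norm (indicat_real {0<..} t *\<^sub>R F (?z t)))"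
      using int unfolding ray_integrable_def set_integrable_def by (rule integrable_norm)
    show "AE t in lborel. norm (indicat_real {0<..} t *\<^sub>R (F (?z t) * h n (?z t))) \<le> norm (indicat_real {0<..} t *\<^sub>R F (?z t))" for n
      using mult_left_mono[OF h1, of _ "norm (F _)"]
      by (intro AE_I2) (auto simp: indicator_def norm_mult ray_def)
    show "AE t in lborel. (\<lambda>n. indicat_real {0<..} t *\<^sub>R (F (?z t) * h n (?z t))) \<longlonglongrightarrow> indicat_real {0<..} t *\<^sub>R F (?z t)"
    proof (rule AE_I2)
      fix t :: real
      show "(\<lambda>n. indicat_real {0<..} t *\<^sub>R (F (?z t) * h n (?z t))) \<longlonglongrightarrow> indicat_real {0<..} t *\<^sub>R F (?z t)"
      proof (cases "t > 0")
        case True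
        then have "(\<lambda>n. F (?z t) * h n (?z t)) \<longlonglongrightarrow> F (?z t) * 1"
          by (intro tendsto_mult_left lim) (auto simp: ray_def)
        then show ?thesis using True by simp
      qed simp
    qed
  qed
qed

text \<open>Under a bound 1/|z| the connecting arcs cannot be estimated away. The regularised
  integrands are rotated instead, and dominated convergence on the two rays removes the
  factor.\<close>

lemma ray_integral_rotate_half_plane:
  assumes eta: "0 < \<eta>" "\<eta> \<le> pi / 2" and ab: "\<bar>a\<bar> < \<eta>" "\<bar>b\<bar> < \<eta>"
    and hol: "F holomorphic_on wedge (- \<eta>) \<eta>"
    and M: "\<And>z. z \<in> wedge (- \<eta>) \<eta> \<Longrightarrow> norm (z * F z) \<le> M"
    and int: "ray_integrable a F" "ray_integrable b F"
  shows "ray_integral a F = ray_integral b F"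
proof -
  let ?S = "wedge (- \<eta>) \<eta>"
  let ?F = "\<lambda>n z. F z * regulariser n z"
  have S: "z \<in> ?S \<Longrightarrow> Re z > 0" for z using wedge_Re_pos eta by blast
  have ra: "ray c \<subseteq> ?S" if "\<bar>c\<bar> < \<eta>" for c by (rule ray_subset_wedge) (use that eta in auto)
  have hol': "?F n holomorphic_on ?S" for n
    by (intro holomorphic_intros hol holomorphic_on_subset[OF holomorphic_regulariser]) (use S in auto)
  have cont: "continuous_on (ray c) (?F n)" if "\<bar>c\<bar> < \<eta>" for c n
    using holomorphic_on_imp_continuous_on[OF hol'] ra[OF that] continuous_on_subset by blast
  have int': "ray_integrable c (?F n)" if "\<bar>c\<bar> < \<eta>" "ray_integrable c F" for c n
  proof (rule ray_integrable_bound[OF that(2) cont[OF that(1)]])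
    show "norm (?F n z) \<le> 1 * norm (F z)" if "z \<in> ray c" for z
      using norm_regulariser(1)[of z n] S[of z] ra[OF \<open>\<bar>c\<bar> < \<eta>\<close>] that
      by (auto simp: norm_mult intro!: mult_right_le_one_le)
  qed
  have eq: "ray_integral a (?F n) = ray_integral b (?F n)" for n
  proof (rule ray_integral_rotate_decay[OF eta ab hol'])
    fix z assume z: "z \<in> ?S"
    have nz: "norm z > 0" using S[OF z] by auto
    have Fz: "norm (F z) \<le> M / norm z" using M[OF z] nz by (simp add: norm_mult field_simps)
    then have M0: "M \<ge> 0" using nz by (meson divide_neg_pos leI norm_ge_zero order_trans not_le)
    have "norm (?F n z) \<le> M / norm z * (real (Suc n) * norm z)"
      unfolding norm_mult by (rule mult_mono[OF Fz norm_regulariser(2)[OF S[OF z]]]) (use M0 in auto)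
    then show "norm (?F n z) \<le> M * real (Suc n)" using nz by simp
    have "norm (?F n z) \<le> M / norm z * (real (Suc n) / norm z)"
      unfolding norm_mult by (rule mult_mono[OF Fz norm_regulariser(3)[OF S[OF z]]]) (use M0 in auto)
    then show "norm (?F n z) \<le> M * real (Suc n) / (norm z)\<^sup>2" by (simp add: power2_eq_square)
  qed (use int' int ab in auto)
  have lim: "(\<lambda>n. ray_integral c (?F n)) \<longlonglongrightarrow> ray_integral c F" if "\<bar>c\<bar> < \<eta>" "ray_integrable c F" for c
    by (rule ray_integral_tendsto_dominated[OF that(2) cont[OF that(1)] norm_regulariser(1) regulariser_tendsto])
      (use S ra[OF that(1)] in auto)
  have "(\<lambda>n. ray_integral b (?F n)) \<longlonglongrightarrow> ray_integral a F" using lim[OF ab(1) int(1)] by (simp add: eq)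
  then show ?thesis using lim[OF ab(2) int(2)] LIMSEQ_unique by blast
qed

text \<open>Rotation by the bisecting angle \<mu> makes the wedge symmetric about the positive axis,
  with half opening \<eta> at most pi/2.\<close>

lemma ray_integral_rotate:
  assumes ab: "b - a \<le> pi" and cd: "a < c" "c < b" "a < d" "d < b"
    and hol: "F holomorphic_on wedge a b"
    and M: "\<And>z. z \<in> wedge a b \<Longrightarrow> norm (z * F z) \<le> M"
    and int: "ray_integrable c F" "ray_integrable d F"
  shows "ray_integral c F = ray_integral d F"
proof -
  define \<mu> where "\<mu> = (a + b) / 2"
  define \<eta> where "\<eta> = (b - a) / 2"
  have em: "a = \<mu> - \<eta>" "b = \<mu> + \<eta>" by (simp_all add: \<mu>_def \<eta>_def field_simps)
  have eta: "0 < \<eta>" "\<eta> \<le> pi / 2" using ab cd by (simp_all add: \<eta>_def)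
  let ?G = "\<lambda>z. F (z * cis \<mu>)"
  have w: "z * cis \<mu> \<in> wedge a b" if "z \<in> wedge (- \<eta>) \<eta>" for z
  proof -
    have "\<mu> + - a = - (- \<eta>)" "\<mu> + - b = - \<eta>" by (simp_all add: em)
    then show ?thesis using that by (simp only: wedge_def mem_Collect_eq mult.assoc cis_mult)
  qed
  have "ray_integral (c - \<mu>) ?G = ray_integral (d - \<mu>) ?G"
  proof (rule ray_integral_rotate_half_plane[OF eta])
    show "\<bar>c - \<mu>\<bar> < \<eta>" "\<bar>d - \<mu>\<bar> < \<eta>" using cd em by auto
    have "F \<circ> (\<lambda>z. z * cis \<mu>) holomorphic_on wedge (- \<eta>) \<eta>"
      by (rule holomorphic_on_compose_gen[OF _ hol]) (use w in \<open>auto intro!: holomorphic_intros\<close>)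
    then show "?G holomorphic_on wedge (- \<eta>) \<eta>" by (simp add: o_def)
    show "norm (z * ?G z) \<le> M" if "z \<in> wedge (- \<eta>) \<eta>" for z
      using M[OF w[OF that]] by (simp add: norm_mult)
    show "ray_integrable (c - \<mu>) ?G" "ray_integrable (d - \<mu>) ?G"
      using int ray_integrable_shift[of "c - \<mu>" \<mu> F] ray_integrable_shift[of "d - \<mu>" \<mu> F] by simp_all
  qed
  then show ?thesis using ray_integral_shift[of "c - \<mu>" \<mu> F] ray_integral_shift[of "d - \<mu>" \<mu> F] by simp
qed

lemma wedge_polar:
  assumes "z \<in> wedge a b" "b - a \<le> pi" "a < b"
  obtains t c where "t > 0" "a < c" "c < b" "z = of_real t * cis c"
proof -
  define w where "w = z * cis (- a)"
  have Iw: "Im w > 0" using assms(1) by (simp add: wedge_def w_def)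
  then have w0: "w \<noteq> 0" by auto
  have A: "0 < Arg w" "Arg w < pi" using Iw Arg_lt_pi by blast+
  have "w = of_real (norm w) * cis (Arg w)" using Arg_eq[OF w0] by (simp add: cis_conv_exp)
  moreover have "z = w * cis a" by (simp add: w_def mult.assoc cis_mult)
  ultimately have z: "z = of_real (norm w) * cis (Arg w + a)"
    by (metis cis_mult mult.assoc)
  have "norm w * sin (Arg w + a + - b) < 0"
    using assms(1) unfolding wedge_def mem_Collect_eq by (subst (asm) (2) z) (simp only: Im_ray_mult_cis)
  then have "sin (Arg w + a - b) < 0" using w0 by (simp add: mult_less_0_iff)
  then have "Arg w + a < b"
    using sin_ge_zero[of "Arg w + a - b"] A assms(2,3) by linarith
  then show thesis using that[of "norm w" "Arg w + a"] z A w0 by simp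
qed

section \<open>The boundary of a double sector\<close>

text \<open>The open double sector around the real axis, and with \<open>outside\<close> the one
  around the imaginary axis, described by comparing |Im z| and |Re z|. In this form the symmetries
  under negation and conjugation are immediate and no branch of the argument enters.\<close>

definition bisector :: "real \<Rightarrow> complex set" where
  "bisector \<theta> = {z. cos \<theta> * \<bar>Im z\<bar> < sin \<theta> * \<bar>Re z\<bar>}"

definition outside :: "real \<Rightarrow> complex set" where
  "outside \<phi> = {z. sin \<phi> * \<bar>Re z\<bar> < cos \<phi> * \<bar>Im z\<bar>}"

lemma bisector_uminus [simp]: "- z \<in> bisector \<theta> \<longleftrightarrow> z \<in> bisector \<theta>"
  and bisector_cnj [simp]: "cnj z \<in> bisector \<theta> \<longleftrightarrow> z \<in> bisector \<theta>"
  and outside_uminus [simp]: "- z \<in> outside \<phi> \<longleftrightarrow> z \<in> outside \<phi>"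
  and outside_cnj [simp]: "cnj z \<in> outside \<phi> \<longleftrightarrow> z \<in> outside \<phi>"
  by (auto simp: bisector_def outside_def)

lemma open_bisector: "open (bisector \<theta>)" and open_outside: "open (outside \<theta>)"
  unfolding bisector_def outside_def by (intro open_Collect_less continuous_intros)+

lemma ray_subset_bisector:
  assumes "\<bar>c\<bar> < \<theta>" "\<theta> < pi / 2"
  shows "ray c \<subseteq> bisector \<theta>"
proof -
  have c: "cos c > 0" by (rule cos_gt_zero_pi) (use assms in auto)
  have "sin (\<theta> - c) > 0" "sin (\<theta> + c) > 0" by (intro sin_gt_zero; use assms in linarith)+
  then have *: "cos \<theta> * \<bar>sin c\<bar> < sin \<theta> * cos c" by (simp add: sin_diff sin_add abs_if mult.commute)
  show ?thesis
  proof
    fix z assume "z \<in> ray c"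
    then obtain t where t: "t > 0" "z = of_real t * cis c" by (auto simp: ray_def)
    have "t * (cos \<theta> * \<bar>sin c\<bar>) < t * (sin \<theta> * cos c)" using * t(1) by (rule mult_strict_left_mono)
    then show "z \<in> bisector \<theta>" using t c by (simp add: bisector_def abs_mult mult_ac)
  qed
qed

lemma uminus_in_ray: "- z \<in> ray (c + pi) \<longleftrightarrow> z \<in> ray c"
proof -
  have "cis (c + pi) = - cis c" by (simp add: cis_mult[symmetric])
  then show ?thesis by (auto simp: ray_def image_iff)
qed

lemma ray_subset_bisector_left:
  assumes "\<bar>c - pi\<bar> < \<theta>" "\<theta> < pi / 2"
  shows "ray c \<subseteq> bisector \<theta>"
proof
  fix z assume "z \<in> ray c"
  then have "- z \<in> ray (c - pi)" using uminus_in_ray[of "- z" "c - pi"] by simp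
  then show "z \<in> bisector \<theta>" using ray_subset_bisector[OF assms] by auto
qed

lemma ray_subset_outside:
  assumes "\<phi> < c" "c < pi - \<phi>" "0 < \<phi>"
  shows "ray c \<subseteq> outside \<phi>"
proof -
  have c: "sin c > 0" by (rule sin_gt_zero) (use assms in auto)
  have "sin (c - \<phi>) > 0" "sin (c + \<phi>) > 0" by (intro sin_gt_zero; use assms in linarith)+
  then have *: "sin \<phi> * \<bar>cos c\<bar> < cos \<phi> * sin c" by (simp add: sin_diff sin_add abs_if mult.commute)
  show ?thesis
  proof
    fix z assume "z \<in> ray c"
    then obtain t where t: "t > 0" "z = of_real t * cis c" by (auto simp: ray_def)
    have "t * (sin \<phi> * \<bar>cos c\<bar>) < t * (cos \<phi> * sin c)" using * t(1) by (rule mult_strict_left_mono)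
    then show "z \<in> outside \<phi>" using t c by (simp add: outside_def abs_mult mult_ac)
  qed
qed

lemma ray_subset_outside_lower:
  assumes "pi + \<phi> < c" "c < 2 * pi - \<phi>" "0 < \<phi>"
  shows "ray c \<subseteq> outside \<phi>"
proof
  fix z assume "z \<in> ray c"
  then have "- z \<in> ray (c - pi)" using uminus_in_ray[of "- z" "c - pi"] by simp
  moreover have "ray (c - pi) \<subseteq> outside \<phi>" by (rule ray_subset_outside) (use assms in auto)
  ultimately show "z \<in> outside \<phi>" by auto
qed

lemma wedge_subsetI:
  assumes "\<And>c. a < c \<Longrightarrow> c < b \<Longrightarrow> ray c \<subseteq> S" "b - a \<le> pi" "a < b"
  shows "wedge a b \<subseteq> S"
proof
  fix z assume "z \<in> wedge a b"
  then obtain t c where "t > 0" "a < c" "c < b" "z = of_real t * cis c"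
    using wedge_polar assms(2,3) by blast
  then show "z \<in> S" using assms(1)[of c] by (auto simp: ray_def)
qed

lemma ray_periodic: "ray (a + 2 * pi) = ray a"
  by (simp add: ray_def cis.code)

lemma ray_integral_periodic: "ray_integral (a + 2 * pi) F = ray_integral a F"
  by (simp add: ray_integral_def cis.code)

lemma ray_integrable_periodic: "ray_integrable (a + 2 * pi) F \<longleftrightarrow> ray_integrable a F"
  by (simp add: ray_integrable_def cis.code)

lemma ray_integral_uminus: "ray_integral a (\<lambda>z. F (- z)) = - ray_integral (a + pi) F"
  by (simp add: ray_integral_shift)

text \<open>The sign is \<open>1\<close> for the rays that are traversed away from the origin.\<close>

definition boundary_rays :: "real \<Rightarrow> (real \<times> real) set" where
  "boundary_rays \<phi> = {(1, - \<phi>), (1, pi - \<phi>), (- 1, \<phi>), (- 1, pi + \<phi>)}"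

definition boundary :: "real \<Rightarrow> complex set" where
  "boundary \<phi> = (\<Union>(\<sigma>, a)\<in>boundary_rays \<phi>. ray a)"

definition boundary_integrable :: "real \<Rightarrow> (complex \<Rightarrow> complex) \<Rightarrow> bool" where
  "boundary_integrable \<phi> F \<longleftrightarrow> (\<forall>(\<sigma>, a)\<in>boundary_rays \<phi>. ray_integrable a F)"

text \<open>Each half of the double sector lies to the left of its boundary. With the factor 1/(2 pi
  i) included, Cauchy's formula holds without a constant.\<close>

definition boundary_integral :: "real \<Rightarrow> (complex \<Rightarrow> complex) \<Rightarrow> complex" where
  "boundary_integral \<phi> F =
    (\<Sum>(\<sigma>, a)\<in>boundary_rays \<phi>. of_real \<sigma> * ray_integral a F) / (2 * of_real pi * \<i>)"

lemma boundary_integral_eq: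
  "boundary_integral \<phi> F = (ray_integral (- \<phi>) F + ray_integral (pi - \<phi>) F
     - ray_integral \<phi> F - ray_integral (pi + \<phi>) F) / (2 * of_real pi * \<i>)"
  by (simp add: boundary_integral_def boundary_rays_def)

lemma boundary_integrable_eq:
  "boundary_integrable \<phi> F \<longleftrightarrow> ray_integrable (- \<phi>) F \<and> ray_integrable (pi - \<phi>) F \<and>
     ray_integrable \<phi> F \<and> ray_integrable (pi + \<phi>) F"
  by (simp add: boundary_integrable_def boundary_rays_def)

lemma boundary_eq: "boundary \<phi> = ray (- \<phi>) \<union> ray (pi - \<phi>) \<union> ray \<phi> \<union> ray (pi + \<phi>)"
  by (auto simp: boundary_def boundary_rays_def)

lemma boundary_integral_cong:
  assumes "\<And>z. z \<in> boundary \<phi> \<Longrightarrow> F z = G z"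
  shows "boundary_integral \<phi> F = boundary_integral \<phi> G"
proof -
  have "ray_integral a F = ray_integral a G" if "a \<in> {- \<phi>, pi - \<phi>, \<phi>, pi + \<phi>}" for a
    by (rule ray_integral_cong) (use that assms in \<open>auto simp: boundary_eq\<close>)
  then show ?thesis by (simp add: boundary_integral_eq)
qed

lemma boundary_integrable_cong:
  assumes "\<And>z. z \<in> boundary \<phi> \<Longrightarrow> F z = G z"
  shows "boundary_integrable \<phi> F \<longleftrightarrow> boundary_integrable \<phi> G"
proof -
  have "ray_integrable a F \<longleftrightarrow> ray_integrable a G" if "a \<in> {- \<phi>, pi - \<phi>, \<phi>, pi + \<phi>}" for a
    by (rule ray_integrable_cong) (use that assms in \<open>auto simp: boundary_eq\<close>)
  then show ?thesis by (simp add: boundary_integrable_eq)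
qed

lemma boundary_integrable_add:
  "boundary_integrable \<phi> F \<Longrightarrow> boundary_integrable \<phi> G \<Longrightarrow> boundary_integrable \<phi> (\<lambda>z. F z + G z)"
  and boundary_integrable_diff:
  "boundary_integrable \<phi> F \<Longrightarrow> boundary_integrable \<phi> G \<Longrightarrow> boundary_integrable \<phi> (\<lambda>z. F z - G z)"
  and boundary_integrable_cmult:
  "boundary_integrable \<phi> F \<Longrightarrow> boundary_integrable \<phi> (\<lambda>z. c * F z)"
  by (simp_all add: boundary_integrable_eq ray_integrable_add ray_integrable_diff ray_integrable_cmult)

lemma boundary_integral_add:
  "boundary_integrable \<phi> F \<Longrightarrow> boundary_integrable \<phi> G \<Longrightarrow>
    boundary_integral \<phi> (\<lambda>z. F z + G z) = boundary_integral \<phi> F + boundary_integral \<phi> G"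
  and boundary_integral_diff:
  "boundary_integrable \<phi> F \<Longrightarrow> boundary_integrable \<phi> G \<Longrightarrow>
    boundary_integral \<phi> (\<lambda>z. F z - G z) = boundary_integral \<phi> F - boundary_integral \<phi> G"
  and boundary_integral_cmult: "boundary_integral \<phi> (\<lambda>z. c * F z) = c * boundary_integral \<phi> F"
  by (simp_all add: boundary_integral_eq boundary_integrable_eq ray_integral_add ray_integral_diff
      ray_integral_cmult diff_divide_distrib[symmetric] add_divide_distrib[symmetric] algebra_simps)

lemma boundary_integrable_bound:
  assumes "boundary_integrable \<phi> F" "continuous_on (boundary \<phi>) G"
    and "\<And>z. z \<in> boundary \<phi> \<Longrightarrow> norm (G z) \<le> K * norm (F z)"
  shows "boundary_integrable \<phi> G"
  unfolding boundary_integrable_def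
proof clarify
  fix \<sigma> a assume "(\<sigma>, a) \<in> boundary_rays \<phi>"
  then have sub: "ray a \<subseteq> boundary \<phi>" and "ray_integrable a F"
    using assms(1) by (auto simp: boundary_def boundary_integrable_def)
  then show "ray_integrable a G"
    using ray_integrable_bound[of a F G K] assms(2,3) continuous_on_subset[OF assms(2) sub] by blast
qed

lemma boundary_subset_bisector:
  assumes "0 \<le> \<phi>" "\<phi> < \<theta>" "\<theta> < pi / 2"
  shows "boundary \<phi> \<subseteq> bisector \<theta>"
  unfolding boundary_eq using assms
  by (intro Un_least ray_subset_bisector ray_subset_bisector_left) auto

lemma boundary_subset_outside:
  assumes "0 < \<omega>" "\<omega> < \<phi>" "\<phi> < pi / 2"
  shows "boundary \<phi> \<subseteq> outside \<omega>"
proof -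
  have "ray (- \<phi> + 2 * pi) \<subseteq> outside \<omega>" "ray (pi + \<phi>) \<subseteq> outside \<omega>"
    by (intro ray_subset_outside_lower; use assms in linarith)+
  moreover have "ray \<phi> \<subseteq> outside \<omega>" "ray (pi - \<phi>) \<subseteq> outside \<omega>"
    by (intro ray_subset_outside; use assms in linarith)+
  ultimately show ?thesis unfolding boundary_eq ray_periodic by blast
qed

lemma boundary_nonzero: "z \<in> boundary \<phi> \<Longrightarrow> z \<noteq> 0"
  by (auto simp: boundary_eq ray_def)

lemma wedges_subset_bisector:
  assumes "0 < \<theta>" "\<theta> < pi / 2"
  shows "wedge (- \<theta>) \<theta> \<subseteq> bisector \<theta>" "wedge (pi - \<theta>) (pi + \<theta>) \<subseteq> bisector \<theta>"
proof -
  show "wedge (- \<theta>) \<theta> \<subseteq> bisector \<theta>"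
    by (rule wedge_subsetI[OF ray_subset_bisector]) (use assms in auto)
  show "wedge (pi - \<theta>) (pi + \<theta>) \<subseteq> bisector \<theta>"
    by (rule wedge_subsetI[OF ray_subset_bisector_left]) (use assms in auto)
qed

text \<open>In each of the two halves the outgoing ray can be rotated across the half into the
  incoming one, and the two integrals enter with opposite signs.\<close>

lemma boundary_integral_eq_0:
  assumes "0 < \<phi>" "\<phi> < \<theta>" "\<theta> < pi / 2" and hol: "F holomorphic_on bisector \<theta>"
    and M: "\<And>z. z \<in> bisector \<theta> \<Longrightarrow> norm (z * F z) \<le> M" and int: "boundary_integrable \<phi> F"
  shows "boundary_integral \<phi> F = 0"
proof -
  note sub = wedges_subset_bisector[of \<theta>]
  have "ray_integral (- \<phi>) F = ray_integral \<phi> F"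
    by (rule ray_integral_rotate[of \<theta> "- \<theta>" _ _ F M])
      (use assms sub in \<open>auto simp: boundary_integrable_eq intro: holomorphic_on_subset\<close>)
  moreover have "ray_integral (pi - \<phi>) F = ray_integral (pi + \<phi>) F"
    by (rule ray_integral_rotate[of "pi + \<theta>" "pi - \<theta>" _ _ F M])
      (use assms sub in \<open>auto simp: boundary_integrable_eq intro: holomorphic_on_subset\<close>)
  ultimately show ?thesis by (simp add: boundary_integral_eq)
qed

text \<open>The intersection of \<open>bisector\<close> and \<open>outside\<close> has four sectors
  as components, and each boundary ray is rotated inside its own component.\<close>

lemma boundary_integral_angle:
  assumes "0 < \<omega>" "\<omega> < \<phi>" "\<phi> < \<theta>" "\<omega> < \<psi>" "\<psi> < \<theta>" "\<theta> < pi / 2"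
    and hol: "F holomorphic_on bisector \<theta> \<inter> outside \<omega>"
    and M: "\<And>z. z \<in> bisector \<theta> \<inter> outside \<omega> \<Longrightarrow> norm (z * F z) \<le> M"
    and int: "boundary_integrable \<phi> F" "boundary_integrable \<psi> F"
  shows "boundary_integral \<phi> F = boundary_integral \<psi> F"
proof -
  have *: "ray_integral c F = ray_integral d F"
    if "\<And>x. a < x \<Longrightarrow> x < b \<Longrightarrow> ray x \<subseteq> bisector \<theta> \<inter> outside \<omega>" "b - a \<le> pi"
      "a < c" "c < b" "a < d" "d < b" "ray_integrable c F" "ray_integrable d F" for a b c d
  proof -
    have sub: "wedge a b \<subseteq> bisector \<theta> \<inter> outside \<omega>" by (rule wedge_subsetI[OF that(1,2)]) (use that in auto)
    show ?thesis
      by (rule ray_integral_rotate[of b a c d F M, OF that(2-6) holomorphic_on_subset[OF hol sub] M that(7,8)])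
        (use sub in blast)
  qed
  have up: "ray x \<subseteq> outside \<omega>" if "\<omega> < x" "x < pi - \<omega>" for x
    by (rule ray_subset_outside) (use that assms in auto)
  have low: "ray x \<subseteq> outside \<omega>" if "pi + \<omega> < x" "x < 2 * pi - \<omega>" for x
    by (rule ray_subset_outside_lower) (use that assms in auto)
  have low': "ray x \<subseteq> outside \<omega>" if "- pi + \<omega> < x" "x < - \<omega>" for x
    using low[of "x + 2 * pi"] that by (simp add: ray_periodic)
  have "ray_integral (- \<phi>) F = ray_integral (- \<psi>) F"
    by (rule *[of "- \<theta>" "- \<omega>"])
      (use assms low' ray_subset_bisector in \<open>auto simp: boundary_integrable_eq\<close>)
  moreover have "ray_integral \<phi> F = ray_integral \<psi> F"
    by (rule *[of \<omega> \<theta>])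
      (use assms up ray_subset_bisector in \<open>auto simp: boundary_integrable_eq\<close>)
  moreover have "ray_integral (pi - \<phi>) F = ray_integral (pi - \<psi>) F"
    by (rule *[of "pi - \<theta>" "pi - \<omega>"])
      (use assms up ray_subset_bisector_left in \<open>auto simp: boundary_integrable_eq\<close>)
  moreover have "ray_integral (pi + \<phi>) F = ray_integral (pi + \<psi>) F"
    by (rule *[of "pi + \<omega>" "pi + \<theta>"])
      (use assms low ray_subset_bisector_left in \<open>auto simp: boundary_integrable_eq\<close>)
  ultimately show ?thesis by (simp add: boundary_integral_eq)
qed

section \<open>Elementary integrals and Cauchy's formula\<close>

text \<open>For w = x + iy the squares of the two sides differ by (y (r^2 - x^2 - y^2))^2. Away from
  the imaginary axis this bounds r^2 + w^2 from below by a multiple of r^2 + |w|^2.\<close>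

lemma norm_add_squares_ge:
  fixes w :: complex
  shows "\<bar>Re w\<bar> * (r\<^sup>2 + (norm w)\<^sup>2) \<le> norm w * norm (of_real r ^ 2 + w\<^sup>2)"
proof (rule power2_le_imp_le)
  obtain x y where w: "w = Complex x y" by (cases w)
  have n1: "(norm w)\<^sup>2 = x\<^sup>2 + y\<^sup>2" by (simp add: w cmod_power2)
  have n2: "(norm (of_real r ^ 2 + w\<^sup>2))\<^sup>2 = (r\<^sup>2 + x\<^sup>2 - y\<^sup>2)\<^sup>2 + (2 * x * y)\<^sup>2"
  proof -
    have "Re (of_real r ^ 2 + w\<^sup>2) = r\<^sup>2 + x\<^sup>2 - y\<^sup>2" "Im (of_real r ^ 2 + w\<^sup>2) = 2 * x * y"
      by (simp_all add: w power2_eq_square)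
    then show ?thesis by (simp only: cmod_power2)
  qed
  have "(x\<^sup>2 + y\<^sup>2) * ((r\<^sup>2 + x\<^sup>2 - y\<^sup>2)\<^sup>2 + (2 * x * y)\<^sup>2) - x\<^sup>2 * (r\<^sup>2 + (x\<^sup>2 + y\<^sup>2))\<^sup>2
      = (y * (r\<^sup>2 - x\<^sup>2 - y\<^sup>2))\<^sup>2"
    by (simp add: power2_eq_square algebra_simps)
  then have "x\<^sup>2 * (r\<^sup>2 + (x\<^sup>2 + y\<^sup>2))\<^sup>2 \<le> (x\<^sup>2 + y\<^sup>2) * ((r\<^sup>2 + x\<^sup>2 - y\<^sup>2)\<^sup>2 + (2 * x * y)\<^sup>2)"
    by (metis diff_ge_0_iff_ge zero_le_power2)
  then show "(\<bar>Re w\<bar> * (r\<^sup>2 + (norm w)\<^sup>2))\<^sup>2 \<le> (norm w * norm (of_real r ^ 2 + w\<^sup>2))\<^sup>2"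
    unfolding power_mult_distrib n1 n2 by (simp add: w)
qed simp

lemma norm_wedge_le_Re:
  assumes "z \<in> wedge (- \<eta>) \<eta>" "0 < \<eta>" "\<eta> \<le> pi / 2"
  shows "norm z * cos \<eta> \<le> Re z"
proof -
  have "\<eta> - - \<eta> \<le> pi" "- \<eta> < \<eta>" using assms by auto
  from wedge_polar[OF assms(1) this] obtain t c
    where t: "t > 0" "- \<eta> < c" "c < \<eta>" "z = of_real t * cis c" by blast
  have "cos \<eta> \<le> cos \<bar>c\<bar>" using t assms by (intro cos_monotone_0_pi_le) auto
  then show ?thesis using t by (simp add: norm_mult abs_if split: if_splits)
qed

lemma has_arctan_integral:
  assumes r: "r > 0"
  shows "set_integrable lborel {0<..} (\<lambda>t::real. r / (r\<^sup>2 + t\<^sup>2))"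
    and "(LINT t:{0<..}|lborel. r / (r\<^sup>2 + t\<^sup>2)) = pi / 2"
proof -
  have e: "einterval 0 \<infinity> = {0<..}" by (auto simp: einterval_def zero_ereal_def)
  have l: "(((\<lambda>t. arctan (t / r)) \<circ> real_of_ereal) \<longlongrightarrow> 0) (at_right 0)"
    unfolding zero_ereal_def ereal_tendsto_simps using r by (auto intro!: tendsto_eq_intros)
  have "filterlim (\<lambda>t. (1 / r) * t) at_top at_top"
    by (rule filterlim_tendsto_pos_mult_at_top[OF tendsto_const _ filterlim_ident]) (use r in simp)
  then have "((\<lambda>t. arctan (t / r)) \<longlongrightarrow> pi / 2) at_top"
    using filterlim_compose[OF tendsto_arctan_at_top] by simp
  then have h: "(((\<lambda>t. arctan (t / r)) \<circ> real_of_ereal) \<longlongrightarrow> pi / 2) (at_left \<infinity>)"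
    unfolding ereal_tendsto_simps .
  have nz: "r\<^sup>2 + x\<^sup>2 \<noteq> 0" for x :: real by (metis r less_irrefl sum_power2_eq_zero_iff)
  have d: "((\<lambda>t. arctan (t / r)) has_field_derivative r / (r\<^sup>2 + x\<^sup>2)) (at x)" for x
  proof -
    have "1 + (x / r)\<^sup>2 = (r\<^sup>2 + x\<^sup>2) / r\<^sup>2" using r by (simp add: field_simps)
    then have "inverse (1 + (x / r)\<^sup>2) * (1 / r) = r / (r\<^sup>2 + x\<^sup>2)"
      using r by (simp add: power2_eq_square)
    moreover have "((\<lambda>t. arctan (t / r)) has_field_derivative inverse (1 + (x / r)\<^sup>2) * (1 / r)) (at x)"
      by (rule DERIV_chain2[OF DERIV_arctan]) (use r in \<open>auto intro!: derivative_eq_intros\<close>)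
    ultimately show ?thesis by simp
  qed
  have c: "isCont (\<lambda>t. r / (r\<^sup>2 + t\<^sup>2)) x" for x by (intro continuous_intros) (rule nz)
  have p: "0 \<le> r / (r\<^sup>2 + x\<^sup>2)" for x using r by simp
  note * = interval_integral_FTC_nonneg[of 0 \<infinity> "\<lambda>t. arctan (t / r)" "\<lambda>t. r / (r\<^sup>2 + t\<^sup>2)" 0 "pi / 2", OF _ d c _ l h]
  show "set_integrable lborel {0<..} (\<lambda>t::real. r / (r\<^sup>2 + t\<^sup>2))"
    using *(1) p e by simp
  show "(LINT t:{0<..}|lborel. r / (r\<^sup>2 + t\<^sup>2)) = pi / 2"
    using *(2) p e by (simp add: interval_lebesgue_integral_def)
qed

text \<open>Here \<open>q\<close> and the ray enclose an acute angle; the value does not depend on either.\<close>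

lemma ray_integral_arctan:
  assumes r: "r > 0" and b: "\<bar>b - \<mu>\<bar> < pi / 2" and q: "q = of_real r * cis \<mu>"
  shows "ray_integrable b (\<lambda>z. q / (q\<^sup>2 + z\<^sup>2))" "ray_integral b (\<lambda>z. q / (q\<^sup>2 + z\<^sup>2)) = pi / 2"
proof -
  let ?G = "\<lambda>w. complex_of_real r / (of_real r ^ 2 + w\<^sup>2)"
  have shift: "q / (q\<^sup>2 + (w * cis \<mu>)\<^sup>2) = cis (- \<mu>) * ?G w" for w
  proof -
    have "q / (q\<^sup>2 + (w * cis \<mu>)\<^sup>2) = of_real r * cis \<mu> / (cis \<mu> * (cis \<mu> * (of_real r ^ 2 + w\<^sup>2)))"
      by (simp add: q power2_eq_square algebra_simps)
    also have "\<dots> = (1 / cis \<mu>) * ?G w" by simp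
    finally show ?thesis by (simp add: cis_inverse inverse_eq_divide[symmetric])
  qed
  \<comment> \<open>Strictly between the angle of the ray relative to q and pi/2: the wedge contains
    that ray and the positive axis, and cos \<eta> stays positive.\<close>
  define \<eta> where "\<eta> = (\<bar>b - \<mu>\<bar> + pi / 2) / 2"
  have eta: "0 < \<eta>" "\<eta> < pi / 2" "\<bar>b - \<mu>\<bar> < \<eta>" using b by (simp_all add: \<eta>_def add_nonneg_pos)
  have ce: "cos \<eta> > 0" by (rule cos_gt_zero_pi) (use eta in auto)
  let ?S = "wedge (- \<eta>) \<eta>"
  have ge: "cos \<eta> * (r\<^sup>2 + (norm w)\<^sup>2) \<le> norm (of_real r ^ 2 + w\<^sup>2)" and w0: "w \<noteq> 0"
    if w: "w \<in> ?S" for w :: complex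
  proof -
    have R: "Re w > 0" "norm w * cos \<eta> \<le> Re w" using wedge_Re_pos norm_wedge_le_Re w eta by auto
    then show "w \<noteq> 0" by auto
    then have n: "norm w > 0" by simp
    have "(norm w * cos \<eta>) * (r\<^sup>2 + (norm w)\<^sup>2) \<le> \<bar>Re w\<bar> * (r\<^sup>2 + (norm w)\<^sup>2)"
      using R by (intro mult_right_mono) auto
    also have "\<dots> \<le> norm w * norm (of_real r ^ 2 + w\<^sup>2)" by (rule norm_add_squares_ge)
    finally show "cos \<eta> * (r\<^sup>2 + (norm w)\<^sup>2) \<le> norm (of_real r ^ 2 + w\<^sup>2)"
      using n by (simp add: mult.assoc)
  qed
  have pos: "0 < r\<^sup>2 + (norm w)\<^sup>2" for w :: complex using r by (simp add: add_pos_nonneg)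
  have nz: "of_real r ^ 2 + w\<^sup>2 \<noteq> 0" if "w \<in> ?S" for w :: complex
    using ge[OF that] mult_pos_pos[OF ce pos[of w]] by auto
  have Gb: "norm (?G w) \<le> (1 / cos \<eta>) * (r / (r\<^sup>2 + (norm w)\<^sup>2))" if "w \<in> ?S" for w
  proof -
    have "norm (?G w) = r / norm (of_real r ^ 2 + w\<^sup>2)" using r by (simp add: norm_divide)
    also have "\<dots> \<le> r / (cos \<eta> * (r\<^sup>2 + (norm w)\<^sup>2))"
      using ge[OF that] r mult_pos_pos[OF ce pos[of w]] by (intro divide_left_mono) (auto intro!: mult_pos_pos)
    finally show ?thesis by simp
  qed
  have holG: "?G holomorphic_on ?S" by (intro holomorphic_intros) (use nz in auto)
  have intG: "ray_integrable c ?G" if "\<bar>c\<bar> < \<eta>" for c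
    unfolding ray_integrable_def
  proof (rule set_integrable_dominated_real)
    have sub: "ray c \<subseteq> ?S" by (rule ray_subset_wedge) (use that eta in auto)
    show "set_integrable lborel {0<..} (\<lambda>t. (1 / cos \<eta>) * (r / (r\<^sup>2 + t\<^sup>2)))"
      by (intro set_integrable_mult_right has_arctan_integral r)
    show "set_borel_measurable lborel {0<..} (\<lambda>t. ?G (of_real t * cis c))"
      by (rule set_borel_measurable_ray) (rule continuous_on_subset[OF holomorphic_on_imp_continuous_on[OF holG] sub])
    fix t :: real assume "t \<in> {0<..}"
    then have "of_real t * cis c \<in> ?S" "norm (of_real t * cis c) = t" using sub by (auto simp: ray_def norm_mult)
    then show "norm (?G (of_real t * cis c)) \<le> (1 / cos \<eta>) * (r / (r\<^sup>2 + t\<^sup>2))" using Gb by metis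
  qed
  have "ray_integral (b - \<mu>) ?G = ray_integral 0 ?G"
  proof (rule ray_integral_rotate)
    show "norm (w * ?G w) \<le> 1 / cos \<eta>" if "w \<in> ?S" for w
    proof -
      have "norm (w * ?G w) \<le> norm w * ((1 / cos \<eta>) * (r / (r\<^sup>2 + (norm w)\<^sup>2)))"
        unfolding norm_mult by (rule mult_left_mono[OF Gb[OF that]]) simp
      also have "\<dots> = (1 / cos \<eta>) * (norm w * r / (r\<^sup>2 + (norm w)\<^sup>2))" by simp
      also have "\<dots> \<le> (1 / cos \<eta>) * 1"
      proof (rule mult_left_mono)
        have "2 * (norm w * r) \<le> r\<^sup>2 + (norm w)\<^sup>2" using sum_squares_bound[of "norm w" r] by (simp add: power2_eq_square algebra_simps)
        moreover have "0 \<le> norm w * r" using r by simp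
        ultimately have "norm w * r \<le> r\<^sup>2 + (norm w)\<^sup>2" by linarith
        then show "norm w * r / (r\<^sup>2 + (norm w)\<^sup>2) \<le> 1" using pos[of w] by (simp add: divide_le_eq)
      qed (use ce in simp)
      finally show ?thesis by simp
    qed
  qed (use eta holG intG in auto)
  also have "ray_integral 0 ?G = (LINT t:{0<..}|lborel. complex_of_real (r / (r\<^sup>2 + t\<^sup>2)))"
    by (simp add: ray_integral_def)
  also have "\<dots> = of_real (pi / 2)"
    unfolding set_integral_complex_of_real has_arctan_integral(2)[OF r] by simp
  finally have val: "ray_integral (b - \<mu>) ?G = pi / 2" by simp
  have "ray_integrable (b - \<mu>) (\<lambda>w. cis (- \<mu>) * ?G w)" using intG[of "b - \<mu>"] eta by (intro ray_integrable_cmult) auto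
  then show "ray_integrable b (\<lambda>z. q / (q\<^sup>2 + z\<^sup>2))"
    using ray_integrable_shift[of "b - \<mu>" \<mu> "\<lambda>z. q / (q\<^sup>2 + z\<^sup>2)"] by (simp only: shift diff_add_cancel)
  have "ray_integral b (\<lambda>z. q / (q\<^sup>2 + z\<^sup>2)) = cis \<mu> * (cis (- \<mu>) * (pi / 2))"
    using ray_integral_shift[of "b - \<mu>" \<mu> "\<lambda>z. q / (q\<^sup>2 + z\<^sup>2)"]
    by (simp only: shift diff_add_cancel ray_integral_cmult val)
  also have "\<dots> = pi / 2" by (simp add: mult.assoc[symmetric] cis_mult)
  finally show "ray_integral b (\<lambda>z. q / (q\<^sup>2 + z\<^sup>2)) = pi / 2" .
qed

text \<open>Turning one of the rays into the real axis, the imaginary part of the difference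
  measures the distance of the other point from the line through that ray.\<close>

lemma norm_ray_diff_ge:
  assumes "p \<in> ray a" "s \<in> ray c"
  shows "\<bar>sin (a - c)\<bar> * norm p \<le> norm (p - s)" "\<bar>sin (a - c)\<bar> * norm s \<le> norm (p - s)"
proof -
  obtain u t where u: "u > 0" "p = of_real u * cis a" and t: "t > 0" "s = of_real t * cis c"
    using assms by (auto simp: ray_def)
  have "\<bar>Im ((p - s) * cis (- c))\<bar> \<le> norm ((p - s) * cis (- c))" by (rule abs_Im_le_cmod)
  moreover have "Im ((p - s) * cis (- c)) = u * sin (a - c)"
    unfolding left_diff_distrib minus_complex.sel u(2) t(2) Im_ray_mult_cis by simp
  ultimately show "\<bar>sin (a - c)\<bar> * norm p \<le> norm (p - s)"
    using u by (simp add: norm_mult abs_mult mult.commute)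
  have "\<bar>Im ((p - s) * cis (- a))\<bar> \<le> norm ((p - s) * cis (- a))" by (rule abs_Im_le_cmod)
  moreover have "Im ((p - s) * cis (- a)) = - (t * sin (c - a))"
    unfolding left_diff_distrib minus_complex.sel u(2) t(2) Im_ray_mult_cis by simp
  moreover have "\<bar>sin (c - a)\<bar> = \<bar>sin (a - c)\<bar>" by (metis abs_minus_cancel minus_diff_eq sin_minus)
  ultimately show "\<bar>sin (a - c)\<bar> * norm s \<le> norm (p - s)"
    using t by (simp add: norm_mult abs_mult mult.commute)
qed

section \<open>Cauchy's formula on the boundary of the double sector\<close>

lemma boundary_angles_plus_pi:
  "- \<phi> + pi = pi - \<phi>" "pi - \<phi> + pi = - \<phi> + 2 * pi" "\<phi> + pi = pi + \<phi>" "pi + \<phi> + pi = \<phi> + 2 * pi"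
  by simp_all

lemma boundary_integral_uminus: "boundary_integral \<phi> (\<lambda>z. F (- z)) = - boundary_integral \<phi> F"
  unfolding boundary_integral_eq ray_integral_uminus minus_divide_left
  unfolding boundary_angles_plus_pi[of \<phi>] unfolding ray_integral_periodic
  by (rule arg_cong2[where f = "(/)"]) simp_all

lemma boundary_integrable_uminus:
  assumes "boundary_integrable \<phi> F"
  shows "boundary_integrable \<phi> (\<lambda>z. F (- z))"
proof -
  have *: "ray_integrable a (\<lambda>z. F (- z)) \<longleftrightarrow> ray_integrable (a + pi) F" for a
    by (simp add: ray_integrable_shift)
  show ?thesis
    using assms unfolding boundary_integrable_eq * unfolding boundary_angles_plus_pi[of \<phi>]
    unfolding ray_integrable_periodic by blast
qed

text \<open>The constant F(s) divided by p - s would only be of size 1/|p| and not integrable along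
  the rays. Therefore F(s) is multiplied by 2s/(p + s), which is 1 at p = s: the remaining quotient
  is holomorphic and of size 1/|p|, so its integrals over the two rays cancel, and the subtracted
  kernel 2s/(p^2 - s^2) is integrated explicitly. Each right-hand ray contributes pi i F(s) in the
  orientation of the boundary.\<close>

lemma Cauchy_formula_bisector_right:
  assumes ang: "\<phi> < \<theta>" "\<theta> < pi / 2" and s: "s \<in> ray c" and c: "\<bar>c\<bar> < \<phi>"
    and hol: "F holomorphic_on bisector \<theta>" and M: "\<And>z. z \<in> bisector \<theta> \<Longrightarrow> norm (F z) \<le> M"
    and int: "boundary_integrable \<phi> (\<lambda>z. F z / z)"
  shows "boundary_integral \<phi> (\<lambda>p. F p / (p - s)) = F s"
proof -
  have phi: "0 < \<phi>" using c by linarith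
  have th: "0 < \<theta>" "\<theta> \<le> pi / 2" using phi ang by auto
  let ?S = "wedge (- \<theta>) \<theta>"
  note sub = wedges_subset_bisector[OF th(1) ang(2)]
  have ct: "cos \<theta> > 0" by (rule cos_gt_zero_pi) (use ang th in auto)
  have "ray c \<subseteq> ?S" by (rule ray_subset_wedge; use c ang in linarith)
  then have sS: "s \<in> ?S" using s by blast
  have Rs: "Re s > 0" using wedge_Re_pos[OF sS th] .
  then have s0: "s \<noteq> 0" by auto
  have bS: "boundary \<phi> \<subseteq> bisector \<theta>" by (rule boundary_subset_bisector) (use phi ang in auto)
  have rayS: "ray (- \<phi>) \<subseteq> ?S" "ray \<phi> \<subseteq> ?S" by (intro ray_subset_wedge; use phi ang in simp)+
  have M0: "M \<ge> 0" using M[of s] sub(1) sS norm_ge_zero order_trans by blast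
  have far: "\<exists>k>0. \<forall>p\<in>ray a. k * norm p \<le> norm (p - s)" if "a \<in> {- \<phi>, pi - \<phi>, \<phi>, pi + \<phi>}" for a
  proof (intro exI[of _ "\<bar>sin (a - c)\<bar>"] conjI ballI norm_ray_diff_ge(1)[OF _ s])
    have "sin (- \<phi> - c) < 0" "sin (\<phi> - c) > 0"
      using sin_gt_zero[of "\<phi> + c"] sin_gt_zero[of "\<phi> - c"] c ang sin_minus[of "\<phi> + c"] by auto
    moreover have "sin (pi + \<phi> - c) = - sin (\<phi> - c)" using sin_periodic_pi2[of "\<phi> - c"] by (simp add: algebra_simps)
    moreover have "sin (pi - \<phi> - c) = - sin (- \<phi> - c)" using sin_periodic_pi2[of "- \<phi> - c"] by (simp add: algebra_simps)
    ultimately show "0 < \<bar>sin (a - c)\<bar>" using that by auto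
  qed
  have contF: "continuous_on (ray a) F" if "a \<in> {- \<phi>, pi - \<phi>, \<phi>, pi + \<phi>}" for a
    using holomorphic_on_imp_continuous_on[OF hol] continuous_on_subset bS that
    by (metis boundary_eq empty_iff insert_iff le_sup_iff)
  have intF: "ray_integrable a (\<lambda>p. F p / (p - s))" if a: "a \<in> {- \<phi>, pi - \<phi>, \<phi>, pi + \<phi>}" for a
  proof -
    obtain k where k: "k > 0" "\<And>p. p \<in> ray a \<Longrightarrow> k * norm p \<le> norm (p - s)" using far[OF a] by blast
    have nz: "p \<noteq> 0" "p - s \<noteq> 0" if "p \<in> ray a" for p
      using k(1) k(2)[OF that] that by (auto simp: ray_def mult_le_0_iff)
    show ?thesis
    proof (rule ray_integrable_bound)
      show "ray_integrable a (\<lambda>z. F z / z)" using int a by (auto simp: boundary_integrable_eq)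
      show "continuous_on (ray a) (\<lambda>p. F p / (p - s))"
        by (intro continuous_intros contF[OF a]) (use nz in auto)
      fix p assume p: "p \<in> ray a"
      have "norm (F p) / norm (p - s) \<le> norm (F p) / (k * norm p)"
        using k(2)[OF p] k(1) nz[OF p] by (intro divide_left_mono mult_pos_pos) auto
      then show "norm (F p / (p - s)) \<le> (1 / k) * norm (F p / p)" by (simp add: norm_divide)
    qed
  qed
  \<comment> \<open>The point s lies in the right half, so in the left half the integrand has no
    pole and its two rays cancel.\<close>
  have left: "ray_integral (pi - \<phi>) (\<lambda>p. F p / (p - s)) = ray_integral (pi + \<phi>) (\<lambda>p. F p / (p - s))"
  proof (rule ray_integral_rotate)
    show "pi - \<theta> < pi - \<phi>" "pi - \<phi> < pi + \<theta>" "pi - \<theta> < pi + \<phi>" "pi + \<phi> < pi + \<theta>" "pi + \<theta> - (pi - \<theta>) \<le> pi"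
      using phi ang by auto
    have R: "cos \<theta> * norm p \<le> norm (p - s)" if p: "p \<in> wedge (pi - \<theta>) (pi + \<theta>)" for p
    proof -
      have cs: "cis (- (pi + \<theta>)) = - cis (- \<theta>)" "cis (- (pi - \<theta>)) = - cis \<theta>"
        by (simp_all add: complex_eq_iff cos_add cos_diff sin_add sin_diff)
      have "- p * cis (- (- \<theta>)) = p * cis (- (pi - \<theta>))" "- p * cis (- \<theta>) = p * cis (- (pi + \<theta>))"
        by (simp_all only: cs minus_minus mult_minus_left mult_minus_right)
      then have "- p \<in> ?S" using p unfolding wedge_def mem_Collect_eq by (simp only: simp_thms)
      then have "norm p * cos \<theta> \<le> - Re p" using norm_wedge_le_Re[of "- p" \<theta>] th by simp
      also have "\<dots> \<le> \<bar>Re (p - s)\<bar>" using Rs by simp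
      also have "\<dots> \<le> norm (p - s)" by (rule abs_Re_le_cmod)
      finally show ?thesis by (simp add: mult.commute)
    qed
    have nz: "p - s \<noteq> 0" if p: "p \<in> wedge (pi - \<theta>) (pi + \<theta>)" for p
    proof
      assume "p - s = 0"
      then have "cos \<theta> * norm s \<le> 0" using R[OF p] by simp
      then show False using ct s0 by (simp add: mult_le_0_iff)
    qed
    show "(\<lambda>p. F p / (p - s)) holomorphic_on wedge (pi - \<theta>) (pi + \<theta>)"
      by (intro holomorphic_intros holomorphic_on_subset[OF hol sub(2)]) (use nz in auto)
    show "norm (p * (F p / (p - s))) \<le> M / cos \<theta>" if p: "p \<in> wedge (pi - \<theta>) (pi + \<theta>)" for p
    proof -
      have "norm p * norm (F p) \<le> norm p * M" using M[of p] sub(2) p by (intro mult_left_mono) auto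
      also have "\<dots> \<le> (norm (p - s) / cos \<theta>) * M"
        using R[OF p] ct M0 by (intro mult_right_mono) (simp_all add: field_simps)
      finally show ?thesis using nz[OF p] by (simp add: norm_mult norm_divide divide_le_eq mult_ac)
    qed
  qed (use intF in auto)
  define f where "f p = F p - F s * (2 * s / (p + s))" for p
  define H where "H p = (if p = s then deriv f s else (f p - f s) / (p - s))" for p
  have ps: "Re s \<le> norm (p + s)" if "p \<in> ?S" for p
    using wedge_Re_pos[OF that th] complex_Re_le_cmod[of "p + s"] by simp
  then have ps0: "p + s \<noteq> 0" if "p \<in> ?S" for p using Rs that by fastforce
  have holf: "f holomorphic_on ?S"
    unfolding f_def by (intro holomorphic_intros holomorphic_on_subset[OF hol sub(1)]) (use ps0 in auto)
  have holH: "H holomorphic_on ?S" unfolding H_def by (rule pole_lemma_open[OF holf open_wedge])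
  have fs: "f s = 0" using s0 by (simp add: f_def mult_2[symmetric])
  obtain r where r: "r > 0" "cball s r \<subseteq> ?S" using open_contains_cball open_wedge sS by blast
  define N where "N = M + norm (F s) * (2 * norm s / Re s)"
  have fN: "norm (f p) \<le> N" if "p \<in> ?S" for p
  proof -
    have "norm (F s * (2 * s / (p + s))) \<le> norm (F s) * (2 * norm s / Re s)"
      using ps[OF that] Rs by (auto simp: norm_mult norm_divide intro!: mult_left_mono divide_left_mono mult_pos_pos)
    then show ?thesis unfolding f_def N_def using norm_triangle_ineq4 M[of p] sub(1) that
      by (smt (verit, best) subsetD)
  qed
  have "compact ((\<lambda>p. p * H p) ` cball s r)"
    by (intro compact_continuous_image continuous_intros compact_cball
        continuous_on_subset[OF holomorphic_on_imp_continuous_on[OF holH] r(2)])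
  then obtain B where B: "\<And>p. p \<in> cball s r \<Longrightarrow> norm (p * H p) \<le> B"
    using compact_imp_bounded bounded_iff by (metis imageI)
  \<comment> \<open>Near s the bound comes from compactness, away from s from the boundedness of f
    and from |p - s| being at least r.\<close>
  have Hb: "norm (p * H p) \<le> max B ((1 + norm s / r) * N)" if p: "p \<in> ?S" for p
  proof (cases "p \<in> cball s r")
    case True then show ?thesis using B[OF True] by simp
  next
    case False
    then have d: "r < norm (p - s)" by (simp add: dist_norm norm_minus_commute)
    have "norm p \<le> norm (p - s) + norm s" using norm_triangle_ineq[of "p - s" s] by simp
    also have "norm s \<le> norm (p - s) * (norm s / r)"
      using d r mult_right_mono[of r "norm (p - s)" "norm s"] by (simp add: field_simps)
    finally have pp: "norm p \<le> norm (p - s) * (1 + norm s / r)" by (simp add: distrib_left)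
    have N0: "N \<ge> 0" using fN[OF p] norm_ge_zero order_trans by blast
    have ne: "p \<noteq> s" using d r by auto
    have "norm (p * H p) = norm p * norm (f p) / norm (p - s)" using ne by (simp add: H_def fs norm_mult norm_divide)
    also have "\<dots> \<le> (norm (p - s) * (1 + norm s / r)) * N / norm (p - s)"
      using pp fN[OF p] N0 r(1) by (intro divide_right_mono mult_mono) auto
    also have "\<dots> = (1 + norm s / r) * N" using ne by simp
    finally show ?thesis by simp
  qed
  obtain t where t: "t > 0" "s = of_real t * cis c" using s by (auto simp: ray_def)
  \<comment> \<open>As q^2 = - s^2 for q = is and q = -is, the kernel 2s/(p^2 - s^2) is a multiple
    of q/(q^2 + p^2). For each ray the sign of q is the one that makes an acute angle with
    it.\<close>
  define q1 q2 where "q1 = of_real t * cis (c + pi / 2)" and "q2 = of_real t * cis (c - pi / 2)"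
  have q: "q1 = \<i> * s" "q2 = - \<i> * s"
    unfolding q1_def q2_def t by (simp_all add: cis_mult[symmetric] cis_divide[symmetric] diff_conv_add_uminus del: add_uminus_conv_diff)
  have k1: "ray_integrable \<phi> (\<lambda>z. q1 / (q1\<^sup>2 + z\<^sup>2))" "ray_integral \<phi> (\<lambda>z. q1 / (q1\<^sup>2 + z\<^sup>2)) = pi / 2"
    by (rule ray_integral_arctan[OF t(1) _ q1_def]; use c ang in \<open>simp add: abs_if split: if_splits\<close>)+
  have k2: "ray_integrable (- \<phi>) (\<lambda>z. q2 / (q2\<^sup>2 + z\<^sup>2))" "ray_integral (- \<phi>) (\<lambda>z. q2 / (q2\<^sup>2 + z\<^sup>2)) = pi / 2"
    by (rule ray_integral_arctan[OF t(1) _ q2_def]; use c ang in \<open>simp add: abs_if split: if_splits\<close>)+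
  have split: "F p / (p - s) = H p + F s * (2 * s / (p\<^sup>2 - s\<^sup>2))" if "p \<in> ?S" "p \<noteq> s" for p
  proof -
    have "p\<^sup>2 - s\<^sup>2 = (p + s) * (p - s)" by (simp add: power2_eq_square algebra_simps)
    then have eq: "F s * (2 * s / (p\<^sup>2 - s\<^sup>2)) = F s * (2 * s / (p + s)) / (p - s)"
      by (simp only: divide_divide_eq_left times_divide_eq_right)
    have "H p = F p / (p - s) - F s * (2 * s / (p + s)) / (p - s)"
      using that unfolding H_def fs unfolding f_def by (simp only: if_False diff_zero diff_divide_distrib)
    then show ?thesis unfolding eq by (simp only: diff_add_cancel)
  qed
  have ne: "p \<noteq> s" if "p \<in> ray a" "a \<in> {- \<phi>, \<phi>}" for p a
  proof -
    have "norm p > 0" using that(1) by (auto simp: ray_def)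
    moreover have "a \<in> {- \<phi>, pi - \<phi>, \<phi>, pi + \<phi>}" using that(2) by blast
    ultimately obtain k where k: "k > 0" "k * norm p \<le> norm (p - s)" using far[of a] \<open>p \<in> ray a\<close> by blast
    then have "k * norm p > 0" using k(1) \<open>norm p > 0\<close> by simp
    then show ?thesis using k(2) by auto
  qed
  have e1: "2 * s / (p\<^sup>2 - s\<^sup>2) = - 2 * \<i> * (q1 / (q1\<^sup>2 + p\<^sup>2))"
    and e2: "2 * s / (p\<^sup>2 - s\<^sup>2) = 2 * \<i> * (q2 / (q2\<^sup>2 + p\<^sup>2))" for p
  proof -
    have "\<i> * (\<i> * s) = - s" by (simp add: mult.assoc[symmetric])
    then show "2 * s / (p\<^sup>2 - s\<^sup>2) = - 2 * \<i> * (q1 / (q1\<^sup>2 + p\<^sup>2))"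
      "2 * s / (p\<^sup>2 - s\<^sup>2) = 2 * \<i> * (q2 / (q2\<^sup>2 + p\<^sup>2))"
      by (simp_all add: q power_mult_distrib mult.assoc)
  qed
  have up: "ray_integrable \<phi> H \<and> ray_integral \<phi> (\<lambda>p. F p / (p - s)) = ray_integral \<phi> H - \<i> * pi * F s"
  proof -
    have eq: "F p / (p - s) = H p + (- 2 * \<i> * F s) * (q1 / (q1\<^sup>2 + p\<^sup>2))" if "p \<in> ray \<phi>" for p
      using split[of p] ne[OF that] rayS that by (auto simp: e1)
    have "ray_integrable \<phi> (\<lambda>p. F p / (p - s) - (- 2 * \<i> * F s) * (q1 / (q1\<^sup>2 + p\<^sup>2)))"
      by (intro ray_integrable_diff intF ray_integrable_cmult k1) simp
    then have iH: "ray_integrable \<phi> H" by (rule ray_integrable_cong[THEN iffD1, rotated]) (simp add: eq)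
    have "ray_integral \<phi> (\<lambda>p. F p / (p - s)) = ray_integral \<phi> (\<lambda>p. H p + (- 2 * \<i> * F s) * (q1 / (q1\<^sup>2 + p\<^sup>2)))"
      by (rule ray_integral_cong) (rule eq)
    also have "\<dots> = ray_integral \<phi> H + (- 2 * \<i> * F s) * (pi / 2)"
      by (simp only: ray_integral_add[OF iH ray_integrable_cmult[OF k1(1)]] ray_integral_cmult k1(2))
    finally show ?thesis using iH by simp
  qed
  have low: "ray_integrable (- \<phi>) H \<and> ray_integral (- \<phi>) (\<lambda>p. F p / (p - s)) = ray_integral (- \<phi>) H + \<i> * pi * F s"
  proof -
    have eq: "F p / (p - s) = H p + (2 * \<i> * F s) * (q2 / (q2\<^sup>2 + p\<^sup>2))" if "p \<in> ray (- \<phi>)" for p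
      using split[of p] ne[OF that] rayS that by (auto simp: e2)
    have "ray_integrable (- \<phi>) (\<lambda>p. F p / (p - s) - (2 * \<i> * F s) * (q2 / (q2\<^sup>2 + p\<^sup>2)))"
      by (intro ray_integrable_diff intF ray_integrable_cmult k2) simp
    then have iH: "ray_integrable (- \<phi>) H" by (rule ray_integrable_cong[THEN iffD1, rotated]) (simp add: eq)
    have "ray_integral (- \<phi>) (\<lambda>p. F p / (p - s)) = ray_integral (- \<phi>) (\<lambda>p. H p + (2 * \<i> * F s) * (q2 / (q2\<^sup>2 + p\<^sup>2)))"
      by (rule ray_integral_cong) (rule eq)
    also have "\<dots> = ray_integral (- \<phi>) H + (2 * \<i> * F s) * (pi / 2)"
      by (simp only: ray_integral_add[OF iH ray_integrable_cmult[OF k2(1)]] ray_integral_cmult k2(2))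
    finally show ?thesis using iH by simp
  qed
  have "ray_integral (- \<phi>) H = ray_integral \<phi> H"
    by (rule ray_integral_rotate[of \<theta> "- \<theta>", OF _ _ _ _ _ holH Hb]) (use up low phi ang th in auto)
  then show ?thesis
    unfolding boundary_integral_eq left using up low by (simp add: field_simps)
qed

text \<open>For s on a left-hand ray the formula is applied to F(-z) at -s; the boundary is
  symmetric under negation, which reverses the sign of the integral.\<close>

lemma Cauchy_formula_bisector:
  assumes ang: "0 < \<psi>" "\<psi> < \<phi>" "\<phi> < \<theta>" "\<theta> < pi / 2" and s: "s \<in> boundary \<psi>"
    and hol: "F holomorphic_on bisector \<theta>" and M: "\<And>z. z \<in> bisector \<theta> \<Longrightarrow> norm (F z) \<le> M"
    and int: "boundary_integrable \<phi> (\<lambda>z. F z / z)"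
  shows "boundary_integral \<phi> (\<lambda>p. F p / (p - s)) = F s"
proof (cases "s \<in> ray (- \<psi>) \<union> ray \<psi>")
  case True
  then obtain c where "s \<in> ray c" "\<bar>c\<bar> < \<phi>" using ang by fastforce
  then show ?thesis using Cauchy_formula_bisector_right[OF ang(3,4) _ _ hol M int] by blast
next
  case False
  then have "s \<in> ray (- \<psi> + pi) \<union> ray (\<psi> + pi)" using s by (auto simp: boundary_eq add.commute)
  then have "- s \<in> ray (- \<psi>) \<union> ray \<psi>"
    using uminus_in_ray[of "- s" "- \<psi>"] uminus_in_ray[of "- s" \<psi>] by auto
  then obtain c where c: "- s \<in> ray c" "\<bar>c\<bar> < \<phi>" using ang by fastforce
  let ?G = "\<lambda>z. F (- z)"
  have "boundary_integral \<phi> (\<lambda>p. ?G p / (p - (- s))) = ?G (- s)"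
  proof (rule Cauchy_formula_bisector_right[OF ang(3,4) c])
    have "F \<circ> uminus holomorphic_on bisector \<theta>"
      by (rule holomorphic_on_compose_gen[OF _ hol]) (auto intro!: holomorphic_intros)
    then show "?G holomorphic_on bisector \<theta>" by (simp add: o_def)
    show "norm (?G z) \<le> M" if "z \<in> bisector \<theta>" for z using M that by simp
    show "boundary_integrable \<phi> (\<lambda>z. ?G z / z)"
      using boundary_integrable_cmult[OF boundary_integrable_uminus[OF int], of "- 1"] by simp
  qed
  moreover have "boundary_integral \<phi> (\<lambda>p. ?G p / (p - (- s))) = boundary_integral \<phi> (\<lambda>p. F p / (p - s))"
  proof -
    have "F z / (- z - (- s)) = - 1 * (F z / (z - s))" for z
      by (metis minus_diff_minus minus_divide_right mult_minus1 minus_diff_eq)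
    then have "boundary_integral \<phi> (\<lambda>z. F z / (- z - (- s))) = - boundary_integral \<phi> (\<lambda>p. F p / (p - s))"
      by (simp only: boundary_integral_cmult) simp
    moreover have "boundary_integral \<phi> (\<lambda>p. ?G p / (p - (- s))) = - boundary_integral \<phi> (\<lambda>z. F z / (- z - (- s)))"
      using boundary_integral_uminus[of \<phi> "\<lambda>z. F z / (- z - (- s))"] by simp
    ultimately show ?thesis by simp
  qed
  ultimately show ?thesis by simp
qed

section \<open>Fubini's theorem for the Cauchy kernel\<close>

lemma integrable_lborel_prod:
  fixes f g :: "real \<Rightarrow> real"
  assumes "integrable lborel f" "integrable lborel g"
  shows "integrable (lborel \<Otimes>\<^sub>M lborel) (\<lambda>(x, y). f x * g y)"
proof (rule lborel_pair.Fubini_integrable)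
  have [measurable]: "f \<in> borel_measurable borel" "g \<in> borel_measurable borel"
    using assms[THEN borel_measurable_integrable] by simp_all
  show "(\<lambda>(x, y). f x * g y) \<in> borel_measurable (lborel \<Otimes>\<^sub>M lborel)" by measurable
  show "integrable lborel (\<lambda>x. LINT y|lborel. norm (case (x, y) of (x, y) \<Rightarrow> f x * g y))"
    using assms by (simp add: abs_mult)
  show "AE x in lborel. integrable lborel (\<lambda>y. case (x, y) of (x, y) \<Rightarrow> f x * g y)"
    using assms by simp
qed

text \<open>The Cauchy kernel is dominated by a product because the two rays only meet at the origin.\<close>

lemma ray_Fubini:
  assumes cF: "continuous_on (ray a) F" and iF: "ray_integrable a (\<lambda>s. F s / s)"
    and cH: "continuous_on (ray b) H" and iH: "ray_integrable b H"
    and k: "k > 0" "\<And>s p. s \<in> ray a \<Longrightarrow> p \<in> ray b \<Longrightarrow> k * norm s \<le> norm (p - s)"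
  shows "ray_integrable a (\<lambda>s. ray_integral b (\<lambda>p. F s * H p / (p - s)))"
    and "ray_integrable b (\<lambda>p. ray_integral a (\<lambda>s. F s * H p / (p - s)))"
    and "ray_integral a (\<lambda>s. ray_integral b (\<lambda>p. F s * H p / (p - s))) =
      ray_integral b (\<lambda>p. ray_integral a (\<lambda>s. F s * H p / (p - s)))"
proof -
  let ?z = "\<lambda>t. complex_of_real t * cis a" and ?w = "\<lambda>u. complex_of_real u * cis b"
  define F' where "F' t = indicat_real {0<..} t *\<^sub>R F (?z t)" for t
  define H' where "H' u = indicat_real {0<..} u *\<^sub>R H (?w u)" for u
  define G where "G = (\<lambda>(t, u). F' t * H' u / (?w u - ?z t))"
  have [measurable]: "F' \<in> borel_measurable borel" "H' \<in> borel_measurable borel"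
    using set_borel_measurable_ray[OF cF] set_borel_measurable_ray[OF cH]
    unfolding F'_def H'_def set_borel_measurable_def by simp_all
  have G_meas: "G \<in> borel_measurable (lborel \<Otimes>\<^sub>M lborel)" unfolding G_def by measurable
  have i1: "integrable lborel (\<lambda>t. norm (indicat_real {0<..} t *\<^sub>R (F (?z t) / ?z t)))"
    using iF unfolding ray_integrable_def set_integrable_def by (rule integrable_norm)
  have i2: "integrable lborel (\<lambda>u. (1 / k) * norm (H' u))"
    using iH unfolding ray_integrable_def set_integrable_def H'_def
    by (intro integrable_mult_right integrable_norm)
  have G_int: "integrable (lborel \<Otimes>\<^sub>M lborel) G"
  proof (rule Bochner_Integration.integrable_bound[OF integrable_lborel_prod[OF i1 i2] G_meas], rule AE_I2)
    fix x :: "real \<times> real"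
    obtain t u where x: "x = (t, u)" by (cases x)
    have "norm (G (t, u)) \<le> norm (case (t, u) of (t, u) \<Rightarrow>
        norm (indicat_real {0<..} t *\<^sub>R (F (?z t) / ?z t)) * ((1 / k) * norm (H' u)))"
    proof (cases "t > 0 \<and> u > 0")
      case True
      then have z: "?z t \<in> ray a" "?w u \<in> ray b" by (auto simp: ray_def)
      have pos: "k * norm (?z t) > 0" using k(1) True by (simp add: norm_mult)
      have "norm (F' t * H' u) / norm (?w u - ?z t) \<le> norm (F' t * H' u) / (k * norm (?z t))"
        by (rule divide_left_mono[OF k(2)[OF z] norm_ge_zero mult_pos_pos[OF less_le_trans[OF pos k(2)[OF z]] pos]])
      then show ?thesis using True k(1) by (simp add: G_def norm_divide norm_mult F'_def field_simps)
    qed (auto simp: G_def F'_def H'_def)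
    then show "norm (G x) \<le> norm (case x of (t, u) \<Rightarrow>
        norm (indicat_real {0<..} t *\<^sub>R (F (?z t) / ?z t)) * ((1 / k) * norm (H' u)))" unfolding x .
  qed
  have rw: "(LINT u|lborel. G (t, u)) = indicat_real {0<..} t *\<^sub>R (LINT u:{0<..}|lborel. F (?z t) * H (?w u) / (?w u - ?z t))" for t
    unfolding set_lebesgue_integral_def integral_scaleR_right[symmetric]
    by (intro Bochner_Integration.integral_cong) (auto simp: G_def F'_def H'_def indicator_def)
  have rw': "(LINT t|lborel. G (t, u)) = indicat_real {0<..} u *\<^sub>R (LINT t:{0<..}|lborel. F (?z t) * H (?w u) / (?w u - ?z t))" for u
    unfolding set_lebesgue_integral_def integral_scaleR_right[symmetric]
    by (intro Bochner_Integration.integral_cong) (auto simp: G_def F'_def H'_def indicator_def)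
  have "integrable lborel (\<lambda>t. LINT u|lborel. G (t, u))" using G_int by (rule lborel_pair.integrable_fst')
  then have "integrable lborel (\<lambda>t. cis b * (LINT u|lborel. G (t, u)))" by (rule integrable_mult_right)
  then show "ray_integrable a (\<lambda>s. ray_integral b (\<lambda>p. F s * H p / (p - s)))"
    unfolding ray_integrable_def set_integrable_def ray_integral_def by (simp add: rw)
  have "integrable lborel (\<lambda>u. LINT t|lborel. G (t, u))"
    using lborel_pair.integrable_fst'[OF lborel_pair.integrable_product_swap[OF G_int]] by (simp add: case_prod_beta)
  then have "integrable lborel (\<lambda>u. cis a * (LINT t|lborel. G (t, u)))" by (rule integrable_mult_right)
  then show "ray_integrable b (\<lambda>p. ray_integral a (\<lambda>s. F s * H p / (p - s)))"
    unfolding ray_integrable_def set_integrable_def ray_integral_def by (simp add: rw')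
  have "(LINT u|lborel. LINT t|lborel. G (t, u)) = (LINT t|lborel. LINT u|lborel. G (t, u))"
    using lborel_pair.Fubini_integral[of "\<lambda>t u. G (t, u)"] G_int by simp
  then show "ray_integral a (\<lambda>s. ray_integral b (\<lambda>p. F s * H p / (p - s))) =
      ray_integral b (\<lambda>p. ray_integral a (\<lambda>s. F s * H p / (p - s)))"
    unfolding rw rw' ray_integral_def set_lebesgue_integral_def[symmetric]
    by (simp add: mult.left_commute)
qed

lemma ray_integrable_sum:
  "(\<And>i. i \<in> I \<Longrightarrow> ray_integrable a (f i)) \<Longrightarrow> ray_integrable a (\<lambda>z. \<Sum>i\<in>I. f i z)"
proof (induction I rule: infinite_finite_induct)
  case (insert i I) then show ?case by (simp add: ray_integrable_add)
qed (simp_all add: ray_integrable_def set_integrable_def)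

lemma ray_integral_sum:
  "(\<And>i. i \<in> I \<Longrightarrow> ray_integrable a (f i)) \<Longrightarrow> ray_integral a (\<lambda>z. \<Sum>i\<in>I. f i z) = (\<Sum>i\<in>I. ray_integral a (f i))"
proof (induction I rule: infinite_finite_induct)
  case (insert i I) then show ?case by (simp add: ray_integral_add ray_integrable_sum)
qed (simp_all add: ray_integral_def)

lemma boundary_Fubini:
  assumes cF: "continuous_on (boundary \<phi>) F" and iF: "boundary_integrable \<phi> (\<lambda>s. F s / s)"
    and cH: "continuous_on (boundary \<psi>) H" and iH: "boundary_integrable \<psi> H"
    and k: "k > 0" "\<And>s p. s \<in> boundary \<phi> \<Longrightarrow> p \<in> boundary \<psi> \<Longrightarrow> k * norm s \<le> norm (p - s)"
  shows "boundary_integrable \<phi> (\<lambda>s. boundary_integral \<psi> (\<lambda>p. F s * H p / (p - s)))"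
    and "boundary_integral \<phi> (\<lambda>s. boundary_integral \<psi> (\<lambda>p. F s * H p / (p - s))) =
      boundary_integral \<psi> (\<lambda>p. boundary_integral \<phi> (\<lambda>s. F s * H p / (p - s)))"
proof -
  let ?G = "\<lambda>s p. F s * H p / (p - s)"
  let ?c = "1 / (2 * complex_of_real pi * \<i>)"
  have sub: "ray (snd x) \<subseteq> boundary \<phi>" if "x \<in> boundary_rays \<phi>" for x \<phi>
    using that by (auto simp: boundary_rays_def boundary_eq)
  have F1: "ray_integrable (snd x) (\<lambda>s. ray_integral (snd y) (?G s))"
    and F3: "ray_integrable (snd y) (\<lambda>p. ray_integral (snd x) (\<lambda>s. ?G s p))"
    and F2: "ray_integral (snd x) (\<lambda>s. ray_integral (snd y) (?G s)) =
      ray_integral (snd y) (\<lambda>p. ray_integral (snd x) (\<lambda>s. ?G s p))"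
    if x: "x \<in> boundary_rays \<phi>" and y: "y \<in> boundary_rays \<psi>" for x y
  proof -
    note r = ray_Fubini[of "snd x" F "snd y" H k, OF continuous_on_subset[OF cF sub[OF x]] _
        continuous_on_subset[OF cH sub[OF y]] _ k(1)]
    have *: "ray_integrable (snd x) (\<lambda>s. F s / s)" "ray_integrable (snd y) H"
      using iF iH x y by (auto simp: boundary_integrable_def case_prod_beta)
    show "ray_integrable (snd x) (\<lambda>s. ray_integral (snd y) (?G s))"
      using r(1)[OF *] k(2) sub[OF x] sub[OF y] by blast
    show "ray_integrable (snd y) (\<lambda>p. ray_integral (snd x) (\<lambda>s. ?G s p))"
      using r(2)[OF *] k(2) sub[OF x] sub[OF y] by blast
    show "ray_integral (snd x) (\<lambda>s. ray_integral (snd y) (?G s)) =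
      ray_integral (snd y) (\<lambda>p. ray_integral (snd x) (\<lambda>s. ?G s p))"
      using r(3)[OF *] k(2) sub[OF x] sub[OF y] by blast
  qed
  have bi: "boundary_integral \<xi> f = (\<Sum>x\<in>boundary_rays \<xi>. (?c * of_real (fst x)) * ray_integral (snd x) f)" for \<xi> f
    unfolding boundary_integral_def sum_divide_distrib
    by (intro sum.cong refl) (auto simp: field_simps)
  have int1: "ray_integrable (snd x) (\<lambda>s. \<Sum>y\<in>boundary_rays \<psi>. (?c * of_real (fst y)) * ray_integral (snd y) (?G s))"
    if "x \<in> boundary_rays \<phi>" for x
    by (intro ray_integrable_sum ray_integrable_cmult F1 that)
  then show "boundary_integrable \<phi> (\<lambda>s. boundary_integral \<psi> (\<lambda>p. F s * H p / (p - s)))"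
    unfolding boundary_integrable_def bi by (force simp: case_prod_beta)
  have e1: "ray_integral (snd x) (\<lambda>s. boundary_integral \<psi> (?G s)) =
     (\<Sum>y\<in>boundary_rays \<psi>. (?c * of_real (fst y)) * ray_integral (snd x) (\<lambda>s. ray_integral (snd y) (?G s)))"
    if "x \<in> boundary_rays \<phi>" for x
  proof -
    have "ray_integral (snd x) (\<lambda>s. \<Sum>y\<in>boundary_rays \<psi>. (?c * of_real (fst y)) * ray_integral (snd y) (?G s)) =
      (\<Sum>y\<in>boundary_rays \<psi>. ray_integral (snd x) (\<lambda>s. (?c * of_real (fst y)) * ray_integral (snd y) (?G s)))"
      by (rule ray_integral_sum) (intro ray_integrable_cmult F1 that)
    then show ?thesis unfolding bi by (simp only: ray_integral_cmult)
  qed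
  have e2: "ray_integral (snd y) (\<lambda>p. boundary_integral \<phi> (\<lambda>s. ?G s p)) =
     (\<Sum>x\<in>boundary_rays \<phi>. (?c * of_real (fst x)) * ray_integral (snd y) (\<lambda>p. ray_integral (snd x) (\<lambda>s. ?G s p)))"
    if "y \<in> boundary_rays \<psi>" for y
  proof -
    have "ray_integral (snd y) (\<lambda>p. \<Sum>x\<in>boundary_rays \<phi>. (?c * of_real (fst x)) * ray_integral (snd x) (\<lambda>s. ?G s p)) =
      (\<Sum>x\<in>boundary_rays \<phi>. ray_integral (snd y) (\<lambda>p. (?c * of_real (fst x)) * ray_integral (snd x) (\<lambda>s. ?G s p)))"
      by (rule ray_integral_sum) (intro ray_integrable_cmult F3 that)
    then show ?thesis unfolding bi by (simp only: ray_integral_cmult)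
  qed
  have "boundary_integral \<phi> (\<lambda>s. boundary_integral \<psi> (?G s)) =
     (\<Sum>x\<in>boundary_rays \<phi>. \<Sum>y\<in>boundary_rays \<psi>. (?c * of_real (fst x)) * ((?c * of_real (fst y)) * ray_integral (snd x) (\<lambda>s. ray_integral (snd y) (?G s))))"
    unfolding bi[of \<phi>] by (intro sum.cong refl) (simp only: e1 sum_distrib_left)
  also have "\<dots> = (\<Sum>y\<in>boundary_rays \<psi>. \<Sum>x\<in>boundary_rays \<phi>. (?c * of_real (fst y)) * ((?c * of_real (fst x)) * ray_integral (snd y) (\<lambda>p. ray_integral (snd x) (\<lambda>s. ?G s p))))"
    by (subst sum.swap) (intro sum.cong refl, simp only: F2 mult_ac)
  also have "\<dots> = boundary_integral \<psi> (\<lambda>p. boundary_integral \<phi> (\<lambda>s. ?G s p))"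
    unfolding bi[of \<psi>] by (intro sum.cong refl) (simp only: e2 sum_distrib_left)
  finally show "boundary_integral \<phi> (\<lambda>s. boundary_integral \<psi> (?G s)) = boundary_integral \<psi> (\<lambda>p. boundary_integral \<phi> (\<lambda>s. ?G s p))" .
qed

section \<open>Decaying functions on a double sector\<close>

text \<open>The complex counterpart of \<open>N_0\<close>: symmetry under conjugation corresponds to
  intrinsic functions. The four rays for angles \<phi> from 0 up to \<theta> have exactly the
  directions in \<open>I_angle\<close>; the angle 0 gives the real axis, on which the constants of a
  decomposition are separated.\<close>

definition decaying :: "real \<Rightarrow> (complex \<Rightarrow> complex) \<Rightarrow> bool" where
  "decaying \<theta> F \<longleftrightarrow> F holomorphic_on bisector \<theta> \<and> (\<forall>z\<in>bisector \<theta>. F (cnj z) = cnj (F z)) \<and>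
    bounded (F ` bisector \<theta>) \<and> (\<forall>\<phi>\<ge>0. \<phi> < \<theta> \<longrightarrow> boundary_integrable \<phi> (\<lambda>z. F z / z))"

lemma decayingE:
  assumes "decaying \<theta> F"
  obtains M where "M \<ge> 0" "\<And>z. z \<in> bisector \<theta> \<Longrightarrow> norm (F z) \<le> M"
proof -
  obtain M where M: "\<And>z. z \<in> bisector \<theta> \<Longrightarrow> norm (F z) \<le> M"
    using assms unfolding decaying_def bounded_iff by blast
  have "norm (F z) \<le> max M 0" if "z \<in> bisector \<theta>" for z using M[OF that] by simp
  then show thesis using that[of "max M 0"] by simp
qed

lemma decaying_cong:
  assumes "\<theta> < pi / 2" "\<And>z. z \<in> bisector \<theta> \<Longrightarrow> F z = G z"
  shows "decaying \<theta> F \<longleftrightarrow> decaying \<theta> G"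
proof -
  have *: "boundary_integrable \<phi> (\<lambda>z. F z / z) \<longleftrightarrow> boundary_integrable \<phi> (\<lambda>z. G z / z)"
    if "0 \<le> \<phi>" "\<phi> < \<theta>" for \<phi>
  proof (rule boundary_integrable_cong)
    fix z assume "z \<in> boundary \<phi>"
    then have "z \<in> bisector \<theta>" using boundary_subset_bisector[OF that assms(1)] by blast
    then show "F z / z = G z / z" by (simp add: assms(2))
  qed
  have "F ` bisector \<theta> = G ` bisector \<theta>" using assms(2) by (rule image_cong[OF refl])
  moreover have "F holomorphic_on bisector \<theta> \<longleftrightarrow> G holomorphic_on bisector \<theta>"
    by (rule holomorphic_cong) (use assms(2) in auto)
  moreover have "(\<forall>z\<in>bisector \<theta>. F (cnj z) = cnj (F z)) \<longleftrightarrow> (\<forall>z\<in>bisector \<theta>. G (cnj z) = cnj (G z))"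
    by (intro ball_cong refl) (simp add: assms(2))
  ultimately show ?thesis unfolding decaying_def using * by auto
qed

lemma decaying_add:
  assumes "decaying \<theta> F" "decaying \<theta> G"
  shows "decaying \<theta> (\<lambda>z. F z + G z)"
proof -
  obtain M N where "\<And>z. z \<in> bisector \<theta> \<Longrightarrow> norm (F z) \<le> M" "\<And>z. z \<in> bisector \<theta> \<Longrightarrow> norm (G z) \<le> N"
    using decayingE assms by metis
  then have "norm (F z + G z) \<le> M + N" if "z \<in> bisector \<theta>" for z
    using norm_triangle_mono that by blast
  then have "bounded ((\<lambda>z. F z + G z) ` bisector \<theta>)" unfolding bounded_iff by blast
  then show ?thesis using assms unfolding decaying_def
    by (auto intro!: holomorphic_intros boundary_integrable_add simp: add_divide_distrib)
qed

lemma decaying_mult_bounded: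
  assumes F: "decaying \<theta> F" and \<theta>: "\<theta> < pi / 2"
    and hol: "u holomorphic_on bisector \<theta>" and cnj: "\<And>z. z \<in> bisector \<theta> \<Longrightarrow> u (cnj z) = cnj (u z)"
    and K: "\<And>z. z \<in> bisector \<theta> \<Longrightarrow> norm (u z) \<le> K"
  shows "decaying \<theta> (\<lambda>z. u z * F z)"
  unfolding decaying_def
proof (intro conjI allI impI ballI)
  show hol': "(\<lambda>z. u z * F z) holomorphic_on bisector \<theta>"
    using F hol unfolding decaying_def by (auto intro!: holomorphic_intros)
  show "u (cnj z) * F (cnj z) = cnj (u z * F z)" if "z \<in> bisector \<theta>" for z
    using F cnj that unfolding decaying_def by simp
  obtain M where M: "M \<ge> 0" "\<And>z. z \<in> bisector \<theta> \<Longrightarrow> norm (F z) \<le> M" using decayingE[OF F] by blast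
  have "norm (u z * F z) \<le> K * M" if "z \<in> bisector \<theta>" for z
    unfolding norm_mult using K[OF that] M(2)[OF that] by (intro mult_mono) (auto intro: order_trans[OF norm_ge_zero])
  then show "bounded ((\<lambda>z. u z * F z) ` bisector \<theta>)" unfolding bounded_iff by blast
  fix \<phi> assume \<phi>: "0 \<le> \<phi>" "\<phi> < \<theta>"
  note sub = boundary_subset_bisector[OF \<phi> \<theta>]
  show "boundary_integrable \<phi> (\<lambda>z. u z * F z / z)"
  proof (rule boundary_integrable_bound)
    show "boundary_integrable \<phi> (\<lambda>z. F z / z)" using F \<phi> unfolding decaying_def by blast
    show "continuous_on (boundary \<phi>) (\<lambda>z. u z * F z / z)"
      by (intro continuous_intros continuous_on_subset[OF holomorphic_on_imp_continuous_on[OF hol'] sub])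
        (use boundary_nonzero in blast)
    show "norm (u z * F z / z) \<le> K * norm (F z / z)" if "z \<in> boundary \<phi>" for z
      using mult_right_mono[OF K, of z "norm (F z / z)"] that sub by (auto simp: norm_mult norm_divide)
  qed
qed

lemma decaying_cmult:
  assumes "decaying \<theta> F" "\<theta> < pi / 2"
  shows "decaying \<theta> (\<lambda>z. of_real r * F z)"
  by (rule decaying_mult_bounded[OF assms, of "\<lambda>z. of_real r" "\<bar>r\<bar>"]) (auto intro!: holomorphic_intros)

lemma decaying_mult:
  assumes "decaying \<theta> F" "decaying \<theta> G" "\<theta> < pi / 2"
  shows "decaying \<theta> (\<lambda>z. F z * G z)"
proof -
  obtain M where M: "\<And>z. z \<in> bisector \<theta> \<Longrightarrow> norm (F z) \<le> M" using decayingE[OF assms(1)] by blast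
  show ?thesis
    by (rule decaying_mult_bounded[OF assms(2,3) _ _ M])
      (use assms(1) in \<open>auto simp: decaying_def\<close>)
qed

section \<open>The kernels built from 1/(1 + z^2)\<close>

lemma bisector_cos_le:
  assumes "z \<in> bisector \<theta>" "0 < \<theta>" "\<theta> < pi / 2"
  shows "cos \<theta> * norm z \<le> \<bar>Re z\<bar>" "Re z \<noteq> 0"
proof -
  have c: "cos \<theta> > 0" by (rule cos_gt_zero_pi) (use assms in auto)
  have "(cos \<theta> * \<bar>Im z\<bar>)\<^sup>2 \<le> (sin \<theta> * \<bar>Re z\<bar>)\<^sup>2"
    using assms(1) c unfolding bisector_def by (intro power_mono) auto
  then have "(cos \<theta>)\<^sup>2 * ((Re z)\<^sup>2 + (Im z)\<^sup>2) \<le> ((sin \<theta>)\<^sup>2 + (cos \<theta>)\<^sup>2) * (Re z)\<^sup>2"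
    by (simp only: power_mult_distrib power2_abs distrib_right distrib_left add_mono)
  then have "(cos \<theta> * norm z)\<^sup>2 \<le> \<bar>Re z\<bar>\<^sup>2"
    by (simp only: power_mult_distrib cmod_power2 sin_cos_squared_add power2_abs mult_1)
  then show "cos \<theta> * norm z \<le> \<bar>Re z\<bar>" by (rule power2_le_imp_le) simp
  show "Re z \<noteq> 0"
  proof
    assume "Re z = 0"
    then have "cos \<theta> * \<bar>Im z\<bar> < 0" using assms(1) unfolding bisector_def by simp
    then show False using c by (simp add: mult_less_0_iff)
  qed
qed

text \<open>\<open>norm_add_squares_ge\<close> with r = 1, combined with the comparison of |Re z|
  and |z| inside the double sector.\<close>

lemma bisector_one_plus_square:
  assumes "z \<in> bisector \<theta>" "0 < \<theta>" "\<theta> < pi / 2"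
  shows "cos \<theta> * (1 + (norm z)\<^sup>2) \<le> norm (1 + z\<^sup>2)" "1 + z\<^sup>2 \<noteq> 0"
proof -
  have c: "cos \<theta> > 0" by (rule cos_gt_zero_pi) (use assms in auto)
  have n: "norm z > 0" using bisector_cos_le(2)[OF assms] by auto
  have "(cos \<theta> * norm z) * (1 + (norm z)\<^sup>2) \<le> \<bar>Re z\<bar> * (1\<^sup>2 + (norm z)\<^sup>2)"
    using bisector_cos_le(1)[OF assms] by (simp add: mult_right_mono)
  also have "\<dots> \<le> norm z * norm (of_real 1 ^ 2 + z\<^sup>2)" by (rule norm_add_squares_ge)
  finally show le: "cos \<theta> * (1 + (norm z)\<^sup>2) \<le> norm (1 + z\<^sup>2)" using n by (simp add: mult_ac)
  have "0 < cos \<theta> * (1 + (norm z)\<^sup>2)" using c by (simp add: add_pos_nonneg)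
  then show "1 + z\<^sup>2 \<noteq> 0" using le by auto
qed

lemma bisector_kernel_bounds:
  assumes "z \<in> bisector \<theta>" "0 < \<theta>" "\<theta> < pi / 2"
  shows "norm (1 / (1 + z\<^sup>2)) \<le> 1 / cos \<theta>" "norm (z / (1 + z\<^sup>2)) \<le> 1 / cos \<theta>" "norm (z\<^sup>2 / (1 + z\<^sup>2)) \<le> 1 / cos \<theta>"
proof -
  have c: "cos \<theta> > 0" by (rule cos_gt_zero_pi) (use assms in auto)
  note le = bisector_one_plus_square[OF assms]
  have pos: "norm (1 + z\<^sup>2) > 0" using le(2) by simp
  have b: "x / norm (1 + z\<^sup>2) \<le> 1 / cos \<theta>" if "x \<le> 1 + (norm z)\<^sup>2" for x
  proof -
    have "cos \<theta> * x \<le> norm (1 + z\<^sup>2)" using mult_left_mono[OF that, of "cos \<theta>"] c le(1) by linarith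
    then show ?thesis using pos c by (simp add: field_simps)
  qed
  have "2 * norm z * 1 \<le> (norm z)\<^sup>2 + 1\<^sup>2" by (rule sum_squares_bound)
  then have "norm z \<le> 1 + (norm z)\<^sup>2" using norm_ge_zero[of z] unfolding power_one mult_1_right by linarith
  then show "norm (z / (1 + z\<^sup>2)) \<le> 1 / cos \<theta>" using b[of "norm z"] by (simp add: norm_divide)
  show "norm (1 / (1 + z\<^sup>2)) \<le> 1 / cos \<theta>" using b[of 1] by (simp add: norm_divide)
  show "norm (z\<^sup>2 / (1 + z\<^sup>2)) \<le> 1 / cos \<theta>" using b[of "(norm z)\<^sup>2"] by (simp add: norm_divide norm_power)
qed

lemma decaying_div_one_plus_square:
  assumes "decaying \<theta> F" "0 < \<theta>" "\<theta> < pi / 2"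
  shows "decaying \<theta> (\<lambda>z. 1 / (1 + z\<^sup>2) * F z)"
  by (rule decaying_mult_bounded[OF assms(1,3) _ _ bisector_kernel_bounds(1)[OF _ assms(2,3)]])
    (use bisector_one_plus_square(2)[OF _ assms(2,3)] in \<open>auto intro!: holomorphic_intros\<close>)

text \<open>All four integrals are arctangent integrals: with q = 1 on the right-hand rays and with
  q = -1, in direction pi, on the left-hand ones, where 1/(1 + z^2) is minus the kernel.\<close>

lemma boundary_integrable_one_plus_square:
  assumes "0 \<le> \<phi>" "\<phi> < pi / 2"
  shows "boundary_integrable \<phi> (\<lambda>z. 1 / (1 + z\<^sup>2))"
    and "ray_integral \<phi> (\<lambda>z. 1 / (1 + z\<^sup>2)) = pi / 2" "ray_integral (- \<phi>) (\<lambda>z. 1 / (1 + z\<^sup>2)) = pi / 2"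
    and "ray_integral (pi - \<phi>) (\<lambda>z. 1 / (1 + z\<^sup>2)) = - pi / 2" "ray_integral (pi + \<phi>) (\<lambda>z. 1 / (1 + z\<^sup>2)) = - pi / 2"
proof -
  have r: "ray_integrable b (\<lambda>z. 1 / (1 + z\<^sup>2)) \<and> ray_integral b (\<lambda>z. 1 / (1 + z\<^sup>2)) = pi / 2" if "\<bar>b\<bar> < pi / 2" for b
    using ray_integral_arctan[of 1 b 0 1] that by simp
  have l: "ray_integrable b (\<lambda>z. 1 / (1 + z\<^sup>2)) \<and> ray_integral b (\<lambda>z. 1 / (1 + z\<^sup>2)) = - pi / 2" if "\<bar>b - pi\<bar> < pi / 2" for b
  proof -
    have eq: "(\<lambda>z::complex. 1 / (1 + z\<^sup>2)) = (\<lambda>z. - 1 * (- 1 / ((- 1)\<^sup>2 + z\<^sup>2)))" by auto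
    have i: "ray_integrable b (\<lambda>z. - 1 / ((- 1)\<^sup>2 + z\<^sup>2))" "ray_integral b (\<lambda>z. - 1 / ((- 1)\<^sup>2 + z\<^sup>2)) = pi / 2"
      by (rule ray_integral_arctan[of 1 b pi "- 1"]; use that in simp)+
    show ?thesis unfolding eq
    proof
      show "ray_integrable b (\<lambda>z. - 1 * (- 1 / ((- 1)\<^sup>2 + z\<^sup>2)))" by (rule ray_integrable_cmult[OF i(1)])
      show "ray_integral b (\<lambda>z. - 1 * (- 1 / ((- 1)\<^sup>2 + z\<^sup>2))) = - pi / 2"
        unfolding ray_integral_cmult i(2) by simp
    qed
  qed
  show "boundary_integrable \<phi> (\<lambda>z. 1 / (1 + z\<^sup>2))"
    "ray_integral \<phi> (\<lambda>z. 1 / (1 + z\<^sup>2)) = pi / 2" "ray_integral (- \<phi>) (\<lambda>z. 1 / (1 + z\<^sup>2)) = pi / 2"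
    "ray_integral (pi - \<phi>) (\<lambda>z. 1 / (1 + z\<^sup>2)) = - pi / 2" "ray_integral (pi + \<phi>) (\<lambda>z. 1 / (1 + z\<^sup>2)) = - pi / 2"
    using r[of \<phi>] r[of "- \<phi>"] l[of "pi - \<phi>"] l[of "pi + \<phi>"] assms by (auto simp: boundary_integrable_eq)
qed

lemma decaying_kernel:
  assumes "0 < \<theta>" "\<theta> < pi / 2"
  shows "decaying \<theta> (\<lambda>z. z / (1 + z\<^sup>2))"
  unfolding decaying_def
proof (intro conjI allI impI ballI)
  show "(\<lambda>z. z / (1 + z\<^sup>2)) holomorphic_on bisector \<theta>"
    by (intro holomorphic_intros) (use bisector_one_plus_square(2)[OF _ assms] in auto)
  show "bounded ((\<lambda>z. z / (1 + z\<^sup>2)) ` bisector \<theta>)"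
    unfolding bounded_iff using bisector_kernel_bounds(2)[OF _ assms] by blast
  fix \<phi> assume "0 \<le> \<phi>" "\<phi> < \<theta>"
  then have "boundary_integrable \<phi> (\<lambda>z. 1 / (1 + z\<^sup>2))" using boundary_integrable_one_plus_square(1) assms by auto
  then show "boundary_integrable \<phi> (\<lambda>z. z / (1 + z\<^sup>2) / z)"
    by (rule boundary_integrable_cong[THEN iffD1, rotated]) (use boundary_nonzero in auto)
qed simp

text \<open>On the positive axis the equation says that (c + d/(1 + t^2))/t is integrable. A nonzero
  c makes the integral diverge logarithmically at infinity, and once c vanishes a nonzero d makes it
  diverge at 0.\<close>

lemma decaying_constants_eq_0:
  assumes K: "decaying \<theta> K" "0 < \<theta>" "\<theta> < pi / 2"
    and eq: "\<And>z. z \<in> bisector \<theta> \<Longrightarrow> of_real c + of_real d / (1 + z\<^sup>2) + K z = 0"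
  shows "c = 0" "d = 0"
proof -
  define k where "k t = K (of_real t) / of_real t" for t :: real
  have k: "set_integrable lborel {0<..} k"
  proof -
    have "boundary_integrable 0 (\<lambda>z. K z / z)" using K(1) assms(2) unfolding decaying_def by simp
    then show ?thesis by (simp add: boundary_integrable_eq ray_integrable_def k_def[abs_def])
  qed
  define I where "I = (LINT t:{0<..}|lborel. norm (k t))"
  have kt: "k t = - of_real ((c + d / (1 + t\<^sup>2)) / t)" if "t > 0" for t
  proof -
    have "ray 0 \<subseteq> bisector \<theta>" by (rule ray_subset_bisector) (use assms in auto)
    moreover have "complex_of_real t \<in> ray 0" using that by (auto simp: ray_def)
    ultimately have "of_real t \<in> bisector \<theta>" by blast
    have "K (of_real t) = - (of_real c + of_real d / (1 + (of_real t)\<^sup>2))"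
      using eq[OF \<open>of_real t \<in> bisector \<theta>\<close>] by (rule add_eq_0_iff[THEN iffD1])
    then show ?thesis
      by (simp only: k_def of_real_add of_real_divide of_real_1 of_real_power minus_divide_left)
  qed
  have le: "\<eta> * (ln y - ln x) \<le> I"
    if xy: "0 < x" "x \<le> y" and \<eta>: "\<And>t. x \<le> t \<Longrightarrow> t \<le> y \<Longrightarrow> \<eta> \<le> \<bar>c + d / (1 + t\<^sup>2)\<bar>" for x y \<eta>
  proof -
    have e: "(LINT t|lborel. indicat_real {x..y} t *\<^sub>R (\<eta> / t)) = \<eta> * ln y - \<eta> * ln x"
    proof (rule integral_FTC_atLeastAtMost[OF xy(2)])
      fix t assume "x \<le> t" "t \<le> y"
      then have "((\<lambda>t. \<eta> * ln t) has_field_derivative \<eta> / t) (at t within {x..y})"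
        using xy by (auto intro!: derivative_eq_intros simp: divide_inverse)
      then show "((\<lambda>t. \<eta> * ln t) has_vector_derivative \<eta> / t) (at t within {x..y})"
        by (simp add: has_real_derivative_iff_has_vector_derivative)
    qed (use xy in \<open>auto intro!: continuous_intros\<close>)
    have "(LINT t|lborel. indicat_real {x..y} t *\<^sub>R (\<eta> / t)) \<le> I"
      unfolding I_def set_lebesgue_integral_def
    proof (rule integral_mono)
      have "set_integrable lborel {x..y} (\<lambda>t. \<eta> / t)"
        by (rule borel_integrable_atLeastAtMost') (use xy in \<open>auto intro!: continuous_intros\<close>)
      then show "integrable lborel (\<lambda>t. indicat_real {x..y} t *\<^sub>R (\<eta> / t))" by (simp add: set_integrable_def)
      show "integrable lborel (\<lambda>t. indicat_real {0<..} t *\<^sub>R norm (k t))"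
        using set_integrable_norm[OF k] by (simp add: set_integrable_def)
      fix t :: real
      show "indicat_real {x..y} t *\<^sub>R (\<eta> / t) \<le> indicat_real {0<..} t *\<^sub>R norm (k t)"
      proof (cases "x \<le> t \<and> t \<le> y")
        case True
        then have t: "t > 0" using xy by linarith
        have "\<eta> / t \<le> \<bar>c + d / (1 + t\<^sup>2)\<bar> / t" using \<eta> True t by (intro divide_right_mono) auto
        also have "\<dots> = norm (k t)" unfolding kt[OF t] norm_minus_cancel norm_of_real abs_divide using t by simp
        finally show ?thesis using True t by simp
      qed auto
    qed
    then show ?thesis unfolding e by (simp only: right_diff_distrib)
  qed
  have I0: "I \<ge> 0" using le[of 1 1 0] by simp
  show c: "c = 0"
  proof (rule ccontr)
    assume "c \<noteq> 0"
    define \<eta> where "\<eta> = \<bar>c\<bar> / 2"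
    have \<eta>: "\<eta> > 0" using \<open>c \<noteq> 0\<close> by (simp add: \<eta>_def)
    define x where "x = 1 + \<bar>d\<bar> / \<eta>"
    have x: "x \<ge> 1" using \<eta> by (simp add: x_def)
    \<comment> \<open>Beyond x the term with d is at most half of |c|. The interval {x..y} is long
      enough for the logarithm to push the integral up to I + 1.\<close>
    define y where "y = x * exp ((I + 1) / \<eta>)"
    have y: "x \<le> y" using x I0 \<eta> by (simp add: y_def)
    have "\<eta> * (ln y - ln x) \<le> I"
    proof (rule le)
      fix t assume t: "x \<le> t"
      have "\<bar>d\<bar> \<le> \<eta> * x" using \<eta> by (simp add: x_def field_simps)
      also have "\<dots> \<le> \<eta> * (1 + t\<^sup>2)"
      proof (rule mult_left_mono)
        have "t \<le> t\<^sup>2" using t x by (simp add: self_le_power)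
        then show "x \<le> 1 + t\<^sup>2" using t by linarith
      qed (use \<eta> in simp)
      finally have "\<bar>d / (1 + t\<^sup>2)\<bar> \<le> \<eta>" by (simp add: divide_le_eq add_pos_nonneg)
      then show "\<eta> \<le> \<bar>c + d / (1 + t\<^sup>2)\<bar>" unfolding \<eta>_def by linarith
    qed (use x y in auto)
    moreover have "ln y - ln x = (I + 1) / \<eta>" using x by (simp add: y_def ln_mult)
    ultimately show False using \<eta> by simp
  qed
  show "d = 0"
  proof (rule ccontr)
    assume "d \<noteq> 0"
    define \<eta> where "\<eta> = \<bar>d\<bar> / 2"
    have \<eta>: "\<eta> > 0" using \<open>d \<noteq> 0\<close> by (simp add: \<eta>_def)
    define x where "x = exp (- ((I + 1) / \<eta>))"
    have x: "0 < x" "x \<le> 1" using I0 \<eta> by (auto simp: x_def)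
    have "\<eta> * (ln 1 - ln x) \<le> I"
    proof (rule le)
      fix t :: real assume t: "x \<le> t" "t \<le> 1"
      have "t\<^sup>2 \<le> 1" using t x by (simp add: power_le_one)
      moreover have "0 < 1 + t\<^sup>2" by (simp add: add_pos_nonneg)
      ultimately have "\<eta> \<le> \<bar>d\<bar> / (1 + t\<^sup>2)" using \<eta> by (simp add: \<eta>_def le_divide_eq divide_simps mult_left_mono)
      then show "\<eta> \<le> \<bar>c + d / (1 + t\<^sup>2)\<bar>" using c \<open>0 < 1 + t\<^sup>2\<close> by (simp add: abs_divide)
    qed (use x in auto)
    then show False using \<eta> by (simp add: x_def)
  qed
qed

section \<open>The functional calculus of a bisectorial resolvent\<close>

lemma outside_mono:
  assumes "0 < a" "a \<le> b" "b < pi / 2"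
  shows "outside b \<subseteq> outside a"
proof
  fix z assume z: "z \<in> outside b"
  have ca: "cos a > 0" "cos b > 0" by (intro cos_gt_zero_pi; use assms in linarith)+
  have sb: "sin b \<ge> 0" by (rule sin_ge_zero) (use assms in auto)
  have "sin (b - a) \<ge> 0" by (rule sin_ge_zero) (use assms in auto)
  then have ab: "sin a * cos b \<le> cos a * sin b" by (simp add: sin_diff mult.commute)
  have "cos b * (sin a * \<bar>Re z\<bar>) \<le> cos a * (sin b * \<bar>Re z\<bar>)"
    using mult_right_mono[OF ab, of "\<bar>Re z\<bar>"] by (simp add: mult_ac)
  also have "\<dots> < cos a * (cos b * \<bar>Im z\<bar>)"
    using z ca by (intro mult_strict_left_mono) (auto simp: outside_def)
  finally have "cos b * (sin a * \<bar>Re z\<bar>) < cos b * (cos a * \<bar>Im z\<bar>)" by (simp add: mult_ac)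
  then show "z \<in> outside a" using ca by (simp add: outside_def)
qed

text \<open>
  \<open>Q z\<close> stands for $Q_s[T]^{-1}$ and \<open>P z\<close> for $T Q_s[T]^{-1}$ where $s = x + Jy$, $z = x + iy$.
\<close>

locale bisectorial_resolvent =
  fixes \<omega> :: real and Q P :: "complex \<Rightarrow> ('x::banach \<Rightarrow>\<^sub>L 'x)"
  assumes omega: "0 < \<omega>" "\<omega> < pi / 2"
    and Q_expand: "z \<in> outside \<omega> \<Longrightarrow> w \<in> outside \<omega> \<Longrightarrow>
      Q z = (P z o\<^sub>L P w) - (2 * Re w) *\<^sub>R (P z o\<^sub>L Q w) + (norm w)\<^sup>2 *\<^sub>R (Q z o\<^sub>L Q w)"
    and P_diff: "z \<in> outside \<omega> \<Longrightarrow> w \<in> outside \<omega> \<Longrightarrow>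
      P z - P w = (2 * (Re z - Re w)) *\<^sub>R (P z o\<^sub>L P w) + ((norm w)\<^sup>2 - (norm z)\<^sup>2) *\<^sub>R (P z o\<^sub>L Q w)"
    and QQ: "z \<in> outside \<omega> \<Longrightarrow> w \<in> outside \<omega> \<Longrightarrow> Q z o\<^sub>L Q w = Q w o\<^sub>L Q z"
    and PP: "z \<in> outside \<omega> \<Longrightarrow> w \<in> outside \<omega> \<Longrightarrow> P z o\<^sub>L P w = P w o\<^sub>L P z"
    and PQ: "z \<in> outside \<omega> \<Longrightarrow> w \<in> outside \<omega> \<Longrightarrow> P z o\<^sub>L Q w = Q w o\<^sub>L P z"
    and PQ': "z \<in> outside \<omega> \<Longrightarrow> w \<in> outside \<omega> \<Longrightarrow> P z o\<^sub>L Q w = Q z o\<^sub>L P w"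
    and cnj: "Q (cnj z) = Q z" "P (cnj z) = P z"
    and resolvent_bound: "\<omega> < \<phi> \<Longrightarrow> \<phi> < pi / 2 \<Longrightarrow>
      \<exists>C. \<forall>z\<in>outside \<phi>. norm (Q z) \<le> C / (norm z)\<^sup>2 \<and> norm (P z) \<le> C / norm z"
begin

text \<open>The functional \<open>l\<close> applied to the complexified resolvent $(z - T)^{-1} = \overline{z} Q - T Q$.\<close>

definition res :: "(('x \<Rightarrow>\<^sub>L 'x) \<Rightarrow> real) \<Rightarrow> complex \<Rightarrow> complex" where
  "res l z = cnj z * of_real (l (Q z)) - of_real (l (P z))"

text \<open>The weak form of the Dunford integral of F(z) (z - T)^{-1}, normalised by 1/(2 pi i).
  Since l is real valued, the condition also says that the contour integral is real.\<close>

definition represents :: "real \<Rightarrow> (complex \<Rightarrow> complex) \<Rightarrow> ('x \<Rightarrow>\<^sub>L 'x) \<Rightarrow> bool" where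
  "represents \<phi> F A \<longleftrightarrow> (\<forall>l. bounded_linear l \<longrightarrow>
     of_real (l A) = boundary_integral \<phi> (\<lambda>z. F z * res l z))"

lemma bounded_linear_comp_left: "bounded_linear l \<Longrightarrow> bounded_linear (\<lambda>A. l (A o\<^sub>L B))"
  and bounded_linear_comp_right: "bounded_linear l \<Longrightarrow> bounded_linear (\<lambda>A. l (B o\<^sub>L A))"
  by (rule bounded_linear_compose[OF _ bounded_bilinear.bounded_linear_left[OF bounded_bilinear_blinfun_compose]]
      bounded_linear_compose[OF _ bounded_bilinear.bounded_linear_right[OF bounded_bilinear_blinfun_compose]]; assumption)+

lemma represents_unique:
  assumes "represents \<phi> F A" "represents \<phi> F B"
  shows "A = B"
proof (rule bounded_linear_functionals_separate)
  fix l :: "('x \<Rightarrow>\<^sub>L 'x) \<Rightarrow> real" assume "bounded_linear l"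
  then have "complex_of_real (l A) = of_real (l B)" using assms unfolding represents_def by metis
  then show "l A = l B" by simp
qed

text \<open>Bounds on the resolvent are only available outside strictly larger double sectors. By
  continuity in the angle, a point outside the sector of angle \<omega> is also outside a slightly
  larger one.\<close>

lemma outside_inner:
  assumes "z \<in> outside \<omega>"
  obtains \<phi> where "\<omega> < \<phi>" "\<phi> < pi / 2" "z \<in> outside \<phi>"
proof -
  have "isCont (\<lambda>\<phi>. cos \<phi> * \<bar>Im z\<bar> - sin \<phi> * \<bar>Re z\<bar>) \<omega>" by (intro continuous_intros)
  moreover have "0 < cos \<omega> * \<bar>Im z\<bar> - sin \<omega> * \<bar>Re z\<bar>" using assms by (simp add: outside_def)
  ultimately have "\<forall>\<^sub>F \<phi> in at \<omega>. 0 < cos \<phi> * \<bar>Im z\<bar> - sin \<phi> * \<bar>Re z\<bar>"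
    unfolding isCont_def by (rule order_tendstoD(1))
  then have "\<forall>\<^sub>F \<phi> in at_right \<omega>. 0 < cos \<phi> * \<bar>Im z\<bar> - sin \<phi> * \<bar>Re z\<bar>"
    by (simp add: eventually_at_split)
  moreover have "\<forall>\<^sub>F \<phi> in at_right \<omega>. \<phi> \<in> {\<omega><..<pi / 2}"
    by (rule eventually_at_right_real[OF omega(2)])
  ultimately have "\<forall>\<^sub>F \<phi> in at_right \<omega>. \<omega> < \<phi> \<and> \<phi> < pi / 2 \<and> z \<in> outside \<phi>"
    by eventually_elim (simp add: outside_def)
  from eventually_happens'[OF trivial_limit_at_right_real this] show thesis using that by blast
qed

section \<open>Bounds, resolvent identity and holomorphy of the scalar resolvent\<close>

lemma outside_nonzero: "z \<in> outside \<phi> \<Longrightarrow> z \<noteq> 0"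
  by (auto simp: outside_def)

lemma res_bound:
  assumes "\<omega> < \<phi>" "\<phi> < pi / 2" and l: "bounded_linear l"
  obtains C where "C \<ge> 0" "\<And>z. z \<in> outside \<phi> \<Longrightarrow> norm (res l z) \<le> C / norm z"
proof -
  obtain C where C: "\<And>z. z \<in> outside \<phi> \<Longrightarrow> norm (Q z) \<le> C / (norm z)\<^sup>2 \<and> norm (P z) \<le> C / norm z"
    using resolvent_bound[OF assms(1,2)] by blast
  obtain K where K: "K > 0" "\<And>A. \<bar>l A\<bar> \<le> norm A * K" using bounded_linear.pos_bounded[OF l] by auto
  have "norm (res l z) \<le> \<bar>2 * K * C\<bar> / norm z" if z: "z \<in> outside \<phi>" for z
  proof -
    have n: "norm z > 0" using outside_nonzero[OF z] by simp
    have "norm (res l z) \<le> norm z * \<bar>l (Q z)\<bar> + \<bar>l (P z)\<bar>"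
      unfolding res_def by (rule order_trans[OF norm_triangle_ineq4]) (simp add: norm_mult)
    also have "\<dots> \<le> norm z * (C / (norm z)\<^sup>2 * K) + C / norm z * K"
    proof (rule add_mono)
      have "\<bar>l (Q z)\<bar> \<le> C / (norm z)\<^sup>2 * K"
        using K(2)[of "Q z"] mult_right_mono[of "norm (Q z)" "C / (norm z)\<^sup>2" K] C[OF z] K(1) by linarith
      then show "norm z * \<bar>l (Q z)\<bar> \<le> norm z * (C / (norm z)\<^sup>2 * K)" by (rule mult_left_mono) simp
      show "\<bar>l (P z)\<bar> \<le> C / norm z * K"
        using K(2)[of "P z"] mult_right_mono[of "norm (P z)" "C / norm z" K] C[OF z] K(1) by linarith
    qed
    also have "\<dots> = 2 * K * C / norm z" using n by (simp add: power2_eq_square field_simps)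
    also have "\<dots> \<le> \<bar>2 * K * C\<bar> / norm z" using n by (intro divide_right_mono) auto
    finally show ?thesis .
  qed
  then show thesis using that[of "\<bar>2 * K * C\<bar>"] by simp
qed

text \<open>The functional \<open>l\<close> applied to the product of the resolvents at \<open>z\<close> and \<open>w\<close>.\<close>

definition res2 :: "(('x \<Rightarrow>\<^sub>L 'x) \<Rightarrow> real) \<Rightarrow> complex \<Rightarrow> complex \<Rightarrow> complex" where
  "res2 l z w = cnj w * res (\<lambda>A. l (A o\<^sub>L Q w)) z - res (\<lambda>A. l (A o\<^sub>L P w)) z"

text \<open>The second equation is \<open>Q_expand\<close> with z and w exchanged, brought back to
  the same products by commutation. All values of l are thereby expressed through three composite
  operators and \<open>P w\<close>.\<close>

lemma functional_values:
  assumes z: "z \<in> outside \<omega>" and w: "w \<in> outside \<omega>" and l: "bounded_linear l"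
  shows "l (Q z) = l (P z o\<^sub>L P w) - 2 * Re w * l (P z o\<^sub>L Q w) + (norm w)\<^sup>2 * l (Q z o\<^sub>L Q w)"
    and "l (Q w) = l (P z o\<^sub>L P w) - 2 * Re z * l (P z o\<^sub>L Q w) + (norm z)\<^sup>2 * l (Q z o\<^sub>L Q w)"
    and "l (P z) = l (P w) + 2 * (Re z - Re w) * l (P z o\<^sub>L P w) + ((norm w)\<^sup>2 - (norm z)\<^sup>2) * l (P z o\<^sub>L Q w)"
proof -
  interpret l: bounded_linear l by (rule l)
  show "l (Q z) = l (P z o\<^sub>L P w) - 2 * Re w * l (P z o\<^sub>L Q w) + (norm w)\<^sup>2 * l (Q z o\<^sub>L Q w)"
    by (subst Q_expand[OF z w]) (simp add: l.add l.diff l.scaleR)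
  show "l (Q w) = l (P z o\<^sub>L P w) - 2 * Re z * l (P z o\<^sub>L Q w) + (norm z)\<^sup>2 * l (Q z o\<^sub>L Q w)"
    by (subst Q_expand[OF w z]) (simp add: l.add l.diff l.scaleR QQ[OF z w] PP[OF z w] PQ[OF z w] PQ'[OF w z])
  have "l (P z - P w) = 2 * (Re z - Re w) * l (P z o\<^sub>L P w) + ((norm w)\<^sup>2 - (norm z)\<^sup>2) * l (P z o\<^sub>L Q w)"
    by (subst P_diff[OF z w]) (simp add: l.add l.scaleR)
  then show "l (P z) = l (P w) + 2 * (Re z - Re w) * l (P z o\<^sub>L P w) + ((norm w)\<^sup>2 - (norm z)\<^sup>2) * l (P z o\<^sub>L Q w)"
    by (simp add: l.diff)
qed

text \<open>Once \<open>functional_values\<close> is inserted, the terms l(P w) cancel and both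
  sides are combinations of the same three numbers; what remains is an identity between coefficients
  in the real and imaginary parts of z and w.\<close>

lemma resolvent_identity:
  assumes z: "z \<in> outside \<omega>" and w: "w \<in> outside \<omega>" and l: "bounded_linear l"
  shows "(w - z) * res2 l z w = res l z - res l w"
proof -
  have r2: "res2 l z w = cnj w * (cnj z * of_real (l (Q z o\<^sub>L Q w)) - of_real (l (P z o\<^sub>L Q w)))
      - (cnj z * of_real (l (P z o\<^sub>L Q w)) - of_real (l (P z o\<^sub>L P w)))"
    unfolding res2_def res_def PQ'[OF z w] by simp
  show ?thesis
    unfolding r2 res_def functional_values(3)[OF z w l]
    unfolding functional_values(1,2)[OF z w l] cmod_power2
    by (simp add: complex_eq_iff power2_eq_square algebra_simps)
qed

lemma res2_bound:
  assumes "\<omega> < \<phi>" "\<phi> < pi / 2" and l: "bounded_linear l"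
  obtains C where "C \<ge> 0" "\<And>z. z \<in> outside \<phi> \<Longrightarrow> norm (res2 l z w) \<le> C / norm z"
proof -
  obtain C1 where C1: "C1 \<ge> 0" "\<And>z. z \<in> outside \<phi> \<Longrightarrow> norm (res (\<lambda>A. l (A o\<^sub>L Q w)) z) \<le> C1 / norm z"
    using res_bound[OF assms(1,2) bounded_linear_comp_left[OF l]] by blast
  obtain C2 where C2: "C2 \<ge> 0" "\<And>z. z \<in> outside \<phi> \<Longrightarrow> norm (res (\<lambda>A. l (A o\<^sub>L P w)) z) \<le> C2 / norm z"
    using res_bound[OF assms(1,2) bounded_linear_comp_left[OF l]] by blast
  have "norm (res2 l z w) \<le> (norm w * C1 + C2) / norm z" if z: "z \<in> outside \<phi>" for z
  proof -
    have "norm (res2 l z w) \<le> norm w * norm (res (\<lambda>A. l (A o\<^sub>L Q w)) z) + norm (res (\<lambda>A. l (A o\<^sub>L P w)) z)"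
      unfolding res2_def by (rule order_trans[OF norm_triangle_ineq4]) (simp add: norm_mult)
    also have "\<dots> \<le> norm w * (C1 / norm z) + C2 / norm z"
      by (intro add_mono mult_left_mono C1(2)[OF z] C2(2)[OF z] norm_ge_zero)
    finally show ?thesis by (simp add: add_divide_distrib)
  qed
  then show thesis using that[of "norm w * C1 + C2"] C1(1) C2(1) by simp
qed

text \<open>The resolvent identity writes the increment as (z - w) times \<open>res2\<close>, and
  \<open>res2\<close> is bounded near z.\<close>

lemma isCont_res:
  assumes z: "z \<in> outside \<omega>" and l: "bounded_linear l"
  shows "isCont (res l) z"
proof -
  obtain \<phi> where \<phi>: "\<omega> < \<phi>" "\<phi> < pi / 2" "z \<in> outside \<phi>" by (rule outside_inner[OF z])
  obtain C where C: "C \<ge> 0" "\<And>w. w \<in> outside \<phi> \<Longrightarrow> norm (res2 l w z) \<le> C / norm w"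
    using res2_bound[OF \<phi>(1,2) l] by blast
  have nz: "norm z > 0" using outside_nonzero[OF z] by simp
  have "open (outside \<phi> \<inter> {w. norm z / 2 < norm w})"
    by (intro open_Int open_outside open_Collect_less continuous_intros)
  moreover have "z \<in> outside \<phi> \<inter> {w. norm z / 2 < norm w}" using \<phi> nz by simp
  ultimately have ev: "\<forall>\<^sub>F w in at z. w \<in> outside \<phi> \<inter> {w. norm z / 2 < norm w}"
    by (rule eventually_at_in_open')
  have sub: "outside \<phi> \<subseteq> outside \<omega>" by (rule outside_mono) (use omega \<phi> in auto)
  have "((\<lambda>w. res l w - res l z) \<longlongrightarrow> 0) (at z)"
  proof (rule Lim_null_comparison)
    show "\<forall>\<^sub>F w in at z. norm (res l w - res l z) \<le> norm (z - w) * (C / (norm z / 2))"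
      using ev
    proof eventually_elim
      case (elim w)
      then have w: "w \<in> outside \<phi>" "w \<in> outside \<omega>" "norm z / 2 < norm w" using sub by auto
      have "norm (res l w - res l z) = norm (z - w) * norm (res2 l w z)"
        by (simp only: resolvent_identity[OF w(2) z l, symmetric] norm_mult)
      also have "norm (res2 l w z) \<le> C / norm w" by (rule C(2)[OF w(1)])
      also have "C / norm w \<le> C / (norm z / 2)"
        by (rule divide_left_mono[OF less_imp_le[OF w(3)] C(1)]) (rule mult_pos_pos; use w(3) nz in linarith)
      finally show ?case by (simp add: mult_left_mono)
    qed
    show "((\<lambda>w. norm (z - w) * (C / (norm z / 2))) \<longlongrightarrow> 0) (at z)"
      using nz by (auto intro!: tendsto_eq_intros)
  qed
  then show ?thesis by (simp add: isCont_def LIM_zero_iff)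
qed

lemma isCont_res2:
  assumes "z \<in> outside \<omega>" "bounded_linear l"
  shows "isCont (\<lambda>z. res2 l z w) z"
  unfolding res2_def by (intro continuous_intros isCont_res assms bounded_linear_comp_left)

text \<open>By the resolvent identity the difference quotient equals \<open>- res2 l w z\<close>,
  which is continuous in w.\<close>

lemma res_has_derivative:
  assumes z: "z \<in> outside \<omega>" and l: "bounded_linear l"
  shows "(res l has_field_derivative - res2 l z z) (at z)"
  unfolding has_field_derivative_iff
proof (rule Lim_transform_eventually)
  show "((\<lambda>w. - res2 l w z) \<longlongrightarrow> - res2 l z z) (at z)"
    using isCont_res2[OF z l, of z] by (intro tendsto_minus) (simp add: isCont_def)
  have "\<forall>\<^sub>F w in at z. w \<in> outside \<omega>" using open_outside z by (rule eventually_at_in_open')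
  moreover have "\<forall>\<^sub>F w in at z. w \<noteq> z" by (simp add: eventually_at_filter)
  ultimately show "\<forall>\<^sub>F w in at z. - res2 l w z = (res l w - res l z) / (w - z)"
  proof eventually_elim
    case (elim w)
    then show ?case using resolvent_identity[OF elim(1) z l] by (simp add: field_simps)
  qed
qed

lemma holomorphic_res: "bounded_linear l \<Longrightarrow> res l holomorphic_on outside \<omega>"
  by (auto simp: holomorphic_on_open[OF open_outside] intro: res_has_derivative)

lemma holomorphic_res2: "bounded_linear l \<Longrightarrow> (\<lambda>z. res2 l z w) holomorphic_on outside \<omega>"
  unfolding res2_def by (intro holomorphic_intros holomorphic_res bounded_linear_comp_left)

section \<open>Operators represented by contour integrals\<close>

lemma continuous_on_boundary:
  assumes "F holomorphic_on bisector \<theta>" "0 < \<phi>" "\<phi> < \<theta>" "\<theta> < pi / 2"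
  shows "continuous_on (boundary \<phi>) F"
  by (rule continuous_on_subset[OF holomorphic_on_imp_continuous_on[OF assms(1)] boundary_subset_bisector])
    (use assms in auto)

lemma continuous_on_boundary_res:
  assumes "bounded_linear l" "\<omega> < \<phi>" "\<phi> < pi / 2"
  shows "continuous_on (boundary \<phi>) (res l)"
  using holomorphic_on_imp_continuous_on[OF holomorphic_res[OF assms(1)]]
    boundary_subset_outside[OF omega(1) assms(2,3)] continuous_on_subset by blast

lemma res_bound_boundary:
  assumes "\<omega> < \<phi>" "\<phi> < pi / 2" and l: "bounded_linear l"
  obtains C where "C \<ge> 0" "\<And>z. z \<in> boundary \<phi> \<Longrightarrow> norm (res l z) \<le> C / norm z"
proof -
  define \<psi> where "\<psi> = (\<omega> + \<phi>) / 2"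
  have \<psi>: "\<omega> < \<psi>" "\<psi> < \<phi>" "\<psi> < pi / 2" "0 < \<psi>" using assms omega by (auto simp: \<psi>_def)
  obtain C where "C \<ge> 0" "\<And>z. z \<in> outside \<psi> \<Longrightarrow> norm (res l z) \<le> C / norm z"
    using res_bound[OF \<psi>(1,3) l] by blast
  then show thesis using that boundary_subset_outside[OF \<psi>(4,2) assms(2)] by blast
qed

lemma boundary_integrable_res:
  assumes F: "continuous_on (boundary \<phi>) F" "boundary_integrable \<phi> (\<lambda>z. F z / z)"
    and \<phi>: "\<omega> < \<phi>" "\<phi> < pi / 2" and l: "bounded_linear l"
  shows "boundary_integrable \<phi> (\<lambda>z. F z * res l z)"
proof -
  obtain C where C: "C \<ge> 0" "\<And>z. z \<in> boundary \<phi> \<Longrightarrow> norm (res l z) \<le> C / norm z"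
    using res_bound_boundary[OF \<phi> l] by blast
  show ?thesis
  proof (rule boundary_integrable_bound[OF F(2)])
    show "continuous_on (boundary \<phi>) (\<lambda>z. F z * res l z)"
      by (intro continuous_intros F continuous_on_boundary_res l \<phi>)
    show "norm (F z * res l z) \<le> C * norm (F z / z)" if "z \<in> boundary \<phi>" for z
      using mult_left_mono[OF C(2)[OF that], of "norm (F z)"] by (simp add: norm_mult norm_divide mult.commute)
  qed
qed

lemma decaying_boundary:
  assumes "decaying \<theta> F" "0 < \<phi>" "\<phi> < \<theta>" "\<theta> < pi / 2"
  shows "continuous_on (boundary \<phi>) F" "boundary_integrable \<phi> (\<lambda>z. F z / z)"
  using assms continuous_on_boundary[of F \<theta> \<phi>] unfolding decaying_def by auto

lemma represents_angle:
  assumes F: "decaying \<theta> F" and \<theta>: "\<theta> < pi / 2" and \<phi>: "\<omega> < \<phi>" "\<phi> < \<theta>" and \<psi>: "\<omega> < \<psi>" "\<psi> < \<theta>"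
    and A: "represents \<phi> F A"
  shows "represents \<psi> F A"
  unfolding represents_def
proof (intro allI impI)
  fix l :: "('x \<Rightarrow>\<^sub>L 'x) \<Rightarrow> real" assume l: "bounded_linear l"
  \<comment> \<open>Strictly between \<omega> and both contour angles, so that one resolvent bound
    covers the region swept out when the contour moves.\<close>
  define \<omega>' where "\<omega>' = (\<omega> + min \<phi> \<psi>) / 2"
  have \<omega>': "\<omega> < \<omega>'" "\<omega>' < \<phi>" "\<omega>' < \<psi>" "0 < \<omega>'" "\<omega>' < pi / 2" using \<phi> \<psi> omega \<theta> by (auto simp: \<omega>'_def)
  obtain C where C: "C \<ge> 0" "\<And>z. z \<in> outside \<omega>' \<Longrightarrow> norm (res l z) \<le> C / norm z"
    using res_bound[OF \<omega>'(1,5) l] by blast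
  obtain M where M: "M \<ge> 0" "\<And>z. z \<in> bisector \<theta> \<Longrightarrow> norm (F z) \<le> M" using decayingE[OF F] by blast
  have sub: "outside \<omega>' \<subseteq> outside \<omega>" by (rule outside_mono) (use omega \<omega>' in auto)
  have "boundary_integral \<phi> (\<lambda>z. F z * res l z) = boundary_integral \<psi> (\<lambda>z. F z * res l z)"
  proof (rule boundary_integral_angle[OF \<omega>'(4,2) \<phi>(2) \<omega>'(3) \<psi>(2) \<theta>])
    show "(\<lambda>z. F z * res l z) holomorphic_on bisector \<theta> \<inter> outside \<omega>'"
      using F sub holomorphic_res[OF l] unfolding decaying_def
      by (intro holomorphic_on_mult) (auto elim: holomorphic_on_subset)
    show "norm (z * (F z * res l z)) \<le> M * C" if z: "z \<in> bisector \<theta> \<inter> outside \<omega>'" for z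
    proof -
      have nz: "norm z > 0" using outside_nonzero[of z \<omega>'] z by auto
      have "norm z * norm (res l z) \<le> C" using C(2)[of z] z nz by (simp add: field_simps)
      then have "norm (F z) * (norm z * norm (res l z)) \<le> M * C"
        using M z by (intro mult_mono) auto
      then show ?thesis by (simp add: norm_mult mult_ac)
    qed
    show "boundary_integrable \<phi> (\<lambda>z. F z * res l z)" "boundary_integrable \<psi> (\<lambda>z. F z * res l z)"
      using decaying_boundary[OF F _ _ \<theta>] \<phi> \<psi> \<theta> omega by (auto intro!: boundary_integrable_res l)
  qed
  then show "of_real (l A) = boundary_integral \<psi> (\<lambda>z. F z * res l z)"
    using A l unfolding represents_def by simp
qed

text \<open>The function \<open>N\<close> vanishes on the boundary of angle \<psi>, changes by at
  most twice the distance, and is at most - sin(\<psi> - \<theta>) |s| on the smaller double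
  sector.\<close>

lemma norm_boundary_diff_ge:
  assumes s: "s \<in> bisector \<theta>" and p: "p \<in> boundary \<psi>" and ang: "0 < \<theta>" "\<theta> < \<psi>" "\<psi> < pi / 2"
  shows "sin (\<psi> - \<theta>) / 2 * norm s \<le> norm (p - s)"
proof -
  define N where "N z = cos \<psi> * \<bar>Im z\<bar> - sin \<psi> * \<bar>Re z\<bar>" for z
  have c: "cos \<theta> > 0" "cos \<psi> > 0" by (intro cos_gt_zero_pi; use ang in linarith)+
  have sp: "sin \<psi> > 0" "sin (\<psi> - \<theta>) > 0" by (intro sin_gt_zero; use ang in linarith)+
  have Np: "N p = 0"
    using p c sp unfolding N_def boundary_eq ray_def
    by (auto simp: abs_mult sin_add cos_add sin_diff cos_diff)
  have lip: "N z - N w \<le> 2 * norm (z - w)" for z w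
  proof -
    have "\<bar>Im z\<bar> - \<bar>Im w\<bar> \<le> \<bar>Im (z - w)\<bar>" "\<bar>Re w\<bar> - \<bar>Re z\<bar> \<le> \<bar>Re (z - w)\<bar>" by auto
    then have "\<bar>Im z\<bar> - \<bar>Im w\<bar> \<le> norm (z - w)" "\<bar>Re w\<bar> - \<bar>Re z\<bar> \<le> norm (z - w)"
      using abs_Im_le_cmod[of "z - w"] abs_Re_le_cmod[of "z - w"] by linarith+
    then have "cos \<psi> * (\<bar>Im z\<bar> - \<bar>Im w\<bar>) \<le> cos \<psi> * norm (z - w)" "sin \<psi> * (\<bar>Re w\<bar> - \<bar>Re z\<bar>) \<le> sin \<psi> * norm (z - w)"
      using c sp by (auto intro: mult_left_mono)
    moreover have "cos \<psi> * norm (z - w) \<le> 1 * norm (z - w)" "sin \<psi> * norm (z - w) \<le> 1 * norm (z - w)"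
      by (intro mult_right_mono; simp)+
    ultimately show ?thesis unfolding N_def by (simp add: algebra_simps)
  qed
  have "cos \<theta> * N s \<le> - (sin (\<psi> - \<theta>) * \<bar>Re s\<bar>)"
  proof -
    have "cos \<psi> * (cos \<theta> * \<bar>Im s\<bar>) \<le> cos \<psi> * (sin \<theta> * \<bar>Re s\<bar>)"
      using s c by (intro mult_left_mono) (auto simp: bisector_def)
    then show ?thesis by (simp add: N_def sin_diff algebra_simps)
  qed
  also have "\<dots> \<le> - (sin (\<psi> - \<theta>) * (cos \<theta> * norm s))"
    using bisector_cos_le(1)[OF s ang(1)] ang sp by (simp add: mult_left_mono)
  finally have "cos \<theta> * N s \<le> cos \<theta> * (- (sin (\<psi> - \<theta>) * norm s))" by (simp add: mult_ac)
  then have "N s \<le> - (sin (\<psi> - \<theta>) * norm s)" by (rule mult_left_le_imp_le[OF _ c(1)])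
  then show ?thesis using lip[of p s] Np by simp
qed

text \<open>
  The outer angle of the first factor lies inside the contour of the second one, so of the two
  terms of the resolvent identity one is evaluated by Cauchy's formula and the other one vanishes.
\<close>

lemma represents_mult:
  assumes F: "decaying \<theta> F" and G: "decaying \<theta> G" and \<phi>: "\<omega> < \<phi>" "\<phi> < \<theta>" and \<theta>: "\<theta> < pi / 2"
    and A: "represents \<phi> F A" and B: "represents \<phi> G B"
  shows "represents \<phi> (\<lambda>z. F z * G z) (A o\<^sub>L B)"
  unfolding represents_def
proof (intro allI impI)
  fix l :: "('x \<Rightarrow>\<^sub>L 'x) \<Rightarrow> real" assume l: "bounded_linear l"
  \<comment> \<open>Two angles are inserted, \<phi> < \<theta>1 < \<psi> < \<theta>. The contour for
    G moves out to \<psi>, and \<theta>1 bounds a region around the contour for F that stays away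
    from it.\<close>
  obtain \<delta> where \<delta>: "\<delta> > 0" "\<theta> = \<phi> + 3 * \<delta>"
  proof
    show "(\<theta> - \<phi>) / 3 > 0" "\<theta> = \<phi> + 3 * ((\<theta> - \<phi>) / 3)" using \<phi>(2) by (simp_all add: field_simps)
  qed
  define \<theta>1 where "\<theta>1 = \<phi> + \<delta>"
  define \<psi> where "\<psi> = \<phi> + 2 * \<delta>"
  have ang: "\<phi> < \<theta>1" "\<theta>1 < \<psi>" "\<psi> < \<theta>" "\<theta>1 < \<theta>" "0 < \<phi>" "0 < \<theta>1" "\<omega> < \<psi>" "\<psi> < pi / 2" "\<theta>1 < pi / 2"
      "\<phi> < \<psi>" "0 < \<psi>" "\<phi> < pi / 2"
    using \<phi> \<theta> omega \<delta> unfolding \<theta>1_def \<psi>_def by auto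
  have B': "represents \<psi> G B" by (rule represents_angle[OF G \<theta> \<phi> ang(7,3) B])
  obtain M where M: "M \<ge> 0" "\<And>z. z \<in> bisector \<theta> \<Longrightarrow> norm (F z) \<le> M" using decayingE[OF F] by blast
  obtain N where N: "N \<ge> 0" "\<And>z. z \<in> bisector \<theta> \<Longrightarrow> norm (G z) \<le> N" using decayingE[OF G] by blast
  define k where "k = sin (\<psi> - \<theta>1) / 2"
  have k0: "k > 0" unfolding k_def using sin_gt_zero[of "\<psi> - \<theta>1"] ang by simp
  have k: "k * norm s \<le> norm (p - s)" if "s \<in> bisector \<theta>1" "p \<in> boundary \<psi>" for s p
    unfolding k_def by (rule norm_boundary_diff_ge[OF that ang(6,2,8)])
  have sub1: "bisector \<theta>1 \<subseteq> bisector \<theta>"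
  proof
    fix z assume z: "z \<in> bisector \<theta>1"
    have c: "cos \<theta>1 > 0" "cos \<theta> > 0" by (intro cos_gt_zero_pi; use ang \<theta> in linarith)+
    have "sin (\<theta> - \<theta>1) > 0" by (rule sin_gt_zero) (use ang \<theta> in linarith)+
    then have "sin \<theta>1 * cos \<theta> \<le> cos \<theta>1 * sin \<theta>" by (simp add: sin_diff mult.commute)
    then have "sin \<theta>1 * cos \<theta> * \<bar>Re z\<bar> \<le> cos \<theta>1 * sin \<theta> * \<bar>Re z\<bar>" by (rule mult_right_mono) simp
    moreover have "cos \<theta> * (cos \<theta>1 * \<bar>Im z\<bar>) < cos \<theta> * (sin \<theta>1 * \<bar>Re z\<bar>)"
      using z c by (intro mult_strict_left_mono) (auto simp: bisector_def)
    ultimately have "cos \<theta>1 * (cos \<theta> * \<bar>Im z\<bar>) < cos \<theta>1 * (sin \<theta> * \<bar>Re z\<bar>)" by (simp add: mult_ac)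
    then show "z \<in> bisector \<theta>" using c by (simp add: bisector_def)
  qed
  have b\<phi>: "boundary \<phi> \<subseteq> bisector \<theta>1" by (rule boundary_subset_bisector) (use ang in auto)
  have b\<phi>o: "boundary \<phi> \<subseteq> outside \<omega>" by (rule boundary_subset_outside) (use omega \<phi> ang in auto)
  have b\<psi>o: "boundary \<psi> \<subseteq> outside \<omega>" by (rule boundary_subset_outside) (use omega ang in auto)
  have ne: "p - s \<noteq> 0" if "s \<in> bisector \<theta>1" "p \<in> boundary \<psi>" for s p
  proof
    assume "p - s = 0"
    then have "s \<noteq> 0" "k * norm s \<le> 0" using k[OF that] boundary_nonzero[OF that(2)] by auto
    then show False using k0 by (simp add: mult_le_0_iff)
  qed
  have kp: "norm p \<le> (1 + 1 / k) * norm (p - s)" if "s \<in> bisector \<theta>1" "p \<in> boundary \<psi>" for s p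
  proof -
    have "norm s \<le> norm (p - s) / k" using k[OF that] k0 by (simp add: field_simps)
    then show ?thesis using norm_triangle_ineq[of "p - s" s] by (simp add: algebra_simps)
  qed
  note Fb = decaying_boundary[OF F ang(5) \<phi>(2) \<theta>]
  note Gb = decaying_boundary[OF G ang(11,3) \<theta>]
  define H where "H p = G p * res l p" for p
  have cH: "continuous_on (boundary \<psi>) H" unfolding H_def
    by (intro continuous_intros Gb(1) continuous_on_boundary_res l ang)
  have iH: "boundary_integrable \<psi> H" unfolding H_def
    by (rule boundary_integrable_res[OF Gb ang(7,8) l])
  note Fub = boundary_Fubini[OF Fb cH iH k0 k[OF subsetD[OF b\<phi>]]]
  define m where "m = (\<lambda>X. l (X o\<^sub>L B))"
  have m: "bounded_linear m" unfolding m_def by (rule bounded_linear_comp_left[OF l])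
  \<comment> \<open>The functional m contains B. Writing B as an integral over the contour of angle
    \<psi> and using the resolvent identity under the integral splits \<open>res m s\<close> into a
    Cauchy integral of G and an integral of H.\<close>
  have pt: "F s * res m s = F s * G s * res l s - boundary_integral \<psi> (\<lambda>p. F s * H p / (p - s))"
    if s: "s \<in> boundary \<phi>" for s
  proof -
    have so: "s \<in> outside \<omega>" and sb: "s \<in> bisector \<theta>1" using s b\<phi>o b\<phi> by auto
    have lQ: "of_real (l (X o\<^sub>L B)) = boundary_integral \<psi> (\<lambda>p. G p * res (\<lambda>Y. l (X o\<^sub>L Y)) p)" for X
      using B' bounded_linear_comp_right[OF l] unfolding represents_def by blast
    have int: "boundary_integrable \<psi> (\<lambda>p. G p * res (\<lambda>Y. l (X o\<^sub>L Y)) p)" for X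
      by (rule boundary_integrable_res[OF Gb ang(7,8) bounded_linear_comp_right[OF l]])
    have comm: "res (\<lambda>Y. l (Q s o\<^sub>L Y)) p = res (\<lambda>Y. l (Y o\<^sub>L Q s)) p"
      "res (\<lambda>Y. l (P s o\<^sub>L Y)) p = res (\<lambda>Y. l (Y o\<^sub>L P s)) p" if p: "p \<in> boundary \<psi>" for p
    proof -
      have po: "p \<in> outside \<omega>" using p b\<psi>o by auto
      show "res (\<lambda>Y. l (Q s o\<^sub>L Y)) p = res (\<lambda>Y. l (Y o\<^sub>L Q s)) p"
        unfolding res_def using QQ[OF so po] PQ[OF po so] by simp
      show "res (\<lambda>Y. l (P s o\<^sub>L Y)) p = res (\<lambda>Y. l (Y o\<^sub>L P s)) p"
        unfolding res_def using PP[OF so po] PQ[OF so po] by simp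
    qed
    have kernel: "cnj s * (G p * res (\<lambda>Y. l (Q s o\<^sub>L Y)) p) - G p * res (\<lambda>Y. l (P s o\<^sub>L Y)) p
        = res l s * (G p / (p - s)) - H p / (p - s)" if p: "p \<in> boundary \<psi>" for p
    proof -
      have po: "p \<in> outside \<omega>" using p b\<psi>o by auto
      have n: "p - s \<noteq> 0" by (rule ne[OF sb p])
      have "cnj s * (G p * res (\<lambda>Y. l (Q s o\<^sub>L Y)) p) - G p * res (\<lambda>Y. l (P s o\<^sub>L Y)) p = G p * res2 l p s"
        unfolding comm[OF p] res2_def by (simp add: algebra_simps)
      also have "res2 l p s = (res l s - res l p) / (p - s)"
      proof -
        have "(p - s) * res2 l p s = res l s - res l p"
          using resolvent_identity[OF po so l] by (metis minus_diff_eq mult_minus_left)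
        then show ?thesis using n by (simp add: field_simps)
      qed
      finally show ?thesis unfolding H_def by (simp add: diff_divide_distrib algebra_simps)
    qed
    have iG: "boundary_integrable \<psi> (\<lambda>p. G p / (p - s))"
    proof (rule boundary_integrable_bound[OF Gb(2)])
      show "continuous_on (boundary \<psi>) (\<lambda>p. G p / (p - s))"
        by (intro continuous_intros Gb(1)) (use ne[OF sb] in auto)
      fix p assume p: "p \<in> boundary \<psi>"
      have pos: "norm (p - s) > 0" "norm p > 0" using ne[OF sb p] boundary_nonzero[OF p] by auto
      have "norm (G p) * norm p \<le> norm (G p) * ((1 + 1 / k) * norm (p - s))"
        by (rule mult_left_mono[OF kp[OF sb p]]) simp
      then show "norm (G p / (p - s)) \<le> (1 + 1 / k) * norm (G p / p)"
        using pos by (simp only: norm_divide) (simp add: divide_simps mult_ac)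
    qed
    have iH': "boundary_integrable \<psi> (\<lambda>p. H p / (p - s))"
    proof -
      have "boundary_integrable \<psi> (\<lambda>p. res l s * (G p / (p - s)) - (cnj s * (G p * res (\<lambda>Y. l (Q s o\<^sub>L Y)) p) - G p * res (\<lambda>Y. l (P s o\<^sub>L Y)) p))"
        by (intro boundary_integrable_diff boundary_integrable_cmult iG int)
      then show ?thesis by (rule boundary_integrable_cong[THEN iffD1, rotated]) (simp add: kernel)
    qed
    have "res m s = cnj s * of_real (l (Q s o\<^sub>L B)) - of_real (l (P s o\<^sub>L B))"
      by (simp add: res_def m_def)
    also have "\<dots> = boundary_integral \<psi> (\<lambda>p. cnj s * (G p * res (\<lambda>Y. l (Q s o\<^sub>L Y)) p) - G p * res (\<lambda>Y. l (P s o\<^sub>L Y)) p)"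
      by (simp only: lQ boundary_integral_cmult boundary_integral_diff[OF boundary_integrable_cmult[OF int] int])
    also have "\<dots> = boundary_integral \<psi> (\<lambda>p. res l s * (G p / (p - s)) - H p / (p - s))"
      by (rule boundary_integral_cong) (rule kernel)
    also have "\<dots> = res l s * boundary_integral \<psi> (\<lambda>p. G p / (p - s)) - boundary_integral \<psi> (\<lambda>p. H p / (p - s))"
      by (simp only: boundary_integral_cmult boundary_integral_diff[OF boundary_integrable_cmult[OF iG] iH'])
    also have "boundary_integral \<psi> (\<lambda>p. G p / (p - s)) = G s"
      by (rule Cauchy_formula_bisector[OF ang(5,10,3) \<theta> s _ N(2) Gb(2)]) (use G in \<open>auto simp: decaying_def\<close>)
    finally have rm: "res m s = res l s * G s - boundary_integral \<psi> (\<lambda>p. H p / (p - s))" .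
    have "boundary_integral \<psi> (\<lambda>p. F s * H p / (p - s)) = F s * boundary_integral \<psi> (\<lambda>p. H p / (p - s))"
      by (simp only: boundary_integral_cmult[symmetric] times_divide_eq_right)
    then show ?thesis unfolding rm by (simp only: right_diff_distrib mult_ac)
  qed
  \<comment> \<open>For fixed p on the outer contour the integrand has no pole in the double sector
    of angle \<theta>1. After exchanging the integrals the second term therefore vanishes.\<close>
  have zero: "boundary_integral \<phi> (\<lambda>s. F s * H p / (p - s)) = 0" if p: "p \<in> boundary \<psi>" for p
  proof (rule boundary_integral_eq_0[OF ang(5,1,9)])
    show hol: "(\<lambda>s. F s * H p / (p - s)) holomorphic_on bisector \<theta>1"
      using F sub1 ne[OF _ p] unfolding decaying_def
      by (intro holomorphic_intros) (auto elim: holomorphic_on_subset)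
    show "norm (s * (F s * H p / (p - s))) \<le> M * norm (H p) / k" if s: "s \<in> bisector \<theta>1" for s
    proof -
      have 1: "norm s / norm (p - s) \<le> 1 / k"
        using k[OF s p] k0 ne[OF s p] by (simp add: field_simps)
      have 2: "norm (F s) * norm (H p) \<le> M * norm (H p)" using M(2)[of s] s sub1 by (intro mult_right_mono) auto
      have "(norm (F s) * norm (H p)) * (norm s / norm (p - s)) \<le> (M * norm (H p)) * (1 / k)"
        by (rule mult_mono[OF 2 1]) (use M(1) in auto)
      then show ?thesis by (simp add: norm_mult norm_divide mult_ac)
    qed
    show "boundary_integrable \<phi> (\<lambda>s. F s * H p / (p - s))"
    proof (rule boundary_integrable_bound[OF Fb(2)])
      show "continuous_on (boundary \<phi>) (\<lambda>s. F s * H p / (p - s))"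
        using holomorphic_on_imp_continuous_on[OF hol] b\<phi> continuous_on_subset by blast
      fix s assume "s \<in> boundary \<phi>"
      then have s: "s \<in> bisector \<theta>1" "s \<noteq> 0" using b\<phi> boundary_nonzero by auto
      have "norm (F s) * norm (H p) * (k * norm s) \<le> norm (F s) * norm (H p) * norm (p - s)"
        by (rule mult_left_mono[OF k[OF s(1) p]]) simp
      then show "norm (F s * H p / (p - s)) \<le> (norm (H p) / k) * norm (F s / s)"
        using s(2) ne[OF s(1) p] k0 by (simp only: norm_divide norm_mult) (simp add: divide_simps mult_ac)
    qed
  qed
  have iX: "boundary_integrable \<phi> (\<lambda>s. boundary_integral \<psi> (\<lambda>p. F s * H p / (p - s)))" by (rule Fub(1))
  have iFG: "boundary_integrable \<phi> (\<lambda>s. F s * G s * res l s)"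
  proof -
    note FGb = decaying_boundary[OF decaying_mult[OF F G \<theta>] ang(5) \<phi>(2) \<theta>]
    show ?thesis by (rule boundary_integrable_res[OF FGb \<phi>(1) ang(12) l])
  qed
  have "of_real (l (A o\<^sub>L B)) = boundary_integral \<phi> (\<lambda>s. F s * res m s)"
    using A m unfolding represents_def m_def by blast
  also have "\<dots> = boundary_integral \<phi> (\<lambda>s. F s * G s * res l s - boundary_integral \<psi> (\<lambda>p. F s * H p / (p - s)))"
    by (rule boundary_integral_cong) (rule pt)
  also have "\<dots> = boundary_integral \<phi> (\<lambda>s. F s * G s * res l s)
     - boundary_integral \<psi> (\<lambda>p. boundary_integral \<phi> (\<lambda>s. F s * H p / (p - s)))"
    by (simp only: boundary_integral_diff[OF iFG iX] Fub(2))
  also have "boundary_integral \<psi> (\<lambda>p. boundary_integral \<phi> (\<lambda>s. F s * H p / (p - s))) = boundary_integral \<psi> (\<lambda>p. 0 * (0 :: complex))"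
    by (rule boundary_integral_cong) (simp add: zero)
  also have "\<dots> = 0" by (rule trans[OF boundary_integral_cmult mult_zero_left])
  finally show "of_real (l (A o\<^sub>L B)) = boundary_integral \<phi> (\<lambda>z. F z * G z * res l z)" by simp
qed

end

lemma blinfun_compose_id: "id_blinfun o\<^sub>L X = X" "X o\<^sub>L id_blinfun = X"
  by (rule blinfun_eqI, simp)+

context bisectorial_resolvent
begin

section \<open>Composition with (1 + T^2)^{-1} and the kernel z/(1 + z^2)\<close>

lemma i_outside: "\<i> \<in> outside \<omega>" "- \<i> \<in> outside \<omega>"
  using cos_gt_zero_pi[of \<omega>] omega by (auto simp: outside_def)

lemma res_comp_commute:
  assumes "z \<in> outside \<omega>" "w \<in> outside \<omega>"
  shows "res (\<lambda>A. l (Q w o\<^sub>L A)) z = res (\<lambda>A. l (A o\<^sub>L Q w)) z"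
  unfolding res_def using QQ[OF assms] PQ[OF assms] by simp

text \<open>This is the decomposition 1 + z^2 = (1 + T^2) + (z - T)(z + T), multiplied by (z -
  T)^{-1} (1 + T^2)^{-1}; the terms with \<open>P \<i>\<close> and \<open>Q \<i>\<close> come from
  (z + T)(1 + T^2)^{-1}.\<close>

lemma res_comp_Qi:
  assumes z: "z \<in> outside \<omega>" and l: "bounded_linear l" and nz: "1 + z\<^sup>2 \<noteq> 0"
  shows "res (\<lambda>A. l (A o\<^sub>L Q \<i>)) z = (res l z + of_real (l (P \<i>)) + z * of_real (l (Q \<i>))) / (1 + z\<^sup>2)"
proof -
  note v = functional_values[OF z i_outside(1) l]
  have "(1 + z\<^sup>2) * (cnj z * of_real (l (Q z o\<^sub>L Q \<i>)) - of_real (l (P z o\<^sub>L Q \<i>)))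
      = res l z + of_real (l (P \<i>)) + z * of_real (l (Q \<i>))"
    unfolding res_def v(3) unfolding v(1,2) cmod_power2
    by (simp add: complex_eq_iff power2_eq_square algebra_simps)
  then show ?thesis using nz unfolding res_def by (simp add: field_simps)
qed

text \<open>By \<open>res_comp_Qi\<close> the integrand is that of F/(1 + z^2) plus multiples of
  F/(1 + z^2) and z F/(1 + z^2). The latter are holomorphic inside the double sector and of size
  1/|z|, so their boundary integrals are zero.\<close>

lemma represents_comp_Qi:
  assumes F: "decaying \<theta> F" and \<phi>: "\<omega> < \<phi>" "\<phi> < \<theta>" and \<theta>: "\<theta> < pi / 2" and A: "represents \<phi> F A"
  shows "represents \<phi> (\<lambda>z. 1 / (1 + z\<^sup>2) * F z) (A o\<^sub>L Q \<i>)" "represents \<phi> (\<lambda>z. 1 / (1 + z\<^sup>2) * F z) (Q \<i> o\<^sub>L A)"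
proof -
  have pos: "0 < \<phi>" "0 < \<theta>" "\<phi> < pi / 2" using \<phi> omega \<theta> by auto
  note b = boundary_subset_bisector[OF less_imp_le[OF pos(1)] \<phi>(2) \<theta>]
  have bo: "boundary \<phi> \<subseteq> outside \<omega>" by (rule boundary_subset_outside) (use omega \<phi> pos in auto)
  obtain M where M: "M \<ge> 0" "\<And>z. z \<in> bisector \<theta> \<Longrightarrow> norm (F z) \<le> M" using decayingE[OF F] by blast
  have nz: "1 + z\<^sup>2 \<noteq> 0" if "z \<in> bisector \<theta>" for z by (rule bisector_one_plus_square(2)[OF that pos(2) \<theta>])
  note Fb = decaying_boundary[OF F pos(1) \<phi>(2) \<theta>]
  have aux: "boundary_integrable \<phi> (\<lambda>z. u z * F z)" "boundary_integral \<phi> (\<lambda>z. u z * F z) = 0"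
    if hol: "u holomorphic_on bisector \<theta>" and K: "\<And>z. z \<in> bisector \<theta> \<Longrightarrow> norm (z * u z) \<le> K" for u K
  proof -
    have hol': "(\<lambda>z. u z * F z) holomorphic_on bisector \<theta>"
      using F hol unfolding decaying_def by (auto intro!: holomorphic_intros)
    show int: "boundary_integrable \<phi> (\<lambda>z. u z * F z)"
    proof (rule boundary_integrable_bound[OF Fb(2)])
      show "continuous_on (boundary \<phi>) (\<lambda>z. u z * F z)" by (rule continuous_on_boundary[OF hol' pos(1) \<phi>(2) \<theta>])
      fix z assume z: "z \<in> boundary \<phi>"
      have "norm (u z * F z) = norm (z * u z) * norm (F z / z)"
        using boundary_nonzero[OF z] by (simp add: norm_mult norm_divide)
      also have "\<dots> \<le> K * norm (F z / z)" using K[of z] z b by (intro mult_right_mono) auto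
      finally show "norm (u z * F z) \<le> K * norm (F z / z)" .
    qed
    show "boundary_integral \<phi> (\<lambda>z. u z * F z) = 0"
    proof (rule boundary_integral_eq_0[OF pos(1) \<phi>(2) \<theta> hol' _ int])
      fix z assume z: "z \<in> bisector \<theta>"
      have "norm (z * (u z * F z)) = norm (z * u z) * norm (F z)" by (simp add: norm_mult)
      also have "\<dots> \<le> K * M" using K[OF z] M(2)[OF z] by (intro mult_mono) (auto intro: order_trans[OF norm_ge_zero])
      finally show "norm (z * (u z * F z)) \<le> K * M" .
    qed
  qed
  have a1: "boundary_integrable \<phi> (\<lambda>z. 1 / (1 + z\<^sup>2) * F z)" "boundary_integral \<phi> (\<lambda>z. 1 / (1 + z\<^sup>2) * F z) = 0"
    by (rule aux[of "\<lambda>z. 1 / (1 + z\<^sup>2)" "1 / cos \<theta>"];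
        use nz bisector_kernel_bounds(2)[OF _ pos(2) \<theta>] in \<open>auto intro!: holomorphic_intros\<close>)+
  have a2: "boundary_integrable \<phi> (\<lambda>z. z / (1 + z\<^sup>2) * F z)" "boundary_integral \<phi> (\<lambda>z. z / (1 + z\<^sup>2) * F z) = 0"
    by (rule aux[of "\<lambda>z. z / (1 + z\<^sup>2)" "1 / cos \<theta>"];
        use nz bisector_kernel_bounds(3)[OF _ pos(2) \<theta>] in \<open>auto intro!: holomorphic_intros simp: power2_eq_square\<close>)+
  have main: "boundary_integral \<phi> (\<lambda>z. F z * res (\<lambda>A. l (A o\<^sub>L Q \<i>)) z) = boundary_integral \<phi> (\<lambda>z. 1 / (1 + z\<^sup>2) * F z * res l z)"
    if l: "bounded_linear l" for l
  proof -
    note GB = decaying_boundary[OF decaying_div_one_plus_square[OF F pos(2) \<theta>] pos(1) \<phi>(2) \<theta>]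
    have i: "boundary_integrable \<phi> (\<lambda>z. 1 / (1 + z\<^sup>2) * F z * res l z)"
      by (rule boundary_integrable_res[OF GB \<phi>(1) pos(3) l])
    have "boundary_integral \<phi> (\<lambda>z. F z * res (\<lambda>A. l (A o\<^sub>L Q \<i>)) z) =
      boundary_integral \<phi> (\<lambda>z. 1 / (1 + z\<^sup>2) * F z * res l z +
        (of_real (l (P \<i>)) * (1 / (1 + z\<^sup>2) * F z) + of_real (l (Q \<i>)) * (z / (1 + z\<^sup>2) * F z)))"
    proof (rule boundary_integral_cong)
      fix z assume z: "z \<in> boundary \<phi>"
      then have "z \<in> outside \<omega>" "1 + z\<^sup>2 \<noteq> 0" using bo b nz by auto
      then show "F z * res (\<lambda>A. l (A o\<^sub>L Q \<i>)) z = 1 / (1 + z\<^sup>2) * F z * res l z +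
        (of_real (l (P \<i>)) * (1 / (1 + z\<^sup>2) * F z) + of_real (l (Q \<i>)) * (z / (1 + z\<^sup>2) * F z))"
        by (subst res_comp_Qi[OF _ l]) (simp_all add: divide_simps, simp add: algebra_simps)
    qed
    also have "\<dots> = boundary_integral \<phi> (\<lambda>z. 1 / (1 + z\<^sup>2) * F z * res l z) +
        (of_real (l (P \<i>)) * 0 + of_real (l (Q \<i>)) * 0)"
      by (simp only: boundary_integral_add[OF i boundary_integrable_add[OF boundary_integrable_cmult[OF a1(1)] boundary_integrable_cmult[OF a2(1)]]]
          boundary_integral_add[OF boundary_integrable_cmult[OF a1(1)] boundary_integrable_cmult[OF a2(1)]]
          boundary_integral_cmult a1(2) a2(2))
    finally show ?thesis by simp
  qed
  show "represents \<phi> (\<lambda>z. 1 / (1 + z\<^sup>2) * F z) (A o\<^sub>L Q \<i>)"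
    unfolding represents_def
  proof (intro allI impI)
    fix l :: "('x \<Rightarrow>\<^sub>L 'x) \<Rightarrow> real" assume l: "bounded_linear l"
    have "of_real (l (A o\<^sub>L Q \<i>)) = boundary_integral \<phi> (\<lambda>z. F z * res (\<lambda>A. l (A o\<^sub>L Q \<i>)) z)"
      using A bounded_linear_comp_left[OF l] unfolding represents_def by blast
    then show "of_real (l (A o\<^sub>L Q \<i>)) = boundary_integral \<phi> (\<lambda>z. 1 / (1 + z\<^sup>2) * F z * res l z)"
      by (simp only: main[OF l])
  qed
  show "represents \<phi> (\<lambda>z. 1 / (1 + z\<^sup>2) * F z) (Q \<i> o\<^sub>L A)"
    unfolding represents_def
  proof (intro allI impI)
    fix l :: "('x \<Rightarrow>\<^sub>L 'x) \<Rightarrow> real" assume l: "bounded_linear l"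
    have "of_real (l (Q \<i> o\<^sub>L A)) = boundary_integral \<phi> (\<lambda>z. F z * res (\<lambda>A. l (Q \<i> o\<^sub>L A)) z)"
      using A bounded_linear_comp_right[OF l] unfolding represents_def by blast
    also have "\<dots> = boundary_integral \<phi> (\<lambda>z. F z * res (\<lambda>A. l (A o\<^sub>L Q \<i>)) z)"
      by (rule boundary_integral_cong) (use bo i_outside in \<open>auto simp: res_comp_commute\<close>)
    finally show "of_real (l (Q \<i> o\<^sub>L A)) = boundary_integral \<phi> (\<lambda>z. 1 / (1 + z\<^sup>2) * F z * res l z)"
      by (simp only: main[OF l])
  qed
qed

text \<open>
  Subtracting the pole at $c = \pm i$ leaves a function which can be rotated from one boundary ray
  to the other one through the outer sector containing \<open>c\<close>.
\<close>

lemma kernel_outer_sector: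
  assumes \<phi>: "\<omega> < \<phi>" "\<phi> < pi / 2" and l: "bounded_linear l" and c: "c\<^sup>2 = - 1" "c \<in> outside \<omega>"
    and sec: "wedge a b \<subseteq> outside \<psi>" "\<omega> < \<psi>" "\<psi> < pi / 2"
    and far: "\<And>z. z \<in> wedge a b \<Longrightarrow> 1 \<le> norm (z + c)"
    and ang: "b - a \<le> pi" "a < d" "d < b" "a < d'" "d' < b"
    and rays: "ray d \<subseteq> boundary \<phi>" "ray d' \<subseteq> boundary \<phi>"
    and int: "ray_integrable d (\<lambda>z. 1 / (1 + z\<^sup>2))" "ray_integrable d' (\<lambda>z. 1 / (1 + z\<^sup>2))"
    and int': "ray_integrable d (\<lambda>z. z / (1 + z\<^sup>2) * res l z)" "ray_integrable d' (\<lambda>z. z / (1 + z\<^sup>2) * res l z)"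
  shows "ray_integral d' (\<lambda>z. z / (1 + z\<^sup>2) * res l z) - ray_integral d (\<lambda>z. z / (1 + z\<^sup>2) * res l z)
    = c * res l c * (ray_integral d' (\<lambda>z. 1 / (1 + z\<^sup>2)) - ray_integral d (\<lambda>z. 1 / (1 + z\<^sup>2)))"
proof -
  \<comment> \<open>By the resolvent identity this equals (z \<open>res l z\<close> - c
    \<open>res l c\<close>)/(1 + z^2) wherever 1 + z^2 is nonzero, with the factor z - c already
    cancelled. The remaining denominator z + c is bounded away from 0 in the sector.\<close>
  define L where "L z = (res l z - c * res2 l z c) / (z + c)" for z
  have sub: "outside \<psi> \<subseteq> outside \<omega>" by (rule outside_mono) (use omega sec in auto)
  obtain C1 where C1: "C1 \<ge> 0" "\<And>z. z \<in> outside \<psi> \<Longrightarrow> norm (res l z) \<le> C1 / norm z"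
    using res_bound[OF sec(2,3) l] by blast
  obtain C2 where C2: "C2 \<ge> 0" "\<And>z. z \<in> outside \<psi> \<Longrightarrow> norm (res2 l z c) \<le> C2 / norm z"
    using res2_bound[OF sec(2,3) l] by blast
  have "(norm c)\<^sup>2 = 1" by (simp add: norm_power[symmetric] c(1))
  then have "norm c = 1 \<or> norm c = - 1" by (simp only: power2_eq_1_iff)
  then have nc: "norm c = 1" using norm_ge_zero[of c] by linarith
  have bo: "boundary \<phi> \<subseteq> outside \<omega>" by (rule boundary_subset_outside) (use omega \<phi> in auto)
  have holL: "L holomorphic_on wedge a b"
    unfolding L_def
  proof (intro holomorphic_intros holomorphic_on_subset[OF holomorphic_res[OF l]] holomorphic_on_subset[OF holomorphic_res2[OF l]])
    show "z + c \<noteq> 0" if "z \<in> wedge a b" for z using far[OF that] by auto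
  qed (use sec(1) sub in auto)
  have eq: "z / (1 + z\<^sup>2) * res l z = L z + (c * res l c) * (1 / (1 + z\<^sup>2))" if z: "z \<in> boundary \<phi>" for z
  proof -
    have zb: "z \<in> bisector ((\<phi> + pi / 2) / 2)"
      using boundary_subset_bisector[of \<phi> "(\<phi> + pi / 2) / 2"] z \<phi> omega by auto
    have nz: "1 + z\<^sup>2 \<noteq> 0" by (rule bisector_one_plus_square(2)[OF zb]) (use \<phi> omega in auto)
    have fac: "1 + z\<^sup>2 = (z - c) * (z + c)" using c(1) by (simp add: power2_eq_square algebra_simps)
    then have n: "z - c \<noteq> 0" "z + c \<noteq> 0" using nz by auto
    have ri: "(c - z) * res2 l z c = res l z - res l c" by (rule resolvent_identity[OF _ c(2) l]) (use z bo in auto)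
    have "(z - c) * (res l z - c * res2 l z c) = (z - c) * res l z + c * ((c - z) * res2 l z c)"
      by (simp add: algebra_simps)
    also have "\<dots> = z * res l z - c * res l c" unfolding ri by (simp add: algebra_simps)
    finally have num: "(z - c) * (res l z - c * res2 l z c) = z * res l z - c * res l c" .
    have "L z = (z * res l z - c * res l c) / (1 + z\<^sup>2)"
      unfolding L_def fac num[symmetric] by (rule nonzero_mult_divide_mult_cancel_left[OF n(1), symmetric])
    then show ?thesis using nz by (simp add: field_simps)
  qed
  have intL: "ray_integrable x L"
    if "x = d \<or> x = d'" for x
  proof -
    have i: "ray_integrable x (\<lambda>z. 1 / (1 + z\<^sup>2))" "ray_integrable x (\<lambda>z. z / (1 + z\<^sup>2) * res l z)"
      using that int int' by auto
    have "ray_integrable x (\<lambda>z. z / (1 + z\<^sup>2) * res l z - (c * res l c) * (1 / (1 + z\<^sup>2)))"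
      by (intro ray_integrable_diff ray_integrable_cmult i)
    then show ?thesis by (rule ray_integrable_cong[THEN iffD1, rotated]) (use that rays eq in auto)
  qed
  have val: "ray_integral x (\<lambda>z. z / (1 + z\<^sup>2) * res l z) = ray_integral x L + (c * res l c) * ray_integral x (\<lambda>z. 1 / (1 + z\<^sup>2))"
    if x: "x = d \<or> x = d'" for x
  proof -
    have i: "ray_integrable x (\<lambda>z. 1 / (1 + z\<^sup>2))" using x int by auto
    have "ray_integral x (\<lambda>z. z / (1 + z\<^sup>2) * res l z) = ray_integral x (\<lambda>z. L z + (c * res l c) * (1 / (1 + z\<^sup>2)))"
      by (rule ray_integral_cong) (use x rays eq in auto)
    then show ?thesis by (simp only: ray_integral_add[OF intL[OF x] ray_integrable_cmult[OF i]] ray_integral_cmult)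
  qed
  have "ray_integral d L = ray_integral d' L"
  proof (rule ray_integral_rotate[OF ang holL])
    fix z assume z: "z \<in> wedge a b"
    then have zo: "z \<in> outside \<psi>" using sec(1) by auto
    have nz: "norm z > 0" using outside_nonzero[OF zo] by simp
    have "norm (res l z - c * res2 l z c) \<le> norm (res l z) + norm (res2 l z c)"
      using norm_triangle_ineq4[of "res l z" "c * res2 l z c"] nc by (simp add: norm_mult)
    also have "\<dots> \<le> (C1 + C2) / norm z" using C1(2)[OF zo] C2(2)[OF zo] by (simp add: add_divide_distrib)
    finally have "norm z * norm (res l z - c * res2 l z c) \<le> C1 + C2" using nz by (simp add: field_simps)
    moreover have "norm (res l z - c * res2 l z c) / norm (z + c) \<le> norm (res l z - c * res2 l z c) / 1"
      by (rule divide_left_mono[OF far[OF z]]) (use far[OF z] in auto)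
    then have "norm (z * L z) \<le> norm z * norm (res l z - c * res2 l z c)"
      unfolding L_def norm_mult norm_divide by (intro mult_left_mono) auto
    ultimately show "norm (z * L z) \<le> C1 + C2" by linarith
  qed (use intL in auto)
  then show ?thesis using val by (simp add: algebra_simps)
qed

text \<open>The upper two rays enclose i and the lower two enclose -i. Subtracting the poles leaves
  - (res(i) + res(-i))/2 for the boundary integral; since conjugation exchanges the points and fixes
  Q and P, the terms with Q cancel in this sum and l(P i) remains.\<close>

lemma represents_kernel:
  assumes \<phi>: "\<omega> < \<phi>" "\<phi> < pi / 2"
  shows "represents \<phi> (\<lambda>z. z / (1 + z\<^sup>2)) (P \<i>)"
  unfolding represents_def
proof (intro allI impI)
  fix l :: "('x \<Rightarrow>\<^sub>L 'x) \<Rightarrow> real" assume l: "bounded_linear l"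
  define \<theta> where "\<theta> = (\<phi> + pi / 2) / 2"
  define \<psi> where "\<psi> = (\<omega> + \<phi>) / 2"
  have ang: "\<phi> < \<theta>" "\<theta> < pi / 2" "0 < \<theta>" "\<omega> < \<psi>" "\<psi> < \<phi>" "\<psi> < pi / 2" "0 < \<psi>" "0 < \<phi>"
    using \<phi> omega by (auto simp: \<theta>_def \<psi>_def)
  let ?e = "\<lambda>z. z / (1 + z\<^sup>2) * res l z" and ?u = "\<lambda>z::complex. 1 / (1 + z\<^sup>2)"
  note kb = decaying_boundary[OF decaying_kernel[OF ang(3,2)] ang(8,1,2)]
  have ie: "boundary_integrable \<phi> ?e" by (rule boundary_integrable_res[OF kb \<phi> l])
  note iu = boundary_integrable_one_plus_square[OF less_imp_le[OF ang(8)] \<phi>(2)]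
  \<comment> \<open>The lower right ray gets the angle 2 pi - \<phi>, so that the lower outer sector
    becomes an interval of angles.\<close>
  have iu': "ray_integrable (2 * pi - \<phi>) ?u" "ray_integral (2 * pi - \<phi>) ?u = pi / 2"
    "ray_integrable (2 * pi - \<phi>) ?e" "ray_integral (2 * pi - \<phi>) ?e = ray_integral (- \<phi>) ?e"
    "ray (2 * pi - \<phi>) = ray (- \<phi>)"
    using iu ie ray_integrable_periodic[of "- \<phi>"] ray_integral_periodic[of "- \<phi>"] ray_periodic[of "- \<phi>"]
    by (simp_all add: boundary_integrable_eq)
  have up: "ray_integral (pi - \<phi>) ?e - ray_integral \<phi> ?e = \<i> * res l \<i> * (ray_integral (pi - \<phi>) ?u - ray_integral \<phi> ?u)"
  proof (rule kernel_outer_sector[OF \<phi> l _ i_outside(1) _ ang(4,6)])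
    show "wedge \<psi> (pi - \<psi>) \<subseteq> outside \<psi>"
      by (rule wedge_subsetI[OF ray_subset_outside]) (use ang in auto)
    fix z assume z: "z \<in> wedge \<psi> (pi - \<psi>)"
    have "pi - \<psi> - \<psi> \<le> pi" "\<psi> < pi - \<psi>" using ang by auto
    from wedge_polar[OF z this] obtain t x where t: "t > 0" "\<psi> < x" "x < pi - \<psi>" "z = of_real t * cis x" by blast
    have "sin x > 0" by (rule sin_gt_zero) (use t ang in auto)
    then have "1 \<le> Im (z + \<i>)" using t by simp
    then show "1 \<le> norm (z + \<i>)" using abs_Im_le_cmod[of "z + \<i>"] by linarith
  qed (use ang iu ie in \<open>auto simp: boundary_integrable_eq boundary_eq\<close>)
  have low: "ray_integral (2 * pi - \<phi>) ?e - ray_integral (pi + \<phi>) ?e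
      = (- \<i>) * res l (- \<i>) * (ray_integral (2 * pi - \<phi>) ?u - ray_integral (pi + \<phi>) ?u)"
  proof (rule kernel_outer_sector[OF \<phi> l _ i_outside(2) _ ang(4,6)])
    show "wedge (pi + \<psi>) (2 * pi - \<psi>) \<subseteq> outside \<psi>"
      by (rule wedge_subsetI[OF ray_subset_outside_lower]) (use ang in auto)
    fix z assume z: "z \<in> wedge (pi + \<psi>) (2 * pi - \<psi>)"
    have "2 * pi - \<psi> - (pi + \<psi>) \<le> pi" "pi + \<psi> < 2 * pi - \<psi>" using ang by auto
    from wedge_polar[OF z this] obtain t x where t: "t > 0" "pi + \<psi> < x" "x < 2 * pi - \<psi>" "z = of_real t * cis x" by blast
    have "sin (x - pi) > 0" by (rule sin_gt_zero) (use t ang in auto)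
    then have "sin x < 0" by (simp add: sin_diff)
    then have "1 \<le> - Im (z + - \<i>)" using t by (simp add: mult_less_0_iff mult_pos_neg less_imp_le)
    then show "1 \<le> norm (z + - \<i>)" using abs_Im_le_cmod[of "z + - \<i>"] by linarith
  qed (use ang iu iu' ie in \<open>auto simp: boundary_integrable_eq boundary_eq\<close>)
  have "cnj \<i> = - \<i>" by simp
  then have eqs: "Q (- \<i>) = Q \<i>" "P (- \<i>) = P \<i>" using cnj[of \<i>] by auto
  have sum: "res l \<i> + res l (- \<i>) = - 2 * of_real (l (P \<i>))" unfolding res_def eqs by simp
  have "boundary_integral \<phi> ?e = ((ray_integral (pi - \<phi>) ?e - ray_integral \<phi> ?e) + (ray_integral (2 * pi - \<phi>) ?e - ray_integral (pi + \<phi>) ?e)) / (2 * of_real pi * \<i>)"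
    unfolding boundary_integral_eq iu'(4) by (simp add: algebra_simps)
  also have "\<dots> = (- \<i> * pi * (res l \<i> + res l (- \<i>))) / (2 * of_real pi * \<i>)"
    unfolding up low iu(2,4,5) iu'(2) by (simp add: algebra_simps)
  also have "\<dots> = of_real (l (P \<i>))" unfolding sum by simp
  finally show "of_real (l (P \<i>)) = boundary_integral \<phi> ?e" by simp
qed

text \<open>\<open>Q_expand\<close> at z = w = i, where the real part vanishes; the operator form of
  1/(1 + z^2)^2 = 1/(1 + z^2) - (z/(1 + z^2))^2.\<close>

lemma Qi_square: "Q \<i> o\<^sub>L Q \<i> = Q \<i> - (P \<i> o\<^sub>L P \<i>)"
  using Q_expand[OF i_outside(1,1)] by (simp add: eq_diff_eq add.commute)

lemma represents_add:
  assumes "decaying \<theta> F" "decaying \<theta> G" "\<omega> < \<phi>" "\<phi> < \<theta>" "\<theta> < pi / 2" "represents \<phi> F A" "represents \<phi> G B"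
  shows "represents \<phi> (\<lambda>z. F z + G z) (A + B)"
  unfolding represents_def
proof (intro allI impI)
  fix l :: "('x \<Rightarrow>\<^sub>L 'x) \<Rightarrow> real" assume l: "bounded_linear l"
  have pos: "0 < \<phi>" "\<phi> < pi / 2" using assms omega by auto
  have "of_real (l (A + B)) = boundary_integral \<phi> (\<lambda>z. F z * res l z) + boundary_integral \<phi> (\<lambda>z. G z * res l z)"
    using assms(6,7) l unfolding represents_def by (simp add: linear_add[OF bounded_linear.linear[OF l]])
  also have "\<dots> = boundary_integral \<phi> (\<lambda>z. F z * res l z + G z * res l z)"
    by (intro boundary_integral_add[symmetric] boundary_integrable_res l assms pos
        decaying_boundary[OF assms(1)] decaying_boundary[OF assms(2)])
  finally show "of_real (l (A + B)) = boundary_integral \<phi> (\<lambda>z. (F z + G z) * res l z)"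
    by (simp add: distrib_right)
qed

lemma represents_scaleR:
  assumes "represents \<phi> F A"
  shows "represents \<phi> (\<lambda>z. of_real r * F z) (r *\<^sub>R A)"
  unfolding represents_def
proof (intro allI impI)
  fix l :: "('x \<Rightarrow>\<^sub>L 'x) \<Rightarrow> real" assume l: "bounded_linear l"
  have "of_real (l (r *\<^sub>R A)) = of_real r * boundary_integral \<phi> (\<lambda>z. F z * res l z)"
    using assms l unfolding represents_def by (simp add: linear_scale[OF bounded_linear.linear[OF l]])
  then show "of_real (l (r *\<^sub>R A)) = boundary_integral \<phi> (\<lambda>z. of_real r * F z * res l z)"
    by (simp only: boundary_integral_cmult mult.assoc)
qed

lemma represents_cong:
  assumes "\<And>z. z \<in> bisector \<theta> \<Longrightarrow> F z = G z" "\<omega> < \<phi>" "\<phi> < \<theta>" "\<theta> < pi / 2"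
  shows "represents \<phi> F A \<longleftrightarrow> represents \<phi> G A"
proof -
  have "boundary \<phi> \<subseteq> bisector \<theta>" by (rule boundary_subset_bisector) (use assms omega in auto)
  then have "boundary_integral \<phi> (\<lambda>z. F z * res l z) = boundary_integral \<phi> (\<lambda>z. G z * res l z)" for l
    by (intro boundary_integral_cong) (use assms(1) in auto)
  then show ?thesis unfolding represents_def by simp
qed

end

section \<open>The algebra of the extended calculus\<close>

locale bisectorial_calculus = bisectorial_resolvent \<omega> Q P
  for \<omega> :: real and Q P :: "complex \<Rightarrow> ('x::banach \<Rightarrow>\<^sub>L 'x)" +
  fixes \<phi> \<theta> :: real
  assumes angles: "\<omega> < \<phi>" "\<phi> < \<theta>" "\<theta> < pi / 2"
begin

definition dec_calc :: "(complex \<Rightarrow> complex) \<Rightarrow> ('x \<Rightarrow>\<^sub>L 'x) \<Rightarrow> bool" where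
  "dec_calc F A \<longleftrightarrow> decaying \<theta> F \<and> represents \<phi> F A"

lemma theta_pos: "0 < \<theta>" using angles omega by linarith

lemma dec_calc_add: "dec_calc F A \<Longrightarrow> dec_calc G B \<Longrightarrow> dec_calc (\<lambda>z. F z + G z) (A + B)"
  unfolding dec_calc_def using decaying_add represents_add angles by blast

lemma dec_calc_scaleR: "dec_calc F A \<Longrightarrow> dec_calc (\<lambda>z. of_real r * F z) (r *\<^sub>R A)"
  unfolding dec_calc_def using decaying_cmult represents_scaleR angles by blast

lemma dec_calc_mult: "dec_calc F A \<Longrightarrow> dec_calc G B \<Longrightarrow> dec_calc (\<lambda>z. F z * G z) (A o\<^sub>L B)"
  unfolding dec_calc_def using decaying_mult represents_mult angles by blast

lemma dec_calc_Qi: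
  "dec_calc F A \<Longrightarrow> dec_calc (\<lambda>z. 1 / (1 + z\<^sup>2) * F z) (A o\<^sub>L Q \<i>)"
  "dec_calc F A \<Longrightarrow> dec_calc (\<lambda>z. 1 / (1 + z\<^sup>2) * F z) (Q \<i> o\<^sub>L A)"
  unfolding dec_calc_def using decaying_div_one_plus_square represents_comp_Qi angles theta_pos by blast+

lemma dec_calc_kernel: "dec_calc (\<lambda>z. z / (1 + z\<^sup>2)) (P \<i>)"
  unfolding dec_calc_def using decaying_kernel represents_kernel angles theta_pos by auto

lemma dec_calc_cong: "(\<And>z. z \<in> bisector \<theta> \<Longrightarrow> F z = G z) \<Longrightarrow> dec_calc F A \<longleftrightarrow> dec_calc G A"
  unfolding dec_calc_def using decaying_cong[OF angles(3), of F G] represents_cong[OF _ angles, of F G] by blast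

text \<open>A relation rather than a map, so that closure under sums and products does not involve
  uniqueness of the decomposition. The coefficients are a = g_inf and b = g_0 - g_inf, and
  \<open>Q \<i>\<close> stands for (1 + T^2)^{-1}.\<close>

definition ext_calc :: "(complex \<Rightarrow> complex) \<Rightarrow> ('x \<Rightarrow>\<^sub>L 'x) \<Rightarrow> bool" where
  "ext_calc G A \<longleftrightarrow> (\<exists>a b H B. dec_calc H B \<and>
     (\<forall>z\<in>bisector \<theta>. G z = of_real a + of_real b / (1 + z\<^sup>2) + H z) \<and>
     A = a *\<^sub>R id_blinfun + b *\<^sub>R Q \<i> + B)"

lemma dec_calc_0: "dec_calc (\<lambda>z. 0) 0"
  using dec_calc_scaleR[OF dec_calc_kernel, of 0] by simp

lemma ext_calc_const: "ext_calc (\<lambda>z. of_real r) (r *\<^sub>R id_blinfun)"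
  unfolding ext_calc_def using dec_calc_0
  by (intro exI[of _ r] exI[of _ 0] exI[of _ "\<lambda>z. 0"] exI[of _ 0]) simp

lemma ext_calc_add:
  assumes "ext_calc G A" "ext_calc G' A'"
  shows "ext_calc (\<lambda>z. G z + G' z) (A + A')"
proof -
  obtain a b H B where 1: "dec_calc H B" "\<And>z. z \<in> bisector \<theta> \<Longrightarrow> G z = of_real a + of_real b / (1 + z\<^sup>2) + H z"
    "A = a *\<^sub>R id_blinfun + b *\<^sub>R Q \<i> + B" using assms(1) unfolding ext_calc_def by blast
  obtain a' b' H' B' where 2: "dec_calc H' B'" "\<And>z. z \<in> bisector \<theta> \<Longrightarrow> G' z = of_real a' + of_real b' / (1 + z\<^sup>2) + H' z"
    "A' = a' *\<^sub>R id_blinfun + b' *\<^sub>R Q \<i> + B'" using assms(2) unfolding ext_calc_def by blast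
  show ?thesis
    unfolding ext_calc_def
    using dec_calc_add[OF 1(1) 2(1)] 1(2,3) 2(2,3)
    by (intro exI[of _ "a + a'"] exI[of _ "b + b'"] exI[of _ "\<lambda>z. H z + H' z"] exI[of _ "B + B'"])
      (simp add: scaleR_add_left add_divide_distrib)
qed

text \<open>Of the products of the terms, only the square of 1/(1 + z^2) is neither of the three
  given types nor decaying. It contributes b b' to the coefficient of 1/(1 + z^2) and - b b' times
  the square of z/(1 + z^2) to the decaying part, and \<open>Qi_square\<close> does the same for the
  operators.\<close>

lemma ext_calc_mult:
  assumes "ext_calc G A" "ext_calc G' A'"
  shows "ext_calc (\<lambda>z. G z * G' z) (A o\<^sub>L A')"
proof -
  obtain a b H B where 1: "dec_calc H B" "\<And>z. z \<in> bisector \<theta> \<Longrightarrow> G z = of_real a + of_real b / (1 + z\<^sup>2) + H z"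
    "A = a *\<^sub>R id_blinfun + b *\<^sub>R Q \<i> + B" using assms(1) unfolding ext_calc_def by blast
  obtain a' b' H' B' where 2: "dec_calc H' B'" "\<And>z. z \<in> bisector \<theta> \<Longrightarrow> G' z = of_real a' + of_real b' / (1 + z\<^sup>2) + H' z"
    "A' = a' *\<^sub>R id_blinfun + b' *\<^sub>R Q \<i> + B'" using assms(2) unfolding ext_calc_def by blast
  let ?e = "\<lambda>z::complex. z / (1 + z\<^sup>2)"
  define K where "K z = of_real (- (b * b')) * (?e z * ?e z) + (of_real a * H' z + (of_real a' * H z +
     (of_real b * (1 / (1 + z\<^sup>2) * H' z) + (of_real b' * (1 / (1 + z\<^sup>2) * H z) + H z * H' z))))" for z
  define C where "C = (- (b * b')) *\<^sub>R (P \<i> o\<^sub>L P \<i>) + (a *\<^sub>R B' + (a' *\<^sub>R B +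
     (b *\<^sub>R (Q \<i> o\<^sub>L B') + (b' *\<^sub>R (B o\<^sub>L Q \<i>) + (B o\<^sub>L B')))))"
  have "dec_calc K C"
    unfolding K_def C_def
    by (intro dec_calc_add dec_calc_scaleR dec_calc_mult dec_calc_kernel dec_calc_Qi 1(1) 2(1))
  moreover have "G z * G' z = of_real (a * a') + of_real (a * b' + a' * b + b * b') / (1 + z\<^sup>2) + K z"
    if z: "z \<in> bisector \<theta>" for z
  proof -
    define u where "u = 1 / (1 + z\<^sup>2)"
    have nz: "1 + z\<^sup>2 \<noteq> 0" by (rule bisector_one_plus_square(2)[OF z theta_pos angles(3)])
    have "?e z * ?e z = z\<^sup>2 * u\<^sup>2" by (simp add: u_def power2_eq_square)
    also have "\<dots> = u - u\<^sup>2"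
    proof -
      have "u = (1 + z\<^sup>2) * u\<^sup>2" using nz by (simp add: u_def power2_eq_square)
      then show ?thesis by (simp add: algebra_simps)
    qed
    finally have ee: "?e z * ?e z = u - u\<^sup>2" .
    have du: "x / (1 + z\<^sup>2) = x * u" for x by (simp add: u_def)
    show ?thesis
      unfolding 1(2)[OF z] 2(2)[OF z] K_def ee
      unfolding du
      by (simp add: power2_eq_square algebra_simps)
  qed
  moreover have "A o\<^sub>L A' = (a * a') *\<^sub>R id_blinfun + (a * b' + a' * b + b * b') *\<^sub>R Q \<i> + C"
  proof -
    note bb = bounded_bilinear_blinfun_compose
    show ?thesis
      unfolding 1(3) 2(3) C_def
      by (simp add: bounded_bilinear.add_left[OF bb] bounded_bilinear.add_right[OF bb]
          bounded_bilinear.scaleR_left[OF bb] bounded_bilinear.scaleR_right[OF bb] Qi_square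
          blinfun_compose_id algebra_simps)
  qed
  ultimately show ?thesis unfolding ext_calc_def by blast
qed

lemma ext_calc_power: "ext_calc G A \<Longrightarrow> ext_calc (\<lambda>z. G z ^ n) (((\<lambda>B. A o\<^sub>L B) ^^ n) id_blinfun)"
proof (induction n)
  case 0 then show ?case using ext_calc_const[of 1] by simp
next
  case (Suc n) then show ?case using ext_calc_mult by simp
qed

lemma ext_calc_sum:
  "finite I \<Longrightarrow> (\<And>i. i \<in> I \<Longrightarrow> ext_calc (f i) (A i)) \<Longrightarrow> ext_calc (\<lambda>z. \<Sum>i\<in>I. f i z) (\<Sum>i\<in>I. A i)"
proof (induction I rule: finite_induct)
  case empty then show ?case using ext_calc_const[of 0] by simp
next
  case (insert i I) then show ?case by (simp add: ext_calc_add)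
qed

lemma ext_calc_scaleR: "ext_calc G A \<Longrightarrow> ext_calc (\<lambda>z. of_real r * G z) (r *\<^sub>R A)"
proof -
  assume "ext_calc G A"
  from ext_calc_mult[OF ext_calc_const[of r] this] show ?thesis
    by (simp add: bounded_bilinear.scaleR_left[OF bounded_bilinear_blinfun_compose] blinfun_compose_id)
qed

lemma ext_calc_poly:
  assumes "ext_calc G A"
  shows "ext_calc (\<lambda>z. \<Sum>i\<le>degree p. of_real (coeff p i) * G z ^ i) (op_poly p A)"
  unfolding op_poly_def by (intro ext_calc_sum ext_calc_scaleR ext_calc_power assms) simp

text \<open>The difference of the two decompositions is a vanishing sum of two constants terms and a
  decaying function, so the constants agree by the logarithmic divergence; the decaying parts then
  agree and represent only one operator.\<close>

lemma ext_calc_unique: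
  assumes "dec_calc H B" "dec_calc H' B'"
    and "\<And>z. z \<in> bisector \<theta> \<Longrightarrow> of_real a + of_real b / (1 + z\<^sup>2) + H z = of_real a' + of_real b' / (1 + z\<^sup>2) + H' z"
  shows "a = a'" "b = b'" "B = B'"
proof -
  have d: "dec_calc (\<lambda>z. H z + of_real (- 1) * H' z) (B + (- 1) *\<^sub>R B')"
    by (intro dec_calc_add dec_calc_scaleR assms)
  have eq: "of_real (a - a') + of_real (b - b') / (1 + z\<^sup>2) + (H z + of_real (- 1) * H' z) = 0"
    if "z \<in> bisector \<theta>" for z
    using assms(3)[OF that] by (simp add: diff_divide_distrib algebra_simps)
  have "a - a' = 0" "b - b' = 0"
    using decaying_constants_eq_0[OF _ theta_pos angles(3) eq] d unfolding dec_calc_def by blast+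
  then show ab: "a = a'" "b = b'" by auto
  have "H z = H' z" if "z \<in> bisector \<theta>" for z using assms(3)[OF that] ab by simp
  then have "dec_calc H' B" using assms(1) dec_calc_cong by blast
  then show "B = B'" using assms(2) represents_unique unfolding dec_calc_def by blast
qed

end

section \<open>Slices of the Clifford algebra\<close>

lemma axis_scaleR: "axis i (c *\<^sub>R x) = c *\<^sub>R (axis i x :: 'a::real_vector ^ 'n::finite)"
  by (simp add: axis_def vec_eq_iff)

lemma bounded_linear_axis: "bounded_linear (axis i :: 'a::real_normed_vector \<Rightarrow> 'a ^ 'n::finite)"
proof (rule bounded_linear_intro[of _ 1])
  show "norm (axis i x :: 'a ^ 'n) \<le> norm x * 1" for x
  proof -
    have "norm (axis i x :: 'a ^ 'n) \<le> (\<Sum>j\<in>UNIV. norm (axis i x $ j :: 'a))"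
      unfolding norm_vec_def by (rule L2_set_le_sum) simp
    also have "\<dots> = (\<Sum>j\<in>UNIV. if j = i then norm x else 0)"
      by (intro sum.cong refl) (simp add: axis_def)
    finally show ?thesis by simp
  qed
qed (simp_all add: axis_add axis_scaleR)

lemma cl_lmult_scaleR_left: "(c *\<^sub>R a) \<cdot>\<^sub>l v = c *\<^sub>R (a \<cdot>\<^sub>l v)"
  by (simp add: cl_lmult_def axis_scaleR[symmetric] scaleR_sum_right mult_ac)

lemma cl_lmult_scaleR_right: "a \<cdot>\<^sub>l (c *\<^sub>R v) = c *\<^sub>R (a \<cdot>\<^sub>l v)"
  by (simp add: cl_lmult_def axis_scaleR[symmetric] scaleR_sum_right mult_ac)

lemma cl_lmult_minus_left: "(- a) \<cdot>\<^sub>l v = - (a \<cdot>\<^sub>l v)"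
  using cl_lmult_scaleR_left[of "- 1" a v] by simp

lemma cl_sign_empty [simp]: "cl_sign {} B = 1" "cl_sign A {} = 1"
  by (simp_all add: cl_sign_def)

lemma cl_one_lmult [simp]: "cl_one \<cdot>\<^sub>l v = v"
proof -
  have "cl_one \<cdot>\<^sub>l v = (\<Sum>B\<in>UNIV. cl_one \<cdot>\<^sub>l axis B (v $ B))"
    by (subst vec_axis_sum[of v]) (rule cl_lmult_sum_right)
  also have "\<dots> = (\<Sum>B\<in>UNIV. axis B (v $ B))"
    unfolding cl_one_def cl_lmult_axis by simp
  finally show ?thesis by (simp add: vec_axis_sum[symmetric])
qed

lemma cl_lmult_one [simp]: "a \<cdot>\<^sub>l cl_one = a"
proof -
  have "a \<cdot>\<^sub>l cl_one = (\<Sum>A\<in>UNIV. axis A (a $ A) \<cdot>\<^sub>l cl_one)"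
    by (subst vec_axis_sum[of a]) (rule cl_lmult_sum_left)
  also have "\<dots> = (\<Sum>A\<in>UNIV. axis A (a $ A))"
    unfolding cl_one_def cl_lmult_axis by simp
  finally show ?thesis by (simp add: vec_axis_sum[symmetric])
qed

text \<open>Used to read off real homogeneity of T from its right linearity.\<close>

lemma cl_rmult_real:
  fixes v :: "'v::real_vector ^ 'n::{finite,linorder} set"
  shows "v \<cdot>\<^sub>r (r *\<^sub>R cl_one) = r *\<^sub>R v"
proof -
  have "v \<cdot>\<^sub>r (r *\<^sub>R cl_one) = (\<Sum>A\<in>UNIV. \<Sum>B\<in>(UNIV :: 'n set set). if B = {} then axis A (r *\<^sub>R (v $ A)) else 0)"
    unfolding cl_rmult_def
    by (rule sum.cong[OF refl], rule sum.cong[OF refl]) (auto simp: cl_one_def axis_def vec_eq_iff)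
  also have "\<dots> = r *\<^sub>R (\<Sum>A\<in>UNIV. axis A (v $ A))" by (simp add: axis_scaleR scaleR_sum_right)
  finally show ?thesis by (simp add: vec_axis_sum[symmetric])
qed

lemma bounded_linear_cl_lmult:
  "bounded_linear (\<lambda>v :: 'v::real_normed_vector ^ 'n::{finite,linorder} set. a \<cdot>\<^sub>l v)"
  unfolding cl_lmult_def
  by (intro bounded_linear_sum bounded_linear_compose[OF bounded_linear_axis]
      bounded_linear_compose[OF bounded_linear_scaleR_right] bounded_linear_vec_nth)

lemma left_op_apply [simp]: "blinfun_apply (left_op a) v = a \<cdot>\<^sub>l v"
  unfolding left_op_def by (simp add: bounded_linear_Blinfun_apply[OF bounded_linear_cl_lmult])

context
  fixes J :: "real ^ 'n::{finite,linorder} set"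
  assumes J: "J \<in> unit_sphere"
begin

lemma unit_sphere_re: "J $ {} = 0" and unit_sphere_norm: "norm J = 1"
  using J by (auto simp: unit_sphere_def re_part_def)

text \<open>J is a combination of generators with coefficients of square sum 1. Adding the double
  sum for the square to the same sum with exchanged indices, anticommuting pairs cancel and the
  diagonal leaves -2.\<close>

lemma unit_sphere_square: "J \<cdot>\<^sub>l J = - cl_one"
proof -
  obtain s0 c where Jc: "J = s0 *\<^sub>R cl_one + (\<Sum>i\<in>UNIV. c i *\<^sub>R cl_gen i)"
    using J by (auto simp: unit_sphere_def paravectors_def)
  have "J $ {} = s0" unfolding Jc by (simp add: cl_one_def cl_gen_def axis_def)
  then have Jc: "J = (\<Sum>i\<in>UNIV. c i *\<^sub>R cl_gen i)" using Jc unit_sphere_re by simp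
  have inner: "inner (cl_gen i) (cl_gen j :: real ^ 'n set) = (if i = j then 1 else 0)" for i j :: 'n
    by (simp add: cl_gen_def inner_axis_axis)
  have "1 = inner J J" using unit_sphere_norm by (simp add: dot_square_norm)
  also have "\<dots> = (\<Sum>i\<in>UNIV. c i * c i)"
    unfolding Jc by (simp add: inner_sum_left inner_sum_right inner if_distrib cong: if_cong)
  finally have n1: "(\<Sum>i\<in>UNIV. c i * c i) = 1" by simp
  have JJ: "J \<cdot>\<^sub>l J = (\<Sum>i\<in>UNIV. \<Sum>j\<in>UNIV. (c i * c j) *\<^sub>R (cl_gen j \<cdot>\<^sub>l cl_gen i))"
    unfolding Jc cl_lmult_sum_left cl_lmult_sum_right cl_lmult_scaleR_left cl_lmult_scaleR_right
    by (simp add: scaleR_sum_right)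
  also have "\<dots> = (\<Sum>i\<in>UNIV. \<Sum>j\<in>UNIV. (c i * c j) *\<^sub>R (cl_gen i \<cdot>\<^sub>l cl_gen j))"
    by (subst sum.swap) (simp add: mult.commute)
  finally have "J \<cdot>\<^sub>l J + J \<cdot>\<^sub>l J = (\<Sum>i\<in>UNIV. \<Sum>j\<in>UNIV. (c i * c j) *\<^sub>R (cl_gen i \<cdot>\<^sub>l cl_gen j + cl_gen j \<cdot>\<^sub>l cl_gen i))"
    using JJ by (simp add: sum.distrib scaleR_add_right)
  also have "\<dots> = (\<Sum>i\<in>UNIV. \<Sum>j\<in>UNIV. if i = j then (c i * c i) *\<^sub>R (- 2 *\<^sub>R cl_one) else 0)"
  proof (intro sum.cong refl)
    fix i j :: 'n
    show "(c i * c j) *\<^sub>R (cl_gen i \<cdot>\<^sub>l cl_gen j + cl_gen j \<cdot>\<^sub>l cl_gen i :: real ^ 'n set) =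
      (if i = j then (c i * c i) *\<^sub>R (- 2 *\<^sub>R cl_one) else 0)"
      using cl_gen_anticommute[of i j] by (auto simp: cl_gen_square scaleR_2)
  qed
  also have "\<dots> = (\<Sum>i\<in>UNIV. c i * c i) *\<^sub>R (- 2 *\<^sub>R cl_one)"
    by (simp add: scaleR_sum_left del: scaleR_scaleR scaleR_minus_left)
  finally have "2 *\<^sub>R (J \<cdot>\<^sub>l J) = 2 *\<^sub>R (- cl_one)" by (simp add: n1 scaleR_2[symmetric])
  from arg_cong[OF this, of "\<lambda>x. (1 / 2) *\<^sub>R x"] show ?thesis by simp
qed

lemma unit_sphere_lmult_twice: "J \<cdot>\<^sub>l (J \<cdot>\<^sub>l v) = - v"
  by (simp only: cl_lmult_assoc[symmetric] unit_sphere_square cl_lmult_minus_left cl_one_lmult)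

end

section \<open>Each slice as a copy of the complex numbers\<close>

definition slice_emb :: "real ^ 'n::{finite,linorder} set \<Rightarrow> complex \<Rightarrow> real ^ 'n set" where
  "slice_emb J z = slice_pt J (Re z) (Im z)"

lemma slice_emb_eq: "slice_emb J z = Re z *\<^sub>R cl_one + Im z *\<^sub>R J"
  by (simp add: slice_emb_def slice_pt_def)

lemma slice_pt_eq_emb: "slice_pt J x y = slice_emb J (Complex x y)"
  by (simp add: slice_emb_def)

lemma slice_emb_lmult: "slice_emb J z \<cdot>\<^sub>l v = Re z *\<^sub>R v + Im z *\<^sub>R (J \<cdot>\<^sub>l v)"
  by (simp add: slice_emb_eq cl_lmult_add_left cl_lmult_scaleR_left)

lemma slice_emb_add: "slice_emb J (z + w) = slice_emb J z + slice_emb J w"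
  and slice_emb_diff: "slice_emb J (z - w) = slice_emb J z - slice_emb J w"
  and slice_emb_scaleR: "slice_emb J (of_real r * z) = r *\<^sub>R slice_emb J z"
  and slice_emb_of_real: "slice_emb J (of_real r) = r *\<^sub>R cl_one"
  and slice_emb_1: "slice_emb J 1 = cl_one"
  by (simp_all add: slice_emb_eq algebra_simps)

lemma expJ_eq: "expJ J \<phi> = slice_emb J (cis \<phi>)"
  by (simp add: expJ_def slice_emb_def)

context
  fixes J :: "real ^ 'n::{finite,linorder} set"
  assumes J: "J \<in> unit_sphere"
begin

lemma slice_emb_mult: "slice_emb J z \<cdot>\<^sub>l slice_emb J w = slice_emb J (z * w)"
  unfolding slice_emb_lmult[of J z]
  unfolding slice_emb_eq cl_lmult_add_right cl_lmult_scaleR_right unit_sphere_square[OF J] cl_lmult_one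
  by (simp add: algebra_simps)

lemma slice_emb_re: "re_part (slice_emb J z) = Re z"
  using unit_sphere_re[OF J] by (simp add: re_part_def slice_emb_eq cl_one_def axis_def)

lemma norm_slice_emb: "norm (slice_emb J z) = norm z"
proof -
  have "inner cl_one J = 0" using unit_sphere_re[OF J] by (simp add: cl_one_def inner_axis')
  moreover from this have "inner J cl_one = 0" by (simp only: inner_commute)
  moreover have "inner J J = 1" using unit_sphere_norm[OF J] by (simp add: dot_square_norm)
  moreover have "inner cl_one (cl_one :: real ^ 'n set) = 1" by (simp add: cl_one_def inner_axis_axis)
  ultimately have "(norm (slice_emb J z))\<^sup>2 = (Re z)\<^sup>2 + (Im z)\<^sup>2"
    unfolding power2_norm_eq_inner slice_emb_eq
    by (simp add: inner_add_left inner_add_right power2_eq_square)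
  then show ?thesis by (simp add: cmod_def real_sqrt_unique)
qed

lemma slice_emb_inject: "slice_emb J z = slice_emb J w \<longleftrightarrow> z = w"
  using norm_slice_emb[of "z - w"] by (auto simp: slice_emb_diff)

lemma slice_emb_paravector: "slice_emb J z \<in> paravectors"
proof -
  obtain s0 c where "J = s0 *\<^sub>R cl_one + (\<Sum>i\<in>UNIV. c i *\<^sub>R cl_gen i)"
    using J by (auto simp: unit_sphere_def paravectors_def)
  then have "slice_emb J z = (Re z + Im z * s0) *\<^sub>R cl_one + (\<Sum>i\<in>UNIV. (Im z * c i) *\<^sub>R cl_gen i)"
    by (simp add: slice_emb_eq scaleR_add_right scaleR_add_left scaleR_sum_right)
  then show ?thesis unfolding paravectors_def by (auto intro!: exI[of _ "\<lambda>i. Im z * c i"])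
qed

lemma slice_emb_cnj: "pv_cnj (slice_emb J z) = slice_emb J (cnj z)"
  using unit_sphere_re[OF J] by (auto simp: pv_cnj_def slice_emb_eq vec_eq_iff cl_one_def axis_def)

lemma slice_emb_inverse: "pv_inverse (slice_emb J z) = slice_emb J (inverse z)"
proof -
  have "complex_of_real (1 / (norm z)\<^sup>2) = inverse (z * cnj z)"
    by (simp only: of_real_divide of_real_1 complex_norm_square inverse_eq_divide)
  then have "inverse z = of_real (1 / (norm z)\<^sup>2) * cnj z" by (cases "z = 0") simp_all
  then show ?thesis by (simp only: pv_inverse_def slice_emb_cnj norm_slice_emb slice_emb_scaleR)
qed

lemma slice_emb_i: "slice_emb J \<i> = J" by (simp add: slice_emb_eq)

lemma slice_emb_power: "cl_power (slice_emb J z) k = slice_emb J (z ^ k)"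
  by (induction k) (simp_all add: slice_emb_1 slice_emb_mult)

lemma slice_emb_sum: "slice_emb J (\<Sum>i\<in>I. f i) = (\<Sum>i\<in>I. slice_emb J (f i))"
  by (induction I rule: infinite_finite_induct) (simp_all add: slice_emb_add slice_emb_of_real[of J 0, simplified])

lemma slice_emb_poly: "cl_poly p (slice_emb J z) = slice_emb J (\<Sum>i\<le>degree p. of_real (coeff p i) * z ^ i)"
  by (simp add: cl_poly_def slice_emb_power slice_emb_sum slice_emb_scaleR)

end

text \<open>A type has at least one element, so there is a generator, and generators are imaginary
  units; this is where n >= 1 enters.\<close>

lemma unit_sphere_nonempty: "\<exists>J :: real ^ 'n::{finite,linorder} set. J \<in> unit_sphere"
proof -
  obtain i :: 'n where True by blast
  have "cl_gen i = (0::real) *\<^sub>R cl_one + (\<Sum>j\<in>UNIV. (if j = i then 1 else 0) *\<^sub>R cl_gen j)"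
    by (simp add: if_distrib[of "\<lambda>c. c *\<^sub>R _"] cong: if_cong)
  then have "cl_gen i \<in> paravectors"
    unfolding paravectors_def mem_Collect_eq by (intro exI[of _ 0] exI[of _ "\<lambda>j. if j = i then 1 else 0"])
  moreover have "re_part (cl_gen i) = 0" by (simp add: re_part_def cl_gen_def axis_def)
  moreover have "norm (cl_gen i) = 1" by (simp add: cl_gen_def)
  ultimately have "cl_gen i \<in> unit_sphere" by (simp add: unit_sphere_def)
  then show ?thesis by blast
qed

section \<open>Comparison of the Clifford double sector with the complex one\<close>

lemma bisector_polar:
  assumes "z \<in> bisector \<theta>" "0 < \<theta>" "\<theta> < pi / 2"
  obtains r c where "r > 0" "c \<in> I_angle \<theta>" "z = of_real r * cis c"
proof -
  have right: "\<exists>r>0. \<exists>c. \<bar>c\<bar> < \<theta> \<and> w = of_real r * cis c" if w: "w \<in> bisector \<theta>" "Re w > 0" for w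
  proof -
    have w0: "w \<noteq> 0" using w by auto
    have p: "w = of_real (norm w) * cis (Arg w)" using Arg_eq[OF w0] by (simp add: cis_conv_exp)
    have A: "\<bar>Arg w\<bar> < pi / 2" using w(2) Re_Ln_pos_lt_imp[of w] Arg_eq_Im_Ln[OF w0] Re_Ln_pos_lt[OF w0] by auto
    then have c: "cos (Arg w) > 0" by (intro cos_gt_zero_pi) auto
    have n: "norm w > 0" using w0 by simp
    have "\<bar>Im w\<bar> = norm w * \<bar>sin (Arg w)\<bar>" "\<bar>Re w\<bar> = norm w * cos (Arg w)"
      by (subst p, simp add: abs_mult c less_imp_le)+
    then have "norm w * (cos \<theta> * \<bar>sin (Arg w)\<bar>) < norm w * (sin \<theta> * cos (Arg w))"
      using w(1) by (simp add: bisector_def mult_ac)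
    then have 1: "cos \<theta> * \<bar>sin (Arg w)\<bar> < sin \<theta> * cos (Arg w)" using n by simp
    have 2: "\<bar>sin (Arg w)\<bar> = sin \<bar>Arg w\<bar>"
      using A sin_ge_zero[of "\<bar>Arg w\<bar>"] pi_gt_zero by (cases "Arg w \<ge> 0") auto
    have 3: "cos (Arg w) = cos \<bar>Arg w\<bar>" by (simp only: cos_abs_real)
    have s: "0 < sin (\<theta> - \<bar>Arg w\<bar>)" using 1 unfolding sin_diff 2 3 by linarith
    have "\<bar>Arg w\<bar> < \<theta>"
    proof (rule ccontr)
      assume "\<not> ?thesis"
      then have "0 \<le> sin (\<bar>Arg w\<bar> - \<theta>)" using A assms pi_gt_zero by (intro sin_ge_zero) linarith+
      then show False using s sin_minus[of "\<theta> - \<bar>Arg w\<bar>"] by simp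
    qed
    then show ?thesis using p n by blast
  qed
  consider "Re z > 0" | "Re (- z) > 0" using bisector_cos_le(2)[OF assms] by fastforce
  then show thesis
  proof cases
    case 1
    then obtain r c where rc: "r > 0" "\<bar>c\<bar> < \<theta>" "z = of_real r * cis c" using right[OF assms(1)] by blast
    have "c \<in> I_angle \<theta>" using rc(2) by (auto simp: I_angle_def abs_less_iff)
    then show thesis using that[of r c] rc by blast
  next
    case 2
    then obtain r c where rc: "r > 0" "\<bar>c\<bar> < \<theta>" "- z = of_real r * cis c" using right[of "- z"] assms(1) by auto
    have "z = of_real r * cis (pi + c)" using rc(3) by (simp add: cis_mult[symmetric] minus_equation_iff[of z] eq_commute)
    moreover have "pi + c \<in> I_angle \<theta>" using rc(2) by (auto simp: I_angle_def abs_less_iff)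
    ultimately show thesis using that[of r "pi + c"] rc by blast
  qed
qed

lemma ray_I_angle:
  assumes "c \<in> I_angle \<theta>" "\<theta> < pi / 2"
  shows "ray c \<subseteq> bisector \<theta>"
proof -
  consider "\<bar>c\<bar> < \<theta>" | "\<bar>c - pi\<bar> < \<theta>" using assms(1) by (force simp: I_angle_def)
  then show ?thesis by cases (use assms(2) ray_subset_bisector ray_subset_bisector_left in blast)+
qed

text \<open>Membership may be witnessed by another imaginary unit. Then real parts and moduli agree,
  hence the imaginary parts agree up to sign, and \<open>bisector\<close> does not see the
  sign.\<close>

lemma slice_emb_in_D_sector:
  assumes J: "J \<in> unit_sphere" and \<theta>: "0 < \<theta>" "\<theta> < pi / 2"
  shows "slice_emb J z \<in> D_sector \<theta> \<longleftrightarrow> z \<in> bisector \<theta>"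
proof
  assume "z \<in> bisector \<theta>"
  then obtain r c where "r > 0" "c \<in> I_angle \<theta>" "z = of_real r * cis c" using bisector_polar \<theta> by blast
  then show "slice_emb J z \<in> D_sector \<theta>"
    unfolding D_sector_def expJ_eq using J slice_emb_scaleR[of J r "cis c"] by blast
next
  assume "slice_emb J z \<in> D_sector \<theta>"
  then obtain r K c where rc: "r > 0" "K \<in> unit_sphere" "c \<in> I_angle \<theta>" "slice_emb J z = r *\<^sub>R expJ K c"
    unfolding D_sector_def by blast
  define w where "w = of_real r * cis c"
  have w: "w \<in> bisector \<theta>" using ray_I_angle[OF rc(3) \<theta>(2)] rc(1) by (auto simp: w_def ray_def)
  have e: "slice_emb J z = slice_emb K w" using rc(4) by (simp add: w_def slice_emb_scaleR expJ_eq)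
  have R: "Re z = Re w" using slice_emb_re[OF J, of z] slice_emb_re[OF rc(2), of w] e by simp
  have "norm z = norm w" using norm_slice_emb[OF J, of z] norm_slice_emb[OF rc(2), of w] e by simp
  then have "(Re z)\<^sup>2 + (Im z)\<^sup>2 = (Re w)\<^sup>2 + (Im w)\<^sup>2" by (simp only: cmod_power2[symmetric])
  then have "\<bar>Im z\<bar> = \<bar>Im w\<bar>" using R by (simp add: abs_eq_iff power2_eq_iff)
  then show "z \<in> bisector \<theta>" using w R by (simp add: bisector_def)
qed

lemma D_sectorE:
  assumes "s \<in> D_sector \<theta>" "\<theta> < pi / 2"
  obtains J z where "J \<in> unit_sphere" "z \<in> bisector \<theta>" "s = slice_emb J z"
proof -
  obtain r J c where rc: "r > 0" "J \<in> unit_sphere" "c \<in> I_angle \<theta>" "s = r *\<^sub>R expJ J c"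
    using assms(1) unfolding D_sector_def by blast
  have "s = slice_emb J (of_real r * cis c)" using rc(4) by (simp add: slice_emb_scaleR expJ_eq)
  moreover have "of_real r * cis c \<in> bisector \<theta>" using ray_I_angle[OF rc(3) assms(2)] rc(1) by (auto simp: ray_def)
  ultimately show thesis using that rc(2) by blast
qed

text \<open>The set \<open>C\<close> compares the norm of the vector part with the real part. It is
  closed, contains the sector, and misses the given point because the inequality there is strictly
  reversed.\<close>

lemma closure_D_sector_outside:
  assumes J: "J \<in> unit_sphere" and \<omega>: "0 < \<omega>" "\<omega> < pi / 2" and z: "z \<in> outside \<omega>"
  shows "slice_emb J z \<notin> closure (D_sector \<omega>)"
proof -
  define C :: "(real ^ 'a set) set" where "C = {s. cos \<omega> * norm (s - (s $ {}) *\<^sub>R cl_one) \<le> sin \<omega> * \<bar>s $ {}\<bar>}"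
  have vec: "slice_emb K w - Re w *\<^sub>R cl_one = Im w *\<^sub>R K" "slice_emb K w $ {} = Re w"
    if "K \<in> unit_sphere" for K :: "real ^ 'a set" and w
    using slice_emb_re[OF that, of w] by (simp_all add: re_part_def slice_emb_eq)
  have "closed C" unfolding C_def
    by (intro closed_Collect_le continuous_intros bounded_linear.continuous_on[OF bounded_linear_vec_nth])
  moreover have "D_sector \<omega> \<subseteq> C"
  proof
    fix s :: "real ^ 'a set" assume "s \<in> D_sector \<omega>"
    then obtain K w where K: "K \<in> unit_sphere" "w \<in> bisector \<omega>" "s = slice_emb K w"
      by (rule D_sectorE[OF _ \<omega>(2)])
    then show "s \<in> C" using unit_sphere_norm[OF K(1)] by (simp add: C_def vec bisector_def less_imp_le)
  qed
  ultimately have "closure (D_sector \<omega>) \<subseteq> C" by (rule closure_minimal[rotated])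
  moreover have "slice_emb J z \<notin> C" using z unit_sphere_norm[OF J] by (simp add: C_def vec[OF J] outside_def)
  ultimately show ?thesis by blast
qed

section \<open>The resolvent of a bisectorial operator\<close>

lemma is_bdd_inverse_unique:
  assumes "is_bdd_inverse D A B" "is_bdd_inverse D A B'"
  shows "B = B'"
proof (rule blinfun_eqI)
  fix v
  have "blinfun_apply B' v \<in> D" "A (blinfun_apply B' v) = v" using assms(2) by (auto simp: is_bdd_inverse_def)
  then show "blinfun_apply B v = blinfun_apply B' v" using assms(1) unfolding is_bdd_inverse_def by metis
qed

locale bisectorial_operator =
  fixes \<omega> :: real and D :: "('v::banach ^ 'n::{finite,linorder} set) set" and T :: "'v ^ 'n set \<Rightarrow> 'v ^ 'n set"
  assumes omega: "0 < \<omega>" "\<omega> < pi / 2" and bis: "bisectorial \<omega> D T"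
begin

text \<open>Only the real part and the modulus of z enter, so one family indexed by complex numbers
  serves all slices and is invariant under conjugation.\<close>

definition Qop :: "complex \<Rightarrow> 'v ^ 'n set \<Rightarrow> 'v ^ 'n set" where
  "Qop z v = T (T v) - (2 * Re z) *\<^sub>R T v + (norm z)\<^sup>2 *\<^sub>R v"

definition QT :: "complex \<Rightarrow> ('v ^ 'n set) \<Rightarrow>\<^sub>L ('v ^ 'n set)" where
  "QT z = bdd_inverse (dom_sq D T) (Qop z)"

definition PT :: "complex \<Rightarrow> ('v ^ 'n set) \<Rightarrow>\<^sub>L ('v ^ 'n set)" where
  "PT z = Blinfun (\<lambda>v. T (blinfun_apply (QT z) v))"

lemma closed_T: "closed_right_linear D T"
  using bis unfolding bisectorial_def by blast

lemma T_add: "u \<in> D \<Longrightarrow> v \<in> D \<Longrightarrow> u + v \<in> D" "u \<in> D \<Longrightarrow> v \<in> D \<Longrightarrow> T (u + v) = T u + T v"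
  using closed_T unfolding closed_right_linear_def by auto

lemma T_scaleR: "v \<in> D \<Longrightarrow> r *\<^sub>R v \<in> D" "v \<in> D \<Longrightarrow> T (r *\<^sub>R v) = r *\<^sub>R T v"
proof -
  have "v \<cdot>\<^sub>r (r *\<^sub>R cl_one) \<in> D \<and> T (v \<cdot>\<^sub>r (r *\<^sub>R cl_one)) = T v \<cdot>\<^sub>r (r *\<^sub>R cl_one)" if "v \<in> D"
    using that closed_T unfolding closed_right_linear_def by blast
  then show "v \<in> D \<Longrightarrow> r *\<^sub>R v \<in> D" "v \<in> D \<Longrightarrow> T (r *\<^sub>R v) = r *\<^sub>R T v" by (simp_all add: cl_rmult_real)
qed

lemma T_diff: "u \<in> D \<Longrightarrow> v \<in> D \<Longrightarrow> u - v \<in> D" "u \<in> D \<Longrightarrow> v \<in> D \<Longrightarrow> T (u - v) = T u - T v"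
  using T_add[of u "(- 1) *\<^sub>R v"] T_scaleR[of v "- 1"] by auto

lemma Q_op_slice_emb:
  assumes "J \<in> unit_sphere"
  shows "Q_op T (slice_emb J z) = Qop z"
  using slice_emb_re[OF assms, of z] norm_slice_emb[OF assms, of z] by (simp add: Q_op_def Qop_def fun_eq_iff)

lemma QT_inverse:
  assumes "z \<in> outside \<omega>"
  shows "is_bdd_inverse (dom_sq D T) (Qop z) (QT z)"
proof -
  obtain J :: "real ^ 'n set" where J: "J \<in> unit_sphere" using unit_sphere_nonempty by blast
  have "slice_emb J z \<notin> S_spectrum D T"
    using closure_D_sector_outside[OF J omega assms] bis unfolding bisectorial_def by blast
  then have "slice_emb J z \<in> S_resolvent_set D T"
    using slice_emb_paravector[OF J, of z] unfolding S_spectrum_def by blast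
  then obtain B where "is_bdd_inverse (dom_sq D T) (Qop z) B"
    unfolding S_resolvent_set_def Q_op_slice_emb[OF J] mem_Collect_eq by blast
  then show ?thesis unfolding QT_def bdd_inverse_def
    by (rule theI) (rule is_bdd_inverse_unique[OF _ \<open>is_bdd_inverse (dom_sq D T) (Qop z) B\<close>])
qed

context
  fixes z assumes z: "z \<in> outside \<omega>"
begin

lemma QT_dom: "blinfun_apply (QT z) v \<in> D" "T (blinfun_apply (QT z) v) \<in> D"
  and Qop_QT: "Qop z (blinfun_apply (QT z) v) = v"
  and QT_Qop: "v \<in> D \<Longrightarrow> T v \<in> D \<Longrightarrow> blinfun_apply (QT z) (Qop z v) = v"
  using QT_inverse[OF z] unfolding is_bdd_inverse_def dom_sq_def by auto

text \<open>The graph is the preimage of the closed graph of T under the continuous map that applies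
  \<open>QT z\<close> to the first component, so the closed graph theorem applies.\<close>

lemma bounded_linear_T_QT: "bounded_linear (\<lambda>v. T (blinfun_apply (QT z) v))"
proof (rule closed_graph_bounded_linear)
  show "linear (\<lambda>v. T (blinfun_apply (QT z) v))"
    by (rule linearI) (simp_all add: blinfun.add_right blinfun.scaleR_right T_add T_scaleR QT_dom)
  have "closed {(v, T v) |v. v \<in> D}" using closed_T unfolding closed_right_linear_def by blast
  moreover have "continuous_on UNIV (\<lambda>x. (blinfun_apply (QT z) (fst x), snd x))"
    by (intro continuous_intros)
  ultimately have "closed ((\<lambda>x. (blinfun_apply (QT z) (fst x), snd x)) -` {(v, T v) |v. v \<in> D})"
    by (rule closed_vimage)
  also have "(\<lambda>x. (blinfun_apply (QT z) (fst x), snd x)) -` {(v, T v) |v. v \<in> D} =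
      {(v, T (blinfun_apply (QT z) v)) |v. True}"
    using QT_dom(1) by auto
  finally show "closed {(v, T (blinfun_apply (QT z) v)) |v. True}" .
qed

lemma PT_apply: "blinfun_apply (PT z) v = T (blinfun_apply (QT z) v)"
  unfolding PT_def by (simp add: bounded_linear_Blinfun_apply[OF bounded_linear_T_QT])

lemma T_square_QT: "T (T (blinfun_apply (QT z) v)) = v + (2 * Re z) *\<^sub>R T (blinfun_apply (QT z) v) - (norm z)\<^sup>2 *\<^sub>R blinfun_apply (QT z) v"
  using Qop_QT[of v] unfolding Qop_def by (simp add: algebra_simps)

text \<open>For v in the domain of T, \<open>T_square_QT\<close> puts T T u into the domain, where u
  is \<open>QT z\<close> applied to v. Hence \<open>Qop z\<close> may be applied to T u and commutes
  with T there; inverting it gives the claim.\<close>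

lemma T_QT_commute:
  assumes v: "v \<in> D"
  shows "T (blinfun_apply (QT z) v) = blinfun_apply (QT z) (T v)"
proof -
  let ?u = "blinfun_apply (QT z) v"
  have TTD: "T (T ?u) \<in> D" unfolding T_square_QT by (intro T_add T_diff T_scaleR v QT_dom)
  have "Qop z (T ?u) = T (Qop z ?u)"
    unfolding Qop_def using TTD by (simp add: T_add T_diff T_scaleR QT_dom)
  also have "\<dots> = T v" by (simp add: Qop_QT)
  finally have "blinfun_apply (QT z) (T v) = blinfun_apply (QT z) (Qop z (T ?u))" by simp
  also have "\<dots> = T ?u" by (rule QT_Qop[OF QT_dom(2) TTD])
  finally show ?thesis by simp
qed

end

text \<open>Moving T past \<open>QT z\<close> shows that \<open>Qop w\<close> takes the left side to
  \<open>QT z\<close> applied to v, and \<open>QT w\<close> inverts \<open>Qop w\<close>.\<close>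

lemma QT_commute:
  assumes z: "z \<in> outside \<omega>" and w: "w \<in> outside \<omega>"
  shows "blinfun_apply (QT z) (blinfun_apply (QT w) v) = blinfun_apply (QT w) (blinfun_apply (QT z) v)"
proof -
  let ?u = "blinfun_apply (QT z) (blinfun_apply (QT w) v)"
  have T1: "T ?u = blinfun_apply (QT z) (T (blinfun_apply (QT w) v))" by (rule T_QT_commute[OF z QT_dom(1)[OF w]])
  have T2: "T (T ?u) = blinfun_apply (QT z) (T (T (blinfun_apply (QT w) v)))"
    unfolding T1 by (rule T_QT_commute[OF z QT_dom(2)[OF w]])
  have "Qop w ?u = blinfun_apply (QT z) (Qop w (blinfun_apply (QT w) v))"
    unfolding Qop_def unfolding T2 unfolding T1 by (simp add: blinfun.add_right blinfun.diff_right blinfun.scaleR_right)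
  also have "\<dots> = blinfun_apply (QT z) v" by (simp add: Qop_QT[OF w])
  finally have "blinfun_apply (QT w) (blinfun_apply (QT z) v) = blinfun_apply (QT w) (Qop w ?u)" by simp
  also have "\<dots> = ?u" by (rule QT_Qop[OF w QT_dom[OF z]])
  finally show ?thesis by simp
qed

lemma S_L_resolvent_eq:
  assumes z: "z \<in> outside \<omega>" and J: "J \<in> unit_sphere"
  shows "S_L_resolvent D T (slice_emb J z) = (QT z o\<^sub>L left_op (slice_emb J (cnj z))) - PT z"
proof (rule blinfun_eqI)
  fix v
  have *: "bounded_linear (\<lambda>v. blinfun_apply (QT z) (slice_emb J (cnj z) \<cdot>\<^sub>l v) - T (blinfun_apply (QT z) v))"
    by (intro bounded_linear_sub bounded_linear_T_QT z bounded_linear_compose[OF blinfun.bounded_linear_right] bounded_linear_cl_lmult)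
  show "blinfun_apply (S_L_resolvent D T (slice_emb J z)) v = blinfun_apply ((QT z o\<^sub>L left_op (slice_emb J (cnj z))) - PT z) v"
    unfolding S_L_resolvent_def Let_def Q_op_slice_emb[OF J] QT_def[symmetric] slice_emb_cnj[OF J]
      bounded_linear_Blinfun_apply[OF *]
    by (simp add: blinfun.diff_left PT_apply[OF z])
qed

lemma outside_Im_ge:
  assumes "z \<in> outside \<phi>" "0 < \<phi>" "\<phi> < pi / 2"
  shows "sin \<phi> * norm z \<le> \<bar>Im z\<bar>"
proof -
  have s: "sin \<phi> > 0" by (rule sin_gt_zero) (use assms in linarith)+
  have "(sin \<phi> * \<bar>Re z\<bar>)\<^sup>2 \<le> (cos \<phi> * \<bar>Im z\<bar>)\<^sup>2"
    using assms(1) s unfolding outside_def by (intro power_mono) auto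
  then have "(sin \<phi>)\<^sup>2 * ((Re z)\<^sup>2 + (Im z)\<^sup>2) \<le> ((sin \<phi>)\<^sup>2 + (cos \<phi>)\<^sup>2) * (Im z)\<^sup>2"
    by (simp only: power_mult_distrib power2_abs distrib_right distrib_left)
  then have "(sin \<phi> * norm z)\<^sup>2 \<le> \<bar>Im z\<bar>\<^sup>2"
    by (simp only: power_mult_distrib cmod_power2 sin_cos_squared_add power2_abs mult_1)
  then show ?thesis by (rule power2_le_imp_le) simp
qed

text \<open>
  The bounds on $Q_s[T]^{-1}$ and $T Q_s[T]^{-1}$ come from comparing the S-resolvents at \<open>s\<close> and
  its conjugate, which differ by $2 Q_s[T]^{-1} J \operatorname{Im} s$ up to sign.
\<close>

lemma QT_PT_bound:
  assumes \<phi>: "\<omega> < \<phi>" "\<phi> < pi / 2"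
  shows "\<exists>C. \<forall>z\<in>outside \<phi>. norm (QT z) \<le> C / (norm z)\<^sup>2 \<and> norm (PT z) \<le> C / norm z"
proof -
  obtain J :: "real ^ 'n set" where J: "J \<in> unit_sphere" using unit_sphere_nonempty by blast
  obtain C where C: "C \<ge> 0" "\<And>s. s \<in> paravectors - (D_sector \<phi> \<union> {0}) \<Longrightarrow> norm (S_L_resolvent D T s) \<le> C / norm s"
    using bis \<phi> unfolding bisectorial_def by (metis greaterThanLessThan_iff)
  define L :: "('v ^ 'n set) \<Rightarrow>\<^sub>L ('v ^ 'n set)" where "L = left_op J"
  have sp: "sin \<phi> > 0" by (rule sin_gt_zero) (use \<phi> omega in linarith)+
  have LL: "L o\<^sub>L L = - id_blinfun"
    by (rule blinfun_eqI) (simp add: L_def unit_sphere_lmult_twice[OF J] blinfun.minus_left)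
  have emb: "left_op (slice_emb J w) = Re w *\<^sub>R id_blinfun + Im w *\<^sub>R L" for w
    by (rule blinfun_eqI) (simp add: L_def slice_emb_lmult blinfun.add_left blinfun.scaleR_left)
  \<comment> \<open>The division by sin \<phi> comes from |Im z| >= sin \<phi> |z| outside the
    double sector, the factor \<open>norm L\<close> from removing J again.\<close>
  define K where "K = C * norm L / sin \<phi>"
  have K0: "K \<ge> 0" using C(1) sp by (simp add: K_def)
  note bb = bounded_bilinear_blinfun_compose
  have "norm (QT z) \<le> K / (norm z)\<^sup>2 \<and> norm (PT z) \<le> (K * (1 + norm L) + C) / norm z" if z: "z \<in> outside \<phi>" for z
  proof -
    have zo: "z \<in> outside \<omega>" "cnj z \<in> outside \<omega>"
      using z outside_cnj[of z \<omega>] outside_mono[of \<omega> \<phi>] omega \<phi> by auto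
    have "norm z > 0" using z by (auto simp: outside_def)
    have nb: "w \<notin> bisector \<phi>" if "w \<in> outside \<phi>" for w using that by (auto simp: outside_def bisector_def)
    have bound: "norm (S_L_resolvent D T (slice_emb J w)) \<le> C / norm z" if w: "w \<in> outside \<phi>" "norm w = norm z" for w
    proof -
      have "slice_emb J w \<in> paravectors - (D_sector \<phi> \<union> {0})"
        using slice_emb_paravector[OF J, of w] slice_emb_in_D_sector[OF J, of \<phi> w] nb[OF w(1)] \<phi> omega
          norm_slice_emb[OF J, of w] w(2) \<open>norm z > 0\<close> by auto
      from C(2)[OF this] show ?thesis by (simp add: norm_slice_emb[OF J] w(2))
    qed
    have QPcnj: "QT (cnj z) = QT z" "PT (cnj z) = PT z" unfolding PT_def QT_def Qop_def[abs_def] by simp_all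
    have S: "S_L_resolvent D T (slice_emb J z) = (Re z *\<^sub>R QT z - Im z *\<^sub>R (QT z o\<^sub>L L)) - PT z"
      unfolding S_L_resolvent_eq[OF zo(1) J] emb
      by (simp add: bounded_bilinear.add_right[OF bb] bounded_bilinear.scaleR_right[OF bb] bounded_bilinear.diff_right[OF bb] blinfun_compose_id)
    have S': "S_L_resolvent D T (slice_emb J (cnj z)) = (Re z *\<^sub>R QT z + Im z *\<^sub>R (QT z o\<^sub>L L)) - PT z"
      unfolding S_L_resolvent_eq[OF zo(2) J] emb QPcnj
      by (simp add: bounded_bilinear.add_right[OF bb] bounded_bilinear.scaleR_right[OF bb] blinfun_compose_id)
    have b1: "norm (S_L_resolvent D T (slice_emb J z)) \<le> C / norm z" by (rule bound) (use z in auto)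
    have b2: "norm (S_L_resolvent D T (slice_emb J (cnj z))) \<le> C / norm z" by (rule bound) (use z in auto)
    have e: "(2 * Im z) *\<^sub>R (QT z o\<^sub>L L) = S_L_resolvent D T (slice_emb J (cnj z)) - S_L_resolvent D T (slice_emb J z)"
      unfolding S S' by (simp add: scaleR_2[symmetric] algebra_simps)
    have "norm ((2 * Im z) *\<^sub>R (QT z o\<^sub>L L)) \<le> C / norm z + C / norm z"
      unfolding e by (rule order_trans[OF norm_triangle_ineq4 add_mono[OF b2 b1]])
    then have 1: "\<bar>Im z\<bar> * norm (QT z o\<^sub>L L) \<le> C / norm z" by (simp add: abs_mult)
    have "sin \<phi> * norm z * norm (QT z o\<^sub>L L) \<le> \<bar>Im z\<bar> * norm (QT z o\<^sub>L L)"
      using outside_Im_ge[OF z] \<phi> omega by (intro mult_right_mono) auto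
    with 1 have "sin \<phi> * norm z * norm (QT z o\<^sub>L L) \<le> C / norm z" by linarith
    then have 2: "norm (QT z o\<^sub>L L) \<le> C / (sin \<phi> * (norm z)\<^sup>2)"
      using sp \<open>norm z > 0\<close> by (simp add: field_simps power2_eq_square)
    \<comment> \<open>Because \<open>L\<close> squares to minus the identity, the operator
      \<open>QT z\<close> is recovered from its composition with \<open>L\<close> by composing once
      more.\<close>
    have assoc: "(QT z o\<^sub>L L) o\<^sub>L L = QT z o\<^sub>L (L o\<^sub>L L)" by (rule blinfun_eqI) simp
    have QL: "QT z = - ((QT z o\<^sub>L L) o\<^sub>L L)"
      by (simp add: assoc LL bounded_bilinear.minus_right[OF bb] blinfun_compose_id)
    have "norm (QT z) = norm ((QT z o\<^sub>L L) o\<^sub>L L)" by (subst QL) (rule norm_minus_cancel)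
    also have "\<dots> \<le> norm (QT z o\<^sub>L L) * norm L" by (rule norm_blinfun_compose)
    also have "\<dots> \<le> C / (sin \<phi> * (norm z)\<^sup>2) * norm L" by (rule mult_right_mono[OF 2]) simp
    also have "\<dots> = K / (norm z)\<^sup>2" by (simp add: K_def)
    finally have Q: "norm (QT z) \<le> K / (norm z)\<^sup>2" .
    have PL: "PT z = (QT z o\<^sub>L left_op (slice_emb J (cnj z))) - S_L_resolvent D T (slice_emb J z)"
      unfolding S_L_resolvent_eq[OF zo(1) J] by simp
    have "norm (PT z) \<le> norm (QT z) * norm (left_op (slice_emb J (cnj z)) :: ('v ^ 'n set) \<Rightarrow>\<^sub>L ('v ^ 'n set)) + C / norm z"
      by (subst PL) (rule order_trans[OF norm_triangle_ineq4 add_mono[OF norm_blinfun_compose b1]])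
    also have "norm (left_op (slice_emb J (cnj z)) :: ('v ^ 'n set) \<Rightarrow>\<^sub>L ('v ^ 'n set)) \<le> norm z * (1 + norm L)"
    proof -
      have "norm (left_op (slice_emb J (cnj z)) :: ('v ^ 'n set) \<Rightarrow>\<^sub>L ('v ^ 'n set)) \<le> \<bar>Re z\<bar> * norm (id_blinfun :: ('v ^ 'n set) \<Rightarrow>\<^sub>L ('v ^ 'n set)) + \<bar>Im z\<bar> * norm L"
        unfolding emb by (rule order_trans[OF norm_triangle_ineq]) simp
      also have "\<dots> \<le> norm z * 1 + norm z * norm L"
        by (intro add_mono mult_mono abs_Re_le_cmod abs_Im_le_cmod) (auto simp: norm_blinfun_id_le)
      finally show ?thesis by (simp add: distrib_left)
    qed
    also have "norm (QT z) * (norm z * (1 + norm L)) \<le> K / (norm z)\<^sup>2 * (norm z * (1 + norm L))"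
      by (rule mult_right_mono[OF Q]) simp
    also have "K / (norm z)\<^sup>2 * (norm z * (1 + norm L)) + C / norm z = (K * (1 + norm L) + C) / norm z"
      using \<open>norm z > 0\<close> by (simp add: power2_eq_square add_divide_distrib)
    finally show ?thesis using Q by (simp add: mult_left_mono)
  qed
  note bounds = this
  have "norm (QT z) \<le> max K (K * (1 + norm L) + C) / (norm z)\<^sup>2 \<and> norm (PT z) \<le> max K (K * (1 + norm L) + C) / norm z"
    if "z \<in> outside \<phi>" for z
  proof -
    have "K / (norm z)\<^sup>2 \<le> max K (K * (1 + norm L) + C) / (norm z)\<^sup>2"
      "(K * (1 + norm L) + C) / norm z \<le> max K (K * (1 + norm L) + C) / norm z"
      by (intro divide_right_mono; simp)+
    then show ?thesis using bounds[OF that] by linarith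
  qed
  then show ?thesis by blast
qed

lemma bisectorial_resolvent_QT_PT: "bisectorial_resolvent \<omega> QT PT"
proof
  show "0 < \<omega>" "\<omega> < pi / 2" by (rule omega)+
  show "QT (cnj z) = QT z" "PT (cnj z) = PT z" for z unfolding PT_def QT_def Qop_def[abs_def] by simp_all
  show "\<exists>C. \<forall>z\<in>outside \<phi>. norm (QT z) \<le> C / (norm z)\<^sup>2 \<and> norm (PT z) \<le> C / norm z" if "\<omega> < \<phi>" "\<phi> < pi / 2" for \<phi>
    by (rule QT_PT_bound[OF that])
  fix z w assume z: "z \<in> outside \<omega>" and w: "w \<in> outside \<omega>"
  note Tc = T_QT_commute[OF z QT_dom(1)[OF w]] T_QT_commute[OF w QT_dom(1)[OF z]]
    T_QT_commute[OF z QT_dom(2)[OF w]] T_QT_commute[OF w QT_dom(2)[OF z]]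
  note ap = PT_apply[OF z] PT_apply[OF w] blinfun.add_left blinfun.diff_left blinfun.scaleR_left
  show "QT z o\<^sub>L QT w = QT w o\<^sub>L QT z" by (rule blinfun_eqI) (simp add: QT_commute[OF z w])
  show PQ: "PT z o\<^sub>L QT w = QT w o\<^sub>L PT z"
    by (rule blinfun_eqI) (simp add: ap QT_commute[OF z w] Tc)
  show "PT z o\<^sub>L QT w = QT z o\<^sub>L PT w"
    by (rule blinfun_eqI) (simp add: ap Tc)
  show "PT z o\<^sub>L PT w = PT w o\<^sub>L PT z"
  proof (rule blinfun_eqI)
    fix v
    have "T (blinfun_apply (QT z) (T (blinfun_apply (QT w) v))) = T (T (blinfun_apply (QT z) (blinfun_apply (QT w) v)))"
      by (simp only: Tc)
    also have "\<dots> = T (T (blinfun_apply (QT w) (blinfun_apply (QT z) v)))" by (simp only: QT_commute[OF z w])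
    also have "\<dots> = T (blinfun_apply (QT w) (T (blinfun_apply (QT z) v)))" by (simp only: Tc)
    finally show "blinfun_apply (PT z o\<^sub>L PT w) v = blinfun_apply (PT w o\<^sub>L PT z) v" by (simp add: ap)
  qed
  \<comment> \<open>Inserts \<open>Qop w\<close> between \<open>QT z\<close> and
    \<open>QT w\<close>, which changes nothing since it inverts \<open>QT w\<close>, and moves every
    T past \<open>QT z\<close>.\<close>
  have split: "blinfun_apply (QT z) v = blinfun_apply (PT z o\<^sub>L PT w) v - (2 * Re w) *\<^sub>R blinfun_apply (PT z o\<^sub>L QT w) v
      + (norm w)\<^sup>2 *\<^sub>R blinfun_apply (QT z o\<^sub>L QT w) v"
    if z: "z \<in> outside \<omega>" and w: "w \<in> outside \<omega>" for z w v
  proof -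
    have "blinfun_apply (QT z) v = blinfun_apply (QT z) (Qop w (blinfun_apply (QT w) v))" by (simp add: Qop_QT[OF w])
    then show ?thesis
      unfolding Qop_def
      by (simp add: PT_apply[OF z] PT_apply[OF w] blinfun.add_right blinfun.diff_right blinfun.scaleR_right
          T_QT_commute[OF z QT_dom(1)[OF w]] T_QT_commute[OF z QT_dom(2)[OF w]])
  qed
  show "QT z = (PT z o\<^sub>L PT w) - (2 * Re w) *\<^sub>R (PT z o\<^sub>L QT w) + (norm w)\<^sup>2 *\<^sub>R (QT z o\<^sub>L QT w)"
    by (rule blinfun_eqI) (simp only: blinfun.add_left blinfun.diff_left blinfun.scaleR_left split[OF z w])
  show "PT z - PT w = (2 * (Re z - Re w)) *\<^sub>R (PT z o\<^sub>L PT w) + ((norm w)\<^sup>2 - (norm z)\<^sup>2) *\<^sub>R (PT z o\<^sub>L QT w)"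
  proof (rule blinfun_eqI)
    fix v
    let ?u = "blinfun_apply (QT z) (blinfun_apply (QT w) v)"
    have u': "blinfun_apply (QT w) (blinfun_apply (QT z) v) = ?u" by (simp add: QT_commute[OF z w])
    have TTu: "T (T ?u) = blinfun_apply (QT z) (T (T (blinfun_apply (QT w) v)))" by (simp only: Tc)
    have Du: "?u \<in> D" "T ?u \<in> D" "T (T ?u) \<in> D"
      unfolding TTu using QT_dom[OF z] by auto
    have Qz: "blinfun_apply (QT z) v = T (T ?u) - (2 * Re w) *\<^sub>R T ?u + (norm w)\<^sup>2 *\<^sub>R ?u"
    proof -
      have "blinfun_apply (QT z) v = blinfun_apply (QT z) (Qop w (blinfun_apply (QT w) v))" by (simp add: Qop_QT[OF w])
      then show ?thesis unfolding Qop_def by (simp add: blinfun.add_right blinfun.diff_right blinfun.scaleR_right Tc)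
    qed
    have Qw: "blinfun_apply (QT w) v = T (T ?u) - (2 * Re z) *\<^sub>R T ?u + (norm z)\<^sup>2 *\<^sub>R ?u"
      using Qop_QT[OF z, of "blinfun_apply (QT w) v"] unfolding Qop_def by simp
    \<comment> \<open>Both terms are T applied to expressions in \<open>?u\<close>; the third powers
      of T cancel in the difference.\<close>
    have "T (blinfun_apply (QT z) v) - T (blinfun_apply (QT w) v)
      = (2 * (Re z - Re w)) *\<^sub>R T (T ?u) + ((norm w)\<^sup>2 - (norm z)\<^sup>2) *\<^sub>R T ?u"
    proof -
      have "T (blinfun_apply (QT z) v) = T (T (T ?u)) - (2 * Re w) *\<^sub>R T (T ?u) + (norm w)\<^sup>2 *\<^sub>R T ?u"
        by (rule trans[OF arg_cong[OF Qz, of T]]) (simp only: T_add T_diff T_scaleR Du)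
      moreover have "T (blinfun_apply (QT w) v) = T (T (T ?u)) - (2 * Re z) *\<^sub>R T (T ?u) + (norm z)\<^sup>2 *\<^sub>R T ?u"
        by (rule trans[OF arg_cong[OF Qw, of T]]) (simp only: T_add T_diff T_scaleR Du)
      ultimately show ?thesis by (simp only: right_diff_distrib scaleR_diff_left) simp
    qed
    then show "blinfun_apply (PT z - PT w) v = blinfun_apply ((2 * (Re z - Re w)) *\<^sub>R (PT z o\<^sub>L PT w) + ((norm w)\<^sup>2 - (norm z)\<^sup>2) *\<^sub>R (PT z o\<^sub>L QT w)) v"
      by (simp only: ap blinfun_apply_blinfun_compose Tc)
  qed
qed

end

section \<open>The integral in a slice\<close>

lemma ray_integral_cnj:
  assumes "\<And>z. z \<in> ray a \<Longrightarrow> F (cnj z) = cnj (F z)"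
  shows "ray_integral (- a) F = cnj (ray_integral a F)"
proof -
  have "(LINT t:{0<..}|lborel. F (of_real t * cis (- a))) = (LINT t:{0<..}|lborel. cnj (F (of_real t * cis a)))"
  proof (rule set_lebesgue_integral_cong)
    show "\<forall>t. t \<in> {0<..} \<longrightarrow> F (of_real t * cis (- a)) = cnj (F (of_real t * cis a))"
    proof (intro allI impI)
      fix t :: real assume "t \<in> {0<..}"
      then have "of_real t * cis a \<in> ray a" by (auto simp: ray_def)
      moreover have "of_real t * cis (- a) = cnj (of_real t * cis a)" by (simp add: cis_cnj)
      ultimately show "F (of_real t * cis (- a)) = cnj (F (of_real t * cis a))" using assms by metis
    qed
  qed simp
  also have "\<dots> = cnj (LINT t:{0<..}|lborel. F (of_real t * cis a))"
    unfolding set_lebesgue_integral_def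
    using integral_bounded_linear'[OF bounded_linear_cnj bounded_linear_cnj, of lborel "\<lambda>t. indicat_real {0<..} t *\<^sub>R F (of_real t * cis a)"] by simp
  finally show ?thesis by (simp add: ray_integral_def cis_cnj)
qed

text \<open>Conjugation exchanges outgoing and incoming rays, so the oriented sum consists of
  differences of conjugate numbers. It is purely imaginary, and so is the factor 2 pi i.\<close>

lemma boundary_integral_real:
  assumes "\<And>z. z \<in> boundary \<phi> \<Longrightarrow> F (cnj z) = cnj (F z)"
  shows "Im (boundary_integral \<phi> F) = 0"
proof -
  have 1: "ray_integral (- \<phi>) F = cnj (ray_integral \<phi> F)"
    by (rule ray_integral_cnj) (use assms in \<open>auto simp: boundary_eq\<close>)
  have "ray_integral (- (pi + \<phi>)) F = cnj (ray_integral (pi + \<phi>) F)"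
    by (rule ray_integral_cnj) (use assms in \<open>auto simp: boundary_eq\<close>)
  then have 2: "ray_integral (pi - \<phi>) F = cnj (ray_integral (pi + \<phi>) F)"
    using ray_integral_periodic[of "- (pi + \<phi>)" F] by simp
  show ?thesis
    unfolding boundary_integral_eq 1 2 by (simp add: Im_divide)
qed

context bisectorial_resolvent
begin

lemma res_cnj: "res l (cnj z) = cnj (res l z)"
  by (simp add: res_def cnj)

text \<open>The difference of \<open>Q_expand\<close> for the pairs (z, w) and (w, z): after
  commutation the term with two factors P drops out.\<close>

lemma Q_diff:
  assumes "z \<in> outside \<omega>" "w \<in> outside \<omega>"
  shows "Q z - Q w = (2 * (Re z - Re w)) *\<^sub>R (P z o\<^sub>L Q w) + ((norm w)\<^sup>2 - (norm z)\<^sup>2) *\<^sub>R (Q z o\<^sub>L Q w)"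
proof -
  have cancel: "a + (b + d') = a' + (b' + d)" if "a + b = c + d" "a' + b' = c + d'"
    for a b c d a' b' d' :: "'x \<Rightarrow>\<^sub>L 'x"
    using that by (simp add: add.assoc[symmetric])
  show ?thesis
    using Q_expand[OF assms] Q_expand[OF assms(2,1)] PP[OF assms] QQ[OF assms] PQ[OF assms] PQ'[OF assms(2,1)]
    by (simp add: algebra_simps) (rule cancel)
qed

text \<open>Continuity in the operator norm, which the operator valued gauge integral relies on. The
  difference formulas bound the increments by local bounds times the changes of the real part and of
  the squared modulus.\<close>

lemma isCont_Q_P:
  assumes z: "z \<in> outside \<omega>"
  shows "isCont Q z" "isCont P z"
proof -
  obtain \<phi> where \<phi>: "\<omega> < \<phi>" "\<phi> < pi / 2" "z \<in> outside \<phi>" by (rule outside_inner[OF z])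
  obtain C where C: "\<And>w. w \<in> outside \<phi> \<Longrightarrow> norm (Q w) \<le> C / (norm w)\<^sup>2 \<and> norm (P w) \<le> C / norm w"
    using resolvent_bound[OF \<phi>(1,2)] by blast
  have nz: "norm z > 0" using outside_nonzero[OF z] by simp
  have "0 \<le> C / norm z" using C[OF \<phi>(3)] norm_ge_zero[of "P z"] by linarith
  then have C0: "C \<ge> 0" using nz by (simp add: zero_le_divide_iff)
  have sub: "outside \<phi> \<subseteq> outside \<omega>" by (rule outside_mono) (use omega \<phi> in auto)
  have "open (outside \<phi> \<inter> {w. norm z / 2 < norm w})"
    by (intro open_Int open_outside open_Collect_less continuous_intros)
  moreover have "z \<in> outside \<phi> \<inter> {w. norm z / 2 < norm w}" using \<phi> nz by simp
  ultimately have ev: "\<forall>\<^sub>F w in at z. w \<in> outside \<phi> \<inter> {w. norm z / 2 < norm w}"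
    by (rule eventually_at_in_open')
  define K where "K = max (C / (norm z / 2)\<^sup>2) (C / (norm z / 2))"
  have K: "norm (Q w) \<le> K \<and> norm (P w) \<le> K" if w: "w \<in> outside \<phi>" "norm z / 2 < norm w" for w
  proof -
    have "C / norm w \<le> C / (norm z / 2)"
      by (rule divide_left_mono[OF less_imp_le[OF w(2)] C0]) (rule mult_pos_pos; use w(2) nz in linarith)
    moreover have "(norm z / 2)\<^sup>2 \<le> (norm w)\<^sup>2" using w(2) nz by (intro power_mono) auto
    then have "C / (norm w)\<^sup>2 \<le> C / (norm z / 2)\<^sup>2"
      by (rule divide_left_mono[OF _ C0]) (rule mult_pos_pos; use w(2) nz in \<open>intro zero_less_power, linarith\<close>)
    ultimately show ?thesis using C[OF w(1)] by (auto simp: K_def)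
  qed
  have lim: "((\<lambda>w. \<bar>2 * (Re w - Re z)\<bar> * (K * c) + \<bar>(norm z)\<^sup>2 - (norm w)\<^sup>2\<bar> * (K * d)) \<longlongrightarrow> 0) (at z)" for c d
    by (auto intro!: tendsto_eq_intros)
  have "((\<lambda>w. Q w - Q z) \<longlongrightarrow> 0) (at z)"
  proof (rule Lim_null_comparison[OF _ lim[of "norm (Q z)" "norm (Q z)"]])
    show "\<forall>\<^sub>F w in at z. norm (Q w - Q z) \<le> \<bar>2 * (Re w - Re z)\<bar> * (K * norm (Q z)) + \<bar>(norm z)\<^sup>2 - (norm w)\<^sup>2\<bar> * (K * norm (Q z))"
      using ev
    proof eventually_elim
      case (elim w)
      then have w: "w \<in> outside \<phi>" "w \<in> outside \<omega>" "norm z / 2 < norm w" using sub by auto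
      have "norm (P w o\<^sub>L Q z) \<le> K * norm (Q z)" "norm (Q w o\<^sub>L Q z) \<le> K * norm (Q z)"
        using K[OF w(1,3)] by (auto intro!: order_trans[OF norm_blinfun_compose] mult_right_mono)
      then show ?case unfolding Q_diff[OF w(2) z]
        by (intro order_trans[OF norm_triangle_ineq add_mono]) (auto intro!: mult_left_mono)
    qed
  qed
  then show "isCont Q z" by (simp add: isCont_def LIM_zero_iff)
  have "((\<lambda>w. P w - P z) \<longlongrightarrow> 0) (at z)"
  proof (rule Lim_null_comparison[OF _ lim[of "norm (P z)" "norm (Q z)"]])
    show "\<forall>\<^sub>F w in at z. norm (P w - P z) \<le> \<bar>2 * (Re w - Re z)\<bar> * (K * norm (P z)) + \<bar>(norm z)\<^sup>2 - (norm w)\<^sup>2\<bar> * (K * norm (Q z))"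
      using ev
    proof eventually_elim
      case (elim w)
      then have w: "w \<in> outside \<phi>" "w \<in> outside \<omega>" "norm z / 2 < norm w" using sub by auto
      have "norm (P w o\<^sub>L P z) \<le> K * norm (P z)" "norm (P w o\<^sub>L Q z) \<le> K * norm (Q z)"
        using K[OF w(1,3)] by (auto intro!: order_trans[OF norm_blinfun_compose] mult_right_mono)
      then show ?case unfolding P_diff[OF w(2) z]
        by (intro order_trans[OF norm_triangle_ineq add_mono]) (auto intro!: mult_left_mono)
    qed
  qed
  then show "isCont P z" by (simp add: isCont_def LIM_zero_iff)
qed

lemma continuous_on_Q_P: "continuous_on (outside \<omega>) Q" "continuous_on (outside \<omega>) P"
  using isCont_Q_P by (auto intro!: continuous_at_imp_continuous_on)

end

text \<open>Joins two rays into one integral over the real line, as the paths of the functional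
  calculus run along one ray for t < 0 and another for t > 0.\<close>

lemma two_sided_integral:
  fixes f g :: "real \<Rightarrow> real"
  assumes f: "set_integrable lborel {0<..} f" and g: "set_integrable lborel {0<..} g"
  shows "integrable lborel (\<lambda>t. if t > 0 then f t else if t < 0 then g (- t) else 0)"
    and "(LINT t|lborel. (if t > 0 then f t else if t < 0 then g (- t) else 0))
      = (LINT t:{0<..}|lborel. f t) + (LINT t:{0<..}|lborel. g t)"
proof -
  define f' g' where "f' t = indicat_real {0<..} t *\<^sub>R f t" and "g' t = indicat_real {0<..} t *\<^sub>R g t" for t
  have i: "integrable lborel f'" "integrable lborel g'"
    using f g by (simp_all add: f'_def[abs_def] g'_def[abs_def] set_integrable_def)
  have i': "integrable lborel (\<lambda>t. g' (0 + (- 1) * t))" by (rule lborel_integrable_real_affine[OF i(2)]) simp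
  have eq: "(\<lambda>t. if t > 0 then f t else if t < 0 then g (- t) else 0) = (\<lambda>t. f' t + g' (0 + (- 1) * t))"
    by (auto simp: f'_def g'_def fun_eq_iff indicator_def)
  show "integrable lborel (\<lambda>t. if t > 0 then f t else if t < 0 then g (- t) else 0)"
    unfolding eq by (rule Bochner_Integration.integrable_add[OF i(1) i'])
  have "(LINT t|lborel. g' t) = \<bar>- 1\<bar> *\<^sub>R (LINT t|lborel. g' (0 + (- 1) * t))"
    by (rule lborel_integral_real_affine) simp
  then show "(LINT t|lborel. (if t > 0 then f t else if t < 0 then g (- t) else 0))
      = (LINT t:{0<..}|lborel. f t) + (LINT t:{0<..}|lborel. g t)"
    unfolding eq Bochner_Integration.integral_add[OF i(1) i']
    by (simp add: set_lebesgue_integral_def f'_def[abs_def] g'_def[abs_def])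
qed

lemma ray_integral_linear:
  fixes L :: "complex \<Rightarrow> real"
  assumes "ray_integrable a F" and L: "bounded_linear L"
  shows "set_integrable lborel {0<..} (\<lambda>t. L (cis a * F (of_real t * cis a)))"
    and "(LINT t:{0<..}|lborel. L (cis a * F (of_real t * cis a))) = L (ray_integral a F)"
proof -
  interpret L: bounded_linear L by (rule L)
  let ?g = "\<lambda>t. indicat_real {0<..} t *\<^sub>R (cis a * F (of_real t * cis a))"
  have i: "integrable lborel ?g"
    using assms(1) unfolding ray_integrable_def set_integrable_def[symmetric] by (rule set_integrable_mult_right)
  have e: "indicat_real {0<..} t *\<^sub>R L (cis a * F (of_real t * cis a)) = L (?g t)" for t by (simp add: L.scaleR)
  show "set_integrable lborel {0<..} (\<lambda>t. L (cis a * F (of_real t * cis a)))"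
    unfolding set_integrable_def e by (rule integrable_bounded_linear[OF L i])
  have "(LINT t:{0<..}|lborel. L (cis a * F (of_real t * cis a))) = L (LINT t|lborel. ?g t)"
    unfolding set_lebesgue_integral_def e by (rule integral_bounded_linear[OF L i])
  also have "(LINT t|lborel. ?g t) = ray_integral a F"
    unfolding set_lebesgue_integral_def[symmetric] ray_integral_def by simp
  finally show "(LINT t:{0<..}|lborel. L (cis a * F (of_real t * cis a))) = L (ray_integral a F)" .
qed

section \<open>The operator valued integral in one slice\<close>

context bisectorial_operator
begin

sublocale bisectorial_resolvent \<omega> QT PT
  by (rule bisectorial_resolvent_QT_PT)

context
  fixes J :: "real ^ 'n set" and \<phi> \<theta> :: real and h :: "real ^ 'n set \<Rightarrow> real ^ 'n set" and H :: "complex \<Rightarrow> complex"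
  assumes J: "J \<in> unit_sphere" and ang: "\<omega> < \<phi>" "\<phi> < \<theta>" "\<theta> < pi / 2"
    and H: "decaying \<theta> H" and hH: "\<And>z. z \<in> bisector \<theta> \<Longrightarrow> h (slice_emb J z) = slice_emb J (H z)"
begin

private lemma ang': "0 < \<phi>" "0 < \<theta>" "\<phi> < pi / 2" using ang omega by auto

text \<open>The ray on which the path with sign \<epsilon> runs for t > 0; \<open>angle_neg\<close>
  is the one for t < 0, which is traversed inwards.\<close>

private definition angle_pos :: "real \<Rightarrow> real" where
  "angle_pos \<epsilon> = (if \<epsilon> = 1 then - \<phi> else pi - \<phi>)"

private definition angle_neg :: "real \<Rightarrow> real" where
  "angle_neg \<epsilon> = (if \<epsilon> = 1 then \<phi> else pi + \<phi>)"

text \<open>The velocity of the path as a complex number. It is constant for t > 0 and for t < 0,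
  and the minus sign for t < 0 makes the point equal to t times the velocity on both sides.\<close>

private definition dir :: "real \<Rightarrow> real \<Rightarrow> complex" where
  "dir \<epsilon> t = (if t > 0 then cis (angle_pos \<epsilon>) else - cis (angle_neg \<epsilon>))"

private definition pt :: "real \<Rightarrow> real \<Rightarrow> complex" where
  "pt \<epsilon> t = of_real t * dir \<epsilon> t"

private definition wt :: "real \<Rightarrow> real \<Rightarrow> complex" where
  "wt \<epsilon> t = - \<i> * dir \<epsilon> t * H (pt \<epsilon> t)"

private definition LJ :: "('v ^ 'n set) \<Rightarrow>\<^sub>L ('v ^ 'n set)" where
  "LJ = left_op J"

text \<open>The integrand of \<open>omega_calc\<close> with each slice number x + J y to the right
  of an operator X expanded as x X + y (X o LJ). The value 0 at t = 0 suits the dominating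
  function.\<close>

private definition integrand :: "real \<Rightarrow> real \<Rightarrow> ('v ^ 'n set) \<Rightarrow>\<^sub>L ('v ^ 'n set)" where
  "integrand \<epsilon> t = (if t = 0 then 0 else
     Re (cnj (pt \<epsilon> t) * wt \<epsilon> t) *\<^sub>R QT (pt \<epsilon> t) + Im (cnj (pt \<epsilon> t) * wt \<epsilon> t) *\<^sub>R (QT (pt \<epsilon> t) o\<^sub>L LJ)
     - (Re (wt \<epsilon> t) *\<^sub>R PT (pt \<epsilon> t) + Im (wt \<epsilon> t) *\<^sub>R (PT (pt \<epsilon> t) o\<^sub>L LJ)))"

private lemma pt_boundary:
  assumes "t \<noteq> 0"
  shows "pt \<epsilon> t \<in> boundary \<phi>"
proof (cases "t > 0")
  case True
  then have "pt \<epsilon> t \<in> ray (angle_pos \<epsilon>)" by (auto simp: pt_def dir_def ray_def)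
  then show ?thesis by (auto simp: boundary_eq angle_pos_def split: if_splits)
next
  case False
  then have "pt \<epsilon> t = of_real (- t) * cis (angle_neg \<epsilon>)" "- t > 0" using assms by (auto simp: pt_def dir_def)
  then have "pt \<epsilon> t \<in> ray (angle_neg \<epsilon>)" unfolding ray_def by blast
  then show ?thesis by (auto simp: boundary_eq angle_neg_def split: if_splits)
qed

private lemma boundary_sub: "boundary \<phi> \<subseteq> bisector \<theta>" "boundary \<phi> \<subseteq> outside \<omega>"
  using boundary_subset_bisector[of \<phi> \<theta>] boundary_subset_outside[of \<omega> \<phi>] ang ang' omega by auto

private lemma gamma_eq:
  assumes "\<epsilon> \<in> {1, - 1}" "t \<noteq> 0"
  shows "gamma_path \<epsilon> J \<phi> t = slice_emb J (pt \<epsilon> t)"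
proof -
  have c: "cis (pi - \<phi>) = - cis (- \<phi>)" "cis (pi + \<phi>) = - cis \<phi>"
    by (simp_all add: complex_eq_iff sin_diff sin_add cos_diff cos_add)
  have "of_real (\<epsilon> * \<bar>t\<bar>) * cis (- sgn t * \<phi>) = pt \<epsilon> t"
    using assms by (auto simp: pt_def dir_def angle_pos_def angle_neg_def c sgn_if)
  then show ?thesis unfolding gamma_path_def expJ_eq slice_emb_scaleR[symmetric] by simp
qed

private lemma gamma_derivative:
  assumes "\<epsilon> \<in> {1, - 1}" "t \<noteq> 0"
  shows "vector_derivative (gamma_path \<epsilon> J \<phi>) (at t) = slice_emb J (dir \<epsilon> t)"
proof (rule vector_derivative_at)
  have "((\<lambda>u. u *\<^sub>R slice_emb J (dir \<epsilon> t)) has_vector_derivative slice_emb J (dir \<epsilon> t)) (at t)"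
    by (auto intro!: derivative_eq_intros)
  moreover have "open {u. 0 < u * t}" by (intro open_Collect_less continuous_intros)
  moreover have "t \<in> {u. 0 < u * t}" using assms(2) by (simp add: zero_less_mult_iff) linarith
  moreover have "u *\<^sub>R slice_emb J (dir \<epsilon> t) = gamma_path \<epsilon> J \<phi> u" if "u \<in> {u. 0 < u * t}" for u
  proof -
    have u: "u \<noteq> 0" "0 < u \<longleftrightarrow> 0 < t" using that by (auto simp: zero_less_mult_iff)
    show ?thesis unfolding gamma_eq[OF assms(1) u(1)] pt_def slice_emb_scaleR by (simp add: dir_def u(2))
  qed
  ultimately show "(gamma_path \<epsilon> J \<phi> has_vector_derivative slice_emb J (dir \<epsilon> t)) (at t)"
    by (rule has_vector_derivative_transform_within_open)
qed

text \<open>Left multiplication by J need not commute with the resolvent, but all slice numbers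
  stand to the right of \<open>QT\<close> and \<open>PT\<close>, where they multiply like complex
  numbers; dividing by J becomes the factor -i in \<open>wt\<close>.\<close>

private lemma integrand_eq:
  assumes "\<epsilon> \<in> {1, - 1}" "t \<noteq> 0"
  shows "S_L_resolvent D T (gamma_path \<epsilon> J \<phi> t) o\<^sub>L
     left_op (vector_derivative (gamma_path \<epsilon> J \<phi>) (at t) \<cdot>\<^sub>l pv_inverse J) o\<^sub>L
     left_op (h (gamma_path \<epsilon> J \<phi> t)) = integrand \<epsilon> t"
proof (rule blinfun_eqI)
  fix v
  have b: "pt \<epsilon> t \<in> bisector \<theta>" "pt \<epsilon> t \<in> outside \<omega>" using pt_boundary[OF assms(2)] boundary_sub by auto
  have inv: "pv_inverse J = slice_emb J (- \<i>)" using slice_emb_inverse[OF J, of \<i>] slice_emb_i[OF J] by simp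
  have em: "blinfun_apply B (slice_emb J c \<cdot>\<^sub>l v) = Re c *\<^sub>R blinfun_apply B v + Im c *\<^sub>R blinfun_apply B (J \<cdot>\<^sub>l v)"
    for B :: "('v ^ 'n set) \<Rightarrow>\<^sub>L ('v ^ 'n set)" and c
    by (simp add: slice_emb_lmult blinfun.add_right blinfun.scaleR_right)
  have comb: "slice_emb J (dir \<epsilon> t * - \<i>) \<cdot>\<^sub>l slice_emb J (H (pt \<epsilon> t)) \<cdot>\<^sub>l v = slice_emb J (wt \<epsilon> t) \<cdot>\<^sub>l v"
    by (simp add: cl_lmult_assoc[symmetric] slice_emb_mult[OF J] wt_def mult.commute)
  have comb2: "slice_emb J (cnj (pt \<epsilon> t)) \<cdot>\<^sub>l slice_emb J (wt \<epsilon> t) \<cdot>\<^sub>l v = slice_emb J (cnj (pt \<epsilon> t) * wt \<epsilon> t) \<cdot>\<^sub>l v"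
    by (simp add: cl_lmult_assoc[symmetric] slice_emb_mult[OF J])
  show "blinfun_apply (S_L_resolvent D T (gamma_path \<epsilon> J \<phi> t) o\<^sub>L
     left_op (vector_derivative (gamma_path \<epsilon> J \<phi>) (at t) \<cdot>\<^sub>l pv_inverse J) o\<^sub>L
     left_op (h (gamma_path \<epsilon> J \<phi> t))) v = blinfun_apply (integrand \<epsilon> t) v"
    unfolding gamma_derivative[OF assms] gamma_eq[OF assms] hH[OF b(1)] inv slice_emb_mult[OF J] S_L_resolvent_eq[OF b(2) J]
      integrand_def LJ_def blinfun_apply_blinfun_compose left_op_apply
    unfolding comb
    unfolding blinfun.diff_left blinfun_apply_blinfun_compose left_op_apply
    unfolding comb2
    unfolding em
    using assms(2) by (simp add: blinfun.add_left blinfun.diff_left blinfun.scaleR_left)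
qed

private lemma continuous_dir: "continuous_on (- {0}) (dir \<epsilon>)"
proof -
  have "continuous_on ({0<..} \<union> {..<0}) (dir \<epsilon>)"
  proof (rule continuous_on_open_Un)
    show "continuous_on {0<..} (dir \<epsilon>)"
      by (rule continuous_on_eq[OF continuous_on_const[of _ "cis (angle_pos \<epsilon>)"]]) (simp add: dir_def)
    show "continuous_on {..<0} (dir \<epsilon>)"
      by (rule continuous_on_eq[OF continuous_on_const[of _ "- cis (angle_neg \<epsilon>)"]]) (simp add: dir_def)
  qed auto
  moreover have "{0<..} \<union> {..<0} = - {0::real}" by auto
  ultimately show ?thesis by simp
qed

private lemma continuous_integrand: "continuous_on (- {0}) (integrand \<epsilon>)"
proof -
  have p: "continuous_on (- {0}) (pt \<epsilon>)" unfolding pt_def by (intro continuous_intros continuous_dir)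
  have img: "pt \<epsilon> ` (- {0}) \<subseteq> boundary \<phi>" using pt_boundary by auto
  have "continuous_on (bisector \<theta>) H" using H unfolding decaying_def by (simp add: holomorphic_on_imp_continuous_on)
  then have cH: "continuous_on (- {0}) (\<lambda>t. H (pt \<epsilon> t))"
    by (rule continuous_on_compose2[OF _ p]) (use img boundary_sub in auto)
  have w: "continuous_on (- {0}) (wt \<epsilon>)" unfolding wt_def by (intro continuous_intros cH continuous_dir)
  have q: "continuous_on (- {0}) (\<lambda>t. QT (pt \<epsilon> t))"
    by (rule continuous_on_compose2[OF continuous_on_Q_P(1) p]) (use img boundary_sub in auto)
  have r: "continuous_on (- {0}) (\<lambda>t. PT (pt \<epsilon> t))"
    by (rule continuous_on_compose2[OF continuous_on_Q_P(2) p]) (use img boundary_sub in auto)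
  note bl = bounded_linear.continuous_on[OF bounded_bilinear.bounded_linear_left[OF bounded_bilinear_blinfun_compose, of LJ]]
  have "continuous_on (- {0}) (\<lambda>t. Re (cnj (pt \<epsilon> t) * wt \<epsilon> t) *\<^sub>R QT (pt \<epsilon> t) + Im (cnj (pt \<epsilon> t) * wt \<epsilon> t) *\<^sub>R (QT (pt \<epsilon> t) o\<^sub>L LJ)
     - (Re (wt \<epsilon> t) *\<^sub>R PT (pt \<epsilon> t) + Im (wt \<epsilon> t) *\<^sub>R (PT (pt \<epsilon> t) o\<^sub>L LJ)))"
    by (intro continuous_on_add continuous_on_diff continuous_on_scaleR continuous_on_Re continuous_on_Im continuous_on_mult
        continuous_on_cnj p w q r bl[OF q] bl[OF r])
  then show ?thesis by (rule continuous_on_eq) (simp add: integrand_def)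
qed

private lemma norm_pt_wt:
  assumes "\<epsilon> \<in> {1, - 1}" "t \<noteq> 0"
  shows "norm (pt \<epsilon> t) = \<bar>t\<bar>" "norm (wt \<epsilon> t) = norm (H (pt \<epsilon> t))"
  by (simp_all add: pt_def wt_def dir_def norm_mult)

private lemma rays_pm:
  assumes "\<epsilon> \<in> {1, - 1}" "boundary_integrable \<phi> F"
  shows "ray_integrable (angle_pos \<epsilon>) F" "ray_integrable (angle_neg \<epsilon>) F"
  using assms by (auto simp: angle_pos_def angle_neg_def boundary_integrable_eq)

text \<open>The resolvent bounds 1/|z|^2 for \<open>QT\<close> and 1/|z| for \<open>PT\<close>
  compensate the factor conjugate z of the former, so the norm is at most K |H(z)/z|, which is
  integrable along both rays.\<close>

private lemma integrable_integrand:
  assumes \<epsilon>: "\<epsilon> \<in> {1, - 1}"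
  shows "integrand \<epsilon> integrable_on UNIV"
proof -
  define \<psi> where "\<psi> = (\<omega> + \<phi>) / 2"
  have \<psi>: "\<omega> < \<psi>" "\<psi> < \<phi>" "\<psi> < pi / 2" "0 < \<psi>" using ang ang' omega by (auto simp: \<psi>_def)
  obtain C where C: "\<And>z. z \<in> outside \<psi> \<Longrightarrow> norm (QT z) \<le> C / (norm z)\<^sup>2 \<and> norm (PT z) \<le> C / norm z"
    using resolvent_bound[OF \<psi>(1,3)] by blast
  have sub: "boundary \<phi> \<subseteq> outside \<psi>" by (rule boundary_subset_outside) (use \<psi> ang' in auto)
  define K where "K = 2 * (C * (1 + norm LJ))"
  define b where "b t = (if t > 0 then K * norm (H (of_real t * cis (angle_pos \<epsilon>)) / (of_real t * cis (angle_pos \<epsilon>)))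
     else if t < 0 then K * norm (H (of_real (- t) * cis (angle_neg \<epsilon>)) / (of_real (- t) * cis (angle_neg \<epsilon>))) else 0)" for t
  have "boundary_integrable \<phi> (\<lambda>z. H z / z)" using H ang ang' unfolding decaying_def by auto
  note r = rays_pm[OF \<epsilon> this]
  have "integrable lborel b"
    unfolding b_def[abs_def]
    by (rule two_sided_integral(1)[of "\<lambda>t. K * norm (H (of_real t * cis (angle_pos \<epsilon>)) / (of_real t * cis (angle_pos \<epsilon>)))"
        "\<lambda>t. K * norm (H (of_real t * cis (angle_neg \<epsilon>)) / (of_real t * cis (angle_neg \<epsilon>)))"])
      (use r in \<open>auto simp: ray_integrable_def intro!: set_integrable_mult_right set_integrable_norm\<close>)
  then have ib: "b integrable_on UNIV" using has_integral_integral_lborel by blast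
  show ?thesis
  proof (rule integrable_on_UNIV_dominated[OF continuous_integrand ib])
    fix t :: real
    show "norm (integrand \<epsilon> t) \<le> b t"
    proof (cases "t = 0")
      case False
      let ?s = "pt \<epsilon> t" and ?w = "wt \<epsilon> t"
      have s: "?s \<in> outside \<psi>" using pt_boundary[OF False] sub by auto
      note n = norm_pt_wt[OF \<epsilon> False]
      have ns: "norm ?s > 0" using n False by simp
      have est: "norm (Re c *\<^sub>R X + Im c *\<^sub>R (X o\<^sub>L LJ)) \<le> norm c * (norm X * (1 + norm LJ))" for c and X :: "('v ^ 'n set) \<Rightarrow>\<^sub>L ('v ^ 'n set)"
      proof -
        have "norm (Re c *\<^sub>R X + Im c *\<^sub>R (X o\<^sub>L LJ)) \<le> \<bar>Re c\<bar> * norm X + \<bar>Im c\<bar> * norm (X o\<^sub>L LJ)"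
          by (rule order_trans[OF norm_triangle_ineq]) simp
        also have "\<dots> \<le> norm c * norm X + norm c * (norm X * norm LJ)"
          by (intro add_mono mult_mono abs_Re_le_cmod abs_Im_le_cmod norm_blinfun_compose) auto
        finally show ?thesis by (simp add: algebra_simps)
      qed
      have "norm (integrand \<epsilon> t) \<le> norm (cnj ?s * ?w) * (norm (QT ?s) * (1 + norm LJ)) + norm ?w * (norm (PT ?s) * (1 + norm LJ))"
        unfolding integrand_def if_not_P[OF False] by (rule order_trans[OF norm_triangle_ineq4 add_mono[OF est est]])
      also have "\<dots> \<le> norm (cnj ?s * ?w) * (C / (norm ?s)\<^sup>2 * (1 + norm LJ)) + norm ?w * (C / norm ?s * (1 + norm LJ))"
        using C[OF s] by (intro add_mono mult_left_mono mult_right_mono) auto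
      also have "\<dots> = K * (norm ?w / norm ?s)"
        using ns by (simp add: K_def norm_mult power2_eq_square field_simps)
      also have "\<dots> = b t"
        using False unfolding n by (cases "t > 0") (auto simp: b_def pt_def dir_def norm_divide norm_mult)
      finally show ?thesis .
    qed (simp add: integrand_def b_def)
  qed
qed

text \<open>A slice number x + J y to the right of an operator turns l into x l + y m, where m
  precomposes with \<open>LJ\<close>. Hence the value is the real part of a scalar integral for l
  plus the imaginary part of the same integral for m.\<close>

private lemma functional_integrand:
  assumes \<epsilon>: "\<epsilon> \<in> {1, - 1}" and l: "bounded_linear (l :: (('v ^ 'n set) \<Rightarrow>\<^sub>L ('v ^ 'n set)) \<Rightarrow> real)"
  shows "l (integral UNIV (integrand \<epsilon>)) =
    Re (- \<i> * (ray_integral (angle_pos \<epsilon>) (\<lambda>z. H z * res l z) - ray_integral (angle_neg \<epsilon>) (\<lambda>z. H z * res l z))) +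
    Im (- \<i> * (ray_integral (angle_pos \<epsilon>) (\<lambda>z. H z * res (\<lambda>A. l (A o\<^sub>L LJ)) z) - ray_integral (angle_neg \<epsilon>) (\<lambda>z. H z * res (\<lambda>A. l (A o\<^sub>L LJ)) z)))"
proof -
  interpret l: bounded_linear l by (rule l)
  let ?m = "\<lambda>A. l (A o\<^sub>L LJ)"
  let ?F = "\<lambda>z. H z * res l z" and ?G = "\<lambda>z. H z * res ?m z"
  let ?a = "angle_pos \<epsilon>" and ?b = "angle_neg \<epsilon>"
  have m: "bounded_linear ?m" by (rule bounded_linear_comp_left[OF l])
  note Hb = decaying_boundary[OF H ang'(1) ang(2,3)]
  have i: "boundary_integrable \<phi> ?F" "boundary_integrable \<phi> ?G"
    by (rule boundary_integrable_res[OF Hb ang(1) ang'(3) l] boundary_integrable_res[OF Hb ang(1) ang'(3) m])+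
  note rF = rays_pm[OF \<epsilon> i(1)] and rG = rays_pm[OF \<epsilon> i(2)]
  have bl: "bounded_linear (\<lambda>z. Re (c * z))" "bounded_linear (\<lambda>z. Im (c * z))" for c
    by (intro bounded_linear_compose[OF bounded_linear_Re bounded_linear_mult_right]
        bounded_linear_compose[OF bounded_linear_Im bounded_linear_mult_right])+
  define f where "f t = Re (- \<i> * (cis ?a * ?F (of_real t * cis ?a))) + Im (- \<i> * (cis ?a * ?G (of_real t * cis ?a)))" for t
  \<comment> \<open>On the negative half line the velocity carries a minus sign, so the factor -i
    becomes i.\<close>
  define g where "g t = Re (\<i> * (cis ?b * ?F (of_real t * cis ?b))) + Im (\<i> * (cis ?b * ?G (of_real t * cis ?b)))" for t
  have f: "set_integrable lborel {0<..} f"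
    "(LINT t:{0<..}|lborel. f t) = Re (- \<i> * ray_integral ?a ?F) + Im (- \<i> * ray_integral ?a ?G)"
    unfolding f_def[abs_def]
    by (intro set_integral_add ray_integral_linear(1)[OF _ bl(1)] ray_integral_linear(1)[OF _ bl(2)] rF rG)
      (simp only: set_integral_add(2)[OF ray_integral_linear(1)[OF rF(1) bl(1)] ray_integral_linear(1)[OF rG(1) bl(2)]]
        ray_integral_linear(2)[OF rF(1) bl(1)] ray_integral_linear(2)[OF rG(1) bl(2)])
  have g: "set_integrable lborel {0<..} g"
    "(LINT t:{0<..}|lborel. g t) = Re (\<i> * ray_integral ?b ?F) + Im (\<i> * ray_integral ?b ?G)"
    unfolding g_def[abs_def]
    by (intro set_integral_add ray_integral_linear(1)[OF _ bl(1)] ray_integral_linear(1)[OF _ bl(2)] rF rG)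
      (simp only: set_integral_add(2)[OF ray_integral_linear(1)[OF rF(2) bl(1)] ray_integral_linear(1)[OF rG(2) bl(2)]]
        ray_integral_linear(2)[OF rF(2) bl(1)] ray_integral_linear(2)[OF rG(2) bl(2)])
  have val: "l (integrand \<epsilon> t) = (if t > 0 then f t else if t < 0 then g (- t) else 0)" for t
  proof -
    have *: "l (integrand \<epsilon> t) = Re (wt \<epsilon> t * res l (pt \<epsilon> t)) + Im (wt \<epsilon> t * res ?m (pt \<epsilon> t))" if "t \<noteq> 0"
      using that unfolding integrand_def res_def
      by (simp add: l.add l.diff l.scaleR algebra_simps)
    consider "t > 0" | "t < 0" | "t = 0" by linarith
    then show ?thesis
    proof cases
      case 1
      then show ?thesis unfolding f_def by (simp only: * wt_def pt_def dir_def mult.assoc if_True; simp?)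
    next
      case 2
      then have "pt \<epsilon> t = of_real (- t) * cis ?b" "wt \<epsilon> t = \<i> * cis ?b * H (of_real (- t) * cis ?b)"
        by (simp_all add: pt_def wt_def dir_def)
      then show ?thesis using 2 * unfolding g_def by (simp only: mult.assoc; simp?)
    qed (simp add: integrand_def l.zero)
  qed
  have "l (integral UNIV (integrand \<epsilon>)) = integral UNIV (l \<circ> integrand \<epsilon>)"
    by (rule integral_linear[OF integrable_integrand[OF \<epsilon>] l, symmetric])
  also have "\<dots> = (LINT t|lborel. (if t > 0 then f t else if t < 0 then g (- t) else 0))"
    unfolding o_def val by (rule integral_lborel[OF two_sided_integral(1)[OF f(1) g(1)]])
  also have "\<dots> = (Re (- \<i> * ray_integral ?a ?F) + Im (- \<i> * ray_integral ?a ?G)) + (Re (\<i> * ray_integral ?b ?F) + Im (\<i> * ray_integral ?b ?G))"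
    unfolding two_sided_integral(2)[OF f(1) g(1)] f(2) g(2) ..
  finally show ?thesis by (simp add: algebra_simps)
qed

lemma represents_omega_calc: "represents \<phi> H (omega_calc D T \<phi> J h)"
  unfolding represents_def
proof (intro allI impI)
  fix l :: "(('v ^ 'n set) \<Rightarrow>\<^sub>L ('v ^ 'n set)) \<Rightarrow> real" assume l: "bounded_linear l"
  interpret l: bounded_linear l by (rule l)
  let ?m = "\<lambda>A. l (A o\<^sub>L LJ)"
  have om: "omega_calc D T \<phi> J h = (1 / (2 * pi)) *\<^sub>R (integral UNIV (integrand 1) + integral UNIV (integrand (- 1)))"
  proof -
    have "integral UNIV (\<lambda>t. S_L_resolvent D T (gamma_path \<epsilon> J \<phi> t) o\<^sub>L
       left_op (vector_derivative (gamma_path \<epsilon> J \<phi>) (at t) \<cdot>\<^sub>l pv_inverse J) o\<^sub>L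
       left_op (h (gamma_path \<epsilon> J \<phi> t))) = integral UNIV (integrand \<epsilon>)" if "\<epsilon> \<in> {1, - 1}" for \<epsilon>
      by (rule integral_spike[of "{0}"]) (use integrand_eq[OF that] in auto)
    then show ?thesis unfolding omega_calc_def by simp
  qed
  \<comment> \<open>Uses -i = 1/i: the two branches together give all four rays with their
    orientations.\<close>
  have bi: "- \<i> * (ray_integral (angle_pos 1) F - ray_integral (angle_neg 1) F) +
      - \<i> * (ray_integral (angle_pos (- 1)) F - ray_integral (angle_neg (- 1)) F) = of_real (2 * pi) * boundary_integral \<phi> F" for F
    unfolding boundary_integral_eq angle_pos_def angle_neg_def by (simp add: field_simps)
  have real: "Im (boundary_integral \<phi> (\<lambda>z. H z * res l' z)) = 0" for l'
  proof (rule boundary_integral_real)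
    fix z assume "z \<in> boundary \<phi>"
    then have "z \<in> bisector \<theta>" using boundary_sub by auto
    then have "H (cnj z) = cnj (H z)" using H unfolding decaying_def by blast
    then show "H (cnj z) * res l' (cnj z) = cnj (H z * res l' z)" by (simp add: res_cnj)
  qed
  have "l (integral UNIV (integrand 1) + integral UNIV (integrand (- 1))) =
    Re (of_real (2 * pi) * boundary_integral \<phi> (\<lambda>z. H z * res l z)) + Im (of_real (2 * pi) * boundary_integral \<phi> (\<lambda>z. H z * res ?m z))"
    unfolding bi[symmetric] l.add functional_integrand[OF insertI1 l] functional_integrand[OF insertI2[OF singletonI] l] by simp
  also have "\<dots> = 2 * pi * Re (boundary_integral \<phi> (\<lambda>z. H z * res l z))" using real[of ?m] by simp
  finally have "l (omega_calc D T \<phi> J h) = Re (boundary_integral \<phi> (\<lambda>z. H z * res l z))"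
    unfolding om l.scaleR by simp
  then show "of_real (l (omega_calc D T \<phi> J h)) = boundary_integral \<phi> (\<lambda>z. H z * res l z)"
    using real[of l] by (simp add: complex_eq_iff)
qed

end

end

section \<open>Intrinsic functions on a double sector\<close>

text \<open>On the ray |z| = t. For a nonnegative function gauge integrability is absolute
  integrability, and continuity of F supplies the measurability for passing from the Lebesgue to the
  Borel measure and from the norm to the function.\<close>

lemma ray_integrable_div_iff:
  assumes "continuous_on (ray c) F"
  shows "ray_integrable c (\<lambda>z. F z / z) \<longleftrightarrow> (\<lambda>t. norm (F (of_real t * cis c)) / t) integrable_on {0<..}"
proof -
  let ?f = "\<lambda>t. F (of_real t * cis c) / (of_real t * cis c)"
  have norm: "norm (F (of_real t * cis c)) / t = norm (?f t)" if "t \<in> {0<..}" for t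
    using that by (simp add: norm_divide norm_mult)
  have meas: "set_borel_measurable lborel {0<..} ?f"
    by (rule set_borel_measurable_ray) (use assms in \<open>auto intro!: continuous_intros simp: ray_def\<close>)
  have "set_integrable lborel {0<..} ?f" if "(\<lambda>t. norm (?f t)) integrable_on {0<..}"
  proof -
    have "set_integrable lebesgue {0<..} (\<lambda>t. norm (?f t))"
      by (rule nonnegative_absolutely_integrable_1[OF that]) simp
    then have "integrable (completion lborel) (\<lambda>t. norm (indicat_real {0<..} t *\<^sub>R ?f t))"
      unfolding set_integrable_def by simp
    moreover have m: "(\<lambda>t. indicat_real {0<..} t *\<^sub>R ?f t) \<in> borel_measurable lborel"
      using meas unfolding set_borel_measurable_def .
    ultimately have "integrable lborel (\<lambda>t. norm (indicat_real {0<..} t *\<^sub>R ?f t))"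
      using integrable_completion[OF measurable_compose[OF m borel_measurable_norm]] by blast
    then show ?thesis
      unfolding set_integrable_def integrable_norm_iff[OF m] .
  qed
  moreover have "(\<lambda>t. norm (?f t)) integrable_on {0<..}" if "set_integrable lborel {0<..} ?f"
    by (rule set_borel_integral_eq_integral(1)[OF set_integrable_norm[OF that]])
  moreover have "(\<lambda>t. norm (F (of_real t * cis c)) / t) integrable_on {0<..} \<longleftrightarrow> (\<lambda>t. norm (?f t)) integrable_on {0<..}"
    by (rule integrable_cong[OF norm])
  ultimately show ?thesis unfolding ray_integrable_def by blast
qed

lemma I_angle_rays:
  assumes "\<theta> < pi / 2"
  shows "(\<forall>\<phi>\<ge>0. \<phi> < \<theta> \<longrightarrow> boundary_integrable \<phi> F) \<longleftrightarrow> (\<forall>c\<in>I_angle \<theta>. ray_integrable c F)"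
proof (intro iffI allI ballI impI)
  fix c assume b: "\<forall>\<phi>\<ge>0. \<phi> < \<theta> \<longrightarrow> boundary_integrable \<phi> F" and "c \<in> I_angle \<theta>"
  then consider "\<bar>c\<bar> < \<theta>" | "\<bar>c - pi\<bar> < \<theta>" by (force simp: I_angle_def)
  then show "ray_integrable c F"
  proof cases
    case 1
    then have "boundary_integrable \<bar>c\<bar> F" using b by simp
    then show ?thesis by (cases "c \<ge> 0") (simp_all add: boundary_integrable_eq)
  next
    case 2
    then have "boundary_integrable \<bar>c - pi\<bar> F" using b by simp
    then show ?thesis by (cases "c \<ge> pi") (simp_all add: boundary_integrable_eq)
  qed
next
  fix \<phi> assume "\<forall>c\<in>I_angle \<theta>. ray_integrable c F" "0 \<le> \<phi>" "\<phi> < \<theta>"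
  moreover from this have "\<phi> \<in> I_angle \<theta>" "- \<phi> \<in> I_angle \<theta>" "pi + \<phi> \<in> I_angle \<theta>" "pi - \<phi> \<in> I_angle \<theta>"
    by (simp_all add: I_angle_def)
  ultimately show "boundary_integrable \<phi> F" by (simp add: boundary_integrable_eq)
qed

text \<open>One complex function H describes h on all slices simultaneously; its real and imaginary
  parts play the roles of the real valued components f_0 and f_1.\<close>

definition slice_rep ::
    "real \<Rightarrow> (real ^ 'n::{finite,linorder} set \<Rightarrow> real ^ 'n set) \<Rightarrow> (complex \<Rightarrow> complex) \<Rightarrow> bool" where
  "slice_rep \<theta> h H \<longleftrightarrow> (\<forall>J\<in>unit_sphere. \<forall>z\<in>bisector \<theta>. h (slice_emb J z) = slice_emb J (H z))"

lemma slice_dom_D_sector: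
  assumes "0 < \<theta>" "\<theta> < pi / 2"
  shows "slice_dom (D_sector \<theta> :: (real ^ 'n::{finite,linorder} set) set) = {(x, y). Complex x y \<in> bisector \<theta>}"
proof -
  obtain J :: "real ^ 'n set" where J: "J \<in> unit_sphere" using unit_sphere_nonempty by blast
  show ?thesis
    using J slice_emb_in_D_sector[OF _ assms] by (auto simp: slice_dom_def slice_pt_eq_emb)
qed

text \<open>The embeddings of the slices preserve norms, so boundedness and integrability along rays
  can be tested on H, for any imaginary unit.\<close>

lemma decaying_iff_slice:
  fixes h :: "real ^ 'n::{finite,linorder} set \<Rightarrow> real ^ 'n set"
  assumes \<theta>: "0 < \<theta>" "\<theta> < pi / 2" and rep: "slice_rep \<theta> h H"
    and hol: "H holomorphic_on bisector \<theta>" and cnj: "\<And>z. z \<in> bisector \<theta> \<Longrightarrow> H (cnj z) = cnj (H z)"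
  shows "decaying \<theta> H \<longleftrightarrow> bounded (h ` D_sector \<theta>) \<and>
    (\<forall>J\<in>unit_sphere. \<forall>c\<in>I_angle \<theta>. (\<lambda>t. norm (h (t *\<^sub>R expJ J c)) / t) integrable_on {0<..})"
proof -
  obtain J0 :: "real ^ 'n set" where J0: "J0 \<in> unit_sphere" using unit_sphere_nonempty by blast
  have h: "norm (h (slice_emb J z)) = norm (H z)" if "J \<in> unit_sphere" "z \<in> bisector \<theta>" for J z
    using rep that norm_slice_emb[OF that(1)] unfolding slice_rep_def by simp
  have "bounded (h ` D_sector \<theta>) \<longleftrightarrow> bounded (H ` bisector \<theta>)"
  proof
    assume "bounded (h ` D_sector \<theta>)"
    then obtain K where K: "\<And>s. s \<in> D_sector \<theta> \<Longrightarrow> norm (h s) \<le> K" unfolding bounded_iff by auto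
    have "norm (H z) \<le> K" if "z \<in> bisector \<theta>" for z
      using K[of "slice_emb J0 z"] h[OF J0 that] slice_emb_in_D_sector[OF J0 \<theta>] that by simp
    then show "bounded (H ` bisector \<theta>)" unfolding bounded_iff by auto
  next
    assume "bounded (H ` bisector \<theta>)"
    then obtain K where K: "\<And>z. z \<in> bisector \<theta> \<Longrightarrow> norm (H z) \<le> K" unfolding bounded_iff by auto
    have "norm (h s) \<le> K" if "s \<in> D_sector \<theta>" for s
      by (rule D_sectorE[OF that \<theta>(2)]) (use K h in simp)
    then show "bounded (h ` D_sector \<theta>)" unfolding bounded_iff by auto
  qed
  moreover have "ray_integrable c (\<lambda>z. H z / z) \<longleftrightarrow> (\<lambda>t. norm (h (t *\<^sub>R expJ J c)) / t) integrable_on {0<..}"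
    if "J \<in> unit_sphere" "c \<in> I_angle \<theta>" for J :: "real ^ 'n set" and c
  proof -
    have sub: "ray c \<subseteq> bisector \<theta>" by (rule ray_I_angle[OF that(2) \<theta>(2)])
    have "continuous_on (ray c) H"
      by (rule continuous_on_subset[OF holomorphic_on_imp_continuous_on[OF hol] sub])
    note ray_integrable_div_iff[OF this]
    also have "(\<lambda>t. norm (H (of_real t * cis c)) / t) integrable_on {0<..} \<longleftrightarrow>
      (\<lambda>t. norm (h (t *\<^sub>R expJ J c)) / t) integrable_on {0<..}"
    proof (rule integrable_cong)
      fix t :: real assume "t \<in> {0<..}"
      then have "of_real t * cis c \<in> bisector \<theta>" using sub by (auto simp: ray_def)
      then show "norm (H (of_real t * cis c)) / t = norm (h (t *\<^sub>R expJ J c)) / t"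
        using h[OF that(1)] by (simp add: expJ_eq slice_emb_scaleR[symmetric])
    qed
    finally show ?thesis .
  qed
  ultimately show ?thesis
    unfolding decaying_def I_angle_rays[OF \<theta>(2)] using hol cnj J0 by blast
qed

section \<open>Slice hyperholomorphic intrinsic functions as holomorphic functions\<close>

lemma holomorphic_Complex_partials:
  assumes H: "H holomorphic_on S" and S: "open S"
  defines "d \<equiv> \<lambda>(x, y). deriv H (Complex x y)"
  shows "C1_with_partials {(x, y). Complex x y \<in> S} (\<lambda>(x, y). Re (H (Complex x y)) *\<^sub>R e)
      (\<lambda>p. Re (d p) *\<^sub>R e) (\<lambda>p. - Im (d p) *\<^sub>R e)"
    and "C1_with_partials {(x, y). Complex x y \<in> S} (\<lambda>(x, y). Im (H (Complex x y)) *\<^sub>R e)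
      (\<lambda>p. Im (d p) *\<^sub>R e) (\<lambda>p. Re (d p) *\<^sub>R e)"
proof -
  let ?c = "\<lambda>p. Complex (fst p) (snd p)"
  have c: "?c p = of_real (fst p) + \<i> * of_real (snd p)" for p by (simp add: complex_eq_iff)
  have "continuous_on {(x, y). Complex x y \<in> S} (\<lambda>p. deriv H (?c p))"
    by (rule continuous_on_compose2[OF holomorphic_on_imp_continuous_on[OF holomorphic_deriv[OF H S]]])
      (auto simp: Complex_eq intro!: continuous_intros)
  then have cont: "continuous_on {(x, y). Complex x y \<in> S} d" by (simp add: d_def case_prod_beta')
  have der: "((\<lambda>p. H (?c p)) has_derivative (\<lambda>q. d p * ?c q)) (at p)" if "?c p \<in> S" for p
  proof -
    have "(H has_derivative (\<lambda>w. d p * w)) (at (?c p))"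
      using holomorphic_derivI[OF H S that] by (simp add: d_def has_field_derivative_def case_prod_beta')
    moreover have "(?c has_derivative ?c) (at p)"
      unfolding c by (auto intro!: derivative_eq_intros)
    ultimately show ?thesis by (rule has_derivative_compose[rotated])
  qed
  have eq: "(\<lambda>(h, k). h *\<^sub>R (Re (d p) *\<^sub>R e) + k *\<^sub>R (- Im (d p) *\<^sub>R e)) = (\<lambda>q. Re (d p * ?c q) *\<^sub>R e)"
    "(\<lambda>(h, k). h *\<^sub>R (Im (d p) *\<^sub>R e) + k *\<^sub>R (Re (d p) *\<^sub>R e)) = (\<lambda>q. Im (d p * ?c q) *\<^sub>R e)" for p
    by (auto simp: fun_eq_iff algebra_simps)
  have f: "(\<lambda>(x, y). Re (H (Complex x y)) *\<^sub>R e) = (\<lambda>p. Re (H (?c p)) *\<^sub>R e)"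
    "(\<lambda>(x, y). Im (H (Complex x y)) *\<^sub>R e) = (\<lambda>p. Im (H (?c p)) *\<^sub>R e)"
    by (simp_all add: case_prod_beta')
  have D: "((\<lambda>p. Re (H (?c p)) *\<^sub>R e) has_derivative (\<lambda>q. Re (d p * ?c q) *\<^sub>R e)) (at p)"
    "((\<lambda>p. Im (H (?c p)) *\<^sub>R e) has_derivative (\<lambda>q. Im (d p * ?c q) *\<^sub>R e)) (at p)" if "?c p \<in> S" for p
    by (intro bounded_linear.has_derivative[OF bounded_linear_scaleR_left] has_derivative_Re has_derivative_Im der[OF that])+
  show "C1_with_partials {(x, y). Complex x y \<in> S} (\<lambda>(x, y). Re (H (Complex x y)) *\<^sub>R e)
      (\<lambda>p. Re (d p) *\<^sub>R e) (\<lambda>p. - Im (d p) *\<^sub>R e)"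
    "C1_with_partials {(x, y). Complex x y \<in> S} (\<lambda>(x, y). Im (H (Complex x y)) *\<^sub>R e)
      (\<lambda>p. Im (d p) *\<^sub>R e) (\<lambda>p. Re (d p) *\<^sub>R e)"
    unfolding C1_with_partials_def f eq
    by (intro conjI ballI D continuous_intros cont; auto)+
qed

text \<open>In each coordinate the slice equations are the Cauchy-Riemann equations, so the real
  derivative is multiplication by a complex number.\<close>

lemma Cauchy_Riemann_holomorphic:
  fixes f0 f1 :: "real \<times> real \<Rightarrow> real ^ 'm"
  assumes S: "open S" and C1: "C1_with_partials {(x, y). Complex x y \<in> S} f0 f0x f0y"
      "C1_with_partials {(x, y). Complex x y \<in> S} f1 f1x f1y"
    and CR: "\<And>z. z \<in> S \<Longrightarrow> f0x (Re z, Im z) = f1y (Re z, Im z) \<and> f0y (Re z, Im z) = - f1x (Re z, Im z)"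
  shows "(\<lambda>z. Complex (f0 (Re z, Im z) $ i) (f1 (Re z, Im z) $ i)) holomorphic_on S"
proof -
  have "\<exists>D. ((\<lambda>z. Complex (f0 (Re z, Im z) $ i) (f1 (Re z, Im z) $ i)) has_field_derivative D) (at z)" if z: "z \<in> S" for z
  proof -
    let ?p = "(Re z, Im z)"
    have pair: "((\<lambda>z. (Re z, Im z)) has_derivative (\<lambda>w. (Re w, Im w))) (at z)"
      by (intro has_derivative_Pair bounded_linear_imp_has_derivative bounded_linear_Re bounded_linear_Im)
    have comp: "((\<lambda>z. f (Re z, Im z) $ i) has_derivative (\<lambda>w. Re w * fx ?p $ i + Im w * fy ?p $ i)) (at z)"
      if C: "C1_with_partials {(x, y). Complex x y \<in> S} f fx fy" for f fx fy :: "real \<times> real \<Rightarrow> real ^ 'm"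
    proof -
      have "(f has_derivative (\<lambda>(h, k). h *\<^sub>R fx ?p + k *\<^sub>R fy ?p)) (at ?p)"
        using C z unfolding C1_with_partials_def by auto
      from bounded_linear.has_derivative[OF bounded_linear_vec_nth has_derivative_compose[OF pair this], of i]
      show ?thesis by simp
    qed
    let ?a = "f0x ?p $ i" and ?b = "f1x ?p $ i"
    have eq: "f1y ?p $ i = ?a" "f0y ?p $ i = - ?b" using CR[OF z] by simp_all
    have "((\<lambda>z. of_real (f0 (Re z, Im z) $ i) + \<i> * of_real (f1 (Re z, Im z) $ i)) has_derivative
      (\<lambda>w. of_real (Re w * ?a + Im w * (- ?b)) + \<i> * of_real (Re w * ?b + Im w * ?a))) (at z)"
      using comp[OF C1(1)] comp[OF C1(2)] unfolding eq
      by (intro has_derivative_add has_derivative_mult_right has_derivative_of_real)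
    moreover have "(\<lambda>w. of_real (Re w * ?a + Im w * (- ?b)) + \<i> * of_real (Re w * ?b + Im w * ?a)) = (*) (Complex ?a ?b)"
      by (auto simp: fun_eq_iff complex_eq_iff algebra_simps)
    ultimately have "((\<lambda>z. Complex (f0 (Re z, Im z) $ i) (f1 (Re z, Im z) $ i)) has_field_derivative Complex ?a ?b) (at z)"
      unfolding has_field_derivative_def Complex_eq by (simp only:)
    then show ?thesis ..
  qed
  then show ?thesis unfolding holomorphic_on_open[OF S] by blast
qed

text \<open>For an intrinsic function both components are real multiples of \<open>cl_one\<close>,
  so the coordinates at the empty set contain all the information and are combined into H.\<close>

lemma N_0_decaying:
  fixes h :: "real ^ 'n::{finite,linorder} set \<Rightarrow> real ^ 'n set"
  assumes \<theta>: "0 < \<theta>" "\<theta> < pi / 2" and h: "h \<in> N_0 \<theta>"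
  obtains H where "decaying \<theta> H" "slice_rep \<theta> h H"
proof -
  note dom = slice_dom_D_sector[OF \<theta>, where 'n = 'n]
  have "h \<in> intrinsic (D_sector \<theta>)" using h unfolding N_0_def by simp
  then obtain f0 f1 where sh: "slice_hyperholomorphic_with (D_sector \<theta>) h f0 f1"
    and real: "\<forall>z\<in>slice_dom (D_sector \<theta> :: (real ^ 'n set) set). f0 z \<in> range (\<lambda>r. r *\<^sub>R cl_one) \<and> f1 z \<in> range (\<lambda>r. r *\<^sub>R cl_one)"
    unfolding intrinsic_def by blast
  have cl1: "(cl_one :: real ^ 'n set) $ {} = 1" by (simp add: cl_one_def axis_def)
  define H where "H = (\<lambda>z. Complex (f0 (Re z, Im z) $ {}) (f1 (Re z, Im z) $ {}))"
  have f: "f0 (Re z, Im z) = Re (H z) *\<^sub>R cl_one" "f1 (Re z, Im z) = Im (H z) *\<^sub>R cl_one" if "z \<in> bisector \<theta>" for z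
  proof -
    have r: "v = (v $ {}) *\<^sub>R cl_one" if "v \<in> range (\<lambda>r. r *\<^sub>R cl_one)" for v :: "real ^ 'n set"
      using that cl1 by auto
    have "(Re z, Im z) \<in> slice_dom (D_sector \<theta> :: (real ^ 'n set) set)" using that unfolding dom by simp
    note bspec[OF real this]
    then show "f0 (Re z, Im z) = Re (H z) *\<^sub>R cl_one" "f1 (Re z, Im z) = Im (H z) *\<^sub>R cl_one"
      using r unfolding H_def complex.sel by blast+
  qed
  have rep: "slice_rep \<theta> h H"
    unfolding slice_rep_def
  proof (intro ballI)
    fix J :: "real ^ 'n set" and z assume "J \<in> unit_sphere" "z \<in> bisector \<theta>"
    then have "h (slice_emb J z) = f0 (Re z, Im z) + J \<cdot>\<^sub>l f1 (Re z, Im z)"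
      using sh unfolding slice_hyperholomorphic_with_def dom by (auto simp: slice_emb_def)
    then show "h (slice_emb J z) = slice_emb J (H z)"
      unfolding f[OF \<open>z \<in> bisector \<theta>\<close>] cl_lmult_scaleR_right cl_lmult_one by (simp add: slice_emb_eq)
  qed
  obtain f0x f0y f1x f1y where C1: "C1_with_partials (slice_dom (D_sector \<theta> :: (real ^ 'n set) set)) f0 f0x f0y"
      "C1_with_partials (slice_dom (D_sector \<theta> :: (real ^ 'n set) set)) f1 f1x f1y"
    and CR: "\<forall>z\<in>slice_dom (D_sector \<theta> :: (real ^ 'n set) set). f0x z = f1y z \<and> f0y z = - f1x z"
    using sh unfolding slice_hyperholomorphic_with_def by blast
  have hol: "H holomorphic_on bisector \<theta>"
    unfolding H_def by (rule Cauchy_Riemann_holomorphic[OF open_bisector C1[unfolded dom]]) (use CR in \<open>auto simp: dom\<close>)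
  have cnj: "H (cnj z) = cnj (H z)" if "z \<in> bisector \<theta>" for z
  proof -
    have "f0 (Re z, - Im z) = f0 (Re z, Im z) \<and> f1 (Re z, - Im z) = - f1 (Re z, Im z)"
      using sh that unfolding slice_hyperholomorphic_with_def dom by auto
    then show ?thesis by (simp add: H_def complex_eq_iff)
  qed
  have "decaying \<theta> H"
    using h decaying_iff_slice[OF \<theta> rep hol cnj] unfolding N_0_def SH_L_0_def by auto
  then show ?thesis using rep that by blast
qed

text \<open>The member h supplies openness and axial symmetry of the sector, which
  \<open>N_0\<close> requires and which concern the sector alone; everything else is read off from
  H.\<close>

lemma decaying_N_0:
  fixes h h' :: "real ^ 'n::{finite,linorder} set \<Rightarrow> real ^ 'n set"
  assumes \<theta>: "0 < \<theta>" "\<theta> < pi / 2" and h: "h \<in> N_0 \<theta>" and H: "decaying \<theta> H" and rep: "slice_rep \<theta> h' H"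
  shows "h' \<in> N_0 \<theta>"
proof -
  note dom = slice_dom_D_sector[OF \<theta>, where 'n = 'n]
  have U: "openin (top_of_set paravectors) (D_sector \<theta> :: (real ^ 'n set) set)" "axially_symmetric (D_sector \<theta> :: (real ^ 'n set) set)"
    using h unfolding N_0_def intrinsic_def slice_hyperholomorphic_with_def by auto
  have hol: "H holomorphic_on bisector \<theta>" and cnj: "\<And>z. z \<in> bisector \<theta> \<Longrightarrow> H (cnj z) = cnj (H z)"
    using H unfolding decaying_def by auto
  define f0 f1 :: "real \<times> real \<Rightarrow> real ^ 'n set"
    where "f0 = (\<lambda>(x, y). Re (H (Complex x y)) *\<^sub>R cl_one)" and "f1 = (\<lambda>(x, y). Im (H (Complex x y)) *\<^sub>R cl_one)"
  have "slice_hyperholomorphic_with (D_sector \<theta>) h' f0 f1"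
    unfolding slice_hyperholomorphic_with_def dom
  proof (intro conjI U)
    show "\<forall>(x, y)\<in>{(x, y). Complex x y \<in> bisector \<theta>}. \<forall>J\<in>unit_sphere. h' (slice_pt J x y) = f0 (x, y) + J \<cdot>\<^sub>l f1 (x, y)"
      using rep unfolding slice_rep_def by (auto simp: slice_pt_eq_emb f0_def f1_def cl_lmult_scaleR_right slice_emb_eq[of _ "H _"])
    have "Complex x (- y) = cnj (Complex x y)" for x y by (simp add: complex_eq_iff)
    then show "\<forall>(x, y)\<in>{(x, y). Complex x y \<in> bisector \<theta>}. f0 (x, - y) = f0 (x, y) \<and> f1 (x, - y) = - f1 (x, y)"
      using cnj by (auto simp: f0_def f1_def)
    note C1 = holomorphic_Complex_partials[OF hol open_bisector, of "cl_one :: real ^ 'n set", folded f0_def f1_def]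
    show "\<exists>f0x f0y f1x f1y. C1_with_partials {(x, y). Complex x y \<in> bisector \<theta>} f0 f0x f0y \<and>
        C1_with_partials {(x, y). Complex x y \<in> bisector \<theta>} f1 f1x f1y \<and>
        (\<forall>z\<in>{(x, y). Complex x y \<in> bisector \<theta>}. f0x z = f1y z \<and> f0y z = - f1x z)"
      by (intro exI conjI, rule C1(1), rule C1(2)) simp
  qed
  moreover have "f0 z \<in> range (\<lambda>r. r *\<^sub>R cl_one) \<and> f1 z \<in> range (\<lambda>r. r *\<^sub>R cl_one)" for z
    by (auto simp: f0_def f1_def split: prod.split)
  ultimately have "h' \<in> intrinsic (D_sector \<theta>)" "h' \<in> SH_L (D_sector \<theta>)"
    unfolding intrinsic_def SH_L_def by blast+
  moreover have "bounded (h' ` D_sector \<theta>) \<and> (\<forall>J\<in>unit_sphere. \<forall>c\<in>I_angle \<theta>. (\<lambda>t. norm (h' (t *\<^sub>R expJ J c)) / t) integrable_on {0<..})"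
    using decaying_iff_slice[OF \<theta> rep hol cnj] H by blast
  ultimately show ?thesis unfolding N_0_def SH_L_0_def by auto
qed

lemma pv_inverse_one_plus_square:
  assumes "J \<in> unit_sphere"
  shows "pv_inverse (cl_one + slice_emb J z \<cdot>\<^sub>l slice_emb J z) = slice_emb J (1 / (1 + z\<^sup>2))"
proof -
  have "cl_one + slice_emb J z \<cdot>\<^sub>l slice_emb J z = slice_emb J (1 + z\<^sup>2)"
    unfolding slice_emb_mult[OF assms] slice_emb_add by (simp add: slice_emb_1 power2_eq_square)
  then show ?thesis using slice_emb_inverse[OF assms, of "1 + z\<^sup>2"] by (simp add: inverse_eq_divide)
qed

section \<open>The extended functional calculus of the operator\<close>

context bisectorial_operator
begin

lemma QT_i: "QT \<i> = bdd_inverse (dom_sq D T) (\<lambda>v. v + T (T v))"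
  unfolding QT_def Qop_def[abs_def] by (simp add: add.commute)

context
  fixes J :: "real ^ 'n set" and \<phi> \<theta> :: real
  assumes J: "J \<in> unit_sphere" and ang: "\<omega> < \<phi>" "\<phi> < \<theta>" "\<theta> < pi / 2"
begin

interpretation bisectorial_calculus \<omega> QT PT \<phi> \<theta>
  by unfold_locales (use ang in auto)

lemma bnd_decomp_calc:
  assumes "bnd_decomp \<theta> g g0 ginf h"
  obtains H where "dec_calc H (omega_calc D T \<phi> J h)" "slice_rep \<theta> h H"
    "slice_rep \<theta> g (\<lambda>z. of_real ginf + of_real (g0 - ginf) / (1 + z\<^sup>2) + H z)"
proof -
  have h: "h \<in> N_0 \<theta>" and g: "\<And>s. s \<in> D_sector \<theta> \<Longrightarrow> g s = ginf *\<^sub>R cl_one + (g0 - ginf) *\<^sub>R pv_inverse (cl_one + s \<cdot>\<^sub>l s) + h s"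
    using assms unfolding bnd_decomp_def by auto
  obtain H where H: "decaying \<theta> H" "slice_rep \<theta> h H" using N_0_decaying[OF theta_pos ang(3) h] .
  have "represents \<phi> H (omega_calc D T \<phi> J h)"
    by (rule represents_omega_calc[OF J ang H(1)]) (use H(2) J in \<open>auto simp: slice_rep_def\<close>)
  moreover have "slice_rep \<theta> g (\<lambda>z. of_real ginf + of_real (g0 - ginf) / (1 + z\<^sup>2) + H z)"
    unfolding slice_rep_def
  proof (intro ballI)
    fix I :: "real ^ 'n set" and z assume I: "I \<in> unit_sphere" and z: "z \<in> bisector \<theta>"
    have s: "slice_emb I z \<in> D_sector \<theta>" using slice_emb_in_D_sector[OF I theta_pos ang(3)] z by simp
    have "h (slice_emb I z) = slice_emb I (H z)" using H(2) I z unfolding slice_rep_def by blast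
    moreover have "slice_emb I (of_real ginf + of_real (g0 - ginf) / (1 + z\<^sup>2) + H z) =
      ginf *\<^sub>R cl_one + (g0 - ginf) *\<^sub>R slice_emb I (1 / (1 + z\<^sup>2)) + slice_emb I (H z)"
      unfolding slice_emb_add slice_emb_of_real using slice_emb_scaleR[of I "g0 - ginf" "1 / (1 + z\<^sup>2)"] by simp
    ultimately show "g (slice_emb I z) = slice_emb I (of_real ginf + of_real (g0 - ginf) / (1 + z\<^sup>2) + H z)"
      using g[OF s] pv_inverse_one_plus_square[OF I] by simp
  qed
  ultimately show ?thesis using that H unfolding dec_calc_def by blast
qed

text \<open>Two decompositions of g give two complex functions which agree because the embedding of
  the slice is injective; \<open>ext_calc_unique\<close> then identifies the operators, as the
  definite description demands.\<close>

lemma ext_omega_calc_eq: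
  assumes g: "bnd_decomp \<theta> g g0 ginf h"
  shows "ext_omega_calc D T \<theta> \<phi> J g = ginf *\<^sub>R id_blinfun + (g0 - ginf) *\<^sub>R QT \<i> + omega_calc D T \<phi> J h"
  unfolding ext_omega_calc_def QT_i[symmetric]
proof (rule the_equality)
  show "\<exists>g0' ginf' h'. bnd_decomp \<theta> g g0' ginf' h' \<and> ginf *\<^sub>R id_blinfun + (g0 - ginf) *\<^sub>R QT \<i> + omega_calc D T \<phi> J h =
    ginf' *\<^sub>R id_blinfun + (g0' - ginf') *\<^sub>R QT \<i> + omega_calc D T \<phi> J h'"
    using g by blast
next
  fix A assume "\<exists>g0 ginf h. bnd_decomp \<theta> g g0 ginf h \<and> A = ginf *\<^sub>R id_blinfun + (g0 - ginf) *\<^sub>R QT \<i> + omega_calc D T \<phi> J h"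
  then obtain g0' ginf' h' where g': "bnd_decomp \<theta> g g0' ginf' h'"
    and A: "A = ginf' *\<^sub>R id_blinfun + (g0' - ginf') *\<^sub>R QT \<i> + omega_calc D T \<phi> J h'" by blast
  obtain H where H: "dec_calc H (omega_calc D T \<phi> J h)" "slice_rep \<theta> g (\<lambda>z. of_real ginf + of_real (g0 - ginf) / (1 + z\<^sup>2) + H z)"
    using bnd_decomp_calc[OF g] .
  obtain H' where H': "dec_calc H' (omega_calc D T \<phi> J h')" "slice_rep \<theta> g (\<lambda>z. of_real ginf' + of_real (g0' - ginf') / (1 + z\<^sup>2) + H' z)"
    using bnd_decomp_calc[OF g'] .
  have eq: "of_real ginf + of_real (g0 - ginf) / (1 + z\<^sup>2) + H z = of_real ginf' + of_real (g0' - ginf') / (1 + z\<^sup>2) + H' z"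
    if z: "z \<in> bisector \<theta>" for z
  proof -
    have "slice_emb J (of_real ginf + of_real (g0 - ginf) / (1 + z\<^sup>2) + H z) = g (slice_emb J z)"
      "slice_emb J (of_real ginf' + of_real (g0' - ginf') / (1 + z\<^sup>2) + H' z) = g (slice_emb J z)"
      using H(2) H'(2) J z unfolding slice_rep_def by simp_all
    then show ?thesis using slice_emb_inject[OF J] by metis
  qed
  show "A = ginf *\<^sub>R id_blinfun + (g0 - ginf) *\<^sub>R QT \<i> + omega_calc D T \<phi> J h"
    using ext_calc_unique[OF H(1) H'(1) eq] unfolding A by simp
qed

lemma ext_omega_calc_poly:
  assumes "g \<in> N_bnd \<theta>"
  shows "(cl_poly p \<circ> g) \<in> N_bnd \<theta>"
    and "ext_omega_calc D T \<theta> \<phi> J (cl_poly p \<circ> g) = op_poly p (ext_omega_calc D T \<theta> \<phi> J g)"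
proof -
  obtain g0 ginf h where g: "bnd_decomp \<theta> g g0 ginf h" using assms unfolding N_bnd_def by blast
  define A where "A = ext_omega_calc D T \<theta> \<phi> J g"
  obtain H where H: "dec_calc H (omega_calc D T \<phi> J h)" "slice_rep \<theta> g (\<lambda>z. of_real ginf + of_real (g0 - ginf) / (1 + z\<^sup>2) + H z)"
    using bnd_decomp_calc[OF g] .
  define G where "G z = of_real ginf + of_real (g0 - ginf) / (1 + z\<^sup>2) + H z" for z
  have "ext_calc G A"
    unfolding ext_calc_def A_def ext_omega_calc_eq[OF g] using H(1) G_def by blast
  from ext_calc_poly[OF this, of p] obtain a b K B where K: "dec_calc K B"
    and pG: "\<And>z. z \<in> bisector \<theta> \<Longrightarrow> (\<Sum>i\<le>degree p. of_real (coeff p i) * G z ^ i) = of_real a + of_real b / (1 + z\<^sup>2) + K z"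
    and pA: "op_poly p A = a *\<^sub>R id_blinfun + b *\<^sub>R QT \<i> + B"
    unfolding ext_calc_def by blast
  \<comment> \<open>The candidate for the decaying part has to be a function of Clifford numbers, so
    it is defined as a remainder; on each slice it equals K.\<close>
  define k where "k s = cl_poly p (g s) - a *\<^sub>R cl_one - b *\<^sub>R pv_inverse (cl_one + s \<cdot>\<^sub>l s)" for s
  have k: "slice_rep \<theta> k K"
    unfolding slice_rep_def
  proof (intro ballI)
    fix I :: "real ^ 'n set" and z assume I: "I \<in> unit_sphere" and z: "z \<in> bisector \<theta>"
    have "g (slice_emb I z) = slice_emb I (G z)" using H(2) I z unfolding slice_rep_def G_def by blast
    then have "cl_poly p (g (slice_emb I z)) = slice_emb I (of_real a + of_real b / (1 + z\<^sup>2) + K z)"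
      using slice_emb_poly[OF I] pG[OF z] by simp
    also have "\<dots> = a *\<^sub>R cl_one + b *\<^sub>R slice_emb I (1 / (1 + z\<^sup>2)) + slice_emb I (K z)"
      unfolding slice_emb_add slice_emb_of_real using slice_emb_scaleR[of I b "1 / (1 + z\<^sup>2)"] by simp
    finally show "k (slice_emb I z) = slice_emb I (K z)"
      unfolding k_def pv_inverse_one_plus_square[OF I] by simp
  qed
  have "h \<in> N_0 \<theta>" using g unfolding bnd_decomp_def by blast
  then have kN: "k \<in> N_0 \<theta>"
    by (rule decaying_N_0[OF theta_pos ang(3) _ _ k]) (use K in \<open>simp add: dec_calc_def\<close>)
  \<comment> \<open>The value at the origin is a + b and the value at infinity is a, since b is
    their difference.\<close>
  have dec: "bnd_decomp \<theta> (cl_poly p \<circ> g) (a + b) a k"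
    unfolding bnd_decomp_def using kN by (simp add: k_def)
  then show "(cl_poly p \<circ> g) \<in> N_bnd \<theta>" unfolding N_bnd_def by blast
  \<comment> \<open>Both the operator obtained from the algebra of the calculus and the integral for
    k are represented by K, so they coincide.\<close>
  have "represents \<phi> K (omega_calc D T \<phi> J k)"
    by (rule represents_omega_calc[OF J ang]) (use K k J in \<open>auto simp: dec_calc_def slice_rep_def\<close>)
  then have "omega_calc D T \<phi> J k = B" using K represents_unique unfolding dec_calc_def by blast
  then show "ext_omega_calc D T \<theta> \<phi> J (cl_poly p \<circ> g) = op_poly p (ext_omega_calc D T \<theta> \<phi> J g)"
    using ext_omega_calc_eq[OF dec] pA unfolding A_def by simp
qed

end

end

theorem corollary4p8:
  fixes D :: "('v::banach ^ 'n::{finite,linorder} set) set"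
    and T :: "'v ^ 'n set \<Rightarrow> 'v ^ 'n set"
    and g :: "real ^ 'n set \<Rightarrow> real ^ 'n set"
    and J :: "real ^ 'n set"
    and p :: "real poly"
    and \<omega> \<theta> \<phi> :: real
  assumes "0 < \<omega>" and "\<omega> < pi / 2"
    and "bisectorial \<omega> D T"
    and "\<omega> < \<theta>" and "\<theta> < pi / 2"
    and "g \<in> N_bnd \<theta>"
    and "p \<noteq> 0"
    and "\<omega> < \<phi>" and "\<phi> < \<theta>" and "J \<in> unit_sphere"
  shows "(cl_poly p \<circ> g) \<in> N_bnd \<theta> \<and>
    ext_omega_calc D T \<theta> \<phi> J (cl_poly p \<circ> g) = op_poly p (ext_omega_calc D T \<theta> \<phi> J g)"
proof -
  interpret bisectorial_operator \<omega> D T by unfold_locales (rule assms)+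
  show ?thesis using ext_omega_calc_poly[OF assms(10,8,9,5,6)] by blast
qed

end
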